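(* Let $\theta\in(0,\pi/2)$, let $$\Sigma:=\{(x,y,\cot(\theta)\sqrt{x^2+y^2})\in\mathbb{R}^3:(x,y)\in\mathbb{R}^2\}$$ be the infinite cone, and let $\alpha>0$ and $\beta=4/\alpha$ be constants. Then $$\lambda_n(-\Delta_{\delta',\beta})<\lambda_n(-\Delta_{\delta,\alpha})$$ for all $n\in\mathbb{N}$ such that $\lambda_n(-\Delta_{\delta,\alpha})<\inf\sigma_{\rm ess}(-\Delta_{\delta',\beta})$.
   Context: The cone $\Sigma$ splits $\mathbb{R}^3$ into the two domains $\Omega_1=\{(x,y,z): z>\cot(\theta)\sqrt{x^2+y^2}\}$ and $\Omega_2=\{(x,y,z): z<\cot(\theta)\sqrt{x^2+y^2}\}$. Notation: $(\cdot,\cdot)_\Omega$ and $(\cdot,\cdot)_\Sigma$ are the inner products of $L^2(\Omega)$ (also of $L^2(\Omega,\mathbb{C}^3)$) and $L^2(\Sigma)$ (surface measure). $u|_\Sigma\in L^2(\Sigma)$ is the trace of an $H^1$ function. For $u\in L^2(\mathbb{R}^3)$ write $u=u_1\oplus u_2$ with $u_j=u|_{\Omega_j}$. $H^1(\mathbb{R}^3\setminus\Sigma)=H^1(\Omega_1)\oplus H^1(\Omega_2)$. Operators: $-\Delta_{\delta,\alpha}$ is the self-adjoint operator in $L^2(\mathbb{R}^3)$ associated with the densely defined, symmetric, lower semibounded, closed form $$\mathfrak{a}_{\delta,\alpha}[u,v]=(\nabla u,\nabla v)_{\mathbb{R}^3}-(\alpha u|_\Sigma,v|_\Sigma)_\Sigma,\quad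 \operatorname{dom}\mathfrak{a}_{\delta,\alpha}=H^1(\mathbb{R}^3),$$ and $-\Delta_{\delta',\beta}$ is the self-adjoint operator in $L^2(\mathbb{R}^3)$ associated with the densely defined, symmetric, lower semibounded, closed form $$\mathfrak{a}_{\delta',\beta}[u,v]=(\nabla u_1,\nabla v_1)_{\Omega_1}+(\nabla u_2,\nabla v_2)_{\Omega_2}-\Big(\tfrac1\beta(u_1|_\Sigma-u_2|_\Sigma),v_1|_\Sigma-v_2|_\Sigma\Big)_\Sigma,\quad \operatorname{dom}\mathfrak{a}_{\delta',\beta}=H^1(\mathbb{R}^3\setminus\Sigma).$$ Eigenvalues: for $A=-\Delta_{\delta,\alpha}$ or $A=-\Delta_{\delta',\beta}$, $\sigma_{\rm ess}(A)$ is the essential spectrum and $\lambda_1(A)\le\lambda_2(A)\le\dots<\inf\sigma_{\rm ess}(A)$ are the eigenvalues of $A$ below the bottom of the essential spectrum, counted with multiplicities. The condition on $n$ includes that $\lambda_n(-\Delta_{\delta,\alpha})$ exists. It is known that $\sigma_{\rm ess}(-\Delta_{\delta,\alpha})=[-\alpha^2/4,+\infty)$, that $\inf\sigma_{\rm ess}(-\Delta_{\delta',\beta})\le\inf\sigma_{\rm ess}(-\Delta_{\delta,\alpha})$, and that $\lambda_n(-\Delta_{\delta',\beta})$ exists for all $n$ as in the claim. *)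

theory Defs
  imports "HOL-Analysis.Analysis"
begin

section \<open>Square-integrable functions\<close>

text \<open>
  Elements of $L^2$ are represented by square-integrable functions; equality in $L^2$ is equality
  almost everywhere. All notions below are invariant under changing representatives.
\<close>

definition L2 :: "'a measure \<Rightarrow> ('a \<Rightarrow> 'b::{real_normed_vector, second_countable_topology}) set" where
  "L2 M = {u \<in> borel_measurable M. integrable M (\<lambda>x. (norm (u x))\<^sup>2)}"

definition L2_norm :: "'a measure \<Rightarrow> ('a \<Rightarrow> 'b::real_normed_vector) \<Rightarrow> real" where
  "L2_norm M u = sqrt (\<integral>x. (norm (u x))\<^sup>2 \<partial>M)"

definition ip :: "'a measure \<Rightarrow> ('a \<Rightarrow> complex) \<Rightarrow> ('a \<Rightarrow> complex) \<Rightarrow> complex" where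
  "ip M u v = (\<integral>x. u x * cnj (v x) \<partial>M)"

definition ip3 :: "'a measure \<Rightarrow> ('a \<Rightarrow> complex ^ 3) \<Rightarrow> ('a \<Rightarrow> complex ^ 3) \<Rightarrow> complex" where
  "ip3 M F G = (\<integral>x. (\<Sum>i\<in>UNIV. F x $ i * cnj (G x $ i)) \<partial>M)"

abbreviation leb :: "(real ^ 3) set \<Rightarrow> (real ^ 3) measure" where
  "leb \<Omega> \<equiv> restrict_space lborel \<Omega>"

section \<open>Test functions, weak gradients and the space $H^1$\<close>

definition partial :: "3 \<Rightarrow> (real ^ 3 \<Rightarrow> complex) \<Rightarrow> real ^ 3 \<Rightarrow> complex" where
  "partial i f x = frechet_derivative f (at x) (axis i 1)"

definition grad :: "(real ^ 3 \<Rightarrow> complex) \<Rightarrow> real ^ 3 \<Rightarrow> complex ^ 3" where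
  "grad f x = (\<chi> i. partial i f x)"

primrec cont_diff :: "nat \<Rightarrow> (real ^ 3 \<Rightarrow> complex) \<Rightarrow> bool" where
  "cont_diff 0 f \<longleftrightarrow> continuous_on UNIV f"
| "cont_diff (Suc k) f \<longleftrightarrow> (\<forall>x. f differentiable at x) \<and> (\<forall>i. cont_diff k (partial i f))"

definition test_functions :: "(real ^ 3) set \<Rightarrow> (real ^ 3 \<Rightarrow> complex) set" where
  "test_functions \<Omega> =
     {\<phi>. (\<forall>k. cont_diff k \<phi>) \<and> compact (closure {x. \<phi> x \<noteq> 0}) \<and> closure {x. \<phi> x \<noteq> 0} \<subseteq> \<Omega>}"

definition is_weak_grad ::
  "(real ^ 3) set \<Rightarrow> (real ^ 3 \<Rightarrow> complex) \<Rightarrow> (real ^ 3 \<Rightarrow> complex ^ 3) \<Rightarrow> bool" where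
  "is_weak_grad \<Omega> u G \<longleftrightarrow> G \<in> L2 (leb \<Omega>) \<and>
     (\<forall>\<phi>\<in>test_functions \<Omega>. \<forall>i.
        (\<integral>x. u x * partial i \<phi> x \<partial>leb \<Omega>) = - (\<integral>x. G x $ i * \<phi> x \<partial>leb \<Omega>))"

definition H1 :: "(real ^ 3) set \<Rightarrow> (real ^ 3 \<Rightarrow> complex) set" where
  "H1 \<Omega> = {u \<in> L2 (leb \<Omega>). \<exists>G. is_weak_grad \<Omega> u G}"

definition weak_grad :: "(real ^ 3) set \<Rightarrow> (real ^ 3 \<Rightarrow> complex) \<Rightarrow> real ^ 3 \<Rightarrow> complex ^ 3" where
  "weak_grad \<Omega> u = (SOME G. is_weak_grad \<Omega> u G)"

section \<open>The cone and traces on it\<close>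

definition cone_param :: "real \<Rightarrow> real ^ 2 \<Rightarrow> real ^ 3" where
  "cone_param \<theta> p = vector [p $ 1, p $ 2, cot \<theta> * sqrt ((p $ 1)\<^sup>2 + (p $ 2)\<^sup>2)]"

definition cone_surface :: "real \<Rightarrow> (real ^ 3) set" where
  "cone_surface \<theta> = range (cone_param \<theta>)"

definition Omega1 :: "real \<Rightarrow> (real ^ 3) set" where
  "Omega1 \<theta> = {x. x $ 3 > cot \<theta> * sqrt ((x $ 1)\<^sup>2 + (x $ 2)\<^sup>2)}"

definition Omega2 :: "real \<Rightarrow> (real ^ 3) set" where
  "Omega2 \<theta> = {x. x $ 3 < cot \<theta> * sqrt ((x $ 1)\<^sup>2 + (x $ 2)\<^sup>2)}"

text \<open>
  The surface measure of the graph of $f$ has density $\sqrt{1+|\nabla f|^2}$ with respect to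
  Lebesgue measure in the parameter plane; here $|\nabla f| = \cot\theta$ away from the apex.
\<close>

definition surface_measure :: "real \<Rightarrow> (real ^ 3) measure" where
  "surface_measure \<theta> =
     distr (density lborel (\<lambda>_. ennreal (sqrt (1 + (cot \<theta>)\<^sup>2))))
           (restrict_space borel (cone_surface \<theta>)) (cone_param \<theta>)"

text \<open>
  The trace is the continuous extension to $H^1(\Omega)$ of the restriction to the cone, defined
  first on (restrictions to $\Omega$ of) smooth functions with compact support in
  $\mathbb{R}^3$. It is used for the whole space and for the two Lipschitz domains bounded by the
  cone, where these functions are dense and the extension is unique.
\<close>

definition has_trace ::
  "real \<Rightarrow> (real ^ 3) set \<Rightarrow> (real ^ 3 \<Rightarrow> complex) \<Rightarrow> (real ^ 3 \<Rightarrow> complex) \<Rightarrow> bool" where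
  "has_trace \<theta> \<Omega> u g \<longleftrightarrow> g \<in> L2 (surface_measure \<theta>) \<and>
     (\<exists>\<phi>. (\<forall>k. \<phi> k \<in> test_functions UNIV) \<and>
        (\<lambda>k. L2_norm (leb \<Omega>) (\<lambda>x. \<phi> k x - u x)) \<longlonglongrightarrow> 0 \<and>
        (\<lambda>k. L2_norm (leb \<Omega>) (\<lambda>x. grad (\<phi> k) x - weak_grad \<Omega> u x)) \<longlonglongrightarrow> 0 \<and>
        (\<lambda>k. L2_norm (surface_measure \<theta>) (\<lambda>x. \<phi> k x - g x)) \<longlonglongrightarrow> 0)"

definition cone_trace :: "real \<Rightarrow> (real ^ 3) set \<Rightarrow> (real ^ 3 \<Rightarrow> complex) \<Rightarrow> real ^ 3 \<Rightarrow> complex" where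
  "cone_trace \<theta> \<Omega> u = (SOME g. has_trace \<theta> \<Omega> u g)"

section \<open>Operators in $L^2(\mathbb{R}^3)$ and their spectra\<close>

text \<open>An operator is given by its graph, the set of all pairs $(u, Au)$ with $u$ in its domain.\<close>

type_synonym operator = "((real ^ 3 \<Rightarrow> complex) \<times> (real ^ 3 \<Rightarrow> complex)) set"

text \<open>
  The operator associated with a form $a$ with domain $D$ (first representation theorem):
  $u \in \mathrm{dom}\, A$ and $Au = f$ iff $u \in D$ and $a[u,v] = (f,v)$ for all $v \in D$.
\<close>

definition form_operator ::
  "(real ^ 3 \<Rightarrow> complex) set \<Rightarrow> ((real ^ 3 \<Rightarrow> complex) \<Rightarrow> (real ^ 3 \<Rightarrow> complex) \<Rightarrow> complex) \<Rightarrow> operator"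
where
  "form_operator D a = {(u, f). u \<in> D \<and> f \<in> L2 lborel \<and> (\<forall>v\<in>D. a u v = ip lborel f v)}"

text \<open>
  In the resolvent set, $A - z$ has a bounded everywhere defined inverse; the lower bound also
  yields injectivity.
\<close>

definition resolvent_set :: "operator \<Rightarrow> complex set" where
  "resolvent_set A = {z.
     (\<exists>C. \<forall>(u, f)\<in>A. L2_norm lborel u \<le> C * L2_norm lborel (\<lambda>x. f x - z * u x)) \<and>
     (\<forall>g\<in>L2 lborel. \<exists>(u, f)\<in>A. AE x in lborel. f x - z * u x = g x)}"

definition spectrum :: "operator \<Rightarrow> complex set" where
  "spectrum A = - resolvent_set A"

definition eigenspace :: "operator \<Rightarrow> complex \<Rightarrow> (real ^ 3 \<Rightarrow> complex) set" where
  "eigenspace A z = {u. \<exists>f. (u, f) \<in> A \<and> (AE x in lborel. f x = z * u x)}"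

definition L2_independent :: "(real ^ 3 \<Rightarrow> complex) list \<Rightarrow> bool" where
  "L2_independent us \<longleftrightarrow>
     (\<forall>c :: nat \<Rightarrow> complex. (AE x in lborel. (\<Sum>i<length us. c i * (us ! i) x) = 0) \<longrightarrow>
        (\<forall>i<length us. c i = 0))"

text \<open>The dimension of the eigenspace; it is 0 iff the number is not an eigenvalue.\<close>

definition eig_multiplicity :: "operator \<Rightarrow> complex \<Rightarrow> enat" where
  "eig_multiplicity A z =
     Sup {enat (length us) | us. set us \<subseteq> eigenspace A z \<and> L2_independent us}"

definition discrete_spectrum :: "operator \<Rightarrow> complex set" where
  "discrete_spectrum A =
     {z. z isolated_in spectrum A \<and> 0 < eig_multiplicity A z \<and> eig_multiplicity A z < \<infinity>}"

definition ess_spectrum :: "operator \<Rightarrow> complex set" where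
  "ess_spectrum A = spectrum A - discrete_spectrum A"

text \<open>For self-adjoint operators the spectrum is real, so that taking real parts is harmless.\<close>

definition inf_ess_spectrum :: "operator \<Rightarrow> ereal" where
  "inf_ess_spectrum A = (INF z\<in>ess_spectrum A. ereal (Re z))"

text \<open>
  The list \<open>ls\<close> consists of the first \<open>n\<close> eigenvalues in nondecreasing order: every number below
  the last entry occurs as often as its multiplicity says (hence not at all if it is not an
  eigenvalue), and the last entry occurs at most that often. Indexing starts with \<open>n = 1\<close>.
\<close>

definition is_nth_eigenvalue :: "operator \<Rightarrow> nat \<Rightarrow> real \<Rightarrow> bool" where
  "is_nth_eigenvalue A n l \<longleftrightarrow> ereal l < inf_ess_spectrum A \<and>
     (\<exists>ls. length ls = n \<and> ls \<noteq> [] \<and> sorted ls \<and> last ls = l \<and>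
        (\<forall>m<l. enat (count_list ls m) = eig_multiplicity A (complex_of_real m)) \<and>
        enat (count_list ls l) \<le> eig_multiplicity A (complex_of_real l))"

definition eigenvalue_exists :: "operator \<Rightarrow> nat \<Rightarrow> bool" where
  "eigenvalue_exists A n \<longleftrightarrow> (\<exists>l. is_nth_eigenvalue A n l)"

definition eigenvalue :: "operator \<Rightarrow> nat \<Rightarrow> real" where
  "eigenvalue A n = (THE l. is_nth_eigenvalue A n l)"

section \<open>The $\delta$- and $\delta'$-operators\<close>

definition delta_form ::
  "real \<Rightarrow> real \<Rightarrow> (real ^ 3 \<Rightarrow> complex) \<Rightarrow> (real ^ 3 \<Rightarrow> complex) \<Rightarrow> complex" where
  "delta_form \<theta> \<alpha> u v =
     ip3 lborel (weak_grad UNIV u) (weak_grad UNIV v)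
     - ip (surface_measure \<theta>) (\<lambda>x. of_real \<alpha> * cone_trace \<theta> UNIV u x) (cone_trace \<theta> UNIV v)"

definition delta_operator :: "real \<Rightarrow> real \<Rightarrow> operator" where
  "delta_operator \<theta> \<alpha> = form_operator (H1 UNIV) (delta_form \<theta> \<alpha>)"

definition H1_minus_cone :: "real \<Rightarrow> (real ^ 3 \<Rightarrow> complex) set" where
  "H1_minus_cone \<theta> = {u \<in> L2 lborel. u \<in> H1 (Omega1 \<theta>) \<and> u \<in> H1 (Omega2 \<theta>)}"

definition trace_jump :: "real \<Rightarrow> (real ^ 3 \<Rightarrow> complex) \<Rightarrow> real ^ 3 \<Rightarrow> complex" where
  "trace_jump \<theta> u x = cone_trace \<theta> (Omega1 \<theta>) u x - cone_trace \<theta> (Omega2 \<theta>) u x"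

definition delta'_form ::
  "real \<Rightarrow> real \<Rightarrow> (real ^ 3 \<Rightarrow> complex) \<Rightarrow> (real ^ 3 \<Rightarrow> complex) \<Rightarrow> complex" where
  "delta'_form \<theta> \<beta> u v =
     ip3 (leb (Omega1 \<theta>)) (weak_grad (Omega1 \<theta>) u) (weak_grad (Omega1 \<theta>) v)
     + ip3 (leb (Omega2 \<theta>)) (weak_grad (Omega2 \<theta>) u) (weak_grad (Omega2 \<theta>) v)
     - ip (surface_measure \<theta>) (\<lambda>x. of_real (1 / \<beta>) * trace_jump \<theta> u x) (trace_jump \<theta> v)"

definition delta'_operator :: "real \<Rightarrow> real \<Rightarrow> operator" where
  "delta'_operator \<theta> \<beta> = form_operator (H1_minus_cone \<theta>) (delta'_form \<theta> \<beta>)"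

end

theory Submission
  imports Defs
begin

lemma quadratic_nonneg_imp_discriminant:
  fixes X Y Z :: real
  assumes "\<And>t. 0 \<le> X + 2 * t * Y + t\<^sup>2 * Z" "0 \<le> Z"
  shows "Y\<^sup>2 \<le> X * Z"
proof (cases "Z = 0")
  case True
  have "Y = 0"
  proof (rule ccontr)
    assume "Y \<noteq> 0"
    then show False using assms(1)[of "- (X + 1) / (2 * Y)"] True by (simp add: field_simps)
  qed
  then show ?thesis using True by simp
next
  case False
  then have Z: "Z > 0" using assms(2) by simp
  have "0 \<le> X + 2 * (- Y / Z) * Y + (- Y / Z)\<^sup>2 * Z" by (rule assms(1))
  also have "\<dots> = X - Y\<^sup>2 / Z" using Z by (simp add: power2_eq_square field_simps)
  finally show ?thesis using Z by (simp add: field_simps)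
qed

lemma hermitian_quadratic_nonneg_imp_discriminant:
  fixes X Z :: real and Y :: complex
  assumes "\<And>t::complex. 0 \<le> X + 2 * Re (t * Y) + (cmod t)\<^sup>2 * Z" "0 \<le> Z"
  shows "(cmod Y)\<^sup>2 \<le> X * Z"
proof (cases "Y = 0")
  case True
  then show ?thesis using assms(1)[of 0] assms(2) by simp
next
  case False
  have "((cmod Y)\<^sup>2)\<^sup>2 \<le> X * ((cmod Y)\<^sup>2 * Z)"
  proof (rule quadratic_nonneg_imp_discriminant)
    fix t :: real
    have "Re (of_real t * cnj Y * Y) = t * (cmod Y)\<^sup>2"
      unfolding cmod_power2 by (simp add: power2_eq_square algebra_simps)
    then show "0 \<le> X + 2 * t * (cmod Y)\<^sup>2 + t\<^sup>2 * ((cmod Y)\<^sup>2 * Z)"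
      using assms(1)[of "of_real t * cnj Y"] by (simp add: norm_mult power_mult_distrib algebra_simps)
  qed (use assms(2) in simp)
  then have "(cmod Y)\<^sup>2 * (cmod Y)\<^sup>2 \<le> (X * Z) * (cmod Y)\<^sup>2"
    by (simp only: power2_eq_square ac_simps)
  moreover have "0 < (cmod Y)\<^sup>2" using False by simp
  ultimately show ?thesis by (rule mult_right_le_imp_le)
qed

section \<open>The space of square-integrable functions\<close>

lemma L2_measurable [measurable_dest]: "u \<in> L2 M \<Longrightarrow> u \<in> borel_measurable M"
  by (simp add: L2_def)

lemma L2_integrable: "u \<in> L2 M \<Longrightarrow> integrable M (\<lambda>x. (norm (u x))\<^sup>2)"
  by (simp add: L2_def)

lemma L2I:
  assumes "u \<in> borel_measurable M" "integrable M h" "\<And>x. x \<in> space M \<Longrightarrow> (norm (u x))\<^sup>2 \<le> h x"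
  shows "u \<in> L2 M"
  unfolding L2_def
proof (simp add: assms(1), rule Bochner_Integration.integrable_bound[OF assms(2)])
  show "(\<lambda>x. (norm (u x))\<^sup>2) \<in> borel_measurable M" using assms(1) by measurable
  show "AE x in M. norm ((norm (u x))\<^sup>2) \<le> norm (h x)"
    using assms(3) by (intro AE_I2) (force intro: order_trans)
qed

lemma L2_zero [simp]: "(\<lambda>x. 0) \<in> L2 M"
  by (simp add: L2_def)

lemma norm_add_sq_le: "(norm (a + b :: 'a::real_normed_vector))\<^sup>2 \<le> 2 * (norm a)\<^sup>2 + 2 * (norm b)\<^sup>2"
proof -
  have "(norm (a + b))\<^sup>2 \<le> (norm a + norm b)\<^sup>2"
    by (intro power_mono norm_triangle_ineq) auto
  also have "\<dots> \<le> 2 * (norm a)\<^sup>2 + 2 * (norm b)\<^sup>2"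
    using sum_squares_bound[of "norm a" "norm b"] by (simp add: power2_eq_square algebra_simps)
  finally show ?thesis .
qed

lemma L2_add:
  assumes "u \<in> L2 M" "v \<in> L2 M"
  shows "(\<lambda>x. u x + v x) \<in> L2 M"
proof (rule L2I)
  show "(\<lambda>x. u x + v x) \<in> borel_measurable M" using assms by measurable
  show "integrable M (\<lambda>x. 2 * (norm (u x))\<^sup>2 + 2 * (norm (v x))\<^sup>2)"
    using assms by (intro Bochner_Integration.integrable_add integrable_mult_right L2_integrable)
qed (rule norm_add_sq_le)

lemma L2_uminus: "u \<in> L2 M \<Longrightarrow> (\<lambda>x. - u x) \<in> L2 M"
  by (simp add: L2_def)

lemma L2_diff:
  assumes "u \<in> L2 M" "v \<in> L2 M"
  shows "(\<lambda>x. u x - v x) \<in> L2 M"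
  using L2_add[OF assms(1) L2_uminus[OF assms(2)]] by simp

lemma L2_cmult: "u \<in> L2 M \<Longrightarrow> (\<lambda>x. (c::complex) * u x) \<in> L2 M"
  unfolding L2_def by (auto simp: norm_mult power_mult_distrib intro: borel_measurable_times)

lemma L2_lin: "u \<in> L2 M \<Longrightarrow> v \<in> L2 M \<Longrightarrow> (\<lambda>x. u x + (c::complex) * v x) \<in> L2 M"
  by (intro L2_add L2_cmult)

lemma L2_norm_nonneg [simp]: "0 \<le> L2_norm M u"
  by (simp add: L2_norm_def)

lemma L2_norm_sq: "(L2_norm M u)\<^sup>2 = (\<integral>x. (norm (u x))\<^sup>2 \<partial>M)"
  by (simp add: L2_norm_def)

lemma L2_norm_cong_AE:
  assumes "AE x in M. u x = v x" "u \<in> borel_measurable M" "v \<in> borel_measurable M"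
  shows "L2_norm M u = L2_norm M v"
  unfolding L2_norm_def
proof (rule arg_cong[where f = sqrt], rule integral_cong_AE)
  show "(\<lambda>x. (norm (u x))\<^sup>2) \<in> borel_measurable M" using assms(2) by measurable
  show "(\<lambda>x. (norm (v x))\<^sup>2) \<in> borel_measurable M" using assms(3) by measurable
  show "AE x in M. (norm (u x))\<^sup>2 = (norm (v x))\<^sup>2" using assms(1) by eventually_elim simp
qed

lemma L2_norm_zero_iff:
  assumes "u \<in> L2 M"
  shows "L2_norm M u = 0 \<longleftrightarrow> (AE x in M. u x = 0)"
  using integral_nonneg_eq_0_iff_AE[OF L2_integrable[OF assms]] by (simp add: L2_norm_def)

lemma L2_norm_cmult: "L2_norm M (\<lambda>x. (c::complex) * u x) = cmod c * L2_norm M u"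
  by (simp add: L2_norm_def norm_mult power_mult_distrib real_sqrt_mult)

lemma L2_norm_minus_commute: "L2_norm M (\<lambda>x. u x - v x) = L2_norm M (\<lambda>x. v x - u x)"
  by (simp add: L2_norm_def norm_minus_commute)

lemma L2_norm_uminus [simp]: "L2_norm M (\<lambda>x. - u x) = L2_norm M u"
  by (simp add: L2_norm_def)

lemma L2_mult_integrable:
  assumes "u \<in> L2 M" "v \<in> L2 M" "f \<in> borel_measurable M"
    and "\<And>x. x \<in> space M \<Longrightarrow> norm (f x) \<le> norm (u x) * norm (v x)"
  shows "integrable M (f :: 'a \<Rightarrow> 'b::{banach, second_countable_topology})"
proof (rule Bochner_Integration.integrable_bound[where f = "\<lambda>x. (norm (u x))\<^sup>2 + (norm (v x))\<^sup>2"])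
  show "integrable M (\<lambda>x. (norm (u x))\<^sup>2 + (norm (v x))\<^sup>2)"
    using assms by (intro Bochner_Integration.integrable_add L2_integrable)
  show "AE x in M. norm (f x) \<le> norm ((norm (u x))\<^sup>2 + (norm (v x))\<^sup>2)"
  proof (rule AE_I2)
    fix x assume x: "x \<in> space M"
    have "norm (f x) \<le> norm (u x) * norm (v x)" using assms(4)[OF x] .
    also have "\<dots> \<le> (norm (u x))\<^sup>2 + (norm (v x))\<^sup>2"
      using sum_squares_bound[of "norm (u x)" "norm (v x)"] mult_nonneg_nonneg[of "norm (u x)" "norm (v x)", OF norm_ge_zero norm_ge_zero]
      unfolding mult.assoc by linarith
    finally show "norm (f x) \<le> norm ((norm (u x))\<^sup>2 + (norm (v x))\<^sup>2)" by simp
  qed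
qed (rule assms(3))

lemma L2_Cauchy_Schwarz_norm:
  assumes "u \<in> L2 M" "v \<in> L2 M"
  shows "(\<integral>x. norm (u x) * norm (v x) \<partial>M) \<le> L2_norm M u * L2_norm M v"
proof -
  have [measurable]: "u \<in> borel_measurable M" "v \<in> borel_measurable M" using assms by auto
  have i: "integrable M (\<lambda>x. norm (u x) * norm (v x))"
    by (rule L2_mult_integrable[OF assms]) auto
  have "(\<integral>x. norm (u x) * norm (v x) \<partial>M)\<^sup>2 \<le> (L2_norm M u)\<^sup>2 * (L2_norm M v)\<^sup>2"
  proof (rule quadratic_nonneg_imp_discriminant)
    fix t :: real
    have "0 \<le> (\<integral>x. (norm (u x) + t * norm (v x))\<^sup>2 \<partial>M)" by simp
    also have "\<dots> = (\<integral>x. (norm (u x))\<^sup>2 + 2 * t * (norm (u x) * norm (v x)) + t\<^sup>2 * (norm (v x))\<^sup>2 \<partial>M)"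
      by (intro Bochner_Integration.integral_cong refl) (simp add: power2_eq_square algebra_simps)
    also have "\<dots> = (L2_norm M u)\<^sup>2 + 2 * t * (\<integral>x. norm (u x) * norm (v x) \<partial>M) + t\<^sup>2 * (L2_norm M v)\<^sup>2"
      using assms i by (simp add: L2_norm_sq L2_integrable)
    finally show "0 \<le> \<dots>" .
  qed simp
  then show ?thesis
    by (auto intro: power2_le_imp_le simp: power_mult_distrib)
qed

lemma L2_norm_triangle:
  assumes "u \<in> L2 M" "v \<in> L2 M"
  shows "L2_norm M (\<lambda>x. u x + v x) \<le> L2_norm M u + L2_norm M v"
proof (rule power2_le_imp_le)
  have [measurable]: "u \<in> borel_measurable M" "v \<in> borel_measurable M" using assms by auto
  have i: "integrable M (\<lambda>x. norm (u x) * norm (v x))"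
    by (rule L2_mult_integrable[OF assms]) auto
  have "(L2_norm M (\<lambda>x. u x + v x))\<^sup>2 \<le> (\<integral>x. (norm (u x))\<^sup>2 + 2 * (norm (u x) * norm (v x)) + (norm (v x))\<^sup>2 \<partial>M)"
    unfolding L2_norm_sq
  proof (rule integral_mono)
    fix x
    have "(norm (u x + v x))\<^sup>2 \<le> (norm (u x) + norm (v x))\<^sup>2"
      by (intro power_mono norm_triangle_ineq) auto
    then show "(norm (u x + v x))\<^sup>2 \<le> (norm (u x))\<^sup>2 + 2 * (norm (u x) * norm (v x)) + (norm (v x))\<^sup>2"
      by (simp add: power2_eq_square algebra_simps)
  qed (use assms i in \<open>auto intro!: L2_integrable L2_add Bochner_Integration.integrable_add integrable_mult_right\<close>)
  also have "\<dots> = (L2_norm M u)\<^sup>2 + 2 * (\<integral>x. norm (u x) * norm (v x) \<partial>M) + (L2_norm M v)\<^sup>2"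
    using assms i by (simp add: L2_norm_sq L2_integrable)
  also have "\<dots> \<le> (L2_norm M u + L2_norm M v)\<^sup>2"
    using L2_Cauchy_Schwarz_norm[OF assms] by (simp add: power2_eq_square algebra_simps)
  finally show "(L2_norm M (\<lambda>x. u x + v x))\<^sup>2 \<le> (L2_norm M u + L2_norm M v)\<^sup>2" .
qed simp

lemma L2_norm_triangle3:
  assumes "u \<in> L2 M" "v \<in> L2 M" "w \<in> L2 M"
  shows "L2_norm M (\<lambda>x. u x - w x) \<le> L2_norm M (\<lambda>x. u x - v x) + L2_norm M (\<lambda>x. v x - w x)"
  using L2_norm_triangle[OF L2_diff[OF assms(1,2)] L2_diff[OF assms(2,3)]] by simp

lemma L2_norm_diff_le:
  assumes "u \<in> L2 M" "v \<in> L2 M"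
  shows "\<bar>L2_norm M u - L2_norm M v\<bar> \<le> L2_norm M (\<lambda>x. u x - v x)"
  using L2_norm_triangle3[OF assms L2_zero] L2_norm_triangle3[OF assms(2,1) L2_zero]
    L2_norm_minus_commute[of M u v] by simp

lemma L2_norm_mono:
  fixes u :: "'a \<Rightarrow> 'b::{real_normed_vector, second_countable_topology}"
  assumes "v \<in> L2 M" "u \<in> borel_measurable M" "\<And>x. x \<in> space M \<Longrightarrow> norm (u x) \<le> norm (v x)"
  shows "L2_norm M u \<le> L2_norm M v"
  unfolding L2_norm_def
proof (rule real_sqrt_le_mono, rule integral_mono)
  have "u \<in> L2 M" by (rule L2I[OF assms(2) L2_integrable[OF assms(1)]]) (simp add: assms(3) power_mono)
  then show "integrable M (\<lambda>x. (norm (u x))\<^sup>2)" by (rule L2_integrable)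
qed (use assms in \<open>auto simp: L2_integrable intro!: power_mono\<close>)

lemma L2_nn_integral:
  assumes "u \<in> L2 M"
  shows "(\<integral>\<^sup>+x. ennreal ((norm (u x))\<^sup>2) \<partial>M) = ennreal ((L2_norm M u)\<^sup>2)"
  unfolding L2_norm_sq by (rule nn_integral_eq_integral[OF L2_integrable[OF assms]]) auto

lemma L2_nn_bound:
  assumes [measurable]: "u \<in> borel_measurable M"
    and "(\<integral>\<^sup>+x. ennreal ((norm (u x))\<^sup>2) \<partial>M) \<le> ennreal (B\<^sup>2)" "0 \<le> B"
  shows "u \<in> L2 M \<and> L2_norm M u \<le> B"
proof -
  have "integrable M (\<lambda>x. (norm (u x))\<^sup>2)"
    by (rule integrableI_bounded) (use assms(2) in \<open>auto simp: less_top[symmetric] top_unique\<close>)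
  then have u: "u \<in> L2 M" by (simp add: L2_def)
  have "ennreal ((L2_norm M u)\<^sup>2) \<le> ennreal (B\<^sup>2)" using assms(2) L2_nn_integral[OF u] by simp
  then have "(L2_norm M u)\<^sup>2 \<le> B\<^sup>2" by simp
  then show ?thesis using u assms(3) power2_le_imp_le by blast
qed

subsection \<open>Completeness\<close>

lemma L2_sum_norm:
  fixes d :: "nat \<Rightarrow> 'a \<Rightarrow> 'b::{real_normed_vector, second_countable_topology}"
  assumes "\<And>k. d k \<in> L2 M"
  shows "(\<lambda>x. \<Sum>k<n. norm (d k x)) \<in> L2 M \<and> L2_norm M (\<lambda>x. \<Sum>k<n. norm (d k x)) \<le> (\<Sum>k<n. L2_norm M (d k))"
proof (induction n)
  case 0
  then show ?case by (simp add: L2_norm_def)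
next
  case (Suc n)
  have n: "(\<lambda>x. norm (d n x)) \<in> L2 M" using assms[of n] unfolding L2_def by (auto intro: borel_measurable_norm)
  have "L2_norm M (\<lambda>x. norm (d n x)) = L2_norm M (d n)" by (simp add: L2_norm_def)
  then show ?case using Suc L2_add[OF _ n] L2_norm_triangle[OF _ n] by fastforce
qed

text \<open>Riesz--Fischer: a rapidly convergent subsequence converges almost everywhere because the
  series of the norms of its increments is square-integrable; Fatou's lemma turns its pointwise
  limit into a limit in the mean.\<close>

lemma L2_complete:
  fixes u :: "nat \<Rightarrow> 'a \<Rightarrow> 'b::{banach, second_countable_topology}"
  assumes u: "\<And>n. u n \<in> L2 M"
    and cauchy: "\<And>e. e > 0 \<Longrightarrow> \<exists>N. \<forall>m\<ge>N. \<forall>n\<ge>N. L2_norm M (\<lambda>x. u m x - u n x) < e"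
  shows "\<exists>f\<in>L2 M. (\<lambda>n. L2_norm M (\<lambda>x. u n x - f x)) \<longlonglongrightarrow> 0"
proof -
  have [measurable]: "\<And>n. u n \<in> borel_measurable M" using u by auto
  have "\<exists>r. strict_mono r \<and> (\<forall>k. \<forall>m\<ge>r k. \<forall>n\<ge>r k. L2_norm M (\<lambda>x. u m x - u n x) < (1/2)^k)"
  proof -
    let ?P = "\<lambda>k N. \<forall>m\<ge>N. \<forall>n\<ge>N. L2_norm M (\<lambda>x. u m x - u n x) < (1/2)^k"
    have ex: "\<exists>N>a. ?P k N" for a k
    proof -
      obtain N where "?P k N" using cauchy[of "(1/2)^k"] by auto
      then show ?thesis by (intro exI[of _ "max N (Suc a)"]) auto
    qed
    have "\<exists>r. \<forall>k. ?P k (r k) \<and> r k < r (Suc k)"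
    proof (rule dependent_nat_choice)
      show "\<exists>x. ?P 0 x" using ex[of 0 0] by blast
      show "\<exists>y. ?P (Suc n) y \<and> x < y" if "?P n x" for x n using ex[of x "Suc n"] by blast
    qed
    then show ?thesis unfolding strict_mono_Suc_iff by blast
  qed
  then obtain r where r: "strict_mono r"
    and rk: "\<And>k m n. m \<ge> r k \<Longrightarrow> n \<ge> r k \<Longrightarrow> L2_norm M (\<lambda>x. u m x - u n x) < (1/2)^k" by blast
  define d where "d k x = u (r (Suc k)) x - u (r k) x" for k x
  have d: "d k \<in> L2 M" for k using L2_diff[OF u u] by (simp add: d_def[abs_def])
  then have [measurable]: "\<And>k. d k \<in> borel_measurable M" by auto
  have dn: "L2_norm M (d k) \<le> (1/2)^k" for k
    using rk[of k "r (Suc k)" "r k"] strict_mono_less_eq[OF r, of k "Suc k"] by (simp add: d_def[abs_def])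
  have geo: "(\<Sum>k<n. L2_norm M (d k)) \<le> 2" for n
  proof -
    have "(\<Sum>k<n. L2_norm M (d k)) \<le> (\<Sum>k<n. (1/2)^k)" by (intro sum_mono dn)
    also have "\<dots> \<le> (\<Sum>k. (1/2)^k :: real)" by (rule sum_le_suminf) (auto intro: summable_geometric)
    also have "\<dots> = 2" by (subst suminf_geometric) auto
    finally show ?thesis .
  qed
  define S where "S n x = (\<Sum>k<n. norm (d k x))" for n x
  have "(\<integral>\<^sup>+x. (SUP n. ennreal ((S n x)\<^sup>2)) \<partial>M) = (SUP n. \<integral>\<^sup>+x. ennreal ((S n x)\<^sup>2) \<partial>M)"
  proof (rule nn_integral_monotone_convergence_SUP)
    show "incseq (\<lambda>n x. ennreal ((S n x)\<^sup>2))"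
      by (intro incseq_SucI le_funI ennreal_leI power_mono) (auto simp: S_def intro: sum_nonneg)
  qed (simp add: S_def)
  also have "\<dots> \<le> ennreal 4"
  proof (rule SUP_least)
    fix n
    have "(\<integral>\<^sup>+x. ennreal ((S n x)\<^sup>2) \<partial>M) = ennreal ((L2_norm M (S n))\<^sup>2)"
      using L2_nn_integral[of "S n" M] L2_sum_norm[of d M n, OF d] by (simp add: S_def[abs_def])
    also have "\<dots> \<le> ennreal 4"
    proof (rule ennreal_leI)
      have "L2_norm M (S n) \<le> 2" using L2_sum_norm[of d M n, OF d] geo[of n] by (simp add: S_def[abs_def])
      then have "(L2_norm M (S n))\<^sup>2 \<le> 2\<^sup>2" by (intro power_mono) auto
      then show "(L2_norm M (S n))\<^sup>2 \<le> 4" by simp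
    qed
    finally show "(\<integral>\<^sup>+x. ennreal ((S n x)\<^sup>2) \<partial>M) \<le> ennreal 4" .
  qed
  finally have "(\<integral>\<^sup>+x. (SUP n. ennreal ((S n x)\<^sup>2)) \<partial>M) \<noteq> \<infinity>" by (auto simp: top_unique)
  then have "AE x in M. (SUP n. ennreal ((S n x)\<^sup>2)) \<noteq> \<infinity>"
    by (intro nn_integral_PInf_AE) (auto simp: S_def)
  then have conv: "AE x in M. convergent (\<lambda>k. u (r k) x)"
  proof eventually_elim
    fix x assume "(SUP n. ennreal ((S n x)\<^sup>2)) \<noteq> \<infinity>"
    then obtain B where B: "(SUP n. ennreal ((S n x)\<^sup>2)) = ennreal B" "B \<ge> 0"
      by (cases "SUP n. ennreal ((S n x)\<^sup>2)") auto
    have "S n x \<le> sqrt B" for n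
    proof -
      have "ennreal ((S n x)\<^sup>2) \<le> ennreal B" unfolding B(1)[symmetric] by (rule SUP_upper) auto
      then show ?thesis using B(2) by (intro real_le_rsqrt) simp
    qed
    then have "summable (\<lambda>k. norm (d k x))"
      by (intro summableI_nonneg_bounded[where x = "sqrt B"]) (auto simp: S_def)
    then have "summable (\<lambda>k. d k x)" by (rule summable_norm_cancel)
    then have "convergent (\<lambda>n. \<Sum>k<n. d k x)" by (simp add: summable_iff_convergent)
    moreover have "(\<Sum>k<n. d k x) = u (r n) x - u (r 0) x" for n
      unfolding d_def by (rule sum_lessThan_telescope[of "\<lambda>k. u (r k) x"])
    ultimately have "convergent (\<lambda>n. u (r n) x - u (r 0) x)" by simp
    then show "convergent (\<lambda>n. u (r n) x)"
      by (simp only: convergent_diff_const_right_iff)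
  qed
  define f where "f x = lim (\<lambda>k. u (r k) x)" for x
  have [measurable]: "f \<in> borel_measurable M" unfolding f_def by measurable
  have fatou: "(\<lambda>x. u n x - f x) \<in> L2 M \<and> L2_norm M (\<lambda>x. u n x - f x) \<le> (1/2)^j" if "n \<ge> r j" for n j
  proof (rule L2_nn_bound)
    have "(\<integral>\<^sup>+x. ennreal ((norm (u n x - f x))\<^sup>2) \<partial>M)
        = (\<integral>\<^sup>+x. liminf (\<lambda>k. ennreal ((norm (u n x - u (r k) x))\<^sup>2)) \<partial>M)"
    proof (rule nn_integral_cong_AE, use conv in eventually_elim)
      fix x assume "convergent (\<lambda>k. u (r k) x)"
      then have "(\<lambda>k. u (r k) x) \<longlonglongrightarrow> f x" by (simp add: f_def convergent_LIMSEQ_iff)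
      then have "(\<lambda>k. ennreal ((norm (u n x - u (r k) x))\<^sup>2)) \<longlonglongrightarrow> ennreal ((norm (u n x - f x))\<^sup>2)"
        by (intro tendsto_ennrealI tendsto_intros)
      then show "ennreal ((norm (u n x - f x))\<^sup>2) = liminf (\<lambda>k. ennreal ((norm (u n x - u (r k) x))\<^sup>2))"
        by (rule lim_imp_Liminf[symmetric, OF sequentially_bot])
    qed
    also have "\<dots> \<le> liminf (\<lambda>k. \<integral>\<^sup>+x. ennreal ((norm (u n x - u (r k) x))\<^sup>2) \<partial>M)"
      by (rule nn_integral_liminf) simp
    also have "\<dots> \<le> ennreal (((1/2)^j)\<^sup>2)"
    proof (rule Liminf_le[OF sequentially_bot], rule eventually_sequentiallyI[of j])
      fix k assume "k \<ge> j"
      then have "r k \<ge> r j" using strict_mono_less_eq[OF r] by simp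
      then have "L2_norm M (\<lambda>x. u n x - u (r k) x) \<le> (1/2)^j" using rk[of j n "r k"] that by simp
      then show "(\<integral>\<^sup>+x. ennreal ((norm (u n x - u (r k) x))\<^sup>2) \<partial>M) \<le> ennreal (((1/2)^j)\<^sup>2)"
        using L2_nn_integral[OF L2_diff[OF u u], of n "r k"]
        by (auto intro!: ennreal_leI power_mono)
    qed
    finally show "(\<integral>\<^sup>+x. ennreal ((norm (u n x - f x))\<^sup>2) \<partial>M) \<le> ennreal (((1/2)^j)\<^sup>2)" .
  qed auto
  have "f \<in> L2 M" using L2_diff[OF u[of "r 0"] conjunct1[OF fatou[of 0 "r 0"]]] by simp
  moreover have "(\<lambda>n. L2_norm M (\<lambda>x. u n x - f x)) \<longlonglongrightarrow> 0"
  proof (rule LIMSEQ_I)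
    fix e :: real assume "e > 0"
    then obtain j where j: "(1/2)^j < e" using real_arch_pow_inv[of e "1/2"] by auto
    show "\<exists>N. \<forall>n\<ge>N. norm (L2_norm M (\<lambda>x. u n x - f x) - 0) < e"
      using fatou[of j] j by (intro exI[of _ "r j"]) force
  qed
  ultimately show ?thesis by blast
qed

subsection \<open>The inner product\<close>

lemma cnj_measurable [measurable]: "cnj \<in> borel_measurable borel"
  by (intro borel_measurable_continuous_onI continuous_intros)

lemma ip_integrable: "u \<in> L2 M \<Longrightarrow> v \<in> L2 M \<Longrightarrow> integrable M (\<lambda>x. u x * cnj (v x))"
  by (rule L2_mult_integrable[of u M v]) (auto simp: norm_mult, measurable)

lemma ip_lin_left:
  "u \<in> L2 M \<Longrightarrow> v \<in> L2 M \<Longrightarrow> w \<in> L2 M \<Longrightarrow> ip M (\<lambda>x. u x + c * v x) w = ip M u w + c * ip M v w"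
  using ip_integrable[of u M w] ip_integrable[of v M w] by (simp add: ip_def distrib_right mult.assoc)

lemma ip_cnj: "cnj (ip M u v) = ip M v u"
  unfolding ip_def by (subst Bochner_Integration.integral_cnj[symmetric]) (simp add: mult.commute)

lemma ip_lin_right:
  "u \<in> L2 M \<Longrightarrow> v \<in> L2 M \<Longrightarrow> w \<in> L2 M \<Longrightarrow> ip M w (\<lambda>x. u x + c * v x) = ip M w u + cnj c * ip M w v"
  using ip_lin_left[of u M v w c] by (metis complex_cnj_add complex_cnj_mult ip_cnj)

lemma ip_cmult_left: "ip M (\<lambda>x. c * u x) v = c * ip M u v"
  by (simp add: ip_def mult.assoc)

lemma ip_cmult_right: "ip M u (\<lambda>x. c * v x) = cnj c * ip M u v"
  by (metis complex_cnj_mult ip_cmult_left ip_cnj)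

lemma ip_zero [simp]: "ip M (\<lambda>x. 0) v = 0" "ip M v (\<lambda>x. 0) = 0"
  by (simp_all add: ip_def)

lemma ip_self: "ip M u u = of_real ((L2_norm M u)\<^sup>2)"
proof -
  have "ip M u u = (\<integral>x. complex_of_real ((cmod (u x))\<^sup>2) \<partial>M)"
    unfolding ip_def by (intro Bochner_Integration.integral_cong refl) (simp only: complex_norm_square)
  then show ?thesis by (simp only: integral_complex_of_real L2_norm_sq)
qed

lemma ip_cong_AE:
  assumes "AE x in M. u x = u' x" "AE x in M. v x = v' x"
    and [measurable]: "u \<in> borel_measurable M" "u' \<in> borel_measurable M" "v \<in> borel_measurable M" "v' \<in> borel_measurable M"
  shows "ip M u v = ip M u' v'"
  unfolding ip_def
proof (rule integral_cong_AE)
  show "AE x in M. u x * cnj (v x) = u' x * cnj (v' x)" using assms(1,2) by eventually_elim simp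
qed measurable

lemma ip_Cauchy_Schwarz:
  assumes "u \<in> L2 M" "v \<in> L2 M"
  shows "cmod (ip M u v) \<le> L2_norm M u * L2_norm M v"
proof -
  have "cmod (ip M u v) \<le> (\<integral>x. norm (u x * cnj (v x)) \<partial>M)" unfolding ip_def by (rule integral_norm_bound)
  also have "\<dots> \<le> L2_norm M u * L2_norm M v"
    using L2_Cauchy_Schwarz_norm[OF assms] by (simp add: norm_mult)
  finally show ?thesis .
qed

lemma ip_tendsto:
  assumes "\<And>n. u n \<in> L2 M" "\<And>n. v n \<in> L2 M" "f \<in> L2 M" "g \<in> L2 M"
    and "(\<lambda>n. L2_norm M (\<lambda>x. u n x - f x)) \<longlonglongrightarrow> 0" "(\<lambda>n. L2_norm M (\<lambda>x. v n x - g x)) \<longlonglongrightarrow> 0"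
  shows "(\<lambda>n. ip M (u n) (v n)) \<longlonglongrightarrow> ip M f g"
proof (rule LIM_zero_cancel, rule Lim_null_comparison)
  let ?a = "\<lambda>n. L2_norm M (\<lambda>x. u n x - f x)" and ?b = "\<lambda>n. L2_norm M (\<lambda>x. v n x - g x)"
  show "\<forall>\<^sub>F n in sequentially. norm (ip M (u n) (v n) - ip M f g) \<le> ?a n * (?b n + L2_norm M g) + L2_norm M f * ?b n"
  proof (rule always_eventually, rule allI)
    fix n
    have un: "(\<lambda>x. u n x - f x) \<in> L2 M" and vn: "(\<lambda>x. v n x - g x) \<in> L2 M" using assms L2_diff by blast+
    have "ip M (u n) (v n) = ip M f (v n) + 1 * ip M (\<lambda>x. u n x - f x) (v n)"
      using ip_lin_left[OF assms(3) un assms(2), of 1] by simp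
    moreover have "ip M f (v n) = ip M f g + cnj 1 * ip M f (\<lambda>x. v n x - g x)"
      using ip_lin_right[OF assms(4) vn assms(3), of 1] by simp
    ultimately have "ip M (u n) (v n) - ip M f g = ip M f (\<lambda>x. v n x - g x) + ip M (\<lambda>x. u n x - f x) (v n)" by simp
    then have "norm (ip M (u n) (v n) - ip M f g) \<le> L2_norm M f * ?b n + ?a n * L2_norm M (v n)"
      using norm_triangle_ineq ip_Cauchy_Schwarz[OF assms(3) vn] ip_Cauchy_Schwarz[OF un assms(2)] by (smt (verit))
    also have "\<dots> \<le> L2_norm M f * ?b n + ?a n * (?b n + L2_norm M g)"
      using L2_norm_diff_le[OF assms(2,4), of n] by (intro add_left_mono mult_left_mono) auto
    finally show "norm (ip M (u n) (v n) - ip M f g) \<le> ?a n * (?b n + L2_norm M g) + L2_norm M f * ?b n" by simp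
  qed
  have "(\<lambda>n. ?a n * (?b n + L2_norm M g) + L2_norm M f * ?b n) \<longlonglongrightarrow> 0 * (0 + L2_norm M g) + L2_norm M f * 0"
    by (intro tendsto_intros assms)
  then show "(\<lambda>n. ?a n * (?b n + L2_norm M g) + L2_norm M f * ?b n) \<longlonglongrightarrow> 0" by simp
qed

lemma L2_norm_tendsto:
  assumes "\<And>n. u n \<in> L2 M" "f \<in> L2 M" "(\<lambda>n. L2_norm M (\<lambda>x. u n x - f x)) \<longlonglongrightarrow> 0"
  shows "(\<lambda>n. L2_norm M (u n)) \<longlonglongrightarrow> L2_norm M f"
proof (rule LIM_zero_cancel, rule Lim_null_comparison[OF _ assms(3)])
  show "\<forall>\<^sub>F n in sequentially. norm (L2_norm M (u n) - L2_norm M f) \<le> L2_norm M (\<lambda>x. u n x - f x)"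
    using L2_norm_diff_le[OF assms(1,2)] by simp
qed

lemma L2_norm_sq_add:
  assumes "u \<in> L2 M" "v \<in> L2 M"
  shows "(L2_norm M (\<lambda>x. u x + t * v x))\<^sup>2 = (L2_norm M u)\<^sup>2 + 2 * Re (t * ip M v u) + (cmod t)\<^sup>2 * (L2_norm M v)\<^sup>2"
proof -
  have tv: "(\<lambda>x. u x + t * v x) \<in> L2 M" using assms by (rule L2_lin)
  have "ip M (\<lambda>x. u x + t * v x) (\<lambda>x. u x + t * v x) = ip M u u + cnj t * ip M u v + (t * ip M v u + t * cnj t * ip M v v)"
    using ip_lin_left[OF assms tv, of t] ip_lin_right[OF assms assms(1), of t] ip_lin_right[OF assms assms(2), of t]
    by (simp add: algebra_simps)
  then have "Re (ip M (\<lambda>x. u x + t * v x) (\<lambda>x. u x + t * v x))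
      = Re (ip M u u) + Re (cnj (t * ip M v u)) + (Re (t * ip M v u) + Re (t * cnj t * ip M v v))"
    by (simp only: plus_complex.sel complex_cnj_mult ip_cnj)
  moreover have "t * cnj t * ip M v v = of_real ((cmod t)\<^sup>2 * (L2_norm M v)\<^sup>2)"
    by (simp only: ip_self complex_norm_square[symmetric] of_real_mult)
  ultimately show ?thesis by (simp only: ip_self Re_complex_of_real cnj.sel)
qed

section \<open>The spectrum of a semibounded form below the essential spectrum\<close>

locale semibounded_form =
  fixes D :: "(real ^ 3 \<Rightarrow> complex) set" and a :: "(real ^ 3 \<Rightarrow> complex) \<Rightarrow> (real ^ 3 \<Rightarrow> complex) \<Rightarrow> complex"
    and K :: real
  assumes D_nonempty: "D \<noteq> {}"
    and D_L2: "u \<in> D \<Longrightarrow> u \<in> L2 lborel"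
    and D_lin: "u \<in> D \<Longrightarrow> v \<in> D \<Longrightarrow> (\<lambda>x. u x + c * v x) \<in> D"
    and a_lin: "u \<in> D \<Longrightarrow> v \<in> D \<Longrightarrow> w \<in> D \<Longrightarrow> a (\<lambda>x. u x + c * v x) w = a u w + c * a v w"
    and a_herm: "u \<in> D \<Longrightarrow> v \<in> D \<Longrightarrow> a v u = cnj (a u v)"
    and a_lower: "u \<in> D \<Longrightarrow> - K * (L2_norm lborel u)\<^sup>2 \<le> Re (a u u)"
begin

abbreviation "Op \<equiv> form_operator D a"
abbreviation "nrm \<equiv> L2_norm (lborel :: (real ^ 3) measure)"
abbreviation "inn \<equiv> ip (lborel :: (real ^ 3) measure)"

definition shifted_form :: "real \<Rightarrow> (real ^ 3 \<Rightarrow> complex) \<Rightarrow> (real ^ 3 \<Rightarrow> complex) \<Rightarrow> complex" where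
  "shifted_form m u v = a u v - of_real m * inn u v"

definition shifted_quad :: "real \<Rightarrow> (real ^ 3 \<Rightarrow> complex) \<Rightarrow> real" where
  "shifted_quad m u = Re (a u u) - m * (nrm u)\<^sup>2"

lemma zero_in_D: "(\<lambda>x. 0) \<in> D"
proof -
  obtain u where "u \<in> D" using D_nonempty by blast
  from D_lin[OF this this, of "-1"] show ?thesis by simp
qed

lemma D_cmult: "u \<in> D \<Longrightarrow> (\<lambda>x. c * u x) \<in> D"
  using D_lin[OF zero_in_D, of u c] by simp

lemma a_lin_right:
  assumes "u \<in> D" "v \<in> D" "w \<in> D"
  shows "a w (\<lambda>x. u x + c * v x) = a w u + cnj c * a w v"
  using a_lin[OF assms, of c] a_herm[OF assms(3) D_lin[OF assms(1,2), of c]] a_herm[OF assms(3,1)] a_herm[OF assms(3,2)]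
  by (metis complex_cnj_add complex_cnj_cnj complex_cnj_mult)

lemma shifted_quad_add:
  assumes "u \<in> D" "v \<in> D"
  shows "shifted_quad m (\<lambda>x. u x + t * v x)
    = shifted_quad m u + 2 * Re (t * shifted_form m v u) + (cmod t)\<^sup>2 * shifted_quad m v"
proof -
  have tv: "(\<lambda>x. u x + t * v x) \<in> D" using assms by (rule D_lin)
  have "a (\<lambda>x. u x + t * v x) (\<lambda>x. u x + t * v x) = a u u + cnj t * cnj (a v u) + (t * a v u + t * cnj t * a v v)"
    using a_lin[OF assms tv, of t] a_lin_right[OF assms assms(1), of t] a_lin_right[OF assms assms(2), of t]
      a_herm[OF assms(2,1)]
    by (simp add: algebra_simps)
  then have E1: "Re (a (\<lambda>x. u x + t * v x) (\<lambda>x. u x + t * v x))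
     = Re (a u u) + 2 * Re (t * a v u) + Re (t * cnj t * a v v)"
    by simp
  have E2: "Re (t * cnj t * a v v) = (cmod t)\<^sup>2 * Re (a v v)"
    by (simp only: complex_norm_square[symmetric]) simp
  have E3: "Re (t * shifted_form m v u) = Re (t * a v u) - m * Re (t * inn v u)"
    by (simp add: shifted_form_def algebra_simps)
  show ?thesis
    unfolding shifted_quad_def E1 E2 E3 L2_norm_sq_add[OF D_L2[OF assms(1)] D_L2[OF assms(2)], of t]
    by (simp only: ring_distribs mult_ac)
qed

lemma shifted_form_Cauchy_Schwarz:
  assumes "u \<in> D" "v \<in> D" "\<And>t. 0 \<le> shifted_quad m (\<lambda>x. u x + t * v x)" "0 \<le> shifted_quad m v"
  shows "(cmod (shifted_form m v u))\<^sup>2 \<le> shifted_quad m v * shifted_quad m u"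
  using hermitian_quadratic_nonneg_imp_discriminant[of "shifted_quad m u" "shifted_form m v u" "shifted_quad m v"]
    assms shifted_quad_add[OF assms(1,2), of m] by (simp add: mult.commute)

lemma OpD: "(u, f) \<in> Op \<Longrightarrow> u \<in> D" "(u, f) \<in> Op \<Longrightarrow> f \<in> L2 lborel"
  "(u, f) \<in> Op \<Longrightarrow> v \<in> D \<Longrightarrow> a u v = inn f v"
  by (auto simp: form_operator_def)

lemma Op_L2: "(u, f) \<in> Op \<Longrightarrow> u \<in> L2 lborel"
  by (intro D_L2 OpD(1))

lemma Op_lin: 
  assumes "(u, f) \<in> Op" "(v, g) \<in> Op"
  shows "(\<lambda>x. u x + c * v x, \<lambda>x. f x + c * g x) \<in> Op"
  using assms unfolding form_operator_def
  by (auto simp: D_lin L2_lin a_lin ip_lin_left D_L2)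

lemma Op_cmult:
  assumes "(u, f) \<in> Op"
  shows "(\<lambda>x. c * u x, \<lambda>x. c * f x) \<in> Op"
  using Op_lin[OF Op_lin[OF assms assms, of "-1"] assms, of c] by simp

lemma Op_cong:
  assumes "(u, f) \<in> Op" "g \<in> L2 lborel" "AE x in lborel. f x = g x"
  shows "(u, g) \<in> Op"
proof -
  have "inn g v = inn f v" if "v \<in> D" for v
    using assms OpD(2)[OF assms(1)] D_L2[OF that] by (intro ip_cong_AE) (auto dest: L2_measurable)
  then show ?thesis using assms by (auto simp: form_operator_def)
qed

lemma Op_symmetric:
  assumes "(u, f) \<in> Op" "(v, g) \<in> Op"
  shows "inn f v = inn u g"
  using OpD(3)[OF assms(1) OpD(1)[OF assms(2)]] OpD(3)[OF assms(2) OpD(1)[OF assms(1)]]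
    a_herm[OF OpD(1)[OF assms(1)] OpD(1)[OF assms(2)]]
  by (metis complex_cnj_cnj ip_cnj)

lemma Op_symmetric_shift:
  assumes "(u, f) \<in> Op" "(v, g) \<in> Op"
  shows "inn (\<lambda>x. f x - of_real c * u x) v = inn u (\<lambda>x. g x - of_real c * v x)"
  using ip_lin_left[OF OpD(2)[OF assms(1)] Op_L2[OF assms(1)] Op_L2[OF assms(2)], of "- of_real c"]
    ip_lin_right[OF OpD(2)[OF assms(2)] Op_L2[OF assms(2)] Op_L2[OF assms(1)], of "- of_real c"] Op_symmetric[OF assms]
  by simp

lemma eigenspace_iff: "u \<in> eigenspace Op z \<longleftrightarrow> (u, \<lambda>x. z * u x) \<in> Op"
proof
  assume "u \<in> eigenspace Op z"
  then obtain f where f: "(u, f) \<in> Op" "AE x in lborel. f x = z * u x" by (auto simp: eigenspace_def)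
  then show "(u, \<lambda>x. z * u x) \<in> Op" by (intro Op_cong[OF f(1)]) (auto intro: L2_cmult Op_L2)
qed (auto simp: eigenspace_def)

lemma eigenspace_L2: "u \<in> eigenspace Op z \<Longrightarrow> u \<in> L2 lborel"
  by (auto simp: eigenspace_iff Op_L2)

lemma eigenspace_D: "u \<in> eigenspace Op z \<Longrightarrow> u \<in> D"
  by (auto simp: eigenspace_iff OpD(1))

lemma resolvent_setE:
  assumes "z \<in> resolvent_set Op"
  obtains C where "C > 0" "\<And>u f. (u, f) \<in> Op \<Longrightarrow> nrm u \<le> C * nrm (\<lambda>x. f x - z * u x)"
    "\<And>g. g \<in> L2 lborel \<Longrightarrow> \<exists>u. (u, \<lambda>x. g x + z * u x) \<in> Op \<and> nrm u \<le> C * nrm g"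
proof -
  obtain C0 where C0: "\<And>u f. (u, f) \<in> Op \<Longrightarrow> nrm u \<le> C0 * nrm (\<lambda>x. f x - z * u x)"
    and ex: "\<And>g. g \<in> L2 lborel \<Longrightarrow> \<exists>(u, f)\<in>Op. AE x in lborel. f x - z * u x = g x"
    using assms unfolding resolvent_set_def by blast
  define C where "C = max C0 1"
  have C: "nrm u \<le> C * nrm (\<lambda>x. f x - z * u x)" if "(u, f) \<in> Op" for u f
    using C0[OF that] mult_right_mono[of C0 C "nrm (\<lambda>x. f x - z * u x)"] by (simp add: C_def)
  show ?thesis
  proof (rule that[of C])
    show "C > 0" by (simp add: C_def)
    fix g :: "real ^ 3 \<Rightarrow> complex" assume g: "g \<in> L2 lborel"
    then obtain u f where uf: "(u, f) \<in> Op" "AE x in lborel. f x - z * u x = g x" using ex by blast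
    have "(u, \<lambda>x. g x + z * u x) \<in> Op"
    proof (rule Op_cong[OF uf(1)])
      show "AE x in lborel. f x = g x + z * u x" using uf(2) by eventually_elim (simp add: algebra_simps)
    qed (use uf g in \<open>auto intro: L2_lin Op_L2\<close>)
    with C[OF this] show "\<exists>u. (u, \<lambda>x. g x + z * u x) \<in> Op \<and> nrm u \<le> C * nrm g" by auto
  qed (rule C)
qed

text \<open>The resolvent bound of a self-adjoint operator. The infimum \<open>q\<close> of
  \<open>|(A - c) u|\<^sup>2 / |u|\<^sup>2\<close> cannot be less than \<open>d\<^sup>2\<close>: otherwise \<open>(A - c)\<^sup>2 - q = (A - c - s) (A - c + s)\<close>
  with \<open>s = sqrt q\<close> has a bounded inverse, and a nonnegative form whose operator has a bounded
  inverse is bounded below by a positive constant.\<close>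

lemma resolvent_gap:
  assumes d: "d > 0" and res: "\<And>t. c - d < t \<Longrightarrow> t < c + d \<Longrightarrow> complex_of_real t \<in> resolvent_set Op"
    and uf: "(u, f) \<in> Op"
  shows "d * nrm u \<le> nrm (\<lambda>x. f x - of_real c * u x)"
proof (rule ccontr)
  define N where "N u f = nrm (\<lambda>x. f x - complex_of_real c * u x)" for u f
  assume "\<not> d * nrm u \<le> nrm (\<lambda>x. f x - of_real c * u x)"
  then have less: "N u f < d * nrm u" by (simp add: N_def)
  have N0: "0 \<le> N u f" for u f by (simp add: N_def)
  then have u0: "nrm u > 0" using less N0[of u f] d by (metis L2_norm_nonneg less_eq_real_def mult_zero_right not_le)
  define R where "R = {(N u f)\<^sup>2 / (nrm u)\<^sup>2 | u f. (u, f) \<in> Op \<and> nrm u > 0}"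
  define q where "q = Inf R"
  have inR: "(N u f)\<^sup>2 / (nrm u)\<^sup>2 \<in> R" using uf u0 unfolding R_def by blast
  have bdd: "bdd_below R" unfolding R_def by (intro bdd_belowI[of _ 0]) auto
  have q0: "q \<ge> 0" unfolding q_def by (rule cInf_greatest) (use inR in \<open>auto simp: R_def\<close>)
  have "q \<le> (N u f)\<^sup>2 / (nrm u)\<^sup>2" unfolding q_def by (rule cInf_lower[OF inR bdd])
  also have "\<dots> < d\<^sup>2"
  proof -
    have "(N u f)\<^sup>2 < (d * nrm u)\<^sup>2" using less N0 by (intro power_strict_mono) auto
    then show ?thesis using u0 by (simp add: field_simps power_mult_distrib)
  qed
  finally have qd: "q < d\<^sup>2" .
  define s where "s = sqrt q"
  have s: "0 \<le> s" "s < d" "s * s = q" using q0 qd d real_less_lsqrt[of d q] by (auto simp: s_def)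
  have H0: "q * (nrm u)\<^sup>2 \<le> (N u f)\<^sup>2" if "(u, f) \<in> Op" for u f
  proof (cases "nrm u > 0")
    case True
    then have "q \<le> (N u f)\<^sup>2 / (nrm u)\<^sup>2" unfolding q_def using that by (intro cInf_lower[OF _ bdd]) (auto simp: R_def)
    then show ?thesis using True by (simp add: field_simps)
  next
    case False
    then have "nrm u = 0" using L2_norm_nonneg[of lborel] by (meson antisym not_le)
    then show ?thesis by simp
  qed
  have rp: "complex_of_real (c + s) \<in> resolvent_set Op" and rm: "complex_of_real (c - s) \<in> resolvent_set Op"
    by (rule res; use s d in linarith)+
  obtain C1 where C1: "C1 > 0" "\<And>g. g \<in> L2 lborel \<Longrightarrow> \<exists>u. (u, \<lambda>x. g x + complex_of_real (c + s) * u x) \<in> Op \<and> nrm u \<le> C1 * nrm g"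
    by (rule resolvent_setE[OF rp]) blast
  obtain C2 where C2: "C2 > 0" "\<And>g. g \<in> L2 lborel \<Longrightarrow> \<exists>u. (u, \<lambda>x. g x + complex_of_real (c - s) * u x) \<in> Op \<and> nrm u \<le> C2 * nrm g"
    by (rule resolvent_setE[OF rm]) blast
  define C where "C = C2 * C1"
  have C: "C > 0" using C1 C2 by (simp add: C_def)
  have key: "(nrm u)\<^sup>2 \<le> C * ((N u f)\<^sup>2 - q * (nrm u)\<^sup>2)" if uf: "(u, f) \<in> Op" for u f
  proof (cases "nrm u = 0")
    case True
    then show ?thesis using H0[OF uf] C by simp
  next
    case False
    have uL: "u \<in> L2 lborel" using uf by (rule Op_L2)
    obtain w1 where w1: "(w1, \<lambda>x. u x + complex_of_real (c + s) * w1 x) \<in> Op" "nrm w1 \<le> C1 * nrm u"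
      using C1(2)[OF uL] by blast
    have w1L: "w1 \<in> L2 lborel" using w1 Op_L2 by blast
    obtain w where w: "(w, \<lambda>x. w1 x + complex_of_real (c - s) * w x) \<in> Op" "nrm w \<le> C2 * nrm w1"
      using C2(2)[OF w1L] by blast
    have wL: "w \<in> L2 lborel" using w Op_L2 by blast
    define fw where "fw x = w1 x + complex_of_real (c - s) * w x" for x
    have wA: "(w, fw) \<in> Op" using w by (simp add: fw_def[abs_def])
    have fw: "(\<lambda>x. fw x - of_real c * w x) = (\<lambda>x. w1 x + (- of_real s) * w x)"
      by (auto simp: fw_def algebra_simps)
    have fwL: "fw \<in> L2 lborel" using OpD(2)[OF wA] .
    have h: "inn (\<lambda>x. fw x - of_real c * w x) (\<lambda>x. g x - of_real c * v x) - of_real q * inn w v = inn u v"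
      if vg: "(v, g) \<in> Op" for v g
    proof -
      have vL: "v \<in> L2 lborel" and gL: "g \<in> L2 lborel" using Op_L2[OF vg] OpD(2)[OF vg] .
      have cL: "(\<lambda>x. g x - of_real c * v x) \<in> L2 lborel" using L2_lin[OF gL vL, of "- of_real c"] by simp
      have e1: "inn w1 (\<lambda>x. g x - of_real c * v x) = inn (\<lambda>x. u x + of_real s * w1 x) v"
        using Op_symmetric_shift[OF w1(1) vg, of c] by (simp add: algebra_simps)
      have e2: "inn w (\<lambda>x. g x - of_real c * v x) = inn (\<lambda>x. w1 x + (- of_real s) * w x) v"
        using Op_symmetric_shift[OF wA vg, of c] unfolding fw by simp
      show ?thesis
        unfolding fw ip_lin_left[OF w1L wL cL] e1 e2 ip_lin_left[OF uL w1L vL] ip_lin_left[OF w1L wL vL] s(3)[symmetric]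
        by (simp add: algebra_simps)
    qed
    have PwL: "(\<lambda>x. fw x - of_real c * w x) \<in> L2 lborel" using L2_lin[OF fwL wL, of "- of_real c"] by simp
    have PuL: "(\<lambda>x. f x - of_real c * u x) \<in> L2 lborel" using L2_lin[OF OpD(2)[OF uf] uL, of "- of_real c"] by simp
    have "(N w fw)\<^sup>2 - q * (nrm w)\<^sup>2 = Re (inn u w)"
      using arg_cong[OF h[OF wA], of Re] by (simp add: ip_self N_def)
    also have "\<dots> \<le> nrm u * nrm w"
      using complex_Re_le_cmod ip_Cauchy_Schwarz[OF uL wL] order_trans by blast
    also have "\<dots> \<le> nrm u * (C2 * (C1 * nrm u))"
      by (intro mult_left_mono order_trans[OF w(2)] w1(2)) (use C2 in auto)
    also have "\<dots> = C * (nrm u)\<^sup>2" by (simp add: C_def power2_eq_square)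
    finally have Hw: "(N w fw)\<^sup>2 - q * (nrm w)\<^sup>2 \<le> C * (nrm u)\<^sup>2" .
    have "(cmod (inn u u))\<^sup>2 \<le> ((N u f)\<^sup>2 - q * (nrm u)\<^sup>2) * ((N w fw)\<^sup>2 - q * (nrm w)\<^sup>2)"
    proof (rule hermitian_quadratic_nonneg_imp_discriminant)
      fix t :: complex
      have "q * (nrm (\<lambda>x. u x + t * w x))\<^sup>2 \<le> (N (\<lambda>x. u x + t * w x) (\<lambda>x. f x + t * fw x))\<^sup>2"
        by (intro H0 Op_lin uf wA)
      moreover have "N (\<lambda>x. u x + t * w x) (\<lambda>x. f x + t * fw x)
          = nrm (\<lambda>x. (f x - of_real c * u x) + t * (fw x - of_real c * w x))"
        by (simp add: N_def algebra_simps)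
      moreover have "Re (t * inn u u) = Re (t * inn (\<lambda>x. fw x - of_real c * w x) (\<lambda>x. f x - of_real c * u x)) - q * Re (t * inn w u)"
        unfolding h[OF uf, symmetric] by (simp add: algebra_simps)
      ultimately show "0 \<le> (N u f)\<^sup>2 - q * (nrm u)\<^sup>2 + 2 * Re (t * inn u u) + (cmod t)\<^sup>2 * ((N w fw)\<^sup>2 - q * (nrm w)\<^sup>2)"
        using L2_norm_sq_add[OF uL wL, of t] L2_norm_sq_add[OF PuL PwL, of t]
        by (simp add: N_def algebra_simps)
    qed (use H0[OF wA] in simp)
    also have "\<dots> \<le> ((N u f)\<^sup>2 - q * (nrm u)\<^sup>2) * (C * (nrm u)\<^sup>2)"
      using Hw H0[OF uf] by (intro mult_left_mono) auto
    finally have "(nrm u)\<^sup>2 * (nrm u)\<^sup>2 \<le> (C * ((N u f)\<^sup>2 - q * (nrm u)\<^sup>2)) * (nrm u)\<^sup>2"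
      by (simp add: ip_self norm_mult power2_eq_square mult_ac)
    moreover have "0 < (nrm u)\<^sup>2" using False by simp
    ultimately show ?thesis by (rule mult_right_le_imp_le)
  qed
  have "q + 1 / C \<le> q" unfolding q_def
  proof (rule cInf_greatest, use inR in blast)
    fix r assume "r \<in> R"
    then obtain u f where r: "r = (N u f)\<^sup>2 / (nrm u)\<^sup>2" "(u, f) \<in> Op" "nrm u > 0" unfolding R_def by blast
    have "(Inf R + 1 / C) * (nrm u)\<^sup>2 \<le> (N u f)\<^sup>2"
      using key[OF r(2)] C by (simp add: q_def field_simps)
    then show "Inf R + 1 / C \<le> r" using r(1,3) by (simp add: pos_le_divide_eq)
  qed
  then show False using C by simp
qed

definition orth_below :: "real \<Rightarrow> (real ^ 3 \<Rightarrow> complex) \<Rightarrow> bool" where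
  "orth_below l v \<longleftrightarrow> (\<forall>m<l. \<forall>u\<in>eigenspace Op (of_real m). inn v u = 0)"

lemma orth_below_lin:
  assumes "orth_below l u" "orth_below l v" "u \<in> L2 lborel" "v \<in> L2 lborel"
  shows "orth_below l (\<lambda>x. u x + c * v x)"
  using assms ip_lin_left[OF assms(3,4)] eigenspace_L2 by (fastforce simp: orth_below_def)

lemma orth_below_image:
  assumes "orth_below l u" "(u, f) \<in> Op"
  shows "orth_below l (\<lambda>x. f x - of_real c * u x)"
  unfolding orth_below_def
proof (intro allI impI ballI)
  fix m v assume m: "m < l" and v: "v \<in> eigenspace Op (complex_of_real m)"
  have "inn (\<lambda>x. f x - of_real c * u x) v = inn u (\<lambda>x. of_real (m - c) * v x)"
    using Op_symmetric_shift[OF assms(2) v[unfolded eigenspace_iff], of c] by (simp add: algebra_simps)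
  also have "\<dots> = cnj (of_real (m - c)) * inn u v" by (rule ip_cmult_right)
  also have "\<dots> = 0" using assms(1) m v by (simp add: orth_below_def)
  finally show "inn (\<lambda>x. f x - of_real c * u x) v = 0" .
qed

lemma eigenvector_orth_resolvent:
  assumes t: "complex_of_real t \<in> resolvent_set Op" and g: "orth_below l g" "g \<in> L2 lborel"
    and w: "(w, \<lambda>x. g x + of_real t * w x) \<in> Op"
  shows "orth_below l w"
  unfolding orth_below_def
proof (intro allI impI ballI)
  fix m v assume m: "m < l" and v: "v \<in> eigenspace Op (complex_of_real m)"
  have vL: "v \<in> L2 lborel" using v by (rule eigenspace_L2)
  have "inn g v = inn w (\<lambda>x. of_real (m - t) * v x)"
    using Op_symmetric_shift[OF w v[unfolded eigenspace_iff], of t] by (simp add: algebra_simps)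
  also have "\<dots> = cnj (of_real (m - t)) * inn w v" by (rule ip_cmult_right)
  finally have 0: "(m - t) = 0 \<or> inn w v = 0" using g m v by (auto simp: orth_below_def)
  show "inn w v = 0"
  proof (cases "m = t")
    case True
    obtain C where "nrm v \<le> C * nrm (\<lambda>x. of_real m * v x - of_real t * v x)"
      by (rule resolvent_setE[OF t]) (use v[unfolded eigenspace_iff] in blast)
    also have "nrm (\<lambda>x. of_real m * v x - of_real t * v x) = 0" using True by (simp add: L2_norm_def)
    finally have "nrm v = 0" using L2_norm_nonneg[of lborel v] by (simp add: antisym)
    then show ?thesis using ip_Cauchy_Schwarz[OF Op_L2[OF w] vL] by simp
  qed (use 0 in simp)
qed

text \<open>If the form shifted by \<open>m\<close> is nonnegative on the complement of the eigenvectors below \<open>l\<close>, and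
  if the operator has a bounded inverse at \<open>t \<le> m\<close> on it, with bound \<open>1 / c\<close> and \<open>c > m - t\<close>, then
  the shifted form has a positive lower bound.\<close>

lemma resolvent_imp_form_bound:
  assumes t: "complex_of_real t \<in> resolvent_set Op" "t \<le> m" and c: "c > 0"
    and nonneg: "\<And>v. v \<in> D \<Longrightarrow> orth_below l v \<Longrightarrow> 0 \<le> shifted_quad m v"
    and bound: "\<And>w f. (w, f) \<in> Op \<Longrightarrow> orth_below l w \<Longrightarrow> c * nrm w \<le> nrm (\<lambda>x. f x - of_real t * w x)"
    and v: "v \<in> D" "orth_below l v"
  shows "c * (nrm v)\<^sup>2 \<le> shifted_quad t v"
proof (cases "nrm v = 0")
  case True
  have "shifted_quad t v = shifted_quad m v + (m - t) * (nrm v)\<^sup>2" by (simp add: shifted_quad_def algebra_simps)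
  then show ?thesis using nonneg[OF v] True by simp
next
  case False
  have vL: "v \<in> L2 lborel" using v by (simp add: D_L2)
  have nonneg': "0 \<le> shifted_quad t v" if "v \<in> D" "orth_below l v" for v
  proof -
    have "shifted_quad t v = shifted_quad m v + (m - t) * (nrm v)\<^sup>2" by (simp add: shifted_quad_def algebra_simps)
    then show ?thesis using nonneg[OF that] t by simp
  qed
  obtain w where w: "(w, \<lambda>x. v x + of_real t * w x) \<in> Op" by (rule resolvent_setE[OF t(1)]) (use vL in blast)
  have wD: "w \<in> D" and wL: "w \<in> L2 lborel" using OpD(1)[OF w] Op_L2[OF w] .
  have wo: "orth_below l w" using eigenvector_orth_resolvent[OF t(1) v(2) vL w] .
  have form: "shifted_form t w y = inn v y" if "y \<in> D" for y
    using OpD(3)[OF w that] ip_lin_left[OF vL wL D_L2[OF that], of "of_real t"] by (simp add: shifted_form_def)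
  have "Re (a w w) - t * (nrm w)\<^sup>2 = Re (shifted_form t w w)" by (simp add: shifted_form_def ip_self)
  then have "shifted_quad t w = Re (inn v w)" using form[OF wD] by (simp add: shifted_quad_def)
  also have "\<dots> \<le> nrm v * nrm w" using complex_Re_le_cmod ip_Cauchy_Schwarz[OF vL wL] order_trans by blast
  also have "\<dots> \<le> nrm v * (nrm v / c)"
    using bound[OF w wo] c by (intro mult_left_mono) (auto simp: field_simps)
  finally have qw: "shifted_quad t w \<le> (nrm v)\<^sup>2 / c" by (simp add: power2_eq_square)
  have "(cmod (inn v v))\<^sup>2 \<le> shifted_quad t w * shifted_quad t v"
    unfolding form[OF v(1), symmetric]
    by (intro shifted_form_Cauchy_Schwarz nonneg' D_lin orth_below_lin wo wD v vL wL)
  also have "\<dots> \<le> (nrm v)\<^sup>2 / c * shifted_quad t v"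
    by (intro mult_right_mono qw nonneg' v)
  finally have "(nrm v)\<^sup>2 * (nrm v)\<^sup>2 \<le> (shifted_quad t v / c) * (nrm v)\<^sup>2"
    by (simp add: ip_self norm_mult power2_eq_square mult_ac)
  moreover have "0 < (nrm v)\<^sup>2" using False by simp
  ultimately have "(nrm v)\<^sup>2 \<le> shifted_quad t v / c" by (rule mult_right_le_imp_le)
  then show ?thesis using c by (simp add: field_simps)
qed

lemma discrete_below_ess:
  assumes "ereal m < inf_ess_spectrum Op" "complex_of_real m \<in> spectrum Op"
  shows "complex_of_real m \<in> discrete_spectrum Op"
proof (rule ccontr)
  assume "\<not> ?thesis"
  then have "complex_of_real m \<in> ess_spectrum Op" using assms by (simp add: ess_spectrum_def)
  then have "inf_ess_spectrum Op \<le> ereal (Re (complex_of_real m))" unfolding inf_ess_spectrum_def by (rule INF_lower)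
  then show False using assms(1) by simp
qed

text \<open>An isolated point \<open>m\<close> of the spectrum that is the infimum of the form on the complement of
  the eigenvectors below \<open>l > m\<close>. With \<open>P = A - m\<close>, the gap above \<open>m\<close> says \<open>|P u|\<^sup>2 \<ge> \<delta> (P u, u)\<close>, so
  that \<open>(P w, w) \<ge> \<delta> |w|\<^sup>2\<close> for \<open>w\<close> in the range of \<open>P\<close>, and \<open>\<epsilon> (P + \<epsilon>)\<^sup>-\<^sup>1\<close> contracts this range. Its
  iterates converge to an element of the kernel of \<open>P\<close>, which is trivial here; the speed of the
  convergence bounds the inverse of \<open>P\<close>.\<close>

lemma isolated_bounded_inverse:
  assumes \<delta>: "\<delta> > 0" and iso: "\<And>t. \<bar>t - m\<bar> < \<delta> \<Longrightarrow> t \<noteq> m \<Longrightarrow> complex_of_real t \<in> resolvent_set Op"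
    and ml: "m < l" and nonneg: "\<And>v. v \<in> D \<Longrightarrow> orth_below l v \<Longrightarrow> 0 \<le> shifted_quad m v"
    and uf: "(u, f) \<in> Op" "orth_below l u"
  shows "\<delta> * nrm u \<le> nrm (\<lambda>x. f x - of_real m * u x)"
proof -
  define P where "P u f = (\<lambda>x. f x - complex_of_real m * u x)" for u f :: "real ^ 3 \<Rightarrow> complex"
  have PL: "P u f \<in> L2 lborel" if "(u, f) \<in> Op" for u f
    using L2_lin[OF OpD(2)[OF that] Op_L2[OF that], of "- of_real m"] by (simp add: P_def)
  have quad_P: "shifted_quad m u = Re (inn (P u f) u)" if "(u, f) \<in> Op" for u f
    using OpD(3)[OF that OpD(1)[OF that]] ip_lin_left[OF OpD(2)[OF that] Op_L2[OF that] Op_L2[OF that], of "- of_real m"]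
    by (simp add: shifted_quad_def P_def ip_self)
  have gap: "\<delta> * shifted_quad m u \<le> (nrm (P u f))\<^sup>2" if uf: "(u, f) \<in> Op" for u f
  proof -
    have "\<delta> / 2 * nrm u \<le> nrm (\<lambda>x. f x - of_real (m + \<delta> / 2) * u x)"
      by (rule resolvent_gap[OF _ iso uf]) (use \<delta> in \<open>auto simp: abs_if\<close>)
    also have "(\<lambda>x. f x - of_real (m + \<delta> / 2) * u x) = (\<lambda>x. P u f x + (- of_real (\<delta> / 2)) * u x)"
      by (simp add: P_def algebra_simps)
    finally have "(\<delta> / 2 * nrm u)\<^sup>2 \<le> (nrm (\<lambda>x. P u f x + (- of_real (\<delta> / 2)) * u x))\<^sup>2"
      using \<delta> by (intro power_mono) auto
    also have "\<dots> = (nrm (P u f))\<^sup>2 - \<delta> * Re (inn u (P u f)) + (\<delta> / 2)\<^sup>2 * (nrm u)\<^sup>2"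
      using L2_norm_sq_add[OF PL[OF uf] Op_L2[OF uf], of "- of_real (\<delta> / 2)"] \<delta> by (simp add: norm_divide)
    also have "Re (inn u (P u f)) = shifted_quad m u"
      using quad_P[OF uf] ip_cnj[of lborel "P u f" u] by (metis cnj.sel(1))
    finally show ?thesis by (simp add: power_mult_distrib power_divide)
  qed
  have range: "\<delta> * (nrm (P y g))\<^sup>2 \<le> shifted_quad m (P y g)"
    if yg: "(y, g) \<in> Op" and y: "orth_below l y" and w: "P y g \<in> D" for y g
  proof (cases "nrm (P y g) = 0")
    case True
    then show ?thesis using nonneg[OF w] orth_below_image[OF y yg, of m] by (simp add: P_def)
  next
    case False
    let ?w = "P y g"
    have wo: "orth_below l ?w" using orth_below_image[OF y yg, of m] by (simp add: P_def)
    have yD: "y \<in> D" using OpD(1)[OF yg] .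
    have "shifted_form m y ?w = inn ?w ?w"
      using OpD(3)[OF yg w] ip_lin_left[OF OpD(2)[OF yg] Op_L2[OF yg] D_L2[OF w], of "- of_real m"]
      by (simp add: shifted_form_def P_def)
    then have "(cmod (inn ?w ?w))\<^sup>2 \<le> shifted_quad m y * shifted_quad m ?w"
      using shifted_form_Cauchy_Schwarz[OF w yD, of m] nonneg orth_below_lin[OF wo y] D_L2 w yD y D_lin by simp
    also have "\<dots> \<le> (nrm ?w)\<^sup>2 / \<delta> * shifted_quad m ?w"
      using gap[OF yg] \<delta> nonneg[OF w wo] by (intro mult_right_mono) (auto simp: field_simps)
    finally have "(nrm ?w)\<^sup>2 * (nrm ?w)\<^sup>2 \<le> (shifted_quad m ?w / \<delta>) * (nrm ?w)\<^sup>2"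
      by (simp add: ip_self norm_mult power2_eq_square mult_ac)
    moreover have "0 < (nrm ?w)\<^sup>2" using False by simp
    ultimately have "(nrm ?w)\<^sup>2 \<le> shifted_quad m ?w / \<delta>" by (rule mult_right_le_imp_le)
    then show ?thesis using \<delta> by (simp add: field_simps)
  qed
  define \<epsilon> where "\<epsilon> = \<delta> / 2"
  define t where "t = m - \<epsilon>"
  have \<epsilon>: "\<epsilon> > 0" "\<delta> = 2 * \<epsilon>" using \<delta> by (auto simp: \<epsilon>_def)
  have tres: "complex_of_real t \<in> resolvent_set Op" using \<delta> by (intro iso) (auto simp: t_def \<epsilon>_def abs_if)
  obtain C where C: "C > 0" "\<And>u f. (u, f) \<in> Op \<Longrightarrow> nrm u \<le> C * nrm (\<lambda>x. f x - of_real t * u x)"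
    "\<And>g. g \<in> L2 lborel \<Longrightarrow> \<exists>u. (u, \<lambda>x. g x + of_real t * u x) \<in> Op \<and> nrm u \<le> C * nrm g"
    by (rule resolvent_setE[OF tres]) blast
  define step where "step x = (SOME y. (y, \<lambda>z. of_real \<epsilon> * x z + of_real t * y z) \<in> Op)" for x
  have step: "(step x, \<lambda>z. of_real \<epsilon> * x z + of_real t * step x z) \<in> Op" if "x \<in> L2 lborel" for x
  proof -
    have "\<exists>y. (y, \<lambda>z. of_real \<epsilon> * x z + of_real t * y z) \<in> Op"
      using C(3)[OF L2_cmult[OF that, of "of_real \<epsilon>"]] by blast
    then show ?thesis unfolding step_def by (rule someI_ex)
  qed
  define X where "X k = (step ^^ k) u" for k
  define Y where "Y k = (case k of 0 \<Rightarrow> f | Suc j \<Rightarrow> (\<lambda>z. of_real \<epsilon> * X j z + of_real t * X (Suc j) z))" for k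
  have XY: "(X k, Y k) \<in> Op" for k
  proof (induction k)
    case 0
    then show ?case using uf by (simp add: X_def Y_def)
  next
    case (Suc k)
    then show ?case using step[OF Op_L2[OF Suc]] by (simp add: X_def Y_def)
  qed
  have XL: "X k \<in> L2 lborel" for k using Op_L2[OF XY] .
  have scaled: "orth_below l (\<lambda>x. of_real \<epsilon> * g x)" if "orth_below l g" for g
    using that ip_cmult_left[of lborel "of_real \<epsilon>" g] by (simp add: orth_below_def)
  have Xo: "orth_below l (X k)" for k
  proof (induction k)
    case 0
    then show ?case using uf by (simp add: X_def)
  next
    case (Suc k)
    show ?case
      by (rule eigenvector_orth_resolvent[OF tres scaled[OF Suc] L2_cmult[OF XL]])
         (use XY[of "Suc k"] in \<open>simp add: Y_def\<close>)
  qed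
  define Z where "Z k = P (X k) (Y k)" for k
  have ZL: "Z k \<in> L2 lborel" for k using PL[OF XY] by (simp add: Z_def)
  have Z_Suc: "Z (Suc k) = (\<lambda>x. of_real \<epsilon> * X k x + (- of_real \<epsilon>) * X (Suc k) x)" for k
    by (auto simp: Z_def P_def Y_def t_def algebra_simps)
  have contract: "nrm (Z (Suc k)) \<le> 1/3 * nrm (Z k)" for k
  proof -
    define W where "W = (\<lambda>x. of_real \<epsilon> * Y k x + (- of_real \<epsilon>) * Y (Suc k) x)"
    have ZW: "(Z (Suc k), W) \<in> Op" unfolding Z_Suc W_def by (rule Op_lin[OF Op_cmult[OF XY] XY])
    have PW: "P (Z (Suc k)) W = (\<lambda>x. of_real \<epsilon> * Z k x + (- of_real \<epsilon>) * Z (Suc k) x)"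
      unfolding W_def P_def Z_Suc by (auto simp: Z_def P_def Y_def t_def algebra_simps)
    have ZD: "Z (Suc k) \<in> D" using OpD(1)[OF ZW] .
    have "\<delta> * (nrm (Z (Suc k)))\<^sup>2 \<le> shifted_quad m (Z (Suc k))"
      using range[OF XY Xo, of "Suc k"] ZD by (simp add: Z_def)
    also have "\<dots> = Re (inn (P (Z (Suc k)) W) (Z (Suc k)))" by (rule quad_P[OF ZW])
    also have "\<dots> = \<epsilon> * Re (inn (Z k) (Z (Suc k))) - \<epsilon> * (nrm (Z (Suc k)))\<^sup>2"
      unfolding PW using ip_lin_left[OF L2_cmult[OF ZL] ZL ZL, of "of_real \<epsilon>" k "- of_real \<epsilon>" "Suc k" "Suc k"]
      by (simp add: ip_cmult_left ip_self)
    also have "\<dots> \<le> \<epsilon> * (nrm (Z k) * nrm (Z (Suc k))) - \<epsilon> * (nrm (Z (Suc k)))\<^sup>2"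
      using \<epsilon> complex_Re_le_cmod order_trans[OF complex_Re_le_cmod ip_Cauchy_Schwarz[OF ZL ZL]] by simp
    finally have "\<epsilon> * ((3 * nrm (Z (Suc k))) * nrm (Z (Suc k))) \<le> \<epsilon> * (nrm (Z k) * nrm (Z (Suc k)))"
      unfolding \<epsilon>(2) by (simp add: power2_eq_square algebra_simps)
    then have "(3 * nrm (Z (Suc k))) * nrm (Z (Suc k)) \<le> nrm (Z k) * nrm (Z (Suc k))"
      using \<epsilon> by (simp only: mult_le_cancel_left_pos)
    then have "3 * nrm (Z (Suc k)) \<le> nrm (Z k)"
      using mult_right_le_imp_le[of "3 * nrm (Z (Suc k))" "nrm (Z (Suc k))" "nrm (Z k)"]
        L2_norm_nonneg[of lborel "Z (Suc k)"] L2_norm_nonneg[of lborel "Z k"] by (cases "nrm (Z (Suc k)) = 0") linarith+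
    then show ?thesis by simp
  qed
  have Zk: "nrm (Z k) \<le> (1/3)^k * nrm (Z 0)" for k
  proof (induction k)
    case (Suc k)
    then show ?case using contract[of k] by simp
  qed simp
  have diff: "nrm (\<lambda>x. X k x - X (Suc k) x) \<le> (1/3)^Suc k * (nrm (Z 0) / \<epsilon>)" for k
  proof -
    have "Z (Suc k) = (\<lambda>x. of_real \<epsilon> * (X k x - X (Suc k) x))" unfolding Z_Suc by (simp add: algebra_simps)
    then have "nrm (Z (Suc k)) = \<epsilon> * nrm (\<lambda>x. X k x - X (Suc k) x)" using L2_norm_cmult[of lborel "of_real \<epsilon>" "\<lambda>x. X k x - X (Suc k) x"] \<epsilon> by simp
    then show ?thesis using Zk[of "Suc k"] \<epsilon> by (simp add: field_simps)
  qed
  define B where "B = nrm (Z 0) / (2 * \<epsilon>)"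
  have B0: "B \<ge> 0" using \<epsilon> by (simp add: B_def)
  have dist: "nrm (\<lambda>x. X k x - X (k + j) x) \<le> (1/3)^k * B * (1 - (1/3)^j)" for k j
  proof (induction j)
    case 0
    then show ?case by (simp add: L2_norm_def)
  next
    case (Suc j)
    have "nrm (\<lambda>x. X k x - X (k + Suc j) x) \<le> (1/3)^k * B * (1 - (1/3)^j) + (1/3)^Suc (k + j) * (nrm (Z 0) / \<epsilon>)"
      using L2_norm_triangle3[OF XL[of k] XL[of "k + j"] XL[of "k + Suc j"]] Suc diff[of "k + j"] by simp
    also have "\<dots> = (1/3)^k * B * (1 - (1/3)^Suc j)"
      using \<epsilon> by (simp add: B_def power_add field_simps)
    finally show ?case .
  qed
  have dist': "nrm (\<lambda>x. X k x - X n x) \<le> (1/3)^k * B" if "n \<ge> k" for k n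
  proof -
    have "(1/3)^k * B * (1 - (1/3)^(n - k)) \<le> (1/3)^k * B * 1"
      using B0 by (intro mult_left_mono) auto
    then have "(1/3)^k * B * (1 - (1/3)^(n - k)) \<le> (1/3)^k * B" by (simp only: mult_1_right)
    then show ?thesis using dist[of k "n - k"] that by (simp only: le_add_diff_inverse)
  qed
  have "\<exists>y\<in>L2 lborel. (\<lambda>n. nrm (\<lambda>x. X n x - y x)) \<longlonglongrightarrow> 0"
  proof (rule L2_complete[OF XL])
    fix e :: real assume "e > 0"
    then obtain N where N: "(1/3)^N < e / (B + 1)" using real_arch_pow_inv[of "e / (B + 1)" "1/3"] B0 by auto
    have small: "(1/3)^k * B < e" if "k \<ge> N" for k
    proof -
      have "(1/3)^k \<le> (1/3::real)^N" using that by (intro power_decreasing) auto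
      then have "(1/3)^k * B \<le> (1/3)^N * (B + 1)" using B0 by (intro mult_mono) auto
      also have "\<dots> < e" using N B0 by (simp add: field_simps)
      finally show ?thesis .
    qed
    show "\<exists>N. \<forall>j\<ge>N. \<forall>k\<ge>N. nrm (\<lambda>x. X j x - X k x) < e"
    proof (intro exI allI impI)
      fix j k assume "j \<ge> N" "k \<ge> N"
      then show "nrm (\<lambda>x. X j x - X k x) < e"
        using dist'[of j k] dist'[of k j] small[of j] small[of k] L2_norm_minus_commute[of lborel "X j" "X k"]
        by (cases "j \<le> k") auto
    qed
  qed
  then obtain y where y: "y \<in> L2 lborel" "(\<lambda>n. nrm (\<lambda>x. X n x - y x)) \<longlonglongrightarrow> 0" by blast
  have y0: "nrm y = 0"
  proof -
    let ?y = "step y"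
    have y': "(?y, \<lambda>z. of_real \<epsilon> * y z + of_real t * ?y z) \<in> Op" by (rule step[OF y(1)])
    have y'L: "?y \<in> L2 lborel" using Op_L2[OF y'] .
    have lim': "(\<lambda>n. nrm (\<lambda>x. X (Suc n) x - ?y x)) \<longlonglongrightarrow> 0"
    proof (rule Lim_null_comparison)
      show "\<forall>\<^sub>F n in sequentially. norm (nrm (\<lambda>x. X (Suc n) x - ?y x)) \<le> C * (\<epsilon> * nrm (\<lambda>x. X n x - y x))"
      proof (intro always_eventually allI)
        fix n
        have "(\<lambda>x. X (Suc n) x + (- 1) * ?y x, \<lambda>x. (of_real \<epsilon> * X n x + of_real t * X (Suc n) x) + (- 1) * (of_real \<epsilon> * y x + of_real t * ?y x)) \<in> Op"
          using Op_lin[OF XY[of "Suc n"] y', of "-1"] by (simp add: Y_def)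
        from C(2)[OF this] have "nrm (\<lambda>x. X (Suc n) x - ?y x) \<le> C * nrm (\<lambda>x. of_real \<epsilon> * (X n x - y x))"
          by (simp add: algebra_simps)
        then show "norm (nrm (\<lambda>x. X (Suc n) x - ?y x)) \<le> C * (\<epsilon> * nrm (\<lambda>x. X n x - y x))"
          using L2_norm_cmult[of lborel "of_real \<epsilon>" "\<lambda>x. X n x - y x"] \<epsilon> by simp
      qed
      have "(\<lambda>n. C * (\<epsilon> * nrm (\<lambda>x. X n x - y x))) \<longlonglongrightarrow> C * (\<epsilon> * 0)" by (intro tendsto_intros y)
      then show "(\<lambda>n. C * (\<epsilon> * nrm (\<lambda>x. X n x - y x))) \<longlonglongrightarrow> 0" by simp
    qed
    have "(\<lambda>n. nrm (\<lambda>x. X (Suc n) x - y x) + nrm (\<lambda>x. X (Suc n) x - ?y x)) \<longlonglongrightarrow> 0 + 0"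
      by (intro tendsto_add lim' LIMSEQ_Suc[OF y(2)])
    moreover have "nrm (\<lambda>x. y x - ?y x) \<le> nrm (\<lambda>x. X (Suc n) x - y x) + nrm (\<lambda>x. X (Suc n) x - ?y x)" for n
      using L2_norm_triangle3[OF y(1) XL y'L, of "Suc n"] L2_norm_minus_commute[of lborel y "X (Suc n)"] by simp
    ultimately have "nrm (\<lambda>x. y x - ?y x) \<le> 0"
      by (intro LIMSEQ_le_const) auto
    then have "nrm (\<lambda>x. y x - ?y x) = 0" by (simp add: antisym)
    then have eq: "AE x in lborel. y x - ?y x = 0" using L2_norm_zero_iff[OF L2_diff[OF y(1) y'L]] by simp
    have "?y \<in> eigenspace Op (of_real m)"
      unfolding eigenspace_iff
    proof (rule Op_cong[OF y' L2_cmult[OF y'L]])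
      show "AE x in lborel. of_real \<epsilon> * y x + of_real t * ?y x = of_real m * ?y x"
        using eq by eventually_elim (simp add: t_def algebra_simps)
    qed
    then have "inn (X k) ?y = 0" for k using Xo ml by (simp add: orth_below_def)
    moreover have "(\<lambda>k. inn (X k) ?y) \<longlonglongrightarrow> inn y ?y"
      by (rule ip_tendsto[OF XL y'L y(1) y'L y(2)]) (simp add: L2_norm_def)
    ultimately have "inn y ?y = 0" by (simp add: LIMSEQ_const_iff)
    moreover have "inn y ?y = inn y y"
      by (rule ip_cong_AE) (use eq y(1) y'L in \<open>auto dest: L2_measurable elim: eventually_mono\<close>)
    ultimately show ?thesis by (simp add: ip_self)
  qed
  have "(\<lambda>n. B + nrm (\<lambda>x. X n x - y x)) \<longlonglongrightarrow> B + 0" by (intro tendsto_intros y)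
  moreover have "nrm u \<le> B + nrm (\<lambda>x. X n x - y x)" for n
  proof -
    have uL: "u \<in> L2 lborel" using Op_L2[OF uf(1)] .
    have "nrm u \<le> nrm (\<lambda>x. u x - y x) + nrm y" using L2_norm_diff_le[OF uL y(1)] by simp
    also have "\<dots> \<le> nrm (\<lambda>x. u x - X n x) + nrm (\<lambda>x. X n x - y x)" using y0 L2_norm_triangle3[OF uL XL y(1)] by simp
    also have "nrm (\<lambda>x. u x - X n x) \<le> B" using dist'[of 0 n] by (simp add: X_def)
    finally show ?thesis by simp
  qed
  ultimately have "nrm u \<le> B + 0" by (intro LIMSEQ_le_const) auto
  then show ?thesis using \<epsilon> by (simp add: B_def Z_def X_def Y_def P_def field_simps)
qed

text \<open>The infimum \<open>m\<close> of the form on the complement of the eigenvectors below \<open>l\<close> cannot be less than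
  \<open>l\<close>: it would either belong to the resolvent set or be an isolated eigenvalue, and in both cases
  the form would exceed \<open>m\<close> by a positive constant.\<close>

theorem form_lower_bound_orth_below:
  assumes l: "ereal l < inf_ess_spectrum Op" and v: "v \<in> D" "orth_below l v"
  shows "l * (nrm v)\<^sup>2 \<le> Re (a v v)"
proof (rule ccontr)
  assume less: "\<not> ?thesis"
  have v0: "nrm v > 0" using less a_lower[OF v(1)] L2_norm_nonneg[of lborel v] by (cases "nrm v = 0") (auto simp: less_le)
  define R where "R = {Re (a v v) / (nrm v)\<^sup>2 | v. v \<in> D \<and> orth_below l v \<and> nrm v > 0}"
  define m where "m = Inf R"
  have inR: "Re (a v v) / (nrm v)\<^sup>2 \<in> R" using v v0 by (auto simp: R_def)
  have bdd: "bdd_below R"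
    using a_lower by (intro bdd_belowI[of _ "- K"]) (auto simp: R_def field_simps)
  have "m \<le> Re (a v v) / (nrm v)\<^sup>2" unfolding m_def by (rule cInf_lower[OF inR bdd])
  also have "\<dots> < l" using less v0 by (simp add: field_simps)
  finally have ml: "m < l" .
  have nonneg: "0 \<le> shifted_quad m v" if "v \<in> D" "orth_below l v" for v
  proof (cases "nrm v > 0")
    case True
    then have "m \<le> Re (a v v) / (nrm v)\<^sup>2" unfolding m_def using that by (intro cInf_lower[OF _ bdd]) (auto simp: R_def)
    then show ?thesis using True by (simp add: shifted_quad_def field_simps)
  next
    case False
    then have "nrm v = 0" using L2_norm_nonneg[of lborel] by (meson antisym not_le)
    then show ?thesis using a_lower[OF that(1)] by (simp add: shifted_quad_def)
  qed
  have "\<exists>c>0. \<forall>v. v \<in> D \<longrightarrow> orth_below l v \<longrightarrow> c * (nrm v)\<^sup>2 \<le> shifted_quad m v"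
  proof (cases "complex_of_real m \<in> resolvent_set Op")
    case True
    then obtain C where C: "C > 0" "\<And>u f. (u, f) \<in> Op \<Longrightarrow> nrm u \<le> C * nrm (\<lambda>x. f x - of_real m * u x)"
      by (rule resolvent_setE) blast
    have "1 / C * (nrm v)\<^sup>2 \<le> shifted_quad m v" if "v \<in> D" "orth_below l v" for v
      by (rule resolvent_imp_form_bound[OF True order_refl _ nonneg _ that])
         (use C in \<open>auto simp: field_simps\<close>)
    then show ?thesis using C(1) by (intro exI[of _ "1 / C"]) auto
  next
    case False
    have "ereal m < inf_ess_spectrum Op" using l ml by (metis ereal_less_eq(3) le_less_trans less_imp_le)
    then have "complex_of_real m isolated_in spectrum Op"
      using discrete_below_ess False by (auto simp: spectrum_def discrete_spectrum_def)
    then obtain \<delta> where \<delta>: "\<delta> > 0" "\<And>z. z \<in> spectrum Op \<Longrightarrow> dist (complex_of_real m) z < \<delta> \<Longrightarrow> z = complex_of_real m"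
      unfolding isolated_in_dist_Ex_iff by blast
    have iso: "complex_of_real t \<in> resolvent_set Op" if "\<bar>t - m\<bar> < \<delta>" "t \<noteq> m" for t
    proof (rule ccontr)
      assume "\<not> ?thesis"
      moreover have "dist (complex_of_real m) (complex_of_real t) < \<delta>"
        using that(1) by (simp add: dist_norm norm_of_real abs_minus_commute flip: of_real_diff)
      ultimately show False using \<delta>(2)[of "complex_of_real t"] that(2) by (auto simp: spectrum_def)
    qed
    define \<epsilon> where "\<epsilon> = \<delta> / 2"
    define c where "c = sqrt (\<delta>\<^sup>2 + \<epsilon>\<^sup>2)"
    have c: "c > \<epsilon>" "\<epsilon> > 0" unfolding c_def by (rule real_less_rsqrt) (use \<delta>(1) in \<open>auto simp: \<epsilon>_def\<close>)
    have tres: "complex_of_real (m - \<epsilon>) \<in> resolvent_set Op" using \<delta>(1) by (intro iso) (auto simp: \<epsilon>_def)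
    have bound: "c * nrm w \<le> nrm (\<lambda>x. f x - of_real (m - \<epsilon>) * w x)" if wf: "(w, f) \<in> Op" and w: "orth_below l w" for w f
    proof (rule power2_le_imp_le)
      let ?P = "\<lambda>x. f x - complex_of_real m * w x"
      have wL: "w \<in> L2 lborel" and PL: "?P \<in> L2 lborel"
        using Op_L2[OF wf] L2_lin[OF OpD(2)[OF wf] Op_L2[OF wf], of "- of_real m"] by auto
      have "shifted_quad m w = Re (inn ?P w)"
        using OpD(3)[OF wf OpD(1)[OF wf]] ip_lin_left[OF OpD(2)[OF wf] wL wL, of "- of_real m"]
        by (simp add: shifted_quad_def ip_self)
      then have re: "0 \<le> Re (inn w ?P)"
        using nonneg[OF OpD(1)[OF wf] w] ip_cnj[of lborel ?P w] by (metis cnj.sel(1))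
      have "(\<delta> * nrm w)\<^sup>2 \<le> (nrm ?P)\<^sup>2"
        using isolated_bounded_inverse[OF \<delta>(1) iso ml nonneg wf w] \<delta>(1) by (intro power_mono) auto
      then have "(c * nrm w)\<^sup>2 \<le> (nrm ?P)\<^sup>2 + \<epsilon>\<^sup>2 * (nrm w)\<^sup>2"
        by (simp add: c_def power_mult_distrib algebra_simps)
      also have "\<dots> \<le> (nrm (\<lambda>x. ?P x + of_real \<epsilon> * w x))\<^sup>2"
        using L2_norm_sq_add[OF PL wL, of "of_real \<epsilon>"] re c by simp
      also have "(\<lambda>x. ?P x + of_real \<epsilon> * w x) = (\<lambda>x. f x - of_real (m - \<epsilon>) * w x)" by (simp add: algebra_simps)
      finally show "(c * nrm w)\<^sup>2 \<le> (nrm (\<lambda>x. f x - of_real (m - \<epsilon>) * w x))\<^sup>2" .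
    qed simp
    have "(c - \<epsilon>) * (nrm v)\<^sup>2 \<le> shifted_quad m v" if "v \<in> D" "orth_below l v" for v
      using resolvent_imp_form_bound[OF tres _ _ nonneg bound that] c
      by (simp add: shifted_quad_def algebra_simps)
    then show ?thesis using c by (intro exI[of _ "c - \<epsilon>"]) auto
  qed
  then obtain c where c: "c > 0" "\<And>v. v \<in> D \<Longrightarrow> orth_below l v \<Longrightarrow> c * (nrm v)\<^sup>2 \<le> shifted_quad m v" by blast
  have "m + c \<le> m" unfolding m_def
  proof (rule cInf_greatest, use inR in blast)
    fix r assume "r \<in> R"
    then obtain v where r: "r = Re (a v v) / (nrm v)\<^sup>2" "v \<in> D" "orth_below l v" "nrm v > 0" unfolding R_def by blast
    then have "(Inf R + c) * (nrm v)\<^sup>2 \<le> Re (a v v)"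
      using c(2)[OF r(2,3)] by (simp add: m_def shifted_quad_def algebra_simps)
    then show "Inf R + c \<le> r" using r(1,4) by (simp add: pos_le_divide_eq)
  qed
  then show False using c by simp
qed

end

section \<open>Counting eigenvalues\<close>

definition lincomb :: "(nat \<Rightarrow> complex) \<Rightarrow> (real ^ 3 \<Rightarrow> complex) list \<Rightarrow> real ^ 3 \<Rightarrow> complex" where
  "lincomb c us x = (\<Sum>i<length us. c i * (us ! i) x)"

lemma L2_independent_lincomb:
  "L2_independent us \<longleftrightarrow> (\<forall>c. (AE x in lborel. lincomb c us x = 0) \<longrightarrow> (\<forall>i<length us. c i = 0))"
  by (simp add: L2_independent_def lincomb_def)

lemma sum_lessThan_add: "(\<Sum>i<(n::nat) + m. f i) = (\<Sum>i<n. f i) + (\<Sum>i<m. f (n + i) :: 'a::comm_monoid_add)"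
  by (induction m) (simp_all add: add.assoc)

lemma lincomb_append: "lincomb c (us @ vs) x = lincomb c us x + lincomb (\<lambda>i. c (length us + i)) vs x"
  unfolding lincomb_def length_append sum_lessThan_add by (simp add: nth_append)

lemma lincomb_Nil [simp]: "lincomb c [] x = 0"
  by (simp add: lincomb_def)

lemma lincomb_single: "lincomb c [u] x = c 0 * u x"
  by (simp add: lincomb_def)

lemma lincomb_mem:
  assumes "\<And>u v c. u \<in> S \<Longrightarrow> v \<in> S \<Longrightarrow> (\<lambda>x. u x + c * v x) \<in> S" "(\<lambda>x. 0) \<in> S" "set us \<subseteq> S"
  shows "lincomb c us \<in> S"
  using assms(3)
proof (induction us arbitrary: c rule: rev_induct)
  case Nil
  have "lincomb c [] = (\<lambda>x. 0)" by auto
  then show ?case using assms(2) by simp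
next
  case (snoc u us)
  have "lincomb c (us @ [u]) = (\<lambda>x. lincomb c us x + c (length us) * u x)"
    by (auto simp: lincomb_append lincomb_single)
  then show ?case using snoc assms(1) by simp
qed

lemma L2_independent_take:
  assumes "L2_independent us"
  shows "L2_independent (take k us)"
  unfolding L2_independent_lincomb
proof (intro allI impI)
  fix c i assume c: "AE x in lborel. lincomb c (take k us) x = 0" and i: "i < length (take k us)"
  let ?c = "\<lambda>i. if i < length (take k us) then c i else 0"
  have "lincomb ?c us x = lincomb c (take k us) x" for x
  proof -
    have "lincomb ?c us x = lincomb ?c (take k us @ drop k us) x" by simp
    also have "\<dots> = lincomb ?c (take k us) x + lincomb (\<lambda>i. ?c (length (take k us) + i)) (drop k us) x"
      by (rule lincomb_append)
    also have "(\<lambda>i. ?c (length (take k us) + i)) = (\<lambda>i. 0)" by (simp only: not_add_less1 if_False)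
    finally show ?thesis by (simp add: lincomb_def)
  qed
  then have "AE x in lborel. lincomb ?c us x = 0" using c by simp
  then have "\<forall>i<length us. ?c i = 0" using assms unfolding L2_independent_lincomb by blast
  moreover have "i < length us" using i by simp
  ultimately have "?c i = 0" by blast
  then show "c i = 0" using i by simp
qed

lemma multiplicity_obtain:
  assumes "enat k \<le> eig_multiplicity A z"
  obtains us where "length us = k" "set us \<subseteq> eigenspace A z" "L2_independent us"
proof (cases k)
  case 0
  then show ?thesis by (intro that[of "[]"]) (auto simp: L2_independent_def)
next
  case (Suc j)
  then have "enat j < eig_multiplicity A z" using assms by (metis Suc_ile_eq)
  then obtain us where us: "enat j < enat (length us)" "set us \<subseteq> eigenspace A z" "L2_independent us"
    unfolding eig_multiplicity_def less_Sup_iff by blast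
  show ?thesis
    by (rule that[of "take k us"]) (use us Suc in \<open>auto intro: L2_independent_take dest: in_set_takeD\<close>)
qed

lemma multiplicity_upper:
  "set us \<subseteq> eigenspace A z \<Longrightarrow> L2_independent us \<Longrightarrow> enat (length us) \<le> eig_multiplicity A z"
  unfolding eig_multiplicity_def by (rule Sup_upper) blast

text \<open>Of two lists for the same \<open>n\<close> that end in different numbers, the one with the larger last entry
  contains every entry of the other at least as often, and has an entry more.\<close>

lemma nth_eigenvalue_unique:
  assumes "is_nth_eigenvalue A n l" "is_nth_eigenvalue A n l'"
  shows "l = l'"
proof -
  have False if n: "is_nth_eigenvalue A n l" "is_nth_eigenvalue A n l'" and less: "l < l'" for l l'
  proof -
    obtain ls where ls: "length ls = n" "ls \<noteq> []" "sorted ls" "last ls = l"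
      "\<And>m. m < l \<Longrightarrow> enat (count_list ls m) = eig_multiplicity A (complex_of_real m)"
      "enat (count_list ls l) \<le> eig_multiplicity A (complex_of_real l)"
      using n(1) unfolding is_nth_eigenvalue_def by blast
    obtain ls' where ls': "length ls' = n" "ls' \<noteq> []" "last ls' = l'"
      "\<And>m. m < l' \<Longrightarrow> enat (count_list ls' m) = eig_multiplicity A (complex_of_real m)"
      using n(2) unfolding is_nth_eigenvalue_def by blast
    have le: "m \<le> l" if "m \<in> set ls" for m
      using that ls(2,3,4) by (metis append_butlast_last_id in_set_conv_decomp_last sorted_append list.set_intros(1) Un_iff set_append order_refl empty_iff empty_set set_ConsD)
    have cle: "count_list ls m \<le> count_list ls' m" if "m \<in> set ls" for m
    proof (cases "m = l")
      case True
      have "enat (count_list ls l) \<le> enat (count_list ls' l)" using ls(6) ls'(4)[OF less] by simp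
      then show ?thesis using True by simp
    next
      case False
      then have "m < l" using le[OF that] by simp
      then have "enat (count_list ls m) = enat (count_list ls' m)" using ls(5) ls'(4) less by simp
      then show ?thesis by simp
    qed
    have l': "l' \<in> set ls'" using ls'(2,3) last_in_set by blast
    have "n = (\<Sum>m\<in>set ls. count_list ls m)" using sum_count_set[of ls "set ls"] ls(1) by simp
    also have "\<dots> \<le> (\<Sum>m\<in>set ls. count_list ls' m)" by (intro sum_mono cle)
    also have "\<dots> < (\<Sum>m\<in>insert l' (set ls). count_list ls' m)"
    proof -
      have "l' \<notin> set ls" using le less by fastforce
      moreover have "count_list ls' l' \<noteq> 0" using l' by (simp add: count_list_0_iff)
      ultimately show ?thesis by simp
    qed
    also have "\<dots> \<le> (\<Sum>m\<in>set ls' \<union> set ls. count_list ls' m)" by (rule sum_mono2) (use l' in auto)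
    also have "\<dots> = n" using sum_count_set[of ls' "set ls' \<union> set ls"] ls'(1) by simp
    finally show False by simp
  qed
  then show ?thesis using assms by (metis linorder_neqE_linordered_idom)
qed

lemma eigenvalue_eqI: "is_nth_eigenvalue A n l \<Longrightarrow> eigenvalue A n = l"
  unfolding eigenvalue_def using nth_eigenvalue_unique by blast

lemma homogeneous_system_solution:
  fixes M :: "'i \<Rightarrow> 'j \<Rightarrow> complex"
  assumes "finite J" "finite I" "card J < card I"
  shows "\<exists>c. (\<exists>i\<in>I. c i \<noteq> 0) \<and> (\<forall>j\<in>J. (\<Sum>i\<in>I. c i * M i j) = 0)"
  using assms
proof (induction J arbitrary: I M rule: finite_induct)
  case empty
  then have "I \<noteq> {}" by auto
  then show ?case by (intro exI[of _ "\<lambda>_. 1"]) auto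
next
  case (insert j J)
  show ?case
  proof (cases "\<forall>i\<in>I. M i j = 0")
    case True
    have "card J < card I" using insert by simp
    then obtain c where "\<exists>i\<in>I. c i \<noteq> 0" "\<forall>k\<in>J. (\<Sum>i\<in>I. c i * M i k) = 0" using insert.IH[OF insert.prems(1)] by blast
    then show ?thesis using True by (intro exI[of _ c]) auto
  next
    case False
    then obtain p where p: "p \<in> I" "M p j \<noteq> 0" by blast
    define M' where "M' i k = M i k - M i j / M p j * M p k" for i k
    have "card J < card (I - {p})" using insert p by simp
    then obtain c where c: "\<exists>i\<in>I - {p}. c i \<noteq> 0" "\<And>k. k \<in> J \<Longrightarrow> (\<Sum>i\<in>I - {p}. c i * M' i k) = 0"
      using insert.IH[of "I - {p}" M'] insert.prems by auto
    define s where "s = (\<Sum>i\<in>I - {p}. c i * M i j)"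
    define c' where "c' i = (if i = p then - s / M p j else c i)" for i
    have sum: "(\<Sum>i\<in>I. c' i * M i k) = - s / M p j * M p k + (\<Sum>i\<in>I - {p}. c i * M i k)" for k
      unfolding sum.remove[OF insert.prems(1) p(1)] by (simp add: c'_def)
    have "(\<Sum>i\<in>I. c' i * M i k) = 0" if "k \<in> J" for k
    proof -
      have "0 = (\<Sum>i\<in>I - {p}. c i * M i k - c i * M i j / M p j * M p k)"
        using c(2)[OF that] by (simp add: M'_def algebra_simps)
      also have "\<dots> = (\<Sum>i\<in>I - {p}. c i * M i k) - s / M p j * M p k"
        by (simp add: sum_subtractf s_def sum_divide_distrib sum_distrib_right)
      finally show ?thesis unfolding sum by simp
    qed
    moreover have "(\<Sum>i\<in>I. c' i * M i j) = 0" unfolding sum using p by (simp add: s_def)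
    moreover have "\<exists>i\<in>I. c' i \<noteq> 0" using c(1) by (auto simp: c'_def)
    ultimately show ?thesis by (intro exI[of _ c']) auto
  qed
qed

text \<open>Orthogonal projection onto the span of finitely many functions.\<close>

inductive_set lspan :: "(real ^ 3 \<Rightarrow> complex) list \<Rightarrow> (real ^ 3 \<Rightarrow> complex) set" for gs where
  lspan_zero: "(\<lambda>x. 0) \<in> lspan gs"
| lspan_step: "u \<in> lspan gs \<Longrightarrow> g \<in> set gs \<Longrightarrow> (\<lambda>x. u x + c * g x) \<in> lspan gs"

lemma lspan_lin:
  assumes "u \<in> lspan gs" "v \<in> lspan gs"
  shows "(\<lambda>x. u x + c * v x) \<in> lspan gs"
  using assms(2)
proof (induction rule: lspan.induct)
  case (lspan_step v g d)
  have "(\<lambda>x. u x + c * (v x + d * g x)) = (\<lambda>x. (u x + c * v x) + (c * d) * g x)" by (auto simp: algebra_simps)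
  then show ?case using lspan.lspan_step[OF lspan_step.IH lspan_step.hyps(2), of "c * d"] by simp
qed (use assms(1) in simp)

lemma lspan_subset:
  assumes "u \<in> lspan gs" "(\<lambda>x. 0) \<in> S" "set gs \<subseteq> S" "\<And>u v c. u \<in> S \<Longrightarrow> v \<in> S \<Longrightarrow> (\<lambda>x. u x + c * v x) \<in> S"
  shows "u \<in> S"
  using assms by (induction rule: lspan.induct) auto

lemma lspan_mono: "u \<in> lspan gs \<Longrightarrow> u \<in> lspan (g # gs)"
  by (induction rule: lspan.induct) (auto intro: lspan.intros)

lemma lspan_L2: "u \<in> lspan gs \<Longrightarrow> set gs \<subseteq> L2 lborel \<Longrightarrow> u \<in> L2 lborel"
  by (rule lspan_subset) (auto intro: L2_lin)

lemma lspan_orth: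
  assumes "u \<in> lspan gs" "set gs \<subseteq> L2 lborel" "w \<in> L2 lborel" "\<And>g. g \<in> set gs \<Longrightarrow> ip lborel w g = 0"
  shows "ip lborel w u = 0"
proof -
  have "u \<in> {u \<in> L2 lborel. ip lborel w u = 0}"
    by (rule lspan_subset[OF assms(1)]) (use assms in \<open>auto intro: L2_lin simp: ip_lin_right\<close>)
  then show ?thesis by simp
qed

lemma projection_lspan:
  assumes "set gs \<subseteq> L2 lborel" "w \<in> L2 lborel"
  shows "\<exists>p\<in>lspan gs. \<forall>g\<in>set gs. ip lborel (\<lambda>x. w x + (- 1) * p x) g = 0"
  using assms
proof (induction gs arbitrary: w)
  case Nil
  then show ?case by (auto intro: lspan.intros)
next
  case (Cons g gs)
  have gs: "set gs \<subseteq> L2 lborel" and gL: "g \<in> L2 lborel" using Cons by auto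
  obtain p where p: "p \<in> lspan gs" "\<And>h. h \<in> set gs \<Longrightarrow> ip lborel (\<lambda>x. w x + (- 1) * p x) h = 0"
    using Cons.IH[OF gs Cons.prems(2)] by blast
  obtain r where r: "r \<in> lspan gs" "\<And>h. h \<in> set gs \<Longrightarrow> ip lborel (\<lambda>x. g x + (- 1) * r x) h = 0"
    using Cons.IH[OF gs gL] by blast
  have pL: "p \<in> L2 lborel" and rL: "r \<in> L2 lborel" using p r gs lspan_L2 by auto
  define w' where "w' = (\<lambda>x. w x + (- 1) * p x)"
  define g' where "g' = (\<lambda>x. g x + (- 1) * r x)"
  have w'L: "w' \<in> L2 lborel" and g'L: "g' \<in> L2 lborel" unfolding w'_def g'_def by (intro L2_lin Cons.prems(2) pL rL gL)+
  have g_eq: "g = (\<lambda>x. g' x + 1 * r x)" by (simp add: g'_def)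
  define d where "d = ip lborel w' g' / of_real ((L2_norm lborel g')\<^sup>2)"
  have d: "ip lborel w' g' = d * ip lborel g' g'"
  proof (cases "L2_norm lborel g' = 0")
    case True
    then show ?thesis using ip_Cauchy_Schwarz[OF w'L g'L] by (simp add: ip_self)
  qed (simp add: d_def ip_self)
  have g'span: "g' \<in> lspan (g # gs)"
    unfolding g'_def using lspan_lin[OF lspan_step[OF lspan_zero, of g "g # gs" 1] lspan_mono[OF r(1)], of "-1"] by simp
  have P: "(\<lambda>x. p x + d * g' x) \<in> lspan (g # gs)" by (intro lspan_lin lspan_mono p g'span)
  have eq: "(\<lambda>x. w x + (- 1) * (p x + d * g' x)) = (\<lambda>x. w' x + (- d) * g' x)" by (auto simp: w'_def algebra_simps)
  have old: "ip lborel (\<lambda>x. w' x + (- d) * g' x) h = 0" if "h \<in> set gs" for h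
  proof -
    have "h \<in> L2 lborel" using that gs by auto
    then show ?thesis using p(2)[OF that] r(2)[OF that] unfolding w'_def[symmetric] g'_def[symmetric] by (simp add: ip_lin_left[OF w'L g'L, of h "- d", simplified])
  qed
  have yL: "(\<lambda>x. w' x + (- d) * g' x) \<in> L2 lborel" using w'L g'L by (rule L2_lin)
  have "ip lborel (\<lambda>x. w' x + (- d) * g' x) g = ip lborel (\<lambda>x. w' x + (- d) * g' x) g' + 1 * ip lborel (\<lambda>x. w' x + (- d) * g' x) r"
    by (subst g_eq, subst ip_lin_right[OF g'L rL yL]) simp
  also have "ip lborel (\<lambda>x. w' x + (- d) * g' x) r = 0" by (rule lspan_orth[OF r(1) gs yL old])
  also have "ip lborel (\<lambda>x. w' x + (- d) * g' x) g' = 0" using d by (simp add: ip_lin_left[OF w'L g'L g'L, of "- d", simplified])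
  finally show ?case using P eq old by (intro bexI[of _ "\<lambda>x. p x + d * g' x"]) auto
qed

context semibounded_form
begin

lemma eigenspace_lin:
  "u \<in> eigenspace Op z \<Longrightarrow> v \<in> eigenspace Op z \<Longrightarrow> (\<lambda>x. u x + c * v x) \<in> eigenspace Op z"
  unfolding eigenspace_iff using Op_lin[of u "\<lambda>x. z * u x" v "\<lambda>x. z * v x" c] by (simp add: algebra_simps)

lemma zero_eigenspace: "(\<lambda>x. 0) \<in> eigenspace Op z"
proof -
  have "(\<lambda>x. 0, \<lambda>x. z * 0) \<in> Op"
    unfolding form_operator_def using zero_in_D a_lin[OF zero_in_D zero_in_D, of _ 1] by auto
  then show ?thesis by (auto simp: eigenspace_iff)
qed

lemma a_eigenvector: "u \<in> eigenspace Op z \<Longrightarrow> v \<in> D \<Longrightarrow> a u v = z * inn u v"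
  using OpD(3)[of u "\<lambda>x. z * u x" v] by (simp add: eigenspace_iff ip_cmult_left)

lemma eigenvectors_orth:
  assumes "u \<in> eigenspace Op (of_real m)" "v \<in> eigenspace Op (of_real k)" "m \<noteq> k"
  shows "inn u v = 0"
proof -
  have "of_real m * inn u v = cnj (of_real k * inn v u)"
    using a_eigenvector[OF assms(1) eigenspace_D[OF assms(2)]] a_eigenvector[OF assms(2) eigenspace_D[OF assms(1)]]
      a_herm[OF eigenspace_D[OF assms(2)] eigenspace_D[OF assms(1)]] by simp
  then have "of_real m * inn u v = of_real k * inn u v" by (simp add: ip_cnj)
  then show ?thesis using assms(3) by simp
qed

lemma multiplicity_resolvent:
  assumes "z \<in> resolvent_set Op"
  shows "eig_multiplicity Op z = 0"
proof (rule ccontr)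
  assume "eig_multiplicity Op z \<noteq> 0"
  then have "enat 1 \<le> eig_multiplicity Op z" by (simp add: one_enat_def[symmetric] Suc_ile_eq zero_enat_def[symmetric] ileI1 eSuc_enat[symmetric] one_eSuc)
  then obtain us where us: "length us = 1" "set us \<subseteq> eigenspace Op z" "L2_independent us" by (rule multiplicity_obtain)
  then obtain u where u: "us = [u]" by (auto simp: length_Suc_conv)
  then have uE: "(u, \<lambda>x. z * u x) \<in> Op" using us eigenspace_iff by auto
  have "nrm u \<le> 0"
  proof (rule resolvent_setE[OF assms])
    fix C assume "\<And>u f. (u, f) \<in> Op \<Longrightarrow> nrm u \<le> C * nrm (\<lambda>x. f x - z * u x)"
    from this[OF uE] show ?thesis by (simp add: L2_norm_def)
  qed
  then have "nrm u = 0" by (simp add: antisym)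
  then have "AE x in lborel. lincomb (\<lambda>_. 1) us x = 0"
    using L2_norm_zero_iff[OF Op_L2[OF uE]] by (simp add: u lincomb_single)
  then show False using us(3) u unfolding L2_independent_lincomb by fastforce
qed

lemma multiplicity_finite: "ereal m < inf_ess_spectrum Op \<Longrightarrow> eig_multiplicity Op (of_real m) < \<infinity>"
  using discrete_below_ess[of m] multiplicity_resolvent[of "of_real m"]
  by (cases "complex_of_real m \<in> resolvent_set Op") (auto simp: spectrum_def discrete_spectrum_def)

lemma multiplicity_pos_iff:
  "ereal m < inf_ess_spectrum Op \<Longrightarrow> eig_multiplicity Op (of_real m) \<noteq> 0 \<longleftrightarrow> complex_of_real m \<in> spectrum Op"
  using discrete_below_ess[of m] multiplicity_resolvent[of "of_real m"]
  by (auto simp: spectrum_def discrete_spectrum_def)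

definition mult :: "real \<Rightarrow> nat" where
  "mult m = the_enat (eig_multiplicity Op (of_real m))"

definition eigenvalues_below :: "real \<Rightarrow> real set" where
  "eigenvalues_below l = {m. m < l \<and> complex_of_real m \<in> spectrum Op}"

lemma enat_mult: "ereal m < inf_ess_spectrum Op \<Longrightarrow> enat (mult m) = eig_multiplicity Op (of_real m)"
  using multiplicity_finite[of m] by (auto simp: mult_def)

lemma eigenvector_exists:
  assumes "ereal m < inf_ess_spectrum Op" "complex_of_real m \<in> spectrum Op"
  shows "\<exists>u\<in>eigenspace Op (of_real m). nrm u \<noteq> 0"
proof -
  have "enat 1 \<le> eig_multiplicity Op (of_real m)"
    using multiplicity_pos_iff[OF assms(1)] assms(2) by (simp add: one_enat_def[symmetric] Suc_ile_eq zero_enat_def[symmetric] ileI1 eSuc_enat[symmetric] one_eSuc)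
  then obtain us where us: "length us = 1" "set us \<subseteq> eigenspace Op (of_real m)" "L2_independent us" by (rule multiplicity_obtain)
  then obtain u where u: "us = [u]" by (auto simp: length_Suc_conv)
  have uE: "u \<in> eigenspace Op (of_real m)" using us u by simp
  have "nrm u \<noteq> 0"
  proof
    assume "nrm u = 0"
    then have "AE x in lborel. lincomb (\<lambda>_. 1) us x = 0"
      using L2_norm_zero_iff[OF eigenspace_L2[OF uE]] by (simp add: u lincomb_single)
    then show False using us(3) u unfolding L2_independent_lincomb by fastforce
  qed
  then show ?thesis using uE by blast
qed

text \<open>An accumulation point of eigenvalues belongs to the spectrum and is not isolated in it.\<close>

lemma finite_eigenvalues_below:
  assumes l: "ereal l < inf_ess_spectrum Op"
  shows "finite (eigenvalues_below l)"
proof (rule ccontr)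
  assume inf: "infinite (eigenvalues_below l)"
  have ess: "ereal m < inf_ess_spectrum Op" if "m \<le> l" for m using l that by (metis ereal_less_eq(3) le_less_trans)
  have ev: "\<exists>u\<in>eigenspace Op (of_real m). nrm u \<noteq> 0" if "m \<in> eigenvalues_below l" for m
    using that eigenvector_exists[OF ess] by (auto simp: eigenvalues_below_def)
  have "eigenvalues_below l \<subseteq> {-K..l}"
  proof
    fix m assume m: "m \<in> eigenvalues_below l"
    then obtain u where u: "u \<in> eigenspace Op (of_real m)" "nrm u \<noteq> 0" using ev by blast
    have "- K * (nrm u)\<^sup>2 \<le> m * (nrm u)\<^sup>2"
      using a_lower[OF eigenspace_D[OF u(1)]] a_eigenvector[OF u(1) eigenspace_D[OF u(1)]] by (simp add: ip_self)
    moreover have "0 < (nrm u)\<^sup>2" using u by simp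
    ultimately have "- K \<le> m" by (rule mult_right_le_imp_le)
    then show "m \<in> {-K..l}" using m by (simp add: eigenvalues_below_def)
  qed
  then obtain t where t: "t \<in> {-K..l}" "t islimpt eigenvalues_below l"
    using compact_Icc[of "-K" l] inf unfolding compact_eq_Bolzano_Weierstrass by blast
  have spec: "complex_of_real t \<in> spectrum Op"
  proof (rule ccontr)
    assume "\<not> ?thesis"
    then have "complex_of_real t \<in> resolvent_set Op" by (simp add: spectrum_def)
    then obtain C where C: "C > 0" "\<And>u f. (u, f) \<in> Op \<Longrightarrow> nrm u \<le> C * nrm (\<lambda>x. f x - of_real t * u x)"
      by (rule resolvent_setE) blast
    obtain m where m: "m \<in> eigenvalues_below l" "dist m t < 1 / C"
      using t(2) C(1) unfolding islimpt_approachable by (metis zero_less_divide_1_iff)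
    then obtain u where u: "u \<in> eigenspace Op (of_real m)" "nrm u \<noteq> 0" using ev by blast
    have "nrm u \<le> C * nrm (\<lambda>x. of_real (m - t) * u x)"
      using C(2)[of u "\<lambda>x. of_real m * u x"] u(1) by (simp add: eigenspace_iff algebra_simps)
    also have "\<dots> = C * dist m t * nrm u"
      using L2_norm_cmult[of lborel "of_real (m - t)" u] by (simp add: dist_real_def del: of_real_diff)
    finally have "1 * nrm u \<le> (C * dist m t) * nrm u" by simp
    moreover have "0 < nrm u" using u L2_norm_nonneg[of lborel u] by linarith
    ultimately have "1 \<le> C * dist m t" by (rule mult_right_le_imp_le)
    then show False using m(2) C(1) by (simp add: field_simps)
  qed
  have "complex_of_real t isolated_in spectrum Op"
    using discrete_below_ess[OF ess spec] t(1) by (simp add: discrete_spectrum_def)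
  then obtain \<delta> where \<delta>: "\<delta> > 0" "\<And>z. z \<in> spectrum Op \<Longrightarrow> dist (complex_of_real t) z < \<delta> \<Longrightarrow> z = complex_of_real t"
    unfolding isolated_in_dist_Ex_iff by blast
  obtain m where m: "m \<in> eigenvalues_below l" "m \<noteq> t" "dist m t < \<delta>"
    using t(2) \<delta>(1) unfolding islimpt_approachable by blast
  have "dist (complex_of_real t) (complex_of_real m) < \<delta>"
    using m(3) by (simp add: dist_norm norm_of_real abs_minus_commute flip: of_real_diff)
  then show False using \<delta>(2)[of "complex_of_real m"] m by (simp add: eigenvalues_below_def)
qed

definition dim_below :: "real \<Rightarrow> nat" where
  "dim_below l = (\<Sum>m\<in>eigenvalues_below l. mult m)"

lemma maximal_eigenvector_list:
  assumes "eig_multiplicity Op z = enat (length us)" "set us \<subseteq> eigenspace Op z" "L2_independent us"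
    and u: "u \<in> eigenspace Op z" and v: "v \<in> L2 lborel" "\<And>w. w \<in> set us \<Longrightarrow> inn v w = 0"
  shows "inn v u = 0"
proof -
  have "\<not> L2_independent (us @ [u])"
    using multiplicity_upper[of "us @ [u]" Op z] assms(1,2) u by auto
  then obtain c i where c: "AE x in lborel. lincomb c (us @ [u]) x = 0" "i < length (us @ [u])" "c i \<noteq> 0"
    unfolding L2_independent_lincomb by blast
  then have ae: "AE x in lborel. lincomb c us x + c (length us) * u x = 0" by (simp add: lincomb_append lincomb_single)
  have c0: "c (length us) \<noteq> 0"
  proof
    assume "c (length us) = 0"
    then have "\<forall>i<length us. c i = 0" using ae assms(3) unfolding L2_independent_lincomb by simp
    then show False using c(2,3) \<open>c (length us) = 0\<close> by (auto simp: less_Suc_eq)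
  qed
  have uL: "u \<in> L2 lborel" using eigenspace_L2[OF u] .
  have "lincomb c us \<in> {w \<in> L2 lborel. inn v w = 0}"
    by (rule lincomb_mem) (use assms eigenspace_L2 v in \<open>auto intro: L2_lin simp: ip_lin_right\<close>)
  then have l: "lincomb c us \<in> L2 lborel" "inn v (lincomb c us) = 0" by auto
  have "inn v (\<lambda>x. lincomb c us x + c (length us) * u x) = inn v (\<lambda>x. 0)"
    by (rule ip_cong_AE) (use ae v l uL L2_lin[OF l(1) uL, of "c (length us)"] in \<open>auto dest: L2_measurable\<close>)
  then have "cnj (c (length us)) * inn v u = 0" using ip_lin_right[OF l(1) uL v(1)] l(2) by simp
  then show ?thesis using c0 by simp
qed

lemma spanning_eigenvectors_below:
  assumes l: "ereal l < inf_ess_spectrum Op"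
  obtains gs where "length gs = dim_below l" "\<And>g. g \<in> set gs \<Longrightarrow> \<exists>m<l. g \<in> eigenspace Op (of_real m)"
    "\<And>v. v \<in> L2 lborel \<Longrightarrow> (\<And>g. g \<in> set gs \<Longrightarrow> inn v g = 0) \<Longrightarrow> orth_below l v"
proof -
  have ess: "ereal m < inf_ess_spectrum Op" if "m < l" for m using l that by (metis ereal_less_eq(3) le_less_trans less_imp_le)
  have "\<forall>m. \<exists>us. m < l \<longrightarrow> length us = mult m \<and> set us \<subseteq> eigenspace Op (of_real m) \<and> L2_independent us"
    using multiplicity_obtain[of "mult _" Op "of_real _"] enat_mult[OF ess] by (metis order_refl)
  then obtain es where es: "\<And>m. m < l \<Longrightarrow> length (es m) = mult m" "\<And>m. m < l \<Longrightarrow> set (es m) \<subseteq> eigenspace Op (of_real m)"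
    "\<And>m. m < l \<Longrightarrow> L2_independent (es m)" by metis
  define ms where "ms = sorted_list_of_set (eigenvalues_below l)"
  have ms: "set ms = eigenvalues_below l" "distinct ms"
    using finite_eigenvalues_below[OF l] by (auto simp: ms_def)
  have below: "m < l" if "m \<in> set ms" for m using that ms by (simp add: eigenvalues_below_def)
  show ?thesis
  proof (rule that[of "concat (map es ms)"])
    have "length (concat (map es ms)) = (\<Sum>m\<leftarrow>ms. mult m)"
      unfolding length_concat map_map comp_def using es(1) below by (intro arg_cong[where f = sum_list] map_cong) auto
    then show "length (concat (map es ms)) = dim_below l"
      using ms by (simp add: dim_below_def sum_list_distinct_conv_sum_set)
    show "\<exists>m<l. g \<in> eigenspace Op (of_real m)" if "g \<in> set (concat (map es ms))" for g
      using that es(2) below by fastforce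
    show "orth_below l v" if v: "v \<in> L2 lborel" "\<And>g. g \<in> set (concat (map es ms)) \<Longrightarrow> inn v g = 0" for v
      unfolding orth_below_def
    proof (intro allI impI ballI)
      fix m u assume m: "m < l" and u: "u \<in> eigenspace Op (complex_of_real m)"
      have mult: "eig_multiplicity Op (of_real m) = enat (length (es m))" using enat_mult[OF ess[OF m]] es(1)[OF m] by simp
      show "inn v u = 0"
      proof (rule maximal_eigenvector_list[OF mult es(2)[OF m] es(3)[OF m] u v(1)])
        fix w assume w: "w \<in> set (es m)"
        then have "es m \<noteq> []" by auto
        then have "mult m \<noteq> 0" using es(1)[OF m] by (metis length_0_conv)
        then have "complex_of_real m \<in> spectrum Op"
          using multiplicity_pos_iff[OF ess[OF m]] enat_mult[OF ess[OF m]] by (metis enat_0_iff(2) zero_enat_def enat.inject)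
        then have "m \<in> set ms" using ms m by (simp add: eigenvalues_below_def)
        then show "inn v w = 0" using v(2) w by auto
      qed
    qed
  qed
qed

text \<open>If the form is at most \<open>l\<close> on a space whose dimension exceeds the number of eigenvalues below
  \<open>l\<close>, this space contains a vector orthogonal to all eigenvectors below \<open>l\<close>. It minimizes the form
  on their complement, hence it is a weak eigenvector for \<open>l\<close>.\<close>

theorem trial_space_eigenvector:
  assumes l: "ereal l < inf_ess_spectrum Op"
    and vs: "set vs \<subseteq> D" "L2_independent vs" "dim_below l < length vs"
    and le: "\<And>c. Re (a (lincomb c vs) (lincomb c vs)) \<le> l * (nrm (lincomb c vs))\<^sup>2"
  shows "\<exists>c. nrm (lincomb c vs) \<noteq> 0 \<and> Re (a (lincomb c vs) (lincomb c vs)) = l * (nrm (lincomb c vs))\<^sup>2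
    \<and> (\<forall>w\<in>D. a (lincomb c vs) w = of_real l * inn (lincomb c vs) w)"
proof -
  obtain gs where gs: "length gs = dim_below l" "\<And>g. g \<in> set gs \<Longrightarrow> \<exists>m<l. g \<in> eigenspace Op (of_real m)"
    "\<And>v. v \<in> L2 lborel \<Longrightarrow> (\<And>g. g \<in> set gs \<Longrightarrow> inn v g = 0) \<Longrightarrow> orth_below l v"
    using spanning_eigenvectors_below[OF l] by blast
  have "\<exists>c. (\<exists>i\<in>{..<length vs}. c i \<noteq> 0) \<and> (\<forall>j\<in>{..<length gs}. (\<Sum>i\<in>{..<length vs}. c i * inn (vs ! i) (gs ! j)) = 0)"
    by (rule homogeneous_system_solution) (use vs(3) gs(1) in auto)
  then obtain c where c: "\<exists>i<length vs. c i \<noteq> 0" "\<And>j. j < length gs \<Longrightarrow> (\<Sum>i<length vs. c i * inn (vs ! i) (gs ! j)) = 0" by auto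
  define v where "v = lincomb c vs"
  have vD: "v \<in> D" unfolding v_def by (rule lincomb_mem) (use D_lin zero_in_D vs in auto)
  then have vL: "v \<in> L2 lborel" by (rule D_L2)
  have ip_v: "inn v g = (\<Sum>i<length vs. c i * inn (vs ! i) g)" if g: "g \<in> L2 lborel" for g
  proof -
    have "inn v g = (\<integral>x. (\<Sum>i<length vs. c i * ((vs ! i) x * cnj (g x))) \<partial>lborel)"
      by (simp add: ip_def v_def lincomb_def sum_distrib_right mult.assoc)
    also have "\<dots> = (\<Sum>i<length vs. c i * inn (vs ! i) g)"
      unfolding ip_def using ip_integrable[OF D_L2 g] vs(1) nth_mem
      by (subst Bochner_Integration.integral_sum) (auto intro!: integrable_mult_right ip_integrable D_L2 g)
    finally show ?thesis .
  qed
  have gL: "g \<in> L2 lborel" if "g \<in> set gs" for g using gs(2)[OF that] eigenspace_L2 by blast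
  have "inn v g = 0" if "g \<in> set gs" for g
    using ip_v[OF gL[OF that]] c(2) that by (auto simp: in_set_conv_nth)
  then have vo: "orth_below l v" by (intro gs(3) vL)
  have ge: "0 \<le> shifted_quad l w" if "w \<in> D" "orth_below l w" for w
    using form_lower_bound_orth_below[OF l that] by (simp add: shifted_quad_def)
  have q0: "shifted_quad l v = 0" using ge[OF vD vo] le[of c] by (simp add: shifted_quad_def v_def)
  have ker: "shifted_form l v w = 0" if w: "w \<in> D" for w
  proof -
    obtain p where p: "p \<in> lspan gs" "\<And>g. g \<in> set gs \<Longrightarrow> inn (\<lambda>x. w x + (- 1) * p x) g = 0"
      using projection_lspan[of gs w] gL D_L2[OF w] by blast
    let ?w = "\<lambda>x. w x + (- 1) * p x"
    have "p \<in> {u \<in> D. shifted_form l v u = 0}"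
    proof (rule lspan_subset[OF p(1)])
      show "set gs \<subseteq> {u \<in> D. shifted_form l v u = 0}"
      proof
        fix g assume g: "g \<in> set gs"
        then obtain m where m: "m < l" "g \<in> eigenspace Op (of_real m)" using gs(2) by blast
        have gD: "g \<in> D" using eigenspace_D[OF m(2)] .
        have 0: "inn v g = 0" using vo m by (auto simp: orth_below_def)
        have "a v g = cnj (of_real m * inn g v)" using a_herm[OF gD vD] a_eigenvector[OF m(2) vD] by simp
        then show "g \<in> {u \<in> D. shifted_form l v u = 0}" using 0 gD by (simp add: shifted_form_def ip_cnj)
      qed
      show "(\<lambda>x. 0) \<in> {u \<in> D. shifted_form l v u = 0}"
        using a_lin_right[OF zero_in_D zero_in_D vD, of 1] zero_in_D by (simp add: shifted_form_def)
      show "(\<lambda>x. u x + c * w x) \<in> {u \<in> D. shifted_form l v u = 0}"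
        if "u \<in> {u \<in> D. shifted_form l v u = 0}" "w \<in> {u \<in> D. shifted_form l v u = 0}" for u w c
        using that by (simp add: shifted_form_def D_lin a_lin_right[OF _ _ vD] ip_lin_right D_L2 vL algebra_simps)
    qed
    then have pD: "p \<in> D" and p0: "shifted_form l v p = 0" by auto
    have wD: "?w \<in> D" using D_lin[OF w pD] .
    have wo: "orth_below l ?w" by (intro gs(3) D_L2 wD p(2))
    have "(cmod (shifted_form l v ?w))\<^sup>2 \<le> shifted_quad l v * shifted_quad l ?w"
      by (intro shifted_form_Cauchy_Schwarz ge D_lin[OF wD vD] orth_below_lin wo vo D_L2 wD vD)
    then have "shifted_form l v ?w = 0" using q0 by simp
    moreover have "shifted_form l v ?w = shifted_form l v w + (- 1) * shifted_form l v p"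
      unfolding shifted_form_def a_lin_right[OF w pD vD] ip_lin_right[OF D_L2[OF w] D_L2[OF pD] vL]
      by (simp add: algebra_simps)
    ultimately show ?thesis using p0 by simp
  qed
  have "nrm v \<noteq> 0"
  proof
    assume "nrm v = 0"
    then have "AE x in lborel. lincomb c vs x = 0" using L2_norm_zero_iff[OF vL] by (simp add: v_def)
    then show False using vs(2) c(1) unfolding L2_independent_lincomb by blast
  qed
  then show ?thesis using q0 ker unfolding v_def[symmetric] by (intro exI[of _ c]) (auto simp: v_def[symmetric] shifted_quad_def shifted_form_def)
qed

lemma eigenvalue_exists_below:
  assumes l: "ereal l < inf_ess_spectrum Op" and n: "n \<noteq> 0" "n \<le> dim_below l"
  shows "\<exists>l'<l. is_nth_eigenvalue Op n l'"
proof -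
  have ess: "ereal m < inf_ess_spectrum Op" if "m < l" for m using l that by (metis ereal_less_eq(3) le_less_trans less_imp_le)
  define M where "M = (\<Sum>m\<in>eigenvalues_below l. replicate_mset (mult m) m)"
  define L where "L = sorted_list_of_multiset M"
  note fin = finite_eigenvalues_below[OF l]
  have cM: "count M m = (if m \<in> eigenvalues_below l then mult m else 0)" for m
    unfolding M_def count_sum using fin by simp
  have cL: "count_list L m = count M m" for m
    unfolding L_def by (metis count_mset mset_sorted_list_of_multiset)
  have lenL: "length L = dim_below l"
    unfolding L_def dim_below_def M_def by (metis (no_types, lifting) mset_sorted_list_of_multiset size_mset size_multiset_sum size_replicate_mset sum.cong)
  have setL: "set L \<subseteq> eigenvalues_below l"
    unfolding L_def using cM by (auto simp: set_sorted_list_of_multiset simp flip: count_greater_zero_iff split: if_splits)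
  have sL: "sorted L" unfolding L_def by simp
  define ls where "ls = take n L"
  have ls: "length ls = n" "ls \<noteq> []" "sorted ls" using n lenL sL by (auto simp: ls_def sorted_wrt_take)
  have "last ls \<in> set L" using ls(2) last_in_set[of ls] in_set_takeD unfolding ls_def by fastforce
  then have last: "last ls < l" using setL by (auto simp: eigenvalues_below_def)
  have cnt: "count_list L m = eig_multiplicity Op (of_real m)" if "m < l" for m
    unfolding cL cM using enat_mult[OF ess[OF that]] multiplicity_pos_iff[OF ess[OF that]] that
    by (auto simp: eigenvalues_below_def zero_enat_def)
  have split: "L = ls @ drop n L" by (simp add: ls_def)
  have "is_nth_eigenvalue Op n (last ls)"
    unfolding is_nth_eigenvalue_def
  proof (intro conjI exI[of _ ls] ls refl allI impI)
    show "ereal (last ls) < inf_ess_spectrum Op" using last by (rule ess)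
    show "enat (count_list ls m) = eig_multiplicity Op (of_real m)" if m: "m < last ls" for m
    proof -
      have "last ls \<le> y" if "y \<in> set (drop n L)" for y
        using sL that ls(2) split by (metis last_in_set sorted_append)
      then have "m \<notin> set (drop n L)" using m by fastforce
      then have "count_list L m = count_list ls m" by (subst split) (simp add: count_list_0_iff)
      then show ?thesis using cnt[of m] m last by simp
    qed
    have "count_list L (last ls) = count_list ls (last ls) + count_list (drop n L) (last ls)"
      using arg_cong[OF split, of "\<lambda>xs. count_list xs (last ls)"] by simp
    then have "count_list ls (last ls) \<le> count_list L (last ls)" by simp
    then show "enat (count_list ls (last ls)) \<le> eig_multiplicity Op (of_real (last ls))"
      unfolding cnt[OF last, symmetric] by simp
  qed
  then show ?thesis using last by blast
qed

text \<open>The eigenvectors for the first \<open>n\<close> eigenvalues span such a trial space.\<close>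

theorem nth_eigenvalue_trial_space:
  assumes n: "is_nth_eigenvalue Op n l"
  shows "\<exists>vs. length vs = n \<and> set vs \<subseteq> D \<and> L2_independent vs
    \<and> (\<forall>c. Re (a (lincomb c vs) (lincomb c vs)) \<le> l * (nrm (lincomb c vs))\<^sup>2)"
proof -
  obtain ls where ls: "length ls = n" "ls \<noteq> []" "sorted ls" "last ls = l"
    "\<And>m. m < l \<Longrightarrow> enat (count_list ls m) = eig_multiplicity Op (complex_of_real m)"
    "enat (count_list ls l) \<le> eig_multiplicity Op (complex_of_real l)"
    using n unfolding is_nth_eigenvalue_def by blast
  have le: "m \<le> l" if "m \<in> set ls" for m
    using that ls(2,3,4) by (metis append_butlast_last_id in_set_conv_decomp_last sorted_append list.set_intros(1) Un_iff set_append order_refl empty_iff empty_set set_ConsD)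
  have "\<exists>vs. length vs = (\<Sum>m\<in>set ms. count_list ls m) \<and> set vs \<subseteq> D \<and> L2_independent vs
    \<and> (\<forall>c. Re (a (lincomb c vs) (lincomb c vs)) \<le> l * (nrm (lincomb c vs))\<^sup>2)
    \<and> (\<forall>v\<in>set vs. \<forall>m u. m \<notin> set ms \<longrightarrow> u \<in> eigenspace Op (of_real m) \<longrightarrow> inn v u = 0)"
    if "distinct ms" "set ms \<subseteq> set ls" for ms
    using that
  proof (induction ms)
    case Nil
    then show ?case by (intro exI[of _ "[]"]) (auto simp: L2_independent_def lincomb_def[abs_def] L2_norm_def a_eigenvector[OF zero_eigenspace zero_in_D, of 0])
  next
    case (Cons m ms)
    then obtain vs where vs: "length vs = (\<Sum>m\<in>set ms. count_list ls m)" "set vs \<subseteq> D" "L2_independent vs"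
      "\<And>c. Re (a (lincomb c vs) (lincomb c vs)) \<le> l * (nrm (lincomb c vs))\<^sup>2"
      "\<And>v k u. v \<in> set vs \<Longrightarrow> k \<notin> set ms \<Longrightarrow> u \<in> eigenspace Op (of_real k) \<Longrightarrow> inn v u = 0" by auto
    have ml: "m \<le> l" using Cons.prems le by simp
    have "enat (count_list ls m) \<le> eig_multiplicity Op (of_real m)"
      using ml ls(5)[of m] ls(6) by (cases "m = l") auto
    then obtain us where us: "length us = count_list ls m" "set us \<subseteq> eigenspace Op (of_real m)" "L2_independent us"
      by (rule multiplicity_obtain)
    have vc: "lincomb c vs \<in> D" for c by (rule lincomb_mem) (use D_lin zero_in_D vs in auto)
    have uc: "lincomb c us \<in> eigenspace Op (of_real m)" for c
      by (rule lincomb_mem) (use eigenspace_lin zero_eigenspace us in auto)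
    have orth: "inn (lincomb c vs) u = 0" if "u \<in> eigenspace Op (of_real m)" for c u
    proof -
      have "lincomb c vs \<in> {v \<in> L2 lborel. inn v u = 0}"
        by (rule lincomb_mem) (use vs D_L2 that eigenspace_L2 Cons.prems in \<open>auto intro: L2_lin simp: ip_lin_left\<close>)
      then show ?thesis by simp
    qed
    have app: "lincomb c (vs @ us) = (\<lambda>x. lincomb c vs x + 1 * lincomb (\<lambda>i. c (length vs + i)) us x)" for c
      by (auto simp: lincomb_append)
    have nrm_app: "(nrm (lincomb c (vs @ us)))\<^sup>2 = (nrm (lincomb c vs))\<^sup>2 + (nrm (lincomb (\<lambda>i. c (length vs + i)) us))\<^sup>2" for c
      unfolding app using orth[OF uc, of c "\<lambda>i. c (length vs + i)"] ip_cnj[of lborel "lincomb c vs" "lincomb (\<lambda>i. c (length vs + i)) us"]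
      by (subst L2_norm_sq_add) (auto simp: D_L2 vc eigenspace_L2[OF uc])
    show ?case
    proof (intro exI[of _ "vs @ us"] conjI ballI allI impI)
      show "length (vs @ us) = (\<Sum>m\<in>set (m # ms). count_list ls m)" using vs us Cons.prems by simp
      show "set (vs @ us) \<subseteq> D" using vs us eigenspace_D by auto
      show "L2_independent (vs @ us)"
        unfolding L2_independent_lincomb
      proof (intro allI impI)
        fix c i assume ae: "AE x in lborel. lincomb c (vs @ us) x = 0" and i: "i < length (vs @ us)"
        have "lincomb c (vs @ us) \<in> L2 lborel"
          unfolding app by (intro L2_lin D_L2 vc eigenspace_L2[OF uc])
        then have "nrm (lincomb c (vs @ us)) = 0" using L2_norm_zero_iff ae by blast
        then have "nrm (lincomb c vs) = 0" "nrm (lincomb (\<lambda>i. c (length vs + i)) us) = 0"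
          using nrm_app[of c] by (auto simp: add_nonneg_eq_0_iff)
        then have "AE x in lborel. lincomb c vs x = 0" "AE x in lborel. lincomb (\<lambda>i. c (length vs + i)) us x = 0"
          using L2_norm_zero_iff[OF D_L2[OF vc]] L2_norm_zero_iff[OF eigenspace_L2[OF uc]] by auto
        then have 0: "\<forall>i<length vs. c i = 0" "\<forall>i<length us. c (length vs + i) = 0"
          using vs(3) us(3) unfolding L2_independent_lincomb by auto
        show "c i = 0"
          using 0(1) 0(2)[rule_format, of "i - length vs"] i by (cases "i < length vs") auto
      qed
      show "Re (a (lincomb c (vs @ us)) (lincomb c (vs @ us))) \<le> l * (nrm (lincomb c (vs @ us)))\<^sup>2" for c
      proof -
        define p where "p = lincomb c vs"
        define r where "r = lincomb (\<lambda>i. c (length vs + i)) us"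
        have pD: "p \<in> D" and rE: "r \<in> eigenspace Op (of_real m)" using vc uc by (auto simp: p_def r_def)
        have rD: "r \<in> D" using eigenspace_D[OF rE] .
        have pr: "inn p r = 0" using orth[OF rE] by (simp add: p_def)
        then have rp: "inn r p = 0" by (metis complex_cnj_zero ip_cnj)
        have zero: "shifted_form 0 r p = 0" using a_eigenvector[OF rE pD] rp by (simp add: shifted_form_def)
        have "Re (a (lincomb c (vs @ us)) (lincomb c (vs @ us))) = Re (a p p) + Re (a r r)"
          using shifted_quad_add[OF pD rD, of 0 1] zero unfolding app p_def[symmetric] r_def[symmetric] by (simp add: shifted_quad_def)
        also have "Re (a r r) = m * (nrm r)\<^sup>2" using a_eigenvector[OF rE rD] by (simp add: ip_self)
        also have "Re (a p p) + m * (nrm r)\<^sup>2 \<le> l * (nrm p)\<^sup>2 + l * (nrm r)\<^sup>2"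
          using vs(4)[of c] ml by (intro add_mono mult_right_mono) (auto simp: p_def)
        finally show ?thesis using nrm_app[of c] by (simp add: p_def r_def algebra_simps)
      qed
      show "inn v u = 0" if "v \<in> set (vs @ us)" "k \<notin> set (m # ms)" "u \<in> eigenspace Op (of_real k)" for v k u
        using that vs(5)[of v k u] eigenvectors_orth[of v m u k] us(2) by auto
    qed
  qed
  from this[of "remdups ls"] show ?thesis
    using sum_count_set[of ls "set ls"] ls(1) by auto
qed

end

section \<open>Smooth functions\<close>

lemma partial_eq: "(f has_derivative f') (at x) \<Longrightarrow> partial i f x = f' (axis i 1)"
  unfolding partial_def using frechet_derivative_at by metis

lemma cont_diff_continuous: "cont_diff k f \<Longrightarrow> continuous_on UNIV f"
  by (cases k) (auto intro: differentiable_imp_continuous_on simp: differentiable_on_def)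

lemma cont_diff_mono: "cont_diff (Suc k) f \<Longrightarrow> cont_diff k f"
proof (induction k arbitrary: f)
  case 0
  then show ?case using cont_diff_continuous[of "Suc 0" f] by simp
qed auto

lemma partial_add:
  assumes "f differentiable at x" "g differentiable at x"
  shows "partial i (\<lambda>x. f x + g x) x = partial i f x + partial i g x"
proof -
  obtain f' g' where d: "(f has_derivative f') (at x)" "(g has_derivative g') (at x)"
    using assms unfolding differentiable_def by blast
  show ?thesis using partial_eq[OF has_derivative_add[OF d]] partial_eq[OF d(1)] partial_eq[OF d(2)] by simp
qed

lemma partial_mult:
  assumes "f differentiable at x" "g differentiable at x"
  shows "partial i (\<lambda>x. f x * g x) x = f x * partial i g x + partial i f x * g x"
proof -
  obtain f' g' where d: "(f has_derivative f') (at x)" "(g has_derivative g') (at x)"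
    using assms unfolding differentiable_def by blast
  show ?thesis using partial_eq[OF has_derivative_mult[OF d]] partial_eq[OF d(1)] partial_eq[OF d(2)] by simp
qed

lemma partial_const [simp]: "partial i (\<lambda>x. c) x = 0"
  by (rule partial_eq[OF has_derivative_const, THEN trans]) simp

lemma cont_diff_add: "cont_diff k f \<Longrightarrow> cont_diff k g \<Longrightarrow> cont_diff k (\<lambda>x. f x + g x)"
proof (induction k arbitrary: f g)
  case 0
  then show ?case by (simp add: continuous_on_add)
next
  case (Suc k)
  then have "partial i (\<lambda>x. f x + g x) = (\<lambda>x. partial i f x + partial i g x)" for i
    by (intro ext partial_add) auto
  then show ?case using Suc by (simp add: differentiable_add)
qed

lemma cont_diff_mult: "cont_diff k f \<Longrightarrow> cont_diff k g \<Longrightarrow> cont_diff k (\<lambda>x. f x * g x)"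
proof (induction k arbitrary: f g)
  case 0
  then show ?case by (simp add: continuous_on_mult)
next
  case (Suc k)
  then have "partial i (\<lambda>x. f x * g x) = (\<lambda>x. f x * partial i g x + partial i f x * g x)" for i
    by (intro ext partial_mult) auto
  moreover have "cont_diff k (\<lambda>x. f x * partial i g x + partial i f x * g x)" for i
    using Suc.prems by (intro cont_diff_add Suc.IH cont_diff_mono[OF Suc.prems(1)] cont_diff_mono[OF Suc.prems(2)]) auto
  ultimately show ?case using Suc.prems by (simp add: differentiable_mult)
qed

definition smooth :: "(real ^ 3 \<Rightarrow> complex) \<Rightarrow> bool" where
  "smooth f \<longleftrightarrow> (\<forall>k. cont_diff k f)"

lemma smooth_continuous: "smooth f \<Longrightarrow> continuous_on UNIV f"
  using cont_diff_continuous by (auto simp: smooth_def)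

lemma smooth_differentiable: "smooth f \<Longrightarrow> f differentiable at x"
  unfolding smooth_def by (metis cont_diff.simps(2))

lemma smooth_partial: "smooth f \<Longrightarrow> smooth (partial i f)"
  unfolding smooth_def by (metis cont_diff.simps(2))

lemma smooth_add: "smooth f \<Longrightarrow> smooth g \<Longrightarrow> smooth (\<lambda>x. f x + g x)"
  by (simp add: smooth_def cont_diff_add)

lemma smooth_mult: "smooth f \<Longrightarrow> smooth g \<Longrightarrow> smooth (\<lambda>x. f x * g x)"
  by (simp add: smooth_def cont_diff_mult)

lemma smooth_coinduct:
  assumes "P f" and step: "\<And>g x. P g \<Longrightarrow> g differentiable at x" "\<And>g i. P g \<Longrightarrow> P (partial i g)"
  shows "smooth f"
  unfolding smooth_def
proof
  fix k show "cont_diff k f" using assms(1)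
  proof (induction k arbitrary: f)
    case 0
    then show ?case using step(1) by (auto intro: differentiable_imp_continuous_on simp: differentiable_on_def)
  next
    case (Suc k)
    then show ?case using step by simp
  qed
qed

lemma smooth_const: "smooth (\<lambda>x. c)"
proof (rule smooth_coinduct[where P = "\<lambda>f. \<exists>c. f = (\<lambda>x. c)"])
  show "\<exists>c. partial i g = (\<lambda>x. c)" if "\<exists>c. g = (\<lambda>x. c)" for g i
    using that partial_const by (intro exI[of _ 0]) auto
qed auto

lemma smooth_prod: "finite I \<Longrightarrow> (\<And>i. i \<in> I \<Longrightarrow> smooth (f i)) \<Longrightarrow> smooth (\<lambda>x. \<Prod>i\<in>I. f i x)"
  by (induction I rule: finite_induct) (auto intro: smooth_mult smooth_const)

lemma smooth_coordinate:
  fixes H :: "nat \<Rightarrow> real \<Rightarrow> real"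
  assumes "\<And>n x. (H n has_real_derivative H (Suc n) x) (at x)"
  shows "smooth (\<lambda>x. of_real (H n (x $ i)))"
proof (rule smooth_coinduct[where P = "\<lambda>f. (\<exists>n. f = (\<lambda>x. of_real (H n (x $ i)))) \<or> f = (\<lambda>x. 0)"])
  have d: "((\<lambda>x. complex_of_real (H n (x $ i))) has_derivative (\<lambda>h. of_real (H (Suc n) (x $ i) * h $ i))) (at x)" for n and x :: "real ^ 3"
  proof -
    have "((\<lambda>x. H n (x $ i)) has_derivative (\<lambda>h. H (Suc n) (x $ i) * h $ i)) (at x)"
      using has_derivative_compose[OF bounded_linear_imp_has_derivative[OF bounded_linear_vec_nth]
          has_field_derivative_imp_has_derivative[OF assms[of n "x $ i"]]] by blast
    then show ?thesis by (rule has_derivative_of_real)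
  qed
  fix g :: "real ^ 3 \<Rightarrow> complex" assume g: "(\<exists>n. g = (\<lambda>x. of_real (H n (x $ i)))) \<or> g = (\<lambda>x. 0)"
  show "g differentiable at x" for x using g d differentiable_def by fastforce
  show "(\<exists>n. partial j g = (\<lambda>x. of_real (H n (x $ i)))) \<or> partial j g = (\<lambda>x. 0)" for j
  proof (cases "g = (\<lambda>x. 0)")
    case True
    then show ?thesis by auto
  next
    case False
    then obtain n where n: "g = (\<lambda>x. of_real (H n (x $ i)))" using g by blast
    have p: "partial j g x = of_real (H (Suc n) (x $ i) * axis j 1 $ i)" for x
      unfolding n by (rule partial_eq[OF d])
    show ?thesis
    proof (cases "i = j")
      case True
      then have "partial j g = (\<lambda>x. of_real (H (Suc n) (x $ i)))" using p by auto
      then show ?thesis by blast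
    next
      case False
      then have "partial j g = (\<lambda>x. 0)" using p by (auto simp: axis_def)
      then show ?thesis by blast
    qed
  qed
qed auto

subsection \<open>Bump functions\<close>

text \<open>The derivatives of \<open>exp (- 1 / x)\<close>, extended by \<open>0\<close> to \<open>x \<le> 0\<close>, are of this form.\<close>

definition flat_exp :: "real poly \<Rightarrow> real \<Rightarrow> real" where
  "flat_exp p x = (if x > 0 then poly p (1 / x) * exp (- (1 / x)) else 0)"

lemma poly_div_exp_tendsto_0: "((\<lambda>y::real. poly p y * exp (- y)) \<longlongrightarrow> 0) at_top"
proof -
  have "((\<lambda>y::real. \<Sum>i\<le>degree p. coeff p i * (y ^ i / exp y)) \<longlongrightarrow> (\<Sum>i\<le>degree p. coeff p i * 0)) at_top"
    by (intro tendsto_intros tendsto_power_div_exp_0)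
  then show ?thesis by (simp add: poly_altdef exp_minus divide_inverse sum_distrib_right mult.assoc)
qed

lemma flat_exp_derivative:
  "(flat_exp p has_real_derivative flat_exp ([:0, 0, 1:] * (p - pderiv p)) x) (at x)"
proof -
  consider "x > 0" | "x < 0" | "x = 0" by linarith
  then show ?thesis
  proof cases
    case 1
    have "((\<lambda>x. poly p (1 / x) * exp (- (1 / x))) has_real_derivative
        flat_exp ([:0, 0, 1:] * (p - pderiv p)) x) (at x)"
      using 1 by (auto intro!: derivative_eq_intros DERIV_chain2[OF poly_DERIV] simp: flat_exp_def power2_eq_square field_simps)
    then show ?thesis
      by (rule has_field_derivative_transform_within_open[of _ _ _ "{0<..}"]) (use 1 in \<open>auto simp: flat_exp_def\<close>)
  next
    case 2
    have "((\<lambda>x. 0) has_real_derivative 0) (at x)" by simp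
    then have "(flat_exp p has_real_derivative 0) (at x)"
      by (rule has_field_derivative_transform_within_open[of _ _ _ "{..<0}"]) (use 2 in \<open>auto simp: flat_exp_def\<close>)
    then show ?thesis using 2 by (simp add: flat_exp_def)
  next
    case 3
    have "((\<lambda>h. (flat_exp p (0 + h) - flat_exp p 0) / h) \<longlongrightarrow> 0) (at 0)"
    proof (rule filterlim_split_at)
      have "\<forall>\<^sub>F h in at_left 0. (flat_exp p (0 + h) - flat_exp p 0) / h = (0::real)"
        unfolding eventually_at by (intro exI[of _ 1]) (auto simp: flat_exp_def)
      then show "((\<lambda>h. (flat_exp p (0 + h) - flat_exp p 0) / h) \<longlongrightarrow> 0) (at_left 0)" by (rule tendsto_eventually)
      have "((\<lambda>h. poly ([:0, 1:] * p) (inverse h) * exp (- inverse h)) \<longlongrightarrow> 0) (at_right 0)"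
        by (rule filterlim_compose[OF poly_div_exp_tendsto_0 filterlim_inverse_at_top_right])
      moreover have "\<forall>\<^sub>F h in at_right 0. poly ([:0, 1:] * p) (inverse h) * exp (- inverse h) = (flat_exp p (0 + h) - flat_exp p 0) / (h::real)"
        unfolding eventually_at by (intro exI[of _ 1]) (auto simp: flat_exp_def divide_inverse)
      ultimately show "((\<lambda>h. (flat_exp p (0 + h) - flat_exp p 0) / h) \<longlongrightarrow> 0) (at_right 0)"
        by (rule Lim_transform_eventually)
    qed
    then show ?thesis using 3 by (simp add: DERIV_def flat_exp_def)
  qed
qed

definition flat :: "real \<Rightarrow> real" where
  "flat = flat_exp 1"

lemma flat_pos_iff: "flat x > 0 \<longleftrightarrow> x > 0" and flat_nonneg: "flat x \<ge> 0" and flat_le_1: "flat x \<le> 1"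
  by (auto simp: flat_def flat_exp_def)

lemma flat_derivatives: "\<exists>H. H 0 = flat \<and> (\<forall>n x. (H n has_real_derivative H (Suc n) x) (at x))"
  by (rule exI[of _ "\<lambda>n. flat_exp (((\<lambda>p. [:0, 0, 1:] * (p - pderiv p)) ^^ n) 1)"])
     (simp add: flat_def flat_exp_derivative del: mult_pCons_left)

lemma smooth_flat_coordinate: "smooth (\<lambda>x. of_real (flat (s * (x $ i) + t)))"
proof -
  obtain H where H: "H 0 = flat" "\<And>n x. (H n has_real_derivative H (Suc n) x) (at x)" using flat_derivatives by blast
  define G where "G n x = s ^ n * H n (s * x + t)" for n x
  have "(G n has_real_derivative G (Suc n) x) (at x)" for n x
    unfolding G_def[abs_def] by (auto intro!: derivative_eq_intros DERIV_chain2[OF H(2)])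
  from smooth_coordinate[of G 0 i, OF this] show ?thesis by (simp add: G_def H)
qed

lemma flat_measurable [measurable]: "flat \<in> borel_measurable borel"
  and flat_continuous: "continuous_on A flat"
proof -
  have "continuous_on UNIV flat"
    unfolding flat_def by (rule DERIV_continuous_on[OF has_field_derivative_at_within[OF flat_exp_derivative]])
  then show "flat \<in> borel_measurable borel" "continuous_on A flat"
    by (auto intro: borel_measurable_continuous_onI continuous_on_subset)
qed

definition box_bump :: "real ^ 3 \<Rightarrow> real ^ 3 \<Rightarrow> real ^ 3 \<Rightarrow> real" where
  "box_bump a b x = (\<Prod>i\<in>UNIV. flat (x $ i - a $ i) * flat (b $ i - x $ i))"

lemma box_bump_nonneg: "box_bump a b x \<ge> 0"
  unfolding box_bump_def by (intro prod_nonneg) (auto simp: flat_nonneg)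

lemma box_bump_pos_iff: "box_bump a b x > 0 \<longleftrightarrow> x \<in> box a b"
proof
  assume "x \<in> box a b"
  then show "box_bump a b x > 0"
    unfolding box_bump_def by (intro prod_pos) (auto simp: mem_box_cart flat_pos_iff)
next
  assume pos: "box_bump a b x > 0"
  have "flat (x $ i - a $ i) \<noteq> 0 \<and> flat (b $ i - x $ i) \<noteq> 0" for i
  proof (rule ccontr)
    assume "\<not> ?thesis"
    then have "flat (x $ i - a $ i) * flat (b $ i - x $ i) = 0" by auto
    then have "box_bump a b x = 0" unfolding box_bump_def by (intro prod_zero) auto
    then show False using pos by simp
  qed
  moreover have "z > 0" if "flat z \<noteq> 0" for z using that flat_pos_iff[of z] flat_nonneg[of z] by (simp add: less_le)
  ultimately have "x $ i - a $ i > 0 \<and> b $ i - x $ i > 0" for i by blast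
  then show "x \<in> box a b" unfolding mem_box_cart by simp
qed

lemma box_bump_le_1: "box_bump a b x \<le> 1"
  unfolding box_bump_def by (intro prod_le_1) (auto simp: flat_nonneg flat_le_1 mult_le_one)

lemma smooth_box_bump: "smooth (\<lambda>x. of_real (box_bump a b (s *\<^sub>R x)))"
proof -
  have "smooth (\<lambda>x. complex_of_real (flat (s * (x $ i) + - a $ i)) * of_real (flat ((- s) * (x $ i) + b $ i)))" for i
    by (intro smooth_mult smooth_flat_coordinate)
  from smooth_prod[of UNIV, OF finite this] show ?thesis by (simp add: box_bump_def algebra_simps)
qed

lemma box_bump_measurable [measurable]: "box_bump a b \<in> borel_measurable borel"
  unfolding box_bump_def[abs_def] by measurable

subsection \<open>Test functions\<close>

lemma test_functionsI:
  assumes "smooth \<phi>" "compact K" "K \<subseteq> \<Omega>" "\<And>x. x \<notin> K \<Longrightarrow> \<phi> x = 0"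
  shows "\<phi> \<in> test_functions \<Omega>"
proof -
  have "closure {x. \<phi> x \<noteq> 0} \<subseteq> K" using assms by (intro closure_minimal compact_imp_closed) auto
  moreover have "bounded {x. \<phi> x \<noteq> 0}"
    by (rule bounded_subset[OF compact_imp_bounded[OF assms(2)]]) (use assms(4) in auto)
  ultimately show ?thesis using assms by (auto simp: test_functions_def smooth_def)
qed

lemma test_functionsE:
  assumes "\<phi> \<in> test_functions \<Omega>"
  obtains K where "compact K" "K \<subseteq> \<Omega>" "\<And>x. x \<notin> K \<Longrightarrow> \<phi> x = 0" "\<And>x i. x \<notin> K \<Longrightarrow> partial i \<phi> x = 0"
proof (rule that[of "closure {x. \<phi> x \<noteq> 0}"])
  let ?K = "closure {x. \<phi> x \<noteq> 0}"
  show "compact ?K" "?K \<subseteq> \<Omega>" using assms by (auto simp: test_functions_def)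
  show "\<phi> x = 0" if "x \<notin> ?K" for x using that closure_subset[of "{x. \<phi> x \<noteq> 0}"] by blast
  show "partial i \<phi> x = 0" if "x \<notin> ?K" for x i
  proof -
    have "((\<lambda>x. 0) has_derivative (\<lambda>h. 0)) (at x)" by simp
    then have "(\<phi> has_derivative (\<lambda>h. 0)) (at x)"
      by (rule has_derivative_transform_within_open[of _ _ _ UNIV "- ?K"])
         (use that closure_subset[of "{x. \<phi> x \<noteq> 0}"] in \<open>auto simp: open_Compl\<close>)
    then show ?thesis by (rule partial_eq)
  qed
qed

lemma test_smooth: "\<phi> \<in> test_functions \<Omega> \<Longrightarrow> smooth \<phi>"
  by (simp add: test_functions_def smooth_def)

lemma test_partial: "\<phi> \<in> test_functions \<Omega> \<Longrightarrow> partial i \<phi> \<in> test_functions \<Omega>"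
  by (frule test_smooth, erule test_functionsE) (auto intro!: test_functionsI smooth_partial)

lemma test_mono: "\<phi> \<in> test_functions \<Omega> \<Longrightarrow> \<Omega> \<subseteq> \<Omega>' \<Longrightarrow> \<phi> \<in> test_functions \<Omega>'"
  by (auto simp: test_functions_def)

lemma test_mult_smooth:
  assumes "\<phi> \<in> test_functions \<Omega>" "smooth f"
  shows "(\<lambda>x. \<phi> x * f x) \<in> test_functions \<Omega>"
  using test_smooth[OF assms(1)] assms by (elim test_functionsE) (auto intro!: test_functionsI smooth_mult)

lemma test_add:
  assumes "\<phi> \<in> test_functions \<Omega>" "\<psi> \<in> test_functions \<Omega>"
  shows "(\<lambda>x. \<phi> x + c * \<psi> x) \<in> test_functions \<Omega>"
proof -
  obtain K where K: "compact K" "K \<subseteq> \<Omega>" "\<And>x. x \<notin> K \<Longrightarrow> \<phi> x = 0" using assms(1) by (rule test_functionsE) blast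
  obtain L where L: "compact L" "L \<subseteq> \<Omega>" "\<And>x. x \<notin> L \<Longrightarrow> \<psi> x = 0" using assms(2) by (rule test_functionsE) blast
  show ?thesis
    by (rule test_functionsI[of _ "K \<union> L"]) (use K L assms test_smooth in \<open>auto intro!: smooth_add smooth_mult smooth_const\<close>)
qed

lemma test_continuous: "\<phi> \<in> test_functions \<Omega> \<Longrightarrow> continuous_on A \<phi>"
  using smooth_continuous[OF test_smooth] continuous_on_subset by blast

lemma test_measurable [measurable_dest]: "\<phi> \<in> test_functions \<Omega> \<Longrightarrow> \<phi> \<in> borel_measurable borel"
  by (intro borel_measurable_continuous_onI test_continuous)

lemma test_bounded:
  assumes "\<phi> \<in> test_functions \<Omega>"
  obtains B where "B > 0" "\<And>x. norm (\<phi> x) \<le> B"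
proof -
  obtain K where K: "compact K" "\<And>x. x \<notin> K \<Longrightarrow> \<phi> x = 0" using assms by (rule test_functionsE) blast
  have "bounded (\<phi> ` K)" by (intro compact_imp_bounded compact_continuous_image test_continuous[OF assms] K)
  then obtain B where B: "B > 0" "\<And>x. x \<in> K \<Longrightarrow> norm (\<phi> x) \<le> B" unfolding bounded_pos by blast
  show ?thesis by (rule that[of B]) (use B K in \<open>metis norm_zero less_imp_le\<close>)+
qed

lemma compact_support_L2:
  fixes f :: "'a::euclidean_space \<Rightarrow> 'b::{real_normed_vector, second_countable_topology}"
  assumes [measurable]: "f \<in> borel_measurable borel" and "compact K" "\<And>x. x \<notin> K \<Longrightarrow> f x = 0" "\<And>x. norm (f x) \<le> B"
  shows "f \<in> L2 lborel"
proof (rule L2I)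
  show "integrable lborel (\<lambda>x. B\<^sup>2 * indicat_real K x)"
    using assms(2) by (intro integrable_mult_right integrable_real_indicator emeasure_compact_finite) (auto intro: borel_compact)
  show "(norm (f x))\<^sup>2 \<le> B\<^sup>2 * indicat_real K x" for x
    using assms(3,4)[of x] by (auto simp: indicator_def power_mono)
qed simp

lemma test_L2: "\<phi> \<in> test_functions \<Omega> \<Longrightarrow> \<phi> \<in> L2 lborel"
  by (metis test_functionsE test_bounded compact_support_L2 test_measurable)

lemma box_bump_test:
  assumes "cbox a b \<subseteq> \<Omega>"
  shows "(\<lambda>x. of_real (box_bump a b x)) \<in> test_functions \<Omega>"
proof (rule test_functionsI[of _ "cbox a b"])
  show "smooth (\<lambda>x. of_real (box_bump a b x))" using smooth_box_bump[of a b 1] by simp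
  show "of_real (box_bump a b x) = (0::complex)" if "x \<notin> cbox a b" for x
    using that box_bump_pos_iff[of a b x] box_bump_nonneg[of a b x] box_subset_cbox by (fastforce simp: less_eq_real_def)
qed (use assms in auto)

subsection \<open>Convolution with test functions\<close>

definition conv :: "(real ^ 3 \<Rightarrow> complex) \<Rightarrow> (real ^ 3 \<Rightarrow> complex) \<Rightarrow> real ^ 3 \<Rightarrow> complex" where
  "conv \<eta> u x = (\<integral>y. \<eta> (x - y) * u y \<partial>lborel)"

lemma smooth_has_derivative:
  assumes "smooth f"
  shows "(f has_derivative (\<lambda>h. \<Sum>i\<in>UNIV. of_real (h $ i) * partial i f x)) (at x)"
proof -
  let ?D = "frechet_derivative f (at x)"
  have d: "(f has_derivative ?D) (at x)" using smooth_differentiable[OF assms] frechet_derivative_works by blast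
  have lin: "linear ?D" using d has_derivative_linear by blast
  have "?D h = (\<Sum>i\<in>UNIV. of_real (h $ i) * partial i f x)" for h
  proof -
    have "?D h = ?D (\<Sum>i\<in>UNIV. (h $ i) *\<^sub>R axis i 1)"
      using basis_expansion[of h] by (simp add: scalar_mult_eq_scaleR)
    also have "\<dots> = (\<Sum>i\<in>UNIV. (h $ i) *\<^sub>R ?D (axis i 1))" by (simp add: linear_sum[OF lin] linear_scale[OF lin])
    finally show ?thesis by (simp add: partial_def scaleR_conv_of_real)
  qed
  then show ?thesis using d by (metis (no_types, lifting) ext)
qed

lemma test_Lipschitz:
  assumes "\<phi> \<in> test_functions \<Omega>"
  obtains L where "L > 0" "\<And>x y. norm (\<phi> x - \<phi> y) \<le> L * norm (x - y)"
    "\<And>x h. norm (\<Sum>i\<in>UNIV. of_real (h $ i) * partial i \<phi> x) \<le> L * norm h"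
proof -
  have "\<forall>i. \<exists>B>0. \<forall>x. norm (partial i \<phi> x) \<le> B" using test_bounded[OF test_partial[OF assms]] by metis
  then obtain B where B: "\<And>i. B i > 0" "\<And>i x. norm (partial i \<phi> x) \<le> B i" by metis
  define L where "L = sum B UNIV"
  have L: "L > 0" unfolding L_def by (intro sum_pos) (auto simp: B)
  have D: "norm (\<Sum>i\<in>UNIV. of_real (h $ i) * partial i \<phi> x) \<le> L * norm h" for x h
  proof -
    have "norm (\<Sum>i\<in>UNIV. of_real (h $ i) * partial i \<phi> x) \<le> (\<Sum>i\<in>UNIV. norm h * B i)"
    proof (rule order_trans[OF norm_sum], rule sum_mono)
      fix i show "norm (of_real (h $ i) * partial i \<phi> x) \<le> norm h * B i"
        unfolding norm_mult using component_le_norm_cart[of h i] B by (intro mult_mono) (auto simp: less_imp_le)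
    qed
    then show ?thesis by (simp add: L_def sum_distrib_left mult.commute)
  qed
  have "norm (\<phi> x - \<phi> y) \<le> L * norm (x - y)" for x y
  proof (rule differentiable_bound[where S = UNIV])
    show "(\<phi> has_derivative (\<lambda>h. \<Sum>i\<in>UNIV. of_real (h $ i) * partial i \<phi> x)) (at x within UNIV)" for x
      using smooth_has_derivative[OF test_smooth[OF assms]] by simp
    show "onorm (\<lambda>h. \<Sum>i\<in>UNIV. of_real (h $ i) * partial i \<phi> x) \<le> L" for x
      by (rule onorm_bound) (use D L in auto)
  qed auto
  then show ?thesis using that L D by blast
qed

lemma test_mult_integrable:
  assumes "\<phi> \<in> test_functions \<Omega>" "u \<in> L2 lborel"
  shows "integrable lborel (\<lambda>y. \<phi> (x - y) * u y)"
proof (rule L2_mult_integrable)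
  obtain K where K: "compact K" "\<And>x. x \<notin> K \<Longrightarrow> \<phi> x = 0" using assms(1) by (rule test_functionsE) blast
  obtain B where B: "\<And>x. norm (\<phi> x) \<le> B" using assms(1) by (rule test_bounded) blast
  note [measurable] = test_measurable[OF assms(1)] L2_measurable[OF assms(2)]
  show "(\<lambda>y. \<phi> (x - y)) \<in> L2 lborel"
  proof (rule compact_support_L2[where K = "(\<lambda>y. x - y) ` K" and B = B])
    show "compact ((\<lambda>y. x - y) ` K)" by (intro compact_continuous_image continuous_intros K)
    show "\<phi> (x - y) = 0" if "y \<notin> (\<lambda>y. x - y) ` K" for y
      using that K(2)[of "x - y"] by (metis diff_diff_eq2 add_diff_cancel_left' image_eqI)
  qed (use B in auto)
  show "(\<lambda>y. \<phi> (x - y) * u y) \<in> borel_measurable lborel" by measurable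
qed (use assms in \<open>auto simp: norm_mult\<close>)

text \<open>Differentiation under the integral sign: the difference quotients of \<open>\<eta>\<close> are bounded by its
  Lipschitz constant and vanish outside a fixed compact set, on which \<open>u\<close> is integrable.\<close>

lemma conv_has_derivative:
  assumes \<eta>: "\<eta> \<in> test_functions UNIV" and u: "u \<in> L2 lborel"
  shows "(conv \<eta> u has_derivative (\<lambda>h. \<Sum>i\<in>UNIV. of_real (h $ i) * conv (partial i \<eta>) u x)) (at x)"
  unfolding has_derivative_at
proof
  let ?D = "\<lambda>h. \<Sum>i\<in>UNIV. of_real (h $ i) * conv (partial i \<eta>) u x"
  show "bounded_linear ?D"
    by (intro bounded_linear_sum bounded_linear_mult_left bounded_linear_compose[OF bounded_linear_of_real] 
        bounded_linear_compose[OF bounded_linear_mult_left] bounded_linear_vec_nth)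
  obtain K where K: "compact K" "\<And>x. x \<notin> K \<Longrightarrow> \<eta> x = 0" "\<And>x i. x \<notin> K \<Longrightarrow> partial i \<eta> x = 0" using \<eta> by (rule test_functionsE) blast
  obtain R where R: "K \<subseteq> cball 0 R" "R > 0" using compact_imp_bounded[OF K(1)] unfolding bounded_pos by (auto simp: subset_eq)
  obtain L where L: "L > 0" "\<And>x y. norm (\<eta> x - \<eta> y) \<le> L * norm (x - y)"
    "\<And>x h. norm (\<Sum>i\<in>UNIV. of_real (h $ i) * partial i \<eta> x) \<le> L * norm h" by (rule test_Lipschitz[OF \<eta>]) blast
  define d where "d h y = \<eta> (x + h - y) - \<eta> (x - y) - (\<Sum>i\<in>UNIV. of_real (h $ i) * partial i \<eta> (x - y))" for h y
  have [measurable]: "\<eta> \<in> borel_measurable borel" "\<And>i. partial i \<eta> \<in> borel_measurable borel" "u \<in> borel_measurable borel"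
    "cball x (R + 1) \<in> sets borel"
    using test_measurable[OF \<eta>] test_measurable[OF test_partial[OF \<eta>]] L2_measurable[OF u] by auto
  have d_bound: "norm (d h y) \<le> 2 * L * norm h" for h y
  proof -
    have "norm (d h y) \<le> norm (\<eta> (x + h - y) - \<eta> (x - y)) + norm (\<Sum>i\<in>UNIV. of_real (h $ i) * partial i \<eta> (x - y))"
      unfolding d_def by (rule norm_triangle_ineq4)
    then show ?thesis using L(2)[of "x + h - y" "x - y"] L(3)[of h "x - y"] by simp
  qed
  have d_supp: "d h y = 0" if "norm h \<le> 1" "y \<notin> cball x (R + 1)" for h y
  proof -
    have "norm (x - y) > R + 1" using that by (simp add: dist_norm)
    moreover have "norm (x - y) \<le> norm (x + h - y) + norm h" using norm_triangle_ineq4[of "x + h - y" h] by (simp add: algebra_simps)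
    ultimately have "x + h - y \<notin> K" "x - y \<notin> K" using R that by auto
    then show ?thesis using K by (simp add: d_def)
  qed
  have eq: "conv \<eta> u (x + h) - conv \<eta> u x - ?D h = (\<integral>y. d h y * u y \<partial>lborel)" for h
  proof -
    have i: "integrable lborel (\<lambda>y. \<eta> (z - y) * u y)" "integrable lborel (\<lambda>y. partial i \<eta> (x - y) * u y)" for z i
      using test_mult_integrable \<eta> test_partial u by blast+
    have "(\<integral>y. d h y * u y \<partial>lborel) = (\<integral>y. \<eta> (x + h - y) * u y - \<eta> (x - y) * u y - (\<Sum>i\<in>UNIV. of_real (h $ i) * (partial i \<eta> (x - y) * u y)) \<partial>lborel)"
      by (simp add: d_def algebra_simps sum_distrib_left sum_distrib_right)
    also have "\<dots> = conv \<eta> u (x + h) - conv \<eta> u x - ?D h"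
      using i by (simp add: conv_def)
    finally show ?thesis by simp
  qed
  show "(\<lambda>h. norm (conv \<eta> u (x + h) - conv \<eta> u x - ?D h) / norm h) \<midarrow>0\<rightarrow> 0"
  proof (unfold tendsto_at_iff_sequentially, intro allI impI)
    fix H :: "nat \<Rightarrow> real ^ 3" assume "\<forall>i. H i \<in> UNIV - {0}" and H0: "H \<longlonglongrightarrow> 0"
    then have Hn: "H n \<noteq> 0" for n by auto
    obtain N where N: "\<And>n. n \<ge> N \<Longrightarrow> norm (H n) < 1" using LIMSEQ_D[OF H0, of 1] by auto
    have "(\<lambda>n. \<integral>y. (d (H (n + N)) y / of_real (norm (H (n + N)))) * u y \<partial>lborel) \<longlonglongrightarrow> (\<integral>y. 0 \<partial>(lborel :: (real ^ 3) measure))"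
    proof (rule integral_dominated_convergence)
      show "integrable lborel (\<lambda>y. norm (2 * L * indicat_real (cball x (R + 1)) y * norm (u y)))"
      proof (rule L2_mult_integrable[OF _ u])
        show "(\<lambda>y. 2 * L * indicat_real (cball x (R + 1)) y) \<in> L2 lborel"
          by (rule compact_support_L2[of _ "cball x (R + 1)" "2 * L"]) (use L(1) in \<open>auto simp: indicator_def\<close>)
        show "(\<lambda>y. norm (2 * L * indicat_real (cball x (R + 1)) y * norm (u y))) \<in> borel_measurable lborel" by measurable
      qed (simp add: abs_mult)
      show "(\<lambda>y. d (H (n + N)) y / of_real (norm (H (n + N))) * u y) \<in> borel_measurable lborel" for n
        unfolding d_def by measurable
      show "AE y in lborel. (\<lambda>n. d (H (n + N)) y / of_real (norm (H (n + N))) * u y) \<longlonglongrightarrow> 0"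
      proof (rule AE_I2)
        fix y
        have "(\<lambda>h. norm (\<eta> ((x - y) + h) - \<eta> (x - y) - (\<Sum>i\<in>UNIV. of_real (h $ i) * partial i \<eta> (x - y))) / norm h) \<midarrow>0\<rightarrow> 0"
          using smooth_has_derivative[OF test_smooth[OF \<eta>], of "x - y"] unfolding has_derivative_at by blast
        then have "(\<lambda>h. norm (d h y) / norm h) \<midarrow>0\<rightarrow> 0" by (simp add: d_def algebra_simps)
        then have "(\<lambda>n. norm (d (H n) y) / norm (H n)) \<longlonglongrightarrow> 0"
          unfolding tendsto_at_iff_sequentially using Hn H0 by (auto simp: o_def)
        then have "(\<lambda>n. norm (d (H (n + N)) y) / norm (H (n + N))) \<longlonglongrightarrow> 0" by (rule LIMSEQ_ignore_initial_segment)
        then have "(\<lambda>n. norm (d (H (n + N)) y / of_real (norm (H (n + N))))) \<longlonglongrightarrow> 0" by (simp add: norm_divide)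
        then have "(\<lambda>n. d (H (n + N)) y / of_real (norm (H (n + N)))) \<longlonglongrightarrow> 0" by (rule tendsto_norm_zero_cancel)
        then show "(\<lambda>n. d (H (n + N)) y / of_real (norm (H (n + N))) * u y) \<longlonglongrightarrow> 0" by (rule tendsto_mult_left_zero)
      qed
      show "AE y in lborel. norm (d (H (n + N)) y / of_real (norm (H (n + N))) * u y) \<le> norm (2 * L * indicat_real (cball x (R + 1)) y * norm (u y))" for n
      proof (rule AE_I2)
        fix y
        have h: "norm (H (n + N)) \<le> 1" "norm (H (n + N)) > 0" using N[of "n + N"] Hn by auto
        have "norm (d (H (n + N)) y) / norm (H (n + N)) \<le> 2 * L * indicat_real (cball x (R + 1)) y"
          using d_bound[of "H (n + N)" y] d_supp[OF h(1), of y] h(2) by (auto simp: indicator_def field_simps)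
        then have "norm (d (H (n + N)) y) / norm (H (n + N)) * norm (u y) \<le> 2 * L * indicat_real (cball x (R + 1)) y * norm (u y)"
          by (intro mult_right_mono) auto
        then show "norm (d (H (n + N)) y / of_real (norm (H (n + N))) * u y) \<le> norm (2 * L * indicat_real (cball x (R + 1)) y * norm (u y))"
          using L(1) by (simp add: norm_mult norm_divide abs_mult)
      qed
    qed simp
    then have "(\<lambda>n. norm (\<integral>y. (d (H (n + N)) y / of_real (norm (H (n + N)))) * u y \<partial>lborel)) \<longlonglongrightarrow> 0"
      by (intro tendsto_norm_zero) simp
    moreover have "norm (\<integral>y. (d h y / of_real (norm h)) * u y \<partial>lborel) = norm (conv \<eta> u (x + h) - conv \<eta> u x - ?D h) / norm h" for h
      unfolding eq times_divide_eq_left integral_divide_zero norm_divide by simp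
    ultimately have "(\<lambda>n. norm (conv \<eta> u (x + H (n + N)) - conv \<eta> u x - ?D (H (n + N))) / norm (H (n + N))) \<longlonglongrightarrow> 0" by simp
    then have "(\<lambda>n. norm (conv \<eta> u (x + H n) - conv \<eta> u x - ?D (H n)) / norm (H n)) \<longlonglongrightarrow> 0" by (rule LIMSEQ_offset)
    then show "((\<lambda>h. norm (conv \<eta> u (x + h) - conv \<eta> u x - ?D h) / norm h) \<circ> H) \<longlonglongrightarrow> 0" by (simp add: o_def)
  qed
qed

lemma partial_conv:
  assumes "\<eta> \<in> test_functions UNIV" "u \<in> L2 lborel"
  shows "partial i (conv \<eta> u) = conv (partial i \<eta>) u"
proof
  fix x
  have "partial i (conv \<eta> u) x = (\<Sum>j\<in>UNIV. of_real ((axis i 1 :: real ^ 3) $ j) * conv (partial j \<eta>) u x)"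
    by (rule partial_eq[OF conv_has_derivative[OF assms]])
  also have "\<dots> = (\<Sum>j\<in>UNIV. if j = i then conv (partial j \<eta>) u x else 0)"
    by (intro sum.cong) (auto simp: axis_def)
  finally show "partial i (conv \<eta> u) x = conv (partial i \<eta>) u x" by simp
qed

lemma smooth_conv:
  assumes "\<eta> \<in> test_functions UNIV" "u \<in> L2 lborel"
  shows "smooth (conv \<eta> u)"
proof (rule smooth_coinduct[where P = "\<lambda>f. \<exists>\<eta>\<in>test_functions UNIV. f = conv \<eta> u"])
  show "\<exists>\<eta>'\<in>test_functions UNIV. partial i g = conv \<eta>' u" if "\<exists>\<eta>\<in>test_functions UNIV. g = conv \<eta> u" for g i
    using that partial_conv[OF _ assms(2)] test_partial by blast
  show "g differentiable at x" if "\<exists>\<eta>\<in>test_functions UNIV. g = conv \<eta> u" for g x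
    using that conv_has_derivative[OF _ assms(2)] unfolding differentiable_def by blast
qed (use assms in blast)

lemma test_reflect:
  assumes \<eta>: "\<eta> \<in> test_functions UNIV" and supp: "\<And>y. y \<notin> L \<Longrightarrow> \<eta> y = 0" "compact L" "\<And>y. y \<in> L \<Longrightarrow> x - y \<in> \<Omega>"
  shows "(\<lambda>y. \<eta> (x - y)) \<in> test_functions \<Omega>" "partial i (\<lambda>y. \<eta> (x - y)) y = - partial i \<eta> (x - y)"
proof -
  have d: "((\<lambda>y. c * \<eta> (x - y)) has_derivative (\<lambda>h. c * (\<Sum>i\<in>UNIV. of_real ((- h) $ i) * partial i \<eta> (x - y)))) (at y)"
    if "smooth \<eta>" for \<eta> c y
  proof -
    have "((\<lambda>y. x - y) has_derivative (\<lambda>h. - h)) (at y)" by (auto intro!: derivative_eq_intros)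
    from has_derivative_compose[OF this smooth_has_derivative[OF that, of "x - y"]]
    show ?thesis by (rule has_derivative_mult_right)
  qed
  have p: "partial i (\<lambda>y. c * \<eta> (x - y)) y = - c * partial i \<eta> (x - y)" if "smooth \<eta>" for \<eta> c i y
  proof -
    have "partial i (\<lambda>y. c * \<eta> (x - y)) y = c * (\<Sum>j\<in>UNIV. of_real ((- axis i 1 :: real ^ 3) $ j) * partial j \<eta> (x - y))"
      by (rule partial_eq[OF d[OF that]])
    also have "(\<Sum>j\<in>UNIV. of_real ((- axis i 1 :: real ^ 3) $ j) * partial j \<eta> (x - y)) = (\<Sum>j\<in>UNIV. if j = i then - partial j \<eta> (x - y) else 0)"
      by (intro sum.cong) (auto simp: axis_def)
    finally show ?thesis by simp
  qed
  show "partial i (\<lambda>y. \<eta> (x - y)) y = - partial i \<eta> (x - y)" using p[OF test_smooth[OF \<eta>], of i 1] by simp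
  have "smooth (\<lambda>y. 1 * \<eta> (x - y))"
  proof (rule smooth_coinduct[where P = "\<lambda>f. \<exists>c \<eta>. smooth \<eta> \<and> f = (\<lambda>y. c * \<eta> (x - y))"])
    show "\<exists>c \<eta>'. smooth \<eta>' \<and> partial i g = (\<lambda>y. c * \<eta>' (x - y))" if g: "\<exists>c \<eta>. smooth \<eta> \<and> g = (\<lambda>y. c * \<eta> (x - y))" for g i
    proof -
      obtain c \<eta> where g: "smooth \<eta>" "g = (\<lambda>y. c * \<eta> (x - y))" using g by blast
      have "partial i g = (\<lambda>y. - c * partial i \<eta> (x - y))" unfolding g(2) by (intro ext p g)
      then show ?thesis using smooth_partial[OF g(1)] by blast
    qed
    show "g differentiable at y" if "\<exists>c \<eta>. smooth \<eta> \<and> g = (\<lambda>y. c * \<eta> (x - y))" for g y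
      using that d unfolding differentiable_def by blast
  qed (use test_smooth[OF \<eta>] in blast)
  then show "(\<lambda>y. \<eta> (x - y)) \<in> test_functions \<Omega>"
  proof (intro test_functionsI[of _ "(\<lambda>y. x - y) ` L"])
    show "compact ((\<lambda>y. x - y) ` L)" by (intro compact_continuous_image continuous_intros supp)
    show "(\<lambda>y. x - y) ` L \<subseteq> \<Omega>" using supp by auto
    show "\<eta> (x - y) = 0" if "y \<notin> (\<lambda>y. x - y) ` L" for y
      using that supp(1)[of "x - y"] by (metis diff_diff_eq2 add_diff_cancel_left' image_eqI)
  qed simp
qed

section \<open>Mollification\<close>

lemma lborel_distr_reflect: "distr lborel borel (\<lambda>y. x - y) = (lborel :: 'a::euclidean_space measure)"
  using lborel_affine[of "-1" x] by (simp add: density_1)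

lemma lborel_distr_shift: "distr lborel borel (\<lambda>y. y - h) = (lborel :: 'a::euclidean_space measure)"
proof -
  have "(\<lambda>y. y - h) = (+) (- h)" by auto
  then show ?thesis using lborel_distr_plus[of "- h"] by simp
qed

lemma L2_borel: "u \<in> L2 lborel \<Longrightarrow> u \<in> borel_measurable borel"
  using L2_measurable by fastforce

lemma L2_translate:
  assumes "u \<in> L2 lborel"
  shows "(\<lambda>x. u (x - h)) \<in> L2 (lborel :: 'a::euclidean_space measure)" "L2_norm lborel (\<lambda>x. u (x - h)) = L2_norm lborel u"
proof -
  have [measurable]: "u \<in> borel_measurable borel" using L2_borel[OF assms] .
  have "integrable (distr lborel borel (\<lambda>x. x - h)) (\<lambda>x. (norm (u x))\<^sup>2)"
    using L2_integrable[OF assms] by (simp add: lborel_distr_shift)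
  then have "integrable lborel (\<lambda>x. (norm (u (x - h)))\<^sup>2)" by (subst (asm) integrable_distr_eq) auto
  then show "(\<lambda>x. u (x - h)) \<in> L2 lborel" by (simp add: L2_def)
  have "(\<integral>x. (norm (u x))\<^sup>2 \<partial>lborel) = (\<integral>x. (norm (u x))\<^sup>2 \<partial>(distr lborel borel (\<lambda>x. x - h)))"
    by (simp add: lborel_distr_shift)
  also have "\<dots> = (\<integral>x. (norm (u (x - h)))\<^sup>2 \<partial>lborel)" by (rule integral_distr) auto
  finally show "L2_norm lborel (\<lambda>x. u (x - h)) = L2_norm lborel u" by (simp add: L2_norm_def)
qed

definition translation_continuous :: "(real ^ 3 \<Rightarrow> complex) \<Rightarrow> bool" where
  "translation_continuous u \<longleftrightarrow> u \<in> L2 lborel \<and> ((\<lambda>h. L2_norm lborel (\<lambda>x. u (x - h) - u x)) \<longlongrightarrow> 0) (at 0)"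

lemma translation_continuous_lin:
  assumes "translation_continuous u" "translation_continuous v"
  shows "translation_continuous (\<lambda>x. u x + c * v x)"
  unfolding translation_continuous_def
proof
  have uv: "u \<in> L2 lborel" "v \<in> L2 lborel" using assms by (auto simp: translation_continuous_def)
  then show "(\<lambda>x. u x + c * v x) \<in> L2 lborel" by (rule L2_lin)
  let ?N = "\<lambda>u h. L2_norm lborel (\<lambda>x. u (x - h) - u x :: complex)"
  show "((\<lambda>h. ?N (\<lambda>x. u x + c * v x) h) \<longlongrightarrow> 0) (at 0)"
  proof (rule Lim_null_comparison)
    show "\<forall>\<^sub>F h in at 0. norm (?N (\<lambda>x. u x + c * v x) h) \<le> ?N u h + cmod c * ?N v h"
    proof (intro always_eventually allI)
      fix h
      have "?N (\<lambda>x. u x + c * v x) h = L2_norm lborel (\<lambda>x. (u (x - h) - u x) + c * (v (x - h) - v x))"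
        by (simp add: algebra_simps)
      also have "\<dots> \<le> ?N u h + L2_norm lborel (\<lambda>x. c * (v (x - h) - v x))"
        by (intro L2_norm_triangle L2_cmult L2_diff L2_translate uv)
      finally show "norm (?N (\<lambda>x. u x + c * v x) h) \<le> ?N u h + cmod c * ?N v h" by (simp add: L2_norm_cmult)
    qed
    have "((\<lambda>h. ?N u h + cmod c * ?N v h) \<longlongrightarrow> 0 + cmod c * 0) (at 0)"
      using assms unfolding translation_continuous_def by (intro tendsto_intros) auto
    then show "((\<lambda>h. ?N u h + cmod c * ?N v h) \<longlongrightarrow> 0) (at 0)" by simp
  qed
qed

lemma translation_continuous_limit:
  assumes u: "u \<in> L2 lborel" and approx: "\<And>e. e > 0 \<Longrightarrow> \<exists>v. translation_continuous v \<and> L2_norm lborel (\<lambda>x. u x - v x) < e"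
  shows "translation_continuous u"
  unfolding translation_continuous_def
proof (intro conjI u, rule tendstoI)
  let ?N = "\<lambda>u h. L2_norm lborel (\<lambda>x. u (x - h) - u x :: complex)"
  fix e :: real assume "e > 0"
  then obtain v where v: "translation_continuous v" "L2_norm lborel (\<lambda>x. u x - v x) < e / 3" using approx[of "e / 3"] by auto
  have vL: "v \<in> L2 lborel" using v by (simp add: translation_continuous_def)
  have "\<forall>\<^sub>F h in at 0. dist (?N v h) 0 < e / 3"
    using v(1) \<open>e > 0\<close> unfolding translation_continuous_def by (intro tendstoD) auto
  then show "\<forall>\<^sub>F h in at 0. dist (?N u h) 0 < e"
  proof eventually_elim
    case (elim h)
    have uvh: "L2_norm lborel (\<lambda>x. u (x - h) - v (x - h)) = L2_norm lborel (\<lambda>x. u x - v x)"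
      using L2_translate(2)[OF L2_diff[OF u vL], of h] by simp
    have "?N u h \<le> L2_norm lborel (\<lambda>x. u (x - h) - v (x - h)) + L2_norm lborel (\<lambda>x. v (x - h) - u x)"
      by (intro L2_norm_triangle3 L2_translate u vL)
    also have "L2_norm lborel (\<lambda>x. v (x - h) - u x) \<le> ?N v h + L2_norm lborel (\<lambda>x. v x - u x)"
      by (intro L2_norm_triangle3 L2_translate u vL)
    finally show ?case using elim v(2) uvh L2_norm_minus_commute[of lborel u v] by simp
  qed
qed

lemma indicator_L2:
  assumes "A \<in> sets lborel" "emeasure lborel A < \<infinity>"
  shows "(\<lambda>x. of_real (indicat_real A x) :: complex) \<in> L2 lborel"
  by (rule L2I[of _ _ "indicat_real A"]) (use assms in \<open>auto simp: indicator_def\<close>)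

lemma translation_continuous_open:
  assumes U: "open U" "emeasure lborel U < \<infinity>"
  shows "translation_continuous (\<lambda>x. of_real (indicat_real U x))"
  unfolding translation_continuous_def
proof (intro conjI indicator_L2)
  have [measurable]: "U \<in> sets borel" using U by simp
  have intU: "integrable lborel (indicat_real U)" using U by simp
  define d where "d h x = indicat_real U x * (1 - indicat_real U (x - h))" for h x
  have [measurable]: "d h \<in> borel_measurable borel" for h unfolding d_def[abs_def] by measurable
  have part: "(\<lambda>n. \<integral>x. d (H n) x \<partial>lborel) \<longlonglongrightarrow> 0" if "H \<longlonglongrightarrow> 0" for H
  proof -
    have "(\<lambda>n. \<integral>x. d (H n) x \<partial>lborel) \<longlonglongrightarrow> (\<integral>x. 0 \<partial>(lborel :: (real ^ 3) measure))"
    proof (rule integral_dominated_convergence[OF _ _ intU])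
      show "AE x in lborel. (\<lambda>n. d (H n) x) \<longlonglongrightarrow> 0"
      proof (rule AE_I2)
        fix x
        show "(\<lambda>n. d (H n) x) \<longlonglongrightarrow> 0"
        proof (cases "x \<in> U")
          case True
          have "(\<lambda>n. x - H n) \<longlonglongrightarrow> x - 0" by (intro tendsto_intros that)
          then have "\<forall>\<^sub>F n in sequentially. x - H n \<in> U" using topological_tendstoD U(1) True by fastforce
          then have "\<forall>\<^sub>F n in sequentially. d (H n) x = 0" by eventually_elim (simp add: d_def)
          then show ?thesis by (rule tendsto_eventually)
        qed (simp add: d_def)
      qed
    qed (auto simp: d_def indicator_def)
    then show ?thesis by simp
  qed
  have int_d: "integrable lborel (d h)" for h
    by (rule Bochner_Integration.integrable_bound[OF intU]) (auto, auto simp: d_def indicator_def)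
  show "((\<lambda>h. L2_norm lborel (\<lambda>x. complex_of_real (indicat_real U (x - h)) - of_real (indicat_real U x))) \<longlongrightarrow> 0) (at 0)"
    unfolding tendsto_at_iff_sequentially
  proof (intro allI impI)
    fix H :: "nat \<Rightarrow> real ^ 3" assume H: "H \<longlonglongrightarrow> 0"
    have sq: "(L2_norm lborel (\<lambda>x. complex_of_real (indicat_real U (x - h)) - of_real (indicat_real U x)))\<^sup>2
      = (\<integral>x. d h x \<partial>lborel) + (\<integral>x. d (- h) x \<partial>lborel)" for h
    proof -
      have "(\<integral>x. d (- h) x \<partial>lborel) = (\<integral>x. d (- h) x \<partial>(distr lborel borel (\<lambda>x. x - h)))"
        by (simp add: lborel_distr_shift)
      also have "\<dots> = (\<integral>x. d (- h) (x - h) \<partial>lborel)" by (rule integral_distr) auto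
      finally have shift: "(\<integral>x. d (- h) x \<partial>lborel) = (\<integral>x. d (- h) (x - h) \<partial>lborel)" .
      have "integrable (distr lborel borel (\<lambda>x. x - h)) (d (- h))" using int_d by (simp add: lborel_distr_shift)
      then have i: "integrable lborel (\<lambda>x. d (- h) (x - h))" by (subst (asm) integrable_distr_eq) auto
      have "(L2_norm lborel (\<lambda>x. complex_of_real (indicat_real U (x - h)) - of_real (indicat_real U x)))\<^sup>2
        = (\<integral>x. d h x + d (- h) (x - h) \<partial>lborel)"
        unfolding L2_norm_sq by (intro Bochner_Integration.integral_cong refl) (auto simp: d_def indicator_def)
      then show ?thesis using int_d i shift by simp
    qed
    have "(\<lambda>n. - H n) \<longlonglongrightarrow> - 0" by (intro tendsto_intros H)
    then have "(\<lambda>n. (\<integral>x. d (H n) x \<partial>lborel) + (\<integral>x. d (- H n) x \<partial>lborel)) \<longlonglongrightarrow> 0 + 0"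
      by (intro tendsto_add part H) simp
    then have "(\<lambda>n. sqrt ((L2_norm lborel (\<lambda>x. complex_of_real (indicat_real U (x - H n)) - of_real (indicat_real U x)))\<^sup>2)) \<longlonglongrightarrow> sqrt 0"
      unfolding sq by (intro tendsto_real_sqrt) simp
    then show "((\<lambda>h. L2_norm lborel (\<lambda>x. complex_of_real (indicat_real U (x - h)) - of_real (indicat_real U x))) \<circ> H) \<longlonglongrightarrow> 0"
      by (simp add: o_def)
  qed
qed (use U in auto)

lemma translation_continuous_indicator:
  assumes A: "A \<in> sets lborel" "emeasure lborel A < \<infinity>"
  shows "translation_continuous (\<lambda>x. of_real (indicat_real A x))"
proof (rule translation_continuous_limit[OF indicator_L2[OF A]])
  fix e :: real assume "e > 0"
  have "A \<in> sets lebesgue" using A by simp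
  then obtain U where U: "open U" "A \<subseteq> U" "U - A \<in> lmeasurable" "emeasure lebesgue (U - A) < ennreal (e\<^sup>2)"
    using sets_lebesgue_outer_open[of A "e\<^sup>2"] \<open>e > 0\<close> by auto
  have [measurable]: "A \<in> sets borel" "U \<in> sets borel" using A U by auto
  have UA: "emeasure lborel (U - A) < ennreal (e\<^sup>2)" using U(4) by simp
  have "emeasure lborel U = emeasure lborel (A \<union> (U - A))" using U(2) by (simp add: Un_absorb1)
  also have "\<dots> \<le> emeasure lborel A + emeasure lborel (U - A)" by (rule emeasure_subadditive) auto
  also have "\<dots> < \<infinity>" using A(2) UA by (metis ennreal_add_less_top infinity_ennreal_def ennreal_less_top order_less_trans)
  finally have fin: "emeasure lborel U < \<infinity>" .
  have "(L2_norm lborel (\<lambda>x. complex_of_real (indicat_real A x) - of_real (indicat_real U x)))\<^sup>2 = (\<integral>x. indicat_real (U - A) x \<partial>lborel)"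
    unfolding L2_norm_sq using U(2) by (intro Bochner_Integration.integral_cong refl) (auto simp: indicator_def)
  also have "\<dots> = measure lborel (U - A)" by simp
  also have "\<dots> < e\<^sup>2"
    using UA by (metis emeasure_eq_ennreal_measure ennreal_less_iff measure_nonneg order_less_imp_not_less top.not_eq_extremum ennreal_less_top order_less_trans less_irrefl)
  finally have "L2_norm lborel (\<lambda>x. complex_of_real (indicat_real A x) - of_real (indicat_real U x)) < e"
    using \<open>e > 0\<close> by (auto intro: power2_less_imp_less)
  then show "\<exists>v. translation_continuous v \<and> L2_norm lborel (\<lambda>x. complex_of_real (indicat_real A x) - v x) < e"
    using translation_continuous_open[OF U(1) fin] by blast
qed

lemma translation_continuous_L2:
  assumes u: "u \<in> L2 lborel"
  shows "translation_continuous u"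
proof (rule translation_continuous_limit[OF u])
  fix e :: real assume "e > 0"
  have [measurable]: "u \<in> borel_measurable borel" using L2_borel[OF u] .
  obtain s where s: "\<And>i. simple_function lborel (s i)" "\<And>x. (\<lambda>i. s i x) \<longlonglongrightarrow> u x" "\<And>i x. cmod (s i x) \<le> 2 * cmod (u x)"
    using borel_measurable_implies_sequence_metric[OF L2_measurable[OF u], of 0] by auto
  have [measurable]: "s i \<in> borel_measurable borel" for i using borel_measurable_simple_function[OF s(1)] by simp
  have sL: "s i \<in> L2 lborel" for i
  proof (rule L2I)
    show "integrable lborel (\<lambda>x. 4 * (cmod (u x))\<^sup>2)" using L2_integrable[OF u] by simp
    show "(cmod (s i x))\<^sup>2 \<le> 4 * (cmod (u x))\<^sup>2" for x
      using power_mono[OF s(3)[of i x], of 2] by (simp add: power_mult_distrib)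
  qed simp
  have "(\<lambda>i. \<integral>x. (cmod (u x - s i x))\<^sup>2 \<partial>lborel) \<longlonglongrightarrow> (\<integral>x. 0 \<partial>(lborel :: (real ^ 3) measure))"
  proof (rule integral_dominated_convergence)
    show "integrable lborel (\<lambda>x. 9 * (cmod (u x))\<^sup>2)" using L2_integrable[OF u] by simp
    show "AE x in lborel. (\<lambda>i. (cmod (u x - s i x))\<^sup>2) \<longlonglongrightarrow> 0"
    proof (rule AE_I2)
      fix x
      have "(\<lambda>i. (cmod (u x - s i x))\<^sup>2) \<longlonglongrightarrow> (cmod (u x - u x))\<^sup>2" by (intro tendsto_intros s)
      then show "(\<lambda>i. (cmod (u x - s i x))\<^sup>2) \<longlonglongrightarrow> 0" by simp
    qed
    show "AE x in lborel. norm ((cmod (u x - s i x))\<^sup>2) \<le> 9 * (cmod (u x))\<^sup>2" for i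
    proof (rule AE_I2)
      fix x
      have "cmod (u x - s i x) \<le> 3 * cmod (u x)" using norm_triangle_ineq4[of "u x" "s i x"] s(3)[of i x] by simp
      then have "(cmod (u x - s i x))\<^sup>2 \<le> (3 * cmod (u x))\<^sup>2" by (intro power_mono) auto
      then show "norm ((cmod (u x - s i x))\<^sup>2) \<le> 9 * (cmod (u x))\<^sup>2" by (simp add: power_mult_distrib)
    qed
  qed auto
  then have "(\<lambda>i. (L2_norm lborel (\<lambda>x. u x - s i x))\<^sup>2) \<longlonglongrightarrow> 0" by (simp add: L2_norm_sq)
  then have "\<forall>\<^sub>F i in sequentially. (L2_norm lborel (\<lambda>x. u x - s i x))\<^sup>2 < e\<^sup>2"
    by (rule order_tendstoD(2)) (use \<open>e > 0\<close> in simp)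
  then obtain i where i: "(L2_norm lborel (\<lambda>x. u x - s i x))\<^sup>2 < e\<^sup>2"
    using eventually_happens'[OF sequentially_bot] by blast
  have rep: "s i x = (\<Sum>y\<in>s i ` UNIV - {0}. y * of_real (indicat_real (s i -` {y}) x))" for x
  proof -
    have fin: "finite (s i ` UNIV - {0})" using simple_functionD(1)[OF s(1)[of i]] by simp
    have "(\<Sum>y\<in>s i ` UNIV - {0}. y * of_real (indicat_real (s i -` {y}) x)) = (\<Sum>y\<in>s i ` UNIV - {0}. if y = s i x then y else 0)"
      by (intro sum.cong) (auto simp: indicator_def)
    also have "\<dots> = s i x" using fin by simp
    finally show ?thesis by simp
  qed
  have tc: "translation_continuous (\<lambda>x. \<Sum>y\<in>Y. y * of_real (indicat_real (s i -` {y}) x))" if "finite Y" "0 \<notin> Y" for Y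
    using that
  proof (induction Y rule: finite_induct)
    case empty
    show ?case by (simp add: translation_continuous_def L2_norm_def)
  next
    case (insert y Y)
    have A: "s i -` {y} \<in> sets lborel" using measurable_sets[of "s i" borel borel "{y}"] by simp
    have "emeasure lborel (s i -` {y}) < \<infinity>"
    proof -
      have y0: "(cmod y)\<^sup>2 > 0" using insert.prems by auto
      have "integrable lborel (\<lambda>x. (cmod y)\<^sup>2 * indicat_real (s i -` {y}) x)"
        by (rule Bochner_Integration.integrable_bound[OF L2_integrable[OF sL[of i]]]) (use A in \<open>auto simp: indicator_def\<close>)
      then have "integrable lborel (indicat_real (s i -` {y}))" using y0 by simp
      then show ?thesis using A by (simp add: integrable_indicator_iff)
    qed
    then have "translation_continuous (\<lambda>x. of_real (indicat_real (s i -` {y}) x))" by (rule translation_continuous_indicator[OF A])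
    from translation_continuous_lin[OF insert.IH this, of y] show ?case using insert by (simp add: add.commute)
  qed
  have "(\<lambda>x. \<Sum>y\<in>s i ` UNIV - {0}. y * of_real (indicat_real (s i -` {y}) x)) = s i" by (rule ext) (rule rep[symmetric])
  moreover have "finite (s i ` UNIV - {0})" using simple_functionD(1)[OF s(1)[of i]] by simp
  ultimately have "translation_continuous (s i)" using tc[of "s i ` UNIV - {0}"] by simp
  moreover have "L2_norm lborel (\<lambda>x. u x - s i x) < e" using i \<open>e > 0\<close> by (auto intro: power2_less_imp_less)
  ultimately show "\<exists>v. translation_continuous v \<and> L2_norm lborel (\<lambda>x. u x - v x) < e" by blast
qed

text \<open>Jensen's inequality for the averages with the probability density \<open>\<eta>\<close>, followed by Tonelli.\<close>

lemma conv_approx: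
  assumes \<eta>: "\<And>y. \<eta> y \<ge> 0" "integrable lborel \<eta>" "(\<integral>y. \<eta> y \<partial>lborel) = 1"
    "(\<lambda>y. of_real (\<eta> y)) \<in> test_functions UNIV"
    and u: "u \<in> L2 lborel" and e: "e \<ge> 0"
    and close: "\<And>y. \<eta> y \<noteq> 0 \<Longrightarrow> L2_norm lborel (\<lambda>x. u (x - y) - u x) \<le> e"
  shows "(\<lambda>x. conv (\<lambda>y. of_real (\<eta> y)) u x - u x) \<in> L2 lborel \<and> L2_norm lborel (\<lambda>x. conv (\<lambda>y. of_real (\<eta> y)) u x - u x) \<le> e"
proof (rule L2_nn_bound)
  have [measurable]: "u \<in> borel_measurable borel" using L2_borel[OF u] .
  have [measurable]: "\<eta> \<in> borel_measurable borel" using borel_measurable_integrable[OF \<eta>(2)] by simp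
  have "conv (\<lambda>y. of_real (\<eta> y)) u \<in> borel_measurable borel"
    by (intro borel_measurable_continuous_onI smooth_continuous smooth_conv \<eta> u)
  then show "(\<lambda>x. conv (\<lambda>y. of_real (\<eta> y)) u x - u x) \<in> borel_measurable lborel" by simp
  have nn1: "(\<integral>\<^sup>+y. ennreal (\<eta> y) \<partial>lborel) = 1"
    using nn_integral_eq_integral[OF \<eta>(2)] \<eta>(1,3) by simp
  have pointwise: "ennreal ((cmod (conv (\<lambda>y. of_real (\<eta> y)) u x - u x))\<^sup>2)
      \<le> (\<integral>\<^sup>+y. ennreal (\<eta> y) * ennreal ((cmod (u (x - y) - u x))\<^sup>2) \<partial>lborel)" for x
  proof -
    let ?f = "\<lambda>y. u (x - y) - u x"
    have i1: "integrable lborel (\<lambda>y. of_real (\<eta> (x - y)) * u y)" by (rule test_mult_integrable[OF \<eta>(4) u])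
    have "integrable (distr lborel borel (\<lambda>y. x - y)) (\<lambda>y. of_real (\<eta> (x - y)) * u y)"
      using i1 by (simp add: lborel_distr_reflect)
    then have i2: "integrable lborel (\<lambda>y. of_real (\<eta> y) * u (x - y))" by (subst (asm) integrable_distr_eq) auto
    have "conv (\<lambda>y. of_real (\<eta> y)) u x = (\<integral>y. of_real (\<eta> (x - y)) * u y \<partial>(distr lborel borel (\<lambda>y. x - y)))"
      by (simp add: conv_def lborel_distr_reflect)
    also have "\<dots> = (\<integral>y. of_real (\<eta> y) * u (x - y) \<partial>lborel)" by (subst integral_distr) auto
    finally have "conv (\<lambda>y. of_real (\<eta> y)) u x = (\<integral>y. of_real (\<eta> y) * u (x - y) \<partial>lborel)" .
    moreover have "u x = (\<integral>y. of_real (\<eta> y) * u x \<partial>lborel)" using \<eta>(3) by (simp add: integral_complex_of_real)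
    moreover have i3: "integrable lborel (\<lambda>y. of_real (\<eta> y) * u x)" using \<eta>(2) by simp
    ultimately have "conv (\<lambda>y. of_real (\<eta> y)) u x - u x = (\<integral>y. of_real (\<eta> y) * u (x - y) - of_real (\<eta> y) * u x \<partial>lborel)"
      using Bochner_Integration.integral_diff[OF i2 i3] by simp
    then have eq: "conv (\<lambda>y. of_real (\<eta> y)) u x - u x = (\<integral>y. of_real (\<eta> y) * ?f y \<partial>lborel)" by (simp add: algebra_simps)
    have "integrable lborel (\<lambda>y. of_real (\<eta> y) * ?f y)" using Bochner_Integration.integrable_diff[OF i2 i3] by (simp add: algebra_simps)
    then have "ennreal (cmod (conv (\<lambda>y. of_real (\<eta> y)) u x - u x)) \<le> (\<integral>\<^sup>+y. ennreal (cmod (of_real (\<eta> y) * ?f y)) \<partial>lborel)"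
      unfolding eq by (rule integral_norm_bound_ennreal)
    also have "\<dots> = (\<integral>\<^sup>+y. ennreal (sqrt (\<eta> y)) * ennreal (sqrt (\<eta> y) * cmod (?f y)) \<partial>lborel)"
      using \<eta>(1) by (intro nn_integral_cong) (simp add: norm_mult mult.assoc[symmetric] flip: ennreal_mult)
    finally have "ennreal (cmod (conv (\<lambda>y. of_real (\<eta> y)) u x - u x)) ^ 2 \<le> \<dots> ^ 2" by (rule power_mono) simp
    also have "\<dots> \<le> (\<integral>\<^sup>+y. ennreal (sqrt (\<eta> y)) ^ 2 \<partial>lborel) * (\<integral>\<^sup>+y. ennreal (sqrt (\<eta> y) * cmod (?f y)) ^ 2 \<partial>lborel)"
      by (rule Cauchy_Schwarz_nn_integral) auto
    also have "(\<integral>\<^sup>+y. ennreal (sqrt (\<eta> y)) ^ 2 \<partial>lborel) = 1"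
      using nn1 \<eta>(1) by (simp add: ennreal_power)
    also have "(\<integral>\<^sup>+y. ennreal (sqrt (\<eta> y) * cmod (?f y)) ^ 2 \<partial>lborel) = (\<integral>\<^sup>+y. ennreal (\<eta> y) * ennreal ((cmod (?f y))\<^sup>2) \<partial>lborel)"
      using \<eta>(1) by (intro nn_integral_cong) (simp add: ennreal_power power_mult_distrib flip: ennreal_mult)
    finally show ?thesis by (simp add: ennreal_power)
  qed
  have "(\<integral>\<^sup>+x. ennreal ((cmod (conv (\<lambda>y. of_real (\<eta> y)) u x - u x))\<^sup>2) \<partial>lborel)
      \<le> (\<integral>\<^sup>+x. (\<integral>\<^sup>+y. ennreal (\<eta> y) * ennreal ((cmod (u (x - y) - u x))\<^sup>2) \<partial>lborel) \<partial>lborel)"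
    by (intro nn_integral_mono pointwise)
  also have "\<dots> = (\<integral>\<^sup>+y. (\<integral>\<^sup>+x. ennreal (\<eta> y) * ennreal ((cmod (u (x - y) - u x))\<^sup>2) \<partial>lborel) \<partial>lborel)"
    by (rule lborel_pair.Fubini') measurable
  also have "\<dots> \<le> (\<integral>\<^sup>+y. ennreal (\<eta> y) * ennreal (e\<^sup>2) \<partial>lborel)"
  proof (rule nn_integral_mono)
    fix y
    have "(\<integral>\<^sup>+x. ennreal (\<eta> y) * ennreal ((cmod (u (x - y) - u x))\<^sup>2) \<partial>lborel)
      = ennreal (\<eta> y) * ennreal ((L2_norm lborel (\<lambda>x. u (x - y) - u x))\<^sup>2)"
      by (subst nn_integral_cmult) (auto simp: L2_nn_integral[OF L2_diff[OF L2_translate(1)[OF u] u]])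
    also have "\<dots> \<le> ennreal (\<eta> y) * ennreal (e\<^sup>2)"
      using close[of y] by (cases "\<eta> y = 0") (auto intro!: mult_left_mono ennreal_leI power_mono)
    finally show "(\<integral>\<^sup>+x. ennreal (\<eta> y) * ennreal ((cmod (u (x - y) - u x))\<^sup>2) \<partial>lborel) \<le> ennreal (\<eta> y) * ennreal (e\<^sup>2)" .
  qed
  also have "\<dots> = ennreal (e\<^sup>2)" by (subst nn_integral_multc) (auto simp: nn1)
  finally show "(\<integral>\<^sup>+x. ennreal ((cmod (conv (\<lambda>y. of_real (\<eta> y)) u x - u x))\<^sup>2) \<partial>lborel) \<le> ennreal (e\<^sup>2)" .
qed (rule e)

subsection \<open>Kernels adapted to a domain\<close>

text \<open>A kernel supported in boxes that move points of \<open>\<Omega>\<close> into \<open>\<Omega>\<close>: mollification with it evaluates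
  a function on \<open>\<Omega>\<close> only, which replaces an extension across the boundary. For the two domains
  bounded by a graph such boxes lie on the vertical axis.\<close>

definition shift_kernel :: "(real ^ 3) set \<Rightarrow> real \<Rightarrow> (real ^ 3 \<Rightarrow> real) \<Rightarrow> bool" where
  "shift_kernel \<Omega> r \<eta> \<longleftrightarrow> (\<forall>y. \<eta> y \<ge> 0) \<and> integrable lborel \<eta> \<and> (\<integral>y. \<eta> y \<partial>lborel) = 1
    \<and> (\<lambda>y. of_real (\<eta> y)) \<in> test_functions UNIV
    \<and> (\<exists>L. compact L \<and> L \<subseteq> ball 0 r \<and> (\<forall>y. y \<notin> L \<longrightarrow> \<eta> y = 0) \<and> (\<forall>x\<in>\<Omega>. \<forall>y\<in>L. x - y \<in> \<Omega>))"

lemma shift_kernel_box: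
  assumes ab: "box a b \<noteq> {}" and L: "cbox a b \<subseteq> ball 0 r" "\<And>x y. x \<in> \<Omega> \<Longrightarrow> y \<in> cbox a b \<Longrightarrow> x - y \<in> \<Omega>"
  shows "\<exists>\<eta>. shift_kernel \<Omega> r \<eta>"
proof -
  let ?\<beta> = "box_bump a b"
  have out: "?\<beta> x = 0" if "x \<notin> cbox a b" for x
    using that box_bump_pos_iff[of a b x] box_bump_nonneg[of a b x] box_subset_cbox[of a b] by (auto simp: less_le)
  have int: "integrable lborel ?\<beta>"
  proof (rule Bochner_Integration.integrable_bound)
    show "integrable lborel (indicat_real (cbox a b))" by (intro integrable_real_indicator emeasure_compact_finite) auto
    show "AE x in lborel. norm (?\<beta> x) \<le> norm (indicat_real (cbox a b) x)"
      using out box_bump_le_1 box_bump_nonneg by (intro AE_I2) (auto simp: indicator_def)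
  qed simp
  define c where "c = (\<integral>x. ?\<beta> x \<partial>lborel)"
  have "c \<noteq> 0"
  proof
    assume "c = 0"
    then have "AE x in lborel. ?\<beta> x = 0"
      using integral_nonneg_eq_0_iff_AE[OF int] box_bump_nonneg by (simp add: c_def)
    then have "AE x in lborel. x \<notin> box a b"
      by eventually_elim (use box_bump_pos_iff[of a b] in \<open>metis less_irrefl\<close>)
    then have "box a b \<in> null_sets lborel" using AE_iff_null_sets[where N = "box a b" and M = lborel] by simp
    then show False using ab open_not_negligible[OF open_box] by (metis negligible_iff_null_sets null_sets_completionI)
  qed
  then have c: "c > 0" using Bochner_Integration.integral_nonneg[of lborel ?\<beta>] box_bump_nonneg by (auto simp: c_def less_le)
  have "shift_kernel \<Omega> r (\<lambda>x. ?\<beta> x / c)"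
    unfolding shift_kernel_def
  proof (intro conjI allI exI[of _ "cbox a b"] impI ballI)
    show "(\<lambda>y. complex_of_real (?\<beta> y / c)) \<in> test_functions UNIV"
      using test_mult_smooth[OF box_bump_test[of a b UNIV] smooth_const[of "of_real (1 / c)"]] by simp
  qed (use c int out L in \<open>auto simp: box_bump_nonneg c_def[symmetric]\<close>)
  then show ?thesis by blast
qed

section \<open>Weak gradients\<close>

definition ext0 :: "(real ^ 3) set \<Rightarrow> (real ^ 3 \<Rightarrow> 'b::zero) \<Rightarrow> real ^ 3 \<Rightarrow> 'b" where
  "ext0 \<Omega> f x = (if x \<in> \<Omega> then f x else 0)"

lemma ext0_indicator: "(\<lambda>x. indicator \<Omega> x *\<^sub>R f x) = ext0 \<Omega> (f :: _ \<Rightarrow> 'b::real_vector)"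
  by (auto simp: ext0_def indicator_def)

lemma leb_integral:
  fixes f :: "real ^ 3 \<Rightarrow> 'b::{banach, second_countable_topology}"
  assumes "\<Omega> \<in> sets borel"
  shows "(\<integral>x. f x \<partial>leb \<Omega>) = (\<integral>x. ext0 \<Omega> f x \<partial>lborel)"
  using integral_restrict_space[of \<Omega> lborel f] assms by (simp add: ext0_indicator[symmetric])

lemma leb_integrable:
  fixes f :: "real ^ 3 \<Rightarrow> 'b::{banach, second_countable_topology}"
  assumes "\<Omega> \<in> sets borel"
  shows "integrable (leb \<Omega>) f \<longleftrightarrow> integrable lborel (ext0 \<Omega> f)"
  using integrable_restrict_space[of \<Omega> lborel f] assms by (simp add: ext0_indicator)

lemma leb_measurable:
  fixes f :: "real ^ 3 \<Rightarrow> 'b::real_normed_vector"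
  assumes "\<Omega> \<in> sets borel"
  shows "f \<in> borel_measurable (leb \<Omega>) \<longleftrightarrow> ext0 \<Omega> f \<in> borel_measurable borel"
  using borel_measurable_restrict_space_iff[of \<Omega> lborel f] assms by (simp add: ext0_indicator)

lemma ext0_norm: "(norm (ext0 \<Omega> f x))\<^sup>2 = ext0 \<Omega> (\<lambda>x. (norm (f x))\<^sup>2) x"
  by (simp add: ext0_def)

lemma leb_L2:
  fixes f :: "real ^ 3 \<Rightarrow> 'b::{real_normed_vector, second_countable_topology}"
  assumes "\<Omega> \<in> sets borel"
  shows "f \<in> L2 (leb \<Omega>) \<longleftrightarrow> ext0 \<Omega> f \<in> L2 lborel"
  unfolding L2_def using leb_measurable[OF assms, of f] leb_integrable[OF assms, of "\<lambda>x. (norm (f x))\<^sup>2"]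
  by (simp add: ext0_norm)

lemma leb_L2_norm:
  fixes f :: "real ^ 3 \<Rightarrow> 'b::real_normed_vector"
  assumes "\<Omega> \<in> sets borel"
  shows "L2_norm (leb \<Omega>) f = L2_norm lborel (ext0 \<Omega> f)"
  unfolding L2_norm_def leb_integral[OF assms] by (simp add: ext0_norm)

lemma L2_leb_subset:
  fixes f :: "real ^ 3 \<Rightarrow> 'b::{real_normed_vector, second_countable_topology}"
  assumes "\<Omega> \<in> sets borel" "f \<in> L2 lborel"
  shows "f \<in> L2 (leb \<Omega>)" "L2_norm (leb \<Omega>) f \<le> L2_norm lborel f"
proof -
  have "f \<in> borel_measurable (leb \<Omega>)"
    using L2_measurable[OF assms(2)] by (intro measurable_restrict_space1) auto
  then have m: "ext0 \<Omega> f \<in> borel_measurable lborel" using leb_measurable[OF assms(1), of f] by simp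
  have "ext0 \<Omega> f \<in> L2 lborel" by (rule L2I[OF m L2_integrable[OF assms(2)]]) (simp add: ext0_def)
  then show "f \<in> L2 (leb \<Omega>)" using leb_L2[OF assms(1)] by blast
  show "L2_norm (leb \<Omega>) f \<le> L2_norm lborel f"
    unfolding leb_L2_norm[OF assms(1)] by (rule L2_norm_mono[OF assms(2) m]) (simp add: ext0_def)
qed

lemma leb_UNIV [simp]: "leb UNIV = lborel"
  by (rule measure_eqI) (auto simp: sets_restrict_space emeasure_restrict_space)

lemma leb_L2_norm_le:
  fixes f :: "real ^ 3 \<Rightarrow> 'b::{real_normed_vector, second_countable_topology}"
  assumes \<Omega>: "\<Omega> \<in> sets borel" and "f \<in> L2 (leb \<Omega>)" "g \<in> L2 lborel" "\<And>x. x \<in> \<Omega> \<Longrightarrow> f x = g x"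
  shows "L2_norm (leb \<Omega>) f \<le> L2_norm lborel g"
proof -
  have "ext0 \<Omega> f = ext0 \<Omega> g" using assms(4) by (auto simp: ext0_def)
  then have "L2_norm (leb \<Omega>) f = L2_norm (leb \<Omega>) g" by (simp add: leb_L2_norm[OF \<Omega>])
  then show ?thesis using L2_leb_subset(2)[OF \<Omega> assms(3)] by simp
qed

subsection \<open>Components of vector fields\<close>

lemma vec_nth_measurable [measurable]: "(\<lambda>v :: complex ^ 3. v $ i) \<in> borel_measurable borel"
  by (intro borel_measurable_continuous_onI continuous_intros)

lemma L2_component:
  fixes G :: "'a \<Rightarrow> complex ^ 3"
  assumes "G \<in> L2 M"
  shows "(\<lambda>x. G x $ i) \<in> L2 M"
proof (rule L2I[OF _ L2_integrable[OF assms]])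
  have "G \<in> borel_measurable M" using assms by auto
  then show "(\<lambda>x. G x $ i) \<in> borel_measurable M" by (rule measurable_compose[OF _ vec_nth_measurable])
  show "(norm (G x $ i))\<^sup>2 \<le> (norm (G x))\<^sup>2" for x by (intro power_mono Finite_Cartesian_Product.norm_nth_le) auto
qed

lemma L2_finite_sum_norm:
  fixes f :: "'i \<Rightarrow> 'a \<Rightarrow> complex"
  assumes "finite I" "\<And>i. i \<in> I \<Longrightarrow> f i \<in> L2 M"
  shows "(\<lambda>x. \<Sum>i\<in>I. norm (f i x)) \<in> L2 M \<and> L2_norm M (\<lambda>x. \<Sum>i\<in>I. norm (f i x)) \<le> (\<Sum>i\<in>I. L2_norm M (f i))"
  using assms
proof (induction I rule: finite_induct)
  case empty
  then show ?case by (simp add: L2_norm_def)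
next
  case (insert i I)
  have fi: "f i \<in> L2 M" using insert.prems by simp
  have n: "(\<lambda>x. norm (f i x)) \<in> L2 M"
    by (rule L2I[OF measurable_compose[OF L2_measurable[OF fi] borel_measurable_norm] L2_integrable[OF fi]]) simp
  have IH: "(\<lambda>x. \<Sum>i\<in>I. norm (f i x)) \<in> L2 M" "L2_norm M (\<lambda>x. \<Sum>i\<in>I. norm (f i x)) \<le> (\<Sum>i\<in>I. L2_norm M (f i))"
    using insert.IH insert.prems by blast+
  have "L2_norm M (\<lambda>x. norm (f i x)) = L2_norm M (f i)" by (simp add: L2_norm_def)
  then show ?case using L2_add[OF n IH(1)] L2_norm_triangle[OF n IH(1)] IH(2) unfolding sum.insert[OF insert.hyps] by simp
qed

lemma vec_measurable:
  fixes G :: "'a \<Rightarrow> complex ^ 3"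
  assumes "\<And>i. (\<lambda>x. G x $ i) \<in> borel_measurable M"
  shows "G \<in> borel_measurable M"
proof (rule iffD2[OF borel_measurable_euclidean_space], rule ballI)
  fix b :: "complex ^ 3" assume "b \<in> Basis"
  then obtain i c where "b = axis i c" by (auto simp: Basis_vec_def)
  then have "(\<lambda>x. G x \<bullet> b) = (\<lambda>x. (G x $ i) \<bullet> c)" by (simp add: inner_axis)
  moreover have c: "(\<lambda>z :: complex. z \<bullet> c) \<in> borel_measurable borel" by (intro borel_measurable_continuous_onI continuous_intros)
  ultimately show "(\<lambda>x. G x \<bullet> b) \<in> borel_measurable M" using measurable_compose[OF assms[of i] c] by simp
qed

lemma L2_vec:
  fixes G :: "'a \<Rightarrow> complex ^ 3"
  assumes "\<And>i. (\<lambda>x. G x $ i) \<in> L2 M"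
  shows "G \<in> L2 M" "L2_norm M G \<le> (\<Sum>i\<in>UNIV. L2_norm M (\<lambda>x. G x $ i))"
proof -
  have m: "G \<in> borel_measurable M" using assms by (intro vec_measurable L2_measurable) auto
  have S: "(\<lambda>x. \<Sum>i\<in>UNIV. norm (G x $ i)) \<in> L2 M"
    "L2_norm M (\<lambda>x. \<Sum>i\<in>UNIV. norm (G x $ i)) \<le> (\<Sum>i\<in>UNIV. L2_norm M (\<lambda>x. G x $ i))"
    using L2_finite_sum_norm[of UNIV "\<lambda>i x. G x $ i" M] assms by auto
  have le: "norm (G x) \<le> norm (\<Sum>i\<in>UNIV. norm (G x $ i))" for x
  proof -
    have "norm (G x) \<le> (\<Sum>i\<in>UNIV. norm (G x $ i))" unfolding norm_vec_def by (intro L2_set_le_sum) auto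
    also have "\<dots> = norm (\<Sum>i\<in>UNIV. norm (G x $ i))" by (simp add: sum_nonneg)
    finally show ?thesis .
  qed
  show "G \<in> L2 M" by (rule L2I[OF m L2_integrable[OF S(1)]]) (intro power_mono le norm_ge_zero)
  show "L2_norm M G \<le> (\<Sum>i\<in>UNIV. L2_norm M (\<lambda>x. G x $ i))"
    using L2_norm_mono[OF S(1) m le] S(2) by simp
qed

lemma L2_norm_vec_sq:
  fixes G :: "'a \<Rightarrow> complex ^ 3"
  assumes "G \<in> L2 M"
  shows "(L2_norm M G)\<^sup>2 = (\<Sum>i\<in>UNIV. (L2_norm M (\<lambda>x. G x $ i))\<^sup>2)"
proof -
  have "(L2_norm M G)\<^sup>2 = (\<integral>x. (\<Sum>i\<in>UNIV. (norm (G x $ i))\<^sup>2) \<partial>M)"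
    unfolding L2_norm_sq norm_vec_def L2_set_def by (simp add: sum_nonneg)
  then show ?thesis using L2_integrable[OF L2_component[OF assms]] by (simp add: L2_norm_sq)
qed

lemma ip3_components:
  assumes "F \<in> L2 M" "G \<in> L2 M"
  shows "ip3 M F G = (\<Sum>i\<in>UNIV. ip M (\<lambda>x. F x $ i) (\<lambda>x. G x $ i))"
  unfolding ip3_def ip_def using ip_integrable[OF L2_component[OF assms(1)] L2_component[OF assms(2)]]
  by (subst Bochner_Integration.integral_sum) auto

lemma grad_component [simp]: "grad f x $ i = partial i f x"
  by (simp add: grad_def)

lemma test_grad_L2: "\<phi> \<in> test_functions \<Omega> \<Longrightarrow> grad \<phi> \<in> L2 lborel"
  by (intro L2_vec) (auto intro: test_L2 test_partial)

subsection \<open>Density of test functions and uniqueness of the weak gradient\<close>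

definition shiftable :: "(real ^ 3) set \<Rightarrow> bool" where
  "shiftable \<Omega> \<longleftrightarrow> \<Omega> \<in> sets borel \<and> (\<forall>r>0. \<exists>\<eta>. shift_kernel \<Omega> r \<eta>)"

lemma shiftable_borel: "shiftable \<Omega> \<Longrightarrow> \<Omega> \<in> sets borel"
  by (simp add: shiftable_def)

lemma mollify_approx:
  assumes \<Omega>: "shiftable \<Omega>" and U: "finite U" "\<And>u. u \<in> U \<Longrightarrow> u \<in> L2 lborel" and e: "e > 0"
  shows "\<exists>r \<eta>. shift_kernel \<Omega> r \<eta> \<and> (\<forall>u\<in>U. (\<lambda>x. conv (\<lambda>y. of_real (\<eta> y)) u x - u x) \<in> L2 lborel
     \<and> L2_norm lborel (\<lambda>x. conv (\<lambda>y. of_real (\<eta> y)) u x - u x) \<le> e)"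
proof -
  have "\<forall>\<^sub>F h in at 0. \<forall>u\<in>U. dist (L2_norm lborel (\<lambda>x. u (x - h) - u x)) 0 < e"
    by (intro eventually_ball_finite U ballI tendstoD e) (simp add: translation_continuous_L2[OF U(2), unfolded translation_continuous_def])
  then obtain r where r: "r > 0" "\<And>h u. h \<noteq> 0 \<Longrightarrow> dist h 0 < r \<Longrightarrow> u \<in> U \<Longrightarrow> L2_norm lborel (\<lambda>x. u (x - h) - u x) < e"
    unfolding eventually_at by auto
  obtain \<eta> where \<eta>: "shift_kernel \<Omega> r \<eta>" using \<Omega> r(1) unfolding shiftable_def by blast
  have close: "L2_norm lborel (\<lambda>x. u (x - y) - u x) \<le> e" if "u \<in> U" "\<eta> y \<noteq> 0" for u y
  proof (cases "y = 0")
    case True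
    then show ?thesis using e by (simp add: L2_norm_def)
  next
    case False
    have "dist y 0 < r" using \<eta> that(2) unfolding shift_kernel_def by (metis dist_commute mem_ball subsetD)
    then show ?thesis using r(2)[OF False _ that(1)] by simp
  qed
  have "(\<lambda>x. conv (\<lambda>y. of_real (\<eta> y)) u x - u x) \<in> L2 lborel
     \<and> L2_norm lborel (\<lambda>x. conv (\<lambda>y. of_real (\<eta> y)) u x - u x) \<le> e" if "u \<in> U" for u
    by (rule conv_approx) (use \<eta> U(2) that e close in \<open>auto simp: shift_kernel_def\<close>)
  then show ?thesis using \<eta> by blast
qed

lemma is_weak_grad_conv:
  assumes \<Omega>: "\<Omega> \<in> sets borel" and \<eta>: "shift_kernel \<Omega> r \<eta>" and G: "is_weak_grad \<Omega> u G" and x: "x \<in> \<Omega>"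
  shows "conv (partial i (\<lambda>y. of_real (\<eta> y))) (ext0 \<Omega> u) x = conv (\<lambda>y. of_real (\<eta> y)) (ext0 \<Omega> (\<lambda>x. G x $ i)) x"
proof -
  let ?\<eta> = "\<lambda>y. complex_of_real (\<eta> y)"
  obtain L where L: "compact L" "\<And>y. y \<notin> L \<Longrightarrow> ?\<eta> y = 0" "\<And>y. y \<in> L \<Longrightarrow> x - y \<in> \<Omega>" and t: "?\<eta> \<in> test_functions UNIV"
    using \<eta> x unfolding shift_kernel_def by auto
  note refl = test_reflect[OF t L(2,1,3)]
  have "(\<integral>y. u y * partial i (\<lambda>y. ?\<eta> (x - y)) y \<partial>leb \<Omega>) = - (\<integral>y. G y $ i * ?\<eta> (x - y) \<partial>leb \<Omega>)"
    using G refl(1) unfolding is_weak_grad_def by blast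
  then have eq: "(\<integral>y. u y * partial i ?\<eta> (x - y) \<partial>leb \<Omega>) = (\<integral>y. G y $ i * ?\<eta> (x - y) \<partial>leb \<Omega>)"
    by (simp add: refl(2))
  have "conv (partial i ?\<eta>) (ext0 \<Omega> u) x = (\<integral>y. ext0 \<Omega> (\<lambda>y. u y * partial i ?\<eta> (x - y)) y \<partial>lborel)"
    unfolding conv_def by (intro Bochner_Integration.integral_cong HOL.refl) (simp add: ext0_def)
  also have "\<dots> = (\<integral>y. ext0 \<Omega> (\<lambda>y. G y $ i * ?\<eta> (x - y)) y \<partial>lborel)"
    using eq unfolding leb_integral[OF \<Omega>] .
  also have "\<dots> = conv ?\<eta> (ext0 \<Omega> (\<lambda>x. G x $ i)) x"
    unfolding conv_def by (intro Bochner_Integration.integral_cong HOL.refl) (simp add: ext0_def)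
  finally show ?thesis .
qed

lemma is_weak_grad_L2: "is_weak_grad \<Omega> u G \<Longrightarrow> G \<in> L2 (leb \<Omega>)"
  by (simp add: is_weak_grad_def)

theorem weak_grad_unique:
  assumes \<Omega>: "shiftable \<Omega>" and G: "is_weak_grad \<Omega> u G" "is_weak_grad \<Omega> u G'"
  shows "AE x in leb \<Omega>. G x = G' x"
proof -
  note B = shiftable_borel[OF \<Omega>]
  have "AE x in leb \<Omega>. G x $ i - G' x $ i = 0" for i
  proof -
    define g where "g = ext0 \<Omega> (\<lambda>x. G x $ i)"
    define g' where "g' = ext0 \<Omega> (\<lambda>x. G' x $ i)"
    have gL: "g \<in> L2 lborel" "g' \<in> L2 lborel"
      unfolding g_def g'_def using leb_L2[OF B] L2_component is_weak_grad_L2 G by blast+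
    define h where "h x = g x - g' x" for x
    have hL: "h \<in> L2 lborel" unfolding h_def[abs_def] by (intro L2_diff gL)
    have "L2_norm lborel h \<le> e" if "e > 0" for e
    proof -
      obtain r \<eta> where \<eta>: "shift_kernel \<Omega> r \<eta>" and a: "(\<lambda>x. conv (\<lambda>y. of_real (\<eta> y)) h x - h x) \<in> L2 lborel"
        "L2_norm lborel (\<lambda>x. conv (\<lambda>y. of_real (\<eta> y)) h x - h x) \<le> e"
        using mollify_approx[OF \<Omega>, of "{h}" e] hL \<open>e > 0\<close> by auto
      have t: "(\<lambda>y. complex_of_real (\<eta> y)) \<in> test_functions UNIV" using \<eta> unfolding shift_kernel_def by blast
      have "norm (h x) \<le> norm (conv (\<lambda>y. of_real (\<eta> y)) h x - h x)" for x
      proof (cases "x \<in> \<Omega>")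
        case True
        have "conv (\<lambda>y. of_real (\<eta> y)) h x = conv (\<lambda>y. of_real (\<eta> y)) g x - conv (\<lambda>y. of_real (\<eta> y)) g' x"
          using test_mult_integrable[OF t gL(1), of x] test_mult_integrable[OF t gL(2), of x]
          unfolding conv_def h_def by (simp add: algebra_simps)
        also have "\<dots> = 0" unfolding g_def g'_def is_weak_grad_conv[OF B \<eta> G(1) True, symmetric] is_weak_grad_conv[OF B \<eta> G(2) True, symmetric] by simp
        finally show ?thesis by simp
      qed (simp add: h_def g_def g'_def ext0_def)
      then show ?thesis using L2_norm_mono[OF a(1) L2_measurable[OF hL]] a(2) by fastforce
    qed
    then have "L2_norm lborel h = 0" by (metis L2_norm_nonneg antisym field_le_epsilon add_0)
    moreover have "ext0 \<Omega> (\<lambda>x. G x $ i - G' x $ i) = h" by (auto simp: ext0_def h_def g_def g'_def)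
    ultimately have "L2_norm (leb \<Omega>) (\<lambda>x. G x $ i - G' x $ i) = 0" by (simp add: leb_L2_norm[OF B])
    then show ?thesis
      using L2_norm_zero_iff[OF L2_diff[OF L2_component[OF is_weak_grad_L2[OF G(1)]] L2_component[OF is_weak_grad_L2[OF G(2)]]]] by blast
  qed
  then have "AE x in leb \<Omega>. \<forall>i\<in>UNIV. G x $ i - G' x $ i = 0" by (intro AE_finite_allI) auto
  then show ?thesis by eventually_elim (simp add: vec_eq_iff)
qed

lemma partial_scale:
  assumes "smooth f"
  shows "partial i (\<lambda>x. f (s *\<^sub>R x)) x = of_real s * partial i f (s *\<^sub>R x)"
proof -
  have "((\<lambda>x :: real ^ 3. s *\<^sub>R x) has_derivative (\<lambda>h. s *\<^sub>R h)) (at x)" by (auto intro!: derivative_eq_intros)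
  from has_derivative_compose[OF this smooth_has_derivative[OF assms]]
  have "partial i (\<lambda>x. f (s *\<^sub>R x)) x = (\<Sum>j\<in>UNIV. of_real ((s *\<^sub>R axis i 1 :: real ^ 3) $ j) * partial j f (s *\<^sub>R x))"
    by (rule partial_eq)
  also have "\<dots> = (\<Sum>j\<in>UNIV. if j = i then of_real s * partial j f (s *\<^sub>R x) else 0)"
    by (intro sum.cong) (auto simp: axis_def)
  finally show ?thesis by simp
qed

lemma cutoff_sequence:
  obtains \<zeta> :: "nat \<Rightarrow> real ^ 3 \<Rightarrow> complex" and B C :: real where
    "\<And>k. \<zeta> k \<in> test_functions UNIV" "\<And>k x. norm (\<zeta> k x) \<le> B" "\<And>x. (\<lambda>k. \<zeta> k x) \<longlonglongrightarrow> 1"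
    "\<And>k i x. norm (partial i (\<zeta> k) x) \<le> C / real (Suc k)" "B > 0" "C > 0"
proof -
  define a b :: "real ^ 3" where "a = (\<chi> i. - 1)" and "b = (\<chi> i. 1)"
  have pos: "box_bump a b 0 > 0" unfolding box_bump_pos_iff by (simp add: mem_box_cart a_def b_def)
  define f where "f x = complex_of_real (1 / box_bump a b 0) * of_real (box_bump a b x)" for x
  have f1: "f 0 = 1" using pos by (simp add: f_def)
  have ft: "f \<in> test_functions UNIV"
    unfolding f_def[abs_def] using test_mult_smooth[OF box_bump_test smooth_const, of a b UNIV "of_real (1 / box_bump a b 0)"]
    by (simp add: mult.commute)
  obtain B where B: "B > 0" "\<And>x. norm (f x) \<le> B" using ft by (rule test_bounded) blast
  have "\<forall>i. \<exists>B>0. \<forall>x. norm (partial i f x) \<le> B" using test_bounded[OF test_partial[OF ft]] by metis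
  then obtain C where C: "\<And>i. C i > 0" "\<And>i x. norm (partial i f x) \<le> C i" by metis
  have Ci: "norm (partial i f x) \<le> sum C UNIV" for i x
    using C(2)[of i x] member_le_sum[of i UNIV C] C(1) by (simp add: less_imp_le order_trans)
  define s where "s k = 1 / real (Suc k)" for k
  define \<zeta> where "\<zeta> k x = f (s k *\<^sub>R x)" for k x
  have sm: "smooth (\<zeta> k)" for k
    unfolding \<zeta>_def[abs_def] f_def by (intro smooth_mult smooth_const smooth_box_bump)
  obtain K where K: "compact K" "\<And>x. x \<notin> K \<Longrightarrow> f x = 0" using ft by (rule test_functionsE) blast
  show ?thesis
  proof (rule that[of \<zeta> B "sum C UNIV"])
    show "\<zeta> k \<in> test_functions UNIV" for k
    proof (rule test_functionsI[OF sm])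
      show "compact ((\<lambda>x. (1 / s k) *\<^sub>R x) ` K)" by (intro compact_continuous_image continuous_intros K)
      fix x assume "x \<notin> (\<lambda>x. (1 / s k) *\<^sub>R x) ` K"
      then have "s k *\<^sub>R x \<notin> K" by (auto simp: image_iff s_def dest!: bspec[where x = "s k *\<^sub>R x"])
      then show "\<zeta> k x = 0" using K by (simp add: \<zeta>_def)
    qed simp
    show "norm (\<zeta> k x) \<le> B" for k x using B by (simp add: \<zeta>_def)
    show "(\<lambda>k. \<zeta> k x) \<longlonglongrightarrow> 1" for x
    proof -
      have "s \<longlonglongrightarrow> 0" unfolding s_def by (rule LIMSEQ_inverse_real_of_nat[unfolded inverse_eq_divide])
      then have "(\<lambda>k. s k *\<^sub>R x) \<longlonglongrightarrow> 0 *\<^sub>R x" by (intro tendsto_intros)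
      moreover have "isCont f 0" using test_continuous[OF ft, of UNIV] by (simp add: continuous_on_eq_continuous_at)
      ultimately have "(\<lambda>k. f (s k *\<^sub>R x)) \<longlonglongrightarrow> f 0" by (intro isCont_tendsto_compose[where g = f]) simp_all
      then show ?thesis using f1 by (simp add: \<zeta>_def)
    qed
    show "norm (partial i (\<zeta> k) x) \<le> sum C UNIV / real (Suc k)" for k i x
    proof -
      have "partial i (\<zeta> k) x = of_real (s k) * partial i f (s k *\<^sub>R x)"
        unfolding \<zeta>_def[abs_def] by (rule partial_scale[OF test_smooth[OF ft]])
      then show ?thesis using Ci[of i "s k *\<^sub>R x"] by (simp add: norm_mult norm_divide s_def divide_right_mono del: of_nat_Suc)
    qed
    show "B > 0" by (rule B)
    show "sum C UNIV > 0" by (intro sum_pos) (auto simp: C)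
  qed
qed

lemma cutoff_L2:
  assumes "\<And>k. \<zeta> k \<in> test_functions UNIV" "\<And>k x. norm (\<zeta> k x) \<le> B" "\<And>x. (\<lambda>k. \<zeta> k x) \<longlonglongrightarrow> 1"
    and \<psi>: "\<psi> \<in> L2 lborel"
  shows "(\<lambda>x. (\<zeta> k x - 1) * \<psi> x) \<in> L2 lborel" "(\<lambda>k. L2_norm lborel (\<lambda>x. (\<zeta> k x - 1) * \<psi> x)) \<longlonglongrightarrow> 0"
proof -
  have [measurable]: "\<psi> \<in> borel_measurable borel" "\<And>k. \<zeta> k \<in> borel_measurable borel" using L2_borel[OF \<psi>] test_measurable[OF assms(1)] by auto
  have bound: "(cmod ((\<zeta> k x - 1) * \<psi> x))\<^sup>2 \<le> (B + 1)\<^sup>2 * (cmod (\<psi> x))\<^sup>2" for k x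
  proof -
    have "cmod (\<zeta> k x - 1) \<le> B + 1" using norm_triangle_ineq4[of "\<zeta> k x" 1] assms(2)[of k x] by simp
    then have "cmod ((\<zeta> k x - 1) * \<psi> x) \<le> (B + 1) * cmod (\<psi> x)" by (simp add: norm_mult mult_right_mono)
    then show ?thesis using power_mono[of _ "(B + 1) * cmod (\<psi> x)" 2] by (simp add: power_mult_distrib)
  qed
  have i: "integrable lborel (\<lambda>x. (B + 1)\<^sup>2 * (cmod (\<psi> x))\<^sup>2)" using L2_integrable[OF \<psi>] by simp
  show "(\<lambda>x. (\<zeta> k x - 1) * \<psi> x) \<in> L2 lborel" by (rule L2I[OF _ i bound]) simp
  have "(\<lambda>k. \<integral>x. (cmod ((\<zeta> k x - 1) * \<psi> x))\<^sup>2 \<partial>lborel) \<longlonglongrightarrow> (\<integral>x. 0 \<partial>(lborel :: (real ^ 3) measure))"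
  proof (rule integral_dominated_convergence[OF _ _ i])
    show "AE x in lborel. (\<lambda>k. (cmod ((\<zeta> k x - 1) * \<psi> x))\<^sup>2) \<longlonglongrightarrow> 0"
    proof (rule AE_I2)
      fix x
      have "(\<lambda>k. (cmod ((\<zeta> k x - 1) * \<psi> x))\<^sup>2) \<longlonglongrightarrow> (cmod ((1 - 1) * \<psi> x))\<^sup>2" by (intro tendsto_intros assms)
      then show "(\<lambda>k. (cmod ((\<zeta> k x - 1) * \<psi> x))\<^sup>2) \<longlonglongrightarrow> 0" by simp
    qed
  qed (use bound in auto)
  then have "(\<lambda>k. sqrt (\<integral>x. (cmod ((\<zeta> k x - 1) * \<psi> x))\<^sup>2 \<partial>lborel)) \<longlonglongrightarrow> sqrt 0" by (intro tendsto_real_sqrt) simp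
  then show "(\<lambda>k. L2_norm lborel (\<lambda>x. (\<zeta> k x - 1) * \<psi> x)) \<longlonglongrightarrow> 0" by (simp add: L2_norm_def)
qed

theorem test_functions_dense:
  assumes \<Omega>: "shiftable \<Omega>" and u: "u \<in> L2 (leb \<Omega>)" and G: "is_weak_grad \<Omega> u G" and e: "e > 0"
  shows "\<exists>\<phi>\<in>test_functions UNIV. L2_norm (leb \<Omega>) (\<lambda>x. \<phi> x - u x) < e \<and> L2_norm (leb \<Omega>) (\<lambda>x. grad \<phi> x - G x) < e"
proof -
  note B\<Omega> = shiftable_borel[OF \<Omega>]
  define e' where "e' = e / 10"
  have e': "e' > 0" using e by (simp add: e'_def)
  define u0 where "u0 = ext0 \<Omega> u"
  define g where "g i = ext0 \<Omega> (\<lambda>x. G x $ i)" for i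
  have u0L: "u0 \<in> L2 lborel" using leb_L2[OF B\<Omega>, of u] u by (simp add: u0_def)
  have gL: "g i \<in> L2 lborel" for i using leb_L2[OF B\<Omega>, of "\<lambda>x. G x $ i"] L2_component[OF is_weak_grad_L2[OF G], of i] by (simp add: g_def)
  have "\<exists>r \<eta>. shift_kernel \<Omega> r \<eta> \<and> (\<forall>u\<in>insert u0 (range g). (\<lambda>x. conv (\<lambda>y. of_real (\<eta> y)) u x - u x) \<in> L2 lborel
     \<and> L2_norm lborel (\<lambda>x. conv (\<lambda>y. of_real (\<eta> y)) u x - u x) \<le> e')"
    by (rule mollify_approx[OF \<Omega>]) (use u0L gL e' in auto)
  then obtain r \<eta> where \<eta>: "shift_kernel \<Omega> r \<eta>" and ap: "\<And>v. v \<in> insert u0 (range g) \<Longrightarrow> (\<lambda>x. conv (\<lambda>y. of_real (\<eta> y)) v x - v x) \<in> L2 lborel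
     \<and> L2_norm lborel (\<lambda>x. conv (\<lambda>y. of_real (\<eta> y)) v x - v x) \<le> e'"
    by blast
  let ?\<eta> = "\<lambda>y. complex_of_real (\<eta> y)"
  have t: "?\<eta> \<in> test_functions UNIV" using \<eta> unfolding shift_kernel_def by blast
  define \<psi> where "\<psi> = conv ?\<eta> u0"
  define \<psi>' where "\<psi>' i = conv ?\<eta> (g i)" for i
  have \<psi>: "(\<lambda>x. \<psi> x - u0 x) \<in> L2 lborel" "L2_norm lborel (\<lambda>x. \<psi> x - u0 x) \<le> e'" using ap by (auto simp: \<psi>_def)
  have \<psi>': "(\<lambda>x. \<psi>' i x - g i x) \<in> L2 lborel" "L2_norm lborel (\<lambda>x. \<psi>' i x - g i x) \<le> e'" for i using ap by (auto simp: \<psi>'_def)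
  have \<psi>L: "\<psi> \<in> L2 lborel" using L2_add[OF \<psi>(1) u0L] by simp
  have \<psi>'L: "\<psi>' i \<in> L2 lborel" for i using L2_add[OF \<psi>'(1)[of i] gL[of i]] by simp
  have sm: "smooth \<psi>" unfolding \<psi>_def by (rule smooth_conv[OF t u0L])
  have part: "partial i \<psi> x = \<psi>' i x" if "x \<in> \<Omega>" for i x
    using is_weak_grad_conv[OF B\<Omega> \<eta> G that, of i] partial_conv[OF t u0L, of i] by (simp add: \<psi>_def \<psi>'_def u0_def g_def)
  obtain \<zeta> :: "nat \<Rightarrow> real ^ 3 \<Rightarrow> complex" and B C where \<zeta>: "\<And>k. \<zeta> k \<in> test_functions UNIV" "\<And>k x. norm (\<zeta> k x) \<le> B"
    "\<And>x. (\<lambda>k. \<zeta> k x) \<longlonglongrightarrow> 1" "\<And>k i x. norm (partial i (\<zeta> k) x) \<le> C / real (Suc k)" "B > 0" "C > 0"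
    by (rule cutoff_sequence) blast
  have "(\<lambda>k. C * (1 / real (Suc k)) * L2_norm lborel \<psi>) \<longlonglongrightarrow> C * 0 * L2_norm lborel \<psi>"
    by (intro tendsto_intros LIMSEQ_inverse_real_of_nat[unfolded inverse_eq_divide])
  then have "\<forall>\<^sub>F k in sequentially. C * (1 / real (Suc k)) * L2_norm lborel \<psi> < e'"
    by (rule order_tendstoD(2)) (use e' in simp)
  moreover have "\<forall>\<^sub>F k in sequentially. L2_norm lborel (\<lambda>x. (\<zeta> k x - 1) * \<psi> x) < e'"
    by (rule order_tendstoD(2)[OF cutoff_L2(2)[OF \<zeta>(1-3) \<psi>L] e'])
  moreover have "\<forall>\<^sub>F k in sequentially. \<forall>i\<in>UNIV. L2_norm lborel (\<lambda>x. (\<zeta> k x - 1) * \<psi>' i x) < e'"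
    by (intro eventually_ball_finite ballI order_tendstoD(2)[OF cutoff_L2(2)[OF \<zeta>(1-3) \<psi>'L] e']) auto
  ultimately have "\<forall>\<^sub>F k in sequentially. C * (1 / real (Suc k)) * L2_norm lborel \<psi> < e' \<and> L2_norm lborel (\<lambda>x. (\<zeta> k x - 1) * \<psi> x) < e'
     \<and> (\<forall>i\<in>UNIV. L2_norm lborel (\<lambda>x. (\<zeta> k x - 1) * \<psi>' i x) < e')"
    by eventually_elim simp
  then obtain k where k: "C * (1 / real (Suc k)) * L2_norm lborel \<psi> < e'" "L2_norm lborel (\<lambda>x. (\<zeta> k x - 1) * \<psi> x) < e'"
    "\<And>i. L2_norm lborel (\<lambda>x. (\<zeta> k x - 1) * \<psi>' i x) < e'"
    using eventually_happens'[OF sequentially_bot] by auto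
  define \<phi> where "\<phi> x = \<zeta> k x * \<psi> x" for x
  have \<phi>: "\<phi> \<in> test_functions UNIV" unfolding \<phi>_def[abs_def] by (rule test_mult_smooth[OF \<zeta>(1) sm])
  have N1: "L2_norm (leb \<Omega>) (\<lambda>x. \<phi> x - u x) \<le> 2 * e'"
  proof -
    have "L2_norm (leb \<Omega>) (\<lambda>x. \<phi> x - u x) \<le> L2_norm lborel (\<lambda>x. (\<zeta> k x - 1) * \<psi> x + (\<psi> x - u0 x))"
    proof (rule leb_L2_norm_le[OF B\<Omega>])
      show "(\<lambda>x. \<phi> x - u x) \<in> L2 (leb \<Omega>)" by (intro L2_diff u L2_leb_subset(1)[OF B\<Omega>] test_L2[OF \<phi>])
      show "(\<lambda>x. (\<zeta> k x - 1) * \<psi> x + (\<psi> x - u0 x)) \<in> L2 lborel" by (intro L2_add cutoff_L2(1)[OF \<zeta>(1-3)] \<psi>L \<psi>)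
      show "\<phi> x - u x = (\<zeta> k x - 1) * \<psi> x + (\<psi> x - u0 x)" if "x \<in> \<Omega>" for x
        using that by (simp add: \<phi>_def u0_def ext0_def algebra_simps)
    qed
    also have "\<dots> \<le> L2_norm lborel (\<lambda>x. (\<zeta> k x - 1) * \<psi> x) + L2_norm lborel (\<lambda>x. \<psi> x - u0 x)"
      by (intro L2_norm_triangle cutoff_L2(1)[OF \<zeta>(1-3)] \<psi>L \<psi>)
    finally show ?thesis using k(2) \<psi>(2) by simp
  qed
  have N2: "L2_norm (leb \<Omega>) (\<lambda>x. partial i \<phi> x - G x $ i) \<le> 3 * e'" for i
  proof -
    have p: "partial i \<phi> x = \<zeta> k x * partial i \<psi> x + partial i (\<zeta> k) x * \<psi> x" for x
      unfolding \<phi>_def[abs_def] by (intro partial_mult smooth_differentiable sm test_smooth[OF \<zeta>(1)])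
    have [measurable]: "\<psi> \<in> borel_measurable borel" "partial i (\<zeta> k) \<in> borel_measurable borel"
      using L2_borel[OF \<psi>L] test_measurable[OF test_partial[OF \<zeta>(1)]] by auto
    have le: "norm (partial i (\<zeta> k) x * \<psi> x) \<le> norm (of_real (C / real (Suc k)) * \<psi> x)" for x
      using mult_right_mono[OF \<zeta>(4)[of i k x] norm_ge_zero[of "\<psi> x"]] \<zeta>(6) by (simp add: norm_mult norm_divide del: of_nat_Suc)
    have L2a: "(\<lambda>x. of_real (C / real (Suc k)) * \<psi> x) \<in> L2 lborel" by (rule L2_cmult[OF \<psi>L])
    have L2b: "(\<lambda>x. partial i (\<zeta> k) x * \<psi> x) \<in> L2 lborel"
      by (rule L2I[OF _ L2_integrable[OF L2a]]) (simp, intro power_mono le norm_ge_zero)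
    have "L2_norm lborel (\<lambda>x. partial i (\<zeta> k) x * \<psi> x) \<le> L2_norm lborel (\<lambda>x. of_real (C / real (Suc k)) * \<psi> x)"
      by (rule L2_norm_mono[OF L2a _ le]) simp
    also have "\<dots> = C * (1 / real (Suc k)) * L2_norm lborel \<psi>" using \<zeta>(6) by (subst L2_norm_cmult) (simp add: norm_divide del: of_nat_Suc)
    finally have le': "L2_norm lborel (\<lambda>x. partial i (\<zeta> k) x * \<psi> x) < e'" using k(1) by simp
    have "L2_norm (leb \<Omega>) (\<lambda>x. partial i \<phi> x - G x $ i) \<le> L2_norm lborel (\<lambda>x. ((\<zeta> k x - 1) * \<psi>' i x + (\<psi>' i x - g i x)) + partial i (\<zeta> k) x * \<psi> x)"
    proof (rule leb_L2_norm_le[OF B\<Omega>])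
      show "(\<lambda>x. partial i \<phi> x - G x $ i) \<in> L2 (leb \<Omega>)"
        by (intro L2_diff L2_component is_weak_grad_L2[OF G] L2_leb_subset(1)[OF B\<Omega>] test_L2[OF test_partial[OF \<phi>]])
      show "(\<lambda>x. ((\<zeta> k x - 1) * \<psi>' i x + (\<psi>' i x - g i x)) + partial i (\<zeta> k) x * \<psi> x) \<in> L2 lborel"
        by (intro L2_add cutoff_L2(1)[OF \<zeta>(1-3)] \<psi>'L \<psi>' L2b)
      show "partial i \<phi> x - G x $ i = ((\<zeta> k x - 1) * \<psi>' i x + (\<psi>' i x - g i x)) + partial i (\<zeta> k) x * \<psi> x" if "x \<in> \<Omega>" for x
        unfolding p part[OF that] using that by (simp add: g_def ext0_def algebra_simps)
    qed
    also have "\<dots> \<le> L2_norm lborel (\<lambda>x. (\<zeta> k x - 1) * \<psi>' i x + (\<psi>' i x - g i x)) + L2_norm lborel (\<lambda>x. partial i (\<zeta> k) x * \<psi> x)"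
      by (intro L2_norm_triangle L2_add cutoff_L2(1)[OF \<zeta>(1-3)] \<psi>'L \<psi>' L2b)
    also have "L2_norm lborel (\<lambda>x. (\<zeta> k x - 1) * \<psi>' i x + (\<psi>' i x - g i x)) \<le> L2_norm lborel (\<lambda>x. (\<zeta> k x - 1) * \<psi>' i x) + L2_norm lborel (\<lambda>x. \<psi>' i x - g i x)"
      by (intro L2_norm_triangle cutoff_L2(1)[OF \<zeta>(1-3)] \<psi>'L \<psi>')
    finally show ?thesis using k(3)[of i] \<psi>'(2)[of i] le' by simp
  qed
  have "L2_norm (leb \<Omega>) (\<lambda>x. grad \<phi> x - G x) \<le> (\<Sum>i\<in>UNIV. L2_norm (leb \<Omega>) (\<lambda>x. (grad \<phi> x - G x) $ i))"
    by (intro L2_vec(2) L2_component L2_diff is_weak_grad_L2[OF G] L2_leb_subset(1)[OF B\<Omega>] test_grad_L2[OF \<phi>])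
  also have "\<dots> \<le> (\<Sum>i\<in>(UNIV :: 3 set). 3 * e')" by (intro sum_mono) (simp add: N2)
  also have "\<dots> = 9 * e'" by simp
  finally show ?thesis using N1 \<phi> e' e by (intro bexI[of _ \<phi>]) (auto simp: e'_def)
qed

subsection \<open>Linearity\<close>

lemma test_L2_leb: "\<Omega> \<in> sets borel \<Longrightarrow> \<phi> \<in> test_functions UNIV \<Longrightarrow> \<phi> \<in> L2 (leb \<Omega>)"
  by (intro L2_leb_subset(1) test_L2)

lemma L2_times_integrable:
  fixes u v :: "'a \<Rightarrow> complex"
  shows "u \<in> L2 M \<Longrightarrow> v \<in> L2 M \<Longrightarrow> integrable M (\<lambda>x. u x * v x)"
  by (rule L2_mult_integrable[of u M v]) (auto simp: norm_mult intro!: borel_measurable_times)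

lemma is_weak_grad_lin:
  assumes \<Omega>: "\<Omega> \<in> sets borel" and L: "u \<in> L2 (leb \<Omega>)" "v \<in> L2 (leb \<Omega>)" and G: "is_weak_grad \<Omega> u G" "is_weak_grad \<Omega> v H"
  shows "is_weak_grad \<Omega> (\<lambda>x. u x + c * v x) (\<lambda>x. \<chi> i. G x $ i + c * H x $ i)"
  unfolding is_weak_grad_def
proof (intro conjI ballI allI)
  have GH: "(\<lambda>x. G x $ i) \<in> L2 (leb \<Omega>)" "(\<lambda>x. H x $ i) \<in> L2 (leb \<Omega>)" for i
    using G is_weak_grad_L2 L2_component by blast+
  show "(\<lambda>x. \<chi> i. G x $ i + c * H x $ i) \<in> L2 (leb \<Omega>)" by (rule L2_vec(1)) (auto intro: L2_lin GH)
  fix \<phi> i assume \<phi>: "\<phi> \<in> test_functions \<Omega>"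
  then have \<phi>': "\<phi> \<in> test_functions UNIV" by (rule test_mono) simp
  have p: "partial i \<phi> \<in> L2 (leb \<Omega>)" "\<phi> \<in> L2 (leb \<Omega>)" using test_L2_leb[OF \<Omega>] test_partial \<phi>' by blast+
  have "(\<integral>x. u x * partial i \<phi> x \<partial>leb \<Omega>) = - (\<integral>x. G x $ i * \<phi> x \<partial>leb \<Omega>)" "(\<integral>x. v x * partial i \<phi> x \<partial>leb \<Omega>) = - (\<integral>x. H x $ i * \<phi> x \<partial>leb \<Omega>)"
    using G \<phi> unfolding is_weak_grad_def by blast+
  then show "(\<integral>x. (u x + c * v x) * partial i \<phi> x \<partial>leb \<Omega>) = - (\<integral>x. (\<chi> i. G x $ i + c * H x $ i) $ i * \<phi> x \<partial>leb \<Omega>)"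
    using L2_times_integrable[OF L(1) p(1)] L2_times_integrable[OF L(2) p(1)]
      L2_times_integrable[OF GH(1)[of i] p(2)] L2_times_integrable[OF GH(2)[of i] p(2)]
    by (simp add: distrib_right mult.assoc)
qed

lemma H1D:
  assumes "u \<in> H1 \<Omega>"
  shows "u \<in> L2 (leb \<Omega>)" "is_weak_grad \<Omega> u (weak_grad \<Omega> u)" "weak_grad \<Omega> u \<in> L2 (leb \<Omega>)"
proof -
  show "u \<in> L2 (leb \<Omega>)" using assms by (simp add: H1_def)
  have "\<exists>G. is_weak_grad \<Omega> u G" using assms by (simp add: H1_def)
  then show "is_weak_grad \<Omega> u (weak_grad \<Omega> u)" unfolding weak_grad_def by (rule someI_ex)
  then show "weak_grad \<Omega> u \<in> L2 (leb \<Omega>)" by (rule is_weak_grad_L2)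
qed

lemma H1I: "u \<in> L2 (leb \<Omega>) \<Longrightarrow> is_weak_grad \<Omega> u G \<Longrightarrow> u \<in> H1 \<Omega>"
  by (auto simp: H1_def)

lemma weak_grad_AE: "shiftable \<Omega> \<Longrightarrow> u \<in> H1 \<Omega> \<Longrightarrow> is_weak_grad \<Omega> u G \<Longrightarrow> AE x in leb \<Omega>. weak_grad \<Omega> u x = G x"
  using weak_grad_unique H1D(2) by blast

lemma H1_lin:
  assumes "\<Omega> \<in> sets borel" "u \<in> H1 \<Omega>" "v \<in> H1 \<Omega>"
  shows "(\<lambda>x. u x + c * v x) \<in> H1 \<Omega>"
  using is_weak_grad_lin[OF assms(1) H1D(1)[OF assms(2)] H1D(1)[OF assms(3)] H1D(2)[OF assms(2)] H1D(2)[OF assms(3)]]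
    L2_lin[OF H1D(1)[OF assms(2)] H1D(1)[OF assms(3)]] by (blast intro: H1I)

lemma weak_grad_lin:
  assumes "shiftable \<Omega>" "u \<in> H1 \<Omega>" "v \<in> H1 \<Omega>"
  shows "AE x in leb \<Omega>. \<forall>i. weak_grad \<Omega> (\<lambda>x. u x + c * v x) x $ i = weak_grad \<Omega> u x $ i + c * weak_grad \<Omega> v x $ i"
  using weak_grad_AE[OF assms(1) H1_lin[OF shiftable_borel[OF assms(1)] assms(2,3), of c]
    is_weak_grad_lin[where c = c, OF shiftable_borel[OF assms(1)] H1D(1)[OF assms(2)] H1D(1)[OF assms(3)] H1D(2)[OF assms(2)] H1D(2)[OF assms(3)]]]
  by eventually_elim simp

lemma is_weak_grad_cong:
  assumes "\<Omega> \<in> sets borel" "\<And>x. x \<in> \<Omega> \<Longrightarrow> u x = v x"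
  shows "is_weak_grad \<Omega> u = is_weak_grad \<Omega> v"
proof -
  have "(\<integral>x. u x * w x \<partial>leb \<Omega>) = (\<integral>x. v x * w x \<partial>leb \<Omega>)" for w
    by (rule Bochner_Integration.integral_cong) (auto simp: assms space_restrict_space)
  then show ?thesis unfolding is_weak_grad_def by (intro ext) auto
qed

lemma weak_grad_cong: "\<Omega> \<in> sets borel \<Longrightarrow> (\<And>x. x \<in> \<Omega> \<Longrightarrow> u x = v x) \<Longrightarrow> weak_grad \<Omega> u = weak_grad \<Omega> v"
  unfolding weak_grad_def using is_weak_grad_cong by metis

lemma L2_leb_cong:
  fixes u v :: "real ^ 3 \<Rightarrow> 'b::{real_normed_vector, second_countable_topology}"
  assumes "\<Omega> \<in> sets borel" "\<And>x. x \<in> \<Omega> \<Longrightarrow> u x = v x"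
  shows "u \<in> L2 (leb \<Omega>) \<longleftrightarrow> v \<in> L2 (leb \<Omega>)" "L2_norm (leb \<Omega>) u = L2_norm (leb \<Omega>) v"
proof -
  have "ext0 \<Omega> u = ext0 \<Omega> v" using assms(2) by (auto simp: ext0_def)
  then show "u \<in> L2 (leb \<Omega>) \<longleftrightarrow> v \<in> L2 (leb \<Omega>)" "L2_norm (leb \<Omega>) u = L2_norm (leb \<Omega>) v"
    by (simp_all add: leb_L2[OF assms(1)] leb_L2_norm[OF assms(1)])
qed

lemma H1_cong:
  assumes "\<Omega> \<in> sets borel" "\<And>x. x \<in> \<Omega> \<Longrightarrow> u x = v x"
  shows "u \<in> H1 \<Omega> \<longleftrightarrow> v \<in> H1 \<Omega>"
  unfolding H1_def using is_weak_grad_cong[OF assms] L2_leb_cong(1)[OF assms] by auto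

lemma is_weak_grad_restrict:
  assumes \<Omega>: "\<Omega> \<in> sets borel" and G: "is_weak_grad UNIV u G"
  shows "is_weak_grad \<Omega> u G"
  unfolding is_weak_grad_def
proof (intro conjI ballI allI)
  show "G \<in> L2 (leb \<Omega>)" using L2_leb_subset(1)[OF \<Omega>] is_weak_grad_L2[OF G] by simp
  fix \<phi> i assume \<phi>: "\<phi> \<in> test_functions \<Omega>"
  obtain K where K: "K \<subseteq> \<Omega>" "\<And>x. x \<notin> K \<Longrightarrow> \<phi> x = 0" "\<And>x i. x \<notin> K \<Longrightarrow> partial i \<phi> x = 0" using \<phi> by (rule test_functionsE) blast
  have e: "ext0 \<Omega> (\<lambda>x. u x * partial i \<phi> x) = (\<lambda>x. u x * partial i \<phi> x)" "ext0 \<Omega> (\<lambda>x. G x $ i * \<phi> x) = (\<lambda>x. G x $ i * \<phi> x)"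
    by (rule ext, use K in \<open>auto simp: ext0_def\<close>)+
  have "\<phi> \<in> test_functions UNIV" using \<phi> by (rule test_mono) simp
  then have "(\<integral>x. u x * partial i \<phi> x \<partial>lborel) = - (\<integral>x. G x $ i * \<phi> x \<partial>lborel)" using G unfolding is_weak_grad_def by simp
  then show "(\<integral>x. u x * partial i \<phi> x \<partial>leb \<Omega>) = - (\<integral>x. G x $ i * \<phi> x \<partial>leb \<Omega>)" by (simp add: leb_integral[OF \<Omega>] e)
qed

lemma H1_restrict: "\<Omega> \<in> sets borel \<Longrightarrow> u \<in> H1 UNIV \<Longrightarrow> u \<in> H1 \<Omega>"
  using is_weak_grad_restrict[of \<Omega> u] L2_leb_subset(1)[of \<Omega> u] by (auto simp: H1_def)

lemma weak_grad_restrict: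
  assumes "shiftable \<Omega>" "u \<in> H1 UNIV"
  shows "AE x in leb \<Omega>. weak_grad \<Omega> u x = weak_grad UNIV u x"
  by (rule weak_grad_AE[OF assms(1) H1_restrict is_weak_grad_restrict]) (use assms shiftable_borel H1D(2) in auto)

section \<open>The cone\<close>

text \<open>The coordinates \<open>(p, s)\<close> of the point with vertical projection \<open>p\<close> and signed vertical distance \<open>s\<close>
  from the cone. They flatten the cone and preserve volume.\<close>

definition shear :: "real \<Rightarrow> (real ^ 2) \<times> real \<Rightarrow> real ^ 3" where
  "shear c x = vector [fst x $ 1, fst x $ 2, c * norm (fst x) + snd x]"

lemma shear_component [simp]:
  "shear c x $ 1 = fst x $ 1" "shear c x $ 2 = fst x $ 2" "shear c x $ 3 = c * norm (fst x) + snd x"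
  by (simp_all add: shear_def)

lemma norm_real2: "norm (p :: real ^ 2) = sqrt ((p $ 1)\<^sup>2 + (p $ 2)\<^sup>2)"
  by (simp add: norm_vec_def L2_set_def sum_2)

lemma cone_param_shear: "cone_param \<theta> p = shear (cot \<theta>) (p, 0)"
  by (simp add: cone_param_def shear_def norm_real2)

lemma shear_continuous: "continuous_on A (shear c)"
proof -
  have eq: "shear c = (\<lambda>x. \<chi> i. if i = 1 then fst x $ 1 else if i = 2 then fst x $ 2 else c * norm (fst x) + snd x)"
    by (auto simp: vec_eq_iff forall_3)
  show ?thesis unfolding eq
  proof (rule continuous_on_vec_lambda)
    fix i :: 3
    show "continuous_on A (\<lambda>x. if i = 1 then fst x $ 1 else if i = 2 then fst x $ 2 else c * norm (fst x) + snd x)"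
      by (cases "i = 1"; cases "i = 2") (auto intro!: continuous_intros)
  qed
qed

lemma shear_measurable [measurable]: "shear c \<in> borel_measurable borel"
  by (intro borel_measurable_continuous_onI shear_continuous)

lemma prod_Basis_vec:
  fixes f :: "real ^ 'n::finite \<Rightarrow> 'a::comm_monoid_mult"
  shows "(\<Prod>b\<in>Basis. f b) = (\<Prod>i\<in>UNIV. f (axis i (1 :: real)))"
proof -
  have "(Basis :: (real ^ 'n) set) = (\<lambda>i. axis i 1) ` UNIV" by (auto simp: Basis_vec_def)
  moreover have "inj (\<lambda>i :: 'n. axis i (1 :: real))" by (auto simp: inj_def axis_eq_axis)
  ultimately have "prod f Basis = prod (f \<circ> (\<lambda>i. axis i 1)) UNIV" by (metis prod.reindex)
  then show ?thesis by (simp add: o_def)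
qed

lemma prod_3: "prod f (UNIV :: 3 set) = f 1 * f 2 * f 3"
  unfolding UNIV_3 by (simp add: mult.assoc)

lemma distr_shear: "distr lborel borel (shear c) = lborel"
proof (rule lborel_eqI[symmetric])
  fix l u :: "real ^ 3" assume lu: "\<And>b. b \<in> Basis \<Longrightarrow> l \<bullet> b \<le> u \<bullet> b"
  have le: "l $ i \<le> u $ i" for i using lu[of "axis i 1"] by (simp add: inner_axis)
  define l' u' :: "real ^ 2" where "l' = vector [l $ 1, l $ 2]" and "u' = vector [u $ 1, u $ 2]"
  define S where "S = shear c -` box l u"
  have S: "S \<in> sets borel" unfolding S_def using measurable_sets[OF shear_measurable, of "box l u"] by simp
  have fiber: "Pair p -` S = (if p \<in> box l' u' then {l $ 3 - c * norm p <..< u $ 3 - c * norm p} else {})" for p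
    by (auto simp: S_def mem_box_cart forall_3 forall_2 l'_def u'_def)
  have "emeasure (distr lborel borel (shear c)) (box l u) = emeasure (lborel \<Otimes>\<^sub>M lborel) S"
    by (simp add: emeasure_distr S_def lborel_prod)
  also have "\<dots> = (\<integral>\<^sup>+p. emeasure lborel (Pair p -` S) \<partial>lborel)"
    by (rule lborel.emeasure_pair_measure_alt) (use S in \<open>simp only: sets_lborel lborel_prod sets_pair_measure_cong[OF sets_lborel sets_lborel] borel_prod\<close>)
  also have "\<dots> = (\<integral>\<^sup>+p. ennreal (u $ 3 - l $ 3) * indicator (box l' u') p \<partial>lborel)"
    unfolding fiber using le[of 3] by (intro nn_integral_cong) (auto simp: indicator_def)
  also have "\<dots> = ennreal (u $ 3 - l $ 3) * emeasure lborel (box l' u')" by (simp add: nn_integral_cmult)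
  also have "emeasure lborel (box l' u') = (\<Prod>b\<in>Basis. (u' - l') \<bullet> b)"
  proof (rule emeasure_lborel_box)
    fix b :: "real ^ 2" assume "b \<in> Basis"
    then obtain i where "b = axis i 1" by (auto simp: Basis_vec_def)
    then show "l' \<bullet> b \<le> u' \<bullet> b" using le exhaust_2[of i] by (auto simp: inner_axis l'_def u'_def)
  qed
  also have "(\<Prod>b\<in>Basis. (u' - l') \<bullet> b) = (u $ 1 - l $ 1) * (u $ 2 - l $ 2)"
    by (simp add: prod_Basis_vec inner_axis UNIV_2 l'_def u'_def)
  also have "ennreal (u $ 3 - l $ 3) * ennreal ((u $ 1 - l $ 1) * (u $ 2 - l $ 2)) = ennreal (\<Prod>b\<in>Basis. (u - l) \<bullet> b)"
  proof -
    have "(\<Prod>b\<in>Basis. (u - l) \<bullet> b) = (\<Prod>i\<in>UNIV. u $ i - l $ i)"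
      by (simp add: prod_Basis_vec inner_axis)
    also have "\<dots> = (u $ 3 - l $ 3) * ((u $ 1 - l $ 1) * (u $ 2 - l $ 2))" unfolding prod_3 by (simp only: mult_ac)
    finally have e: "(\<Prod>b\<in>Basis. (u - l) \<bullet> b) = (u $ 3 - l $ 3) * ((u $ 1 - l $ 1) * (u $ 2 - l $ 2))" .
    show ?thesis unfolding e by (rule ennreal_mult[symmetric]) (use le in auto)
  qed
  finally show "emeasure (distr lborel borel (shear c)) (box l u) = (\<Prod>b\<in>Basis. (u - l) \<bullet> b)" .
qed simp

lemma integral_shear:
  fixes f :: "real ^ 3 \<Rightarrow> 'b::{banach, second_countable_topology}"
  assumes "f \<in> borel_measurable borel"
  shows "(\<integral>x. f x \<partial>lborel) = (\<integral>x. f (shear c x) \<partial>lborel)" "integrable lborel f \<longleftrightarrow> integrable lborel (\<lambda>x. f (shear c x))"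
proof -
  have "(\<integral>x. f x \<partial>lborel) = (\<integral>x. f x \<partial>(distr lborel borel (shear c)))" by (simp add: distr_shear)
  also have "\<dots> = (\<integral>x. f (shear c x) \<partial>lborel)" by (rule integral_distr) (use assms in auto)
  finally show "(\<integral>x. f x \<partial>lborel) = (\<integral>x. f (shear c x) \<partial>lborel)" .
  have "integrable lborel f \<longleftrightarrow> integrable (distr lborel borel (shear c)) f" by (simp add: distr_shear)
  also have "\<dots> \<longleftrightarrow> integrable lborel (\<lambda>x. f (shear c x))" by (rule integrable_distr_eq) (use assms in auto)
  finally show "integrable lborel f \<longleftrightarrow> integrable lborel (\<lambda>x. f (shear c x))" .
qed

lemma Omega_eq:
  "Omega1 \<theta> = {x. x $ 3 > cot \<theta> * norm (vector [x $ 1, x $ 2] :: real ^ 2)}"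
  "Omega2 \<theta> = {x. x $ 3 < cot \<theta> * norm (vector [x $ 1, x $ 2] :: real ^ 2)}"
  by (simp_all add: Omega1_def Omega2_def norm_real2)

lemma shear_Omega [simp]: "shear (cot \<theta>) x \<in> Omega1 \<theta> \<longleftrightarrow> snd x > 0" "shear (cot \<theta>) x \<in> Omega2 \<theta> \<longleftrightarrow> snd x < 0"
  by (simp_all add: Omega1_def Omega2_def norm_real2)

lemma Omega_open: "open (Omega1 \<theta>)" "open (Omega2 \<theta>)"
  unfolding Omega1_def Omega2_def by (auto intro!: open_Collect_less continuous_intros)

lemma Omega_borel [measurable, simp]: "Omega1 \<theta> \<in> sets borel" "Omega2 \<theta> \<in> sets borel"
  using Omega_open by auto

lemma Omega_shiftable:
  assumes \<theta>: "0 < \<theta>" "\<theta> < pi / 2"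
  shows "shiftable (Omega1 \<theta>)" "shiftable (Omega2 \<theta>)" "shiftable UNIV"
proof -
  define c where "c = cot \<theta>"
  have c: "c > 0" using \<theta> by (auto simp: c_def cot_def intro!: divide_pos_pos cos_gt_zero sin_gt_zero)
  have ex: "\<exists>\<eta>. shift_kernel \<Omega> r \<eta>"
    if r: "r > 0" and \<Omega>: "\<And>t d y x. t > 0 \<Longrightarrow> d > 0 \<Longrightarrow> 2 * d * c \<le> t - d \<Longrightarrow> x \<in> \<Omega> \<Longrightarrow> \<bar>y $ 1\<bar> \<le> d \<Longrightarrow> \<bar>y $ 2\<bar> \<le> d
      \<Longrightarrow> \<bar>y $ 3 - \<sigma> * t\<bar> \<le> d \<Longrightarrow> x - y \<in> \<Omega>" and \<sigma>: "\<bar>\<sigma>\<bar> = 1" for \<Omega> r \<sigma>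
  proof -
    define t where "t = r / 5"
    define d where "d = t / (1 + 2 * c)"
    have t: "t > 0" using r by (simp add: t_def)
    have d: "d > 0" "d \<le> t" "2 * d * c \<le> t - d" using t c by (auto simp: d_def field_simps)
    define a b :: "real ^ 3" where "a = vector [- d, - d, \<sigma> * t - d]" and "b = vector [d, d, \<sigma> * t + d]"
    have mem: "y \<in> cbox a b \<longleftrightarrow> \<bar>y $ 1\<bar> \<le> d \<and> \<bar>y $ 2\<bar> \<le> d \<and> \<bar>y $ 3 - \<sigma> * t\<bar> \<le> d" for y
      by (auto simp: mem_box_cart forall_3 a_def b_def)
    show ?thesis
    proof (rule shift_kernel_box[of a b])
      have "vector [0, 0, \<sigma> * t] \<in> box a b" using d by (simp add: mem_box_cart forall_3 a_def b_def)
      then show "box a b \<noteq> {}" by blast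
      show "cbox a b \<subseteq> ball 0 r"
      proof
        fix y assume y: "y \<in> cbox a b"
        have "norm y \<le> \<bar>y $ 1\<bar> + \<bar>y $ 2\<bar> + \<bar>y $ 3\<bar>" using norm_le_l1_cart[of y] by (simp add: sum_3)
        also have "\<bar>y $ 3\<bar> \<le> \<bar>\<sigma> * t\<bar> + d" using y unfolding mem by linarith
        also have "\<bar>\<sigma> * t\<bar> = t" using \<sigma> t by (simp add: abs_mult)
        finally have "norm y \<le> 4 * t" using y d unfolding mem by linarith
        then show "y \<in> ball 0 r" using r by (simp add: t_def)
      qed
      show "x - y \<in> \<Omega>" if "x \<in> \<Omega>" "y \<in> cbox a b" for x y
        using \<Omega>[OF t d(1,3) that(1)] that(2) unfolding mem by blast
    qed
  qed
  have tri: "\<bar>norm (vector [x $ 1 - y $ 1, x $ 2 - y $ 2] :: real ^ 2) - norm (vector [x $ 1, x $ 2] :: real ^ 2)\<bar> \<le> 2 * d"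
    if "\<bar>y $ 1\<bar> \<le> d" "\<bar>y $ 2\<bar> \<le> d" for x y :: "real ^ 3" and d
  proof -
    let ?y = "vector [y $ 1, y $ 2] :: real ^ 2" and ?x = "vector [x $ 1, x $ 2] :: real ^ 2"
    have "vector [x $ 1 - y $ 1, x $ 2 - y $ 2] = ?x - ?y" by (simp add: vec_eq_iff forall_2)
    then have "\<bar>norm (vector [x $ 1 - y $ 1, x $ 2 - y $ 2] :: real ^ 2) - norm ?x\<bar> \<le> norm ?y"
      using norm_triangle_ineq3[of "?x - ?y" ?x] by simp
    also have "\<dots> \<le> 2 * d" using norm_le_l1_cart[of ?y] that by (simp add: sum_2)
    finally show ?thesis .
  qed
  have tri': "\<bar>c * norm (vector [x $ 1 - y $ 1, x $ 2 - y $ 2] :: real ^ 2) - c * norm (vector [x $ 1, x $ 2] :: real ^ 2)\<bar> \<le> 2 * d * c"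
    if "\<bar>y $ 1\<bar> \<le> d" "\<bar>y $ 2\<bar> \<le> d" for x y :: "real ^ 3" and d
    using mult_left_mono[OF tri[OF that, of x], of c] c by (simp add: abs_mult mult_ac flip: right_diff_distrib)
  have "\<exists>\<eta>. shift_kernel (Omega1 \<theta>) r \<eta>" if "r > 0" for r
  proof (rule ex[OF that, of _ "-1"])
    fix t d :: real and x y :: "real ^ 3"
    assume "2 * d * c \<le> t - d" "x \<in> Omega1 \<theta>" "\<bar>y $ 1\<bar> \<le> d" "\<bar>y $ 2\<bar> \<le> d" "\<bar>y $ 3 - - 1 * t\<bar> \<le> d"
    then show "x - y \<in> Omega1 \<theta>" using tri'[of y d x] by (simp add: Omega_eq c_def[symmetric])
  qed simp
  then show "shiftable (Omega1 \<theta>)" by (simp add: shiftable_def)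
  have "\<exists>\<eta>. shift_kernel (Omega2 \<theta>) r \<eta>" if "r > 0" for r
  proof (rule ex[OF that, of _ 1])
    fix t d :: real and x y :: "real ^ 3"
    assume "2 * d * c \<le> t - d" "x \<in> Omega2 \<theta>" "\<bar>y $ 1\<bar> \<le> d" "\<bar>y $ 2\<bar> \<le> d" "\<bar>y $ 3 - 1 * t\<bar> \<le> d"
    then show "x - y \<in> Omega2 \<theta>" using tri'[of y d x] by (simp add: Omega_eq c_def[symmetric])
  qed auto
  then show "shiftable (Omega2 \<theta>)" by (simp add: shiftable_def)
  have "\<exists>\<eta>. shift_kernel UNIV r \<eta>" if "r > 0" for r by (rule ex[OF that, of _ 1]) auto
  then show "shiftable UNIV" by (simp add: shiftable_def)
qed

lemma cone_null: "AE x in lborel. x \<in> Omega1 \<theta> \<or> x \<in> Omega2 \<theta>"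
proof -
  have "AE x in lborel \<Otimes>\<^sub>M lborel. snd (x :: (real ^ 2) \<times> real) \<noteq> 0"
  proof (rule AE_I[of _ _ "UNIV \<times> {0}"])
    show "{x \<in> space (lborel \<Otimes>\<^sub>M lborel). \<not> snd (x :: (real ^ 2) \<times> real) \<noteq> 0} \<subseteq> UNIV \<times> {0}" by auto
    show "emeasure (lborel \<Otimes>\<^sub>M lborel) ((UNIV :: (real ^ 2) set) \<times> {0 :: real}) = 0"
      by (subst lborel.emeasure_pair_measure_Times) auto
  qed (auto intro: pair_measureI)
  then have "AE x in lborel. snd (x :: (real ^ 2) \<times> real) \<noteq> 0" by (simp only: lborel_prod)
  then have "AE x in lborel. shear (cot \<theta>) x \<in> Omega1 \<theta> \<or> shear (cot \<theta>) x \<in> Omega2 \<theta>"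
    by eventually_elim auto
  then have "AE x in distr lborel borel (shear (cot \<theta>)). x \<in> Omega1 \<theta> \<or> x \<in> Omega2 \<theta>"
    by (subst AE_distr_iff) auto
  then show ?thesis by (simp only: distr_shear)
qed

subsection \<open>Surface integrals\<close>

lemma cone_param_measurable [measurable]: "cone_param \<theta> \<in> borel_measurable borel"
proof -
  have "(\<lambda>p. shear (cot \<theta>) (p, 0)) \<in> borel_measurable borel"
    by (intro borel_measurable_continuous_onI continuous_on_compose2[OF shear_continuous[of UNIV]] continuous_intros) auto
  then show ?thesis by (simp add: cone_param_shear[abs_def])
qed

lemma cone_param_surface: "cone_param \<theta> \<in> density lborel (\<lambda>_. ennreal k) \<rightarrow>\<^sub>M restrict_space borel (cone_surface \<theta>)"
  by (rule measurable_restrict_space2) (auto simp: cone_surface_def)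

lemma sqrt_cot: "0 < \<theta> \<Longrightarrow> \<theta> < pi / 2 \<Longrightarrow> sqrt (1 + (cot \<theta>)\<^sup>2) = 1 / sin \<theta>"
proof -
  assume \<theta>: "0 < \<theta>" "\<theta> < pi / 2"
  then have s: "sin \<theta> > 0" by (intro sin_gt_zero) auto
  have "1 + (cot \<theta>)\<^sup>2 = (1 / sin \<theta>)\<^sup>2" using s sin_cos_squared_add[of \<theta>] by (simp add: cot_def field_simps)
  then show ?thesis using s by simp
qed

lemma surface_integral:
  fixes g :: "real ^ 3 \<Rightarrow> 'b::{banach, second_countable_topology}"
  assumes \<theta>: "0 < \<theta>" "\<theta> < pi / 2" and g: "g \<in> borel_measurable (surface_measure \<theta>)"
  shows "(\<integral>x. g x \<partial>surface_measure \<theta>) = (1 / sin \<theta>) *\<^sub>R (\<integral>p. g (cone_param \<theta> p) \<partial>lborel)"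
    "integrable (surface_measure \<theta>) g \<longleftrightarrow> integrable lborel (\<lambda>p. g (cone_param \<theta> p))"
    "(\<lambda>p. g (cone_param \<theta> p)) \<in> borel_measurable borel"
proof -
  have s: "sin \<theta> > 0" using \<theta> by (intro sin_gt_zero) auto
  let ?d = "density lborel (\<lambda>_. ennreal (sqrt (1 + (cot \<theta>)\<^sup>2)))"
  have g': "g \<in> borel_measurable (restrict_space borel (cone_surface \<theta>))" using g by (simp add: surface_measure_def)
  have "(\<lambda>p. g (cone_param \<theta> p)) \<in> borel_measurable ?d" by (rule measurable_compose[OF cone_param_surface g'])
  then show m: "(\<lambda>p. g (cone_param \<theta> p)) \<in> borel_measurable borel" by simp
  have "(\<integral>x. g x \<partial>surface_measure \<theta>) = (\<integral>p. g (cone_param \<theta> p) \<partial>?d)"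
    unfolding surface_measure_def by (rule integral_distr[OF cone_param_surface g'])
  also have "\<dots> = (\<integral>p. sqrt (1 + (cot \<theta>)\<^sup>2) *\<^sub>R g (cone_param \<theta> p) \<partial>lborel)"
    using m by (intro integral_density) auto
  finally show "(\<integral>x. g x \<partial>surface_measure \<theta>) = (1 / sin \<theta>) *\<^sub>R (\<integral>p. g (cone_param \<theta> p) \<partial>lborel)"
    using sqrt_cot[OF \<theta>] by simp
  have "integrable (surface_measure \<theta>) g \<longleftrightarrow> integrable ?d (\<lambda>p. g (cone_param \<theta> p))"
    unfolding surface_measure_def by (rule integrable_distr_eq[OF cone_param_surface g'])
  also have "\<dots> \<longleftrightarrow> integrable lborel (\<lambda>p. sqrt (1 + (cot \<theta>)\<^sup>2) *\<^sub>R g (cone_param \<theta> p))"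
    using m by (intro integrable_density) auto
  finally show "integrable (surface_measure \<theta>) g \<longleftrightarrow> integrable lborel (\<lambda>p. g (cone_param \<theta> p))"
    using sqrt_cot[OF \<theta>] integrable_scaleR_right[of "sin \<theta>" lborel "\<lambda>p. (1 / sin \<theta>) *\<^sub>R g (cone_param \<theta> p)"] s by auto
qed

lemma continuous_surface_measurable: "continuous_on UNIV g \<Longrightarrow> g \<in> borel_measurable (surface_measure \<theta>)"
  unfolding surface_measure_def by (simp, intro measurable_restrict_space1 borel_measurable_continuous_onI)

section \<open>Boundary integrals of test functions\<close>

text \<open>The partial derivatives of \<open>|\<phi>|\<^sup>2\<close>.\<close>

definition dsq :: "(real ^ 3 \<Rightarrow> complex) \<Rightarrow> 3 \<Rightarrow> real ^ 3 \<Rightarrow> real" where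
  "dsq \<phi> i x = 2 * Re (cnj (\<phi> x) * partial i \<phi> x)"

lemma dsq_curve:
  assumes \<phi>: "smooth \<phi>" and \<gamma>: "(\<gamma> has_vector_derivative v) (at t)"
  shows "((\<lambda>t. (cmod (\<phi> (\<gamma> t)))\<^sup>2) has_real_derivative (\<Sum>i\<in>UNIV. v $ i * dsq \<phi> i (\<gamma> t))) (at t)"
proof -
  have "((\<lambda>t. \<phi> (\<gamma> t)) has_derivative (\<lambda>h. \<Sum>i\<in>UNIV. of_real ((h *\<^sub>R v) $ i) * partial i \<phi> (\<gamma> t))) (at t)"
    using has_derivative_compose[OF \<gamma>[unfolded has_vector_derivative_def] smooth_has_derivative[OF \<phi>]] .
  from has_derivative_inner[OF this this]
  have "((\<lambda>t. \<phi> (\<gamma> t) \<bullet> \<phi> (\<gamma> t)) has_derivative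
     (\<lambda>h. 2 * (\<phi> (\<gamma> t) \<bullet> (\<Sum>i\<in>UNIV. of_real ((h *\<^sub>R v) $ i) * partial i \<phi> (\<gamma> t))))) (at t)"
    by (simp add: inner_commute)
  moreover have "2 * (\<phi> (\<gamma> t) \<bullet> (\<Sum>i\<in>UNIV. of_real ((h *\<^sub>R v) $ i) * partial i \<phi> (\<gamma> t))) = (\<Sum>i\<in>UNIV. v $ i * dsq \<phi> i (\<gamma> t)) * h" for h
    by (simp add: inner_sum_right inner_complex_def dsq_def sum_distrib_left sum_distrib_right algebra_simps flip: sum.distrib)
  ultimately show ?thesis
    unfolding has_field_derivative_def power2_norm_eq_inner by simp
qed

lemma dsq_continuous:
  assumes "smooth \<phi>"
  shows "continuous_on A (dsq \<phi> i)"
  unfolding dsq_def[abs_def]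
  by (intro continuous_intros continuous_on_subset[OF smooth_continuous[OF assms]] continuous_on_subset[OF smooth_continuous[OF smooth_partial[OF assms]]]) auto

lemma dsq_integrable:
  assumes "\<phi> \<in> test_functions UNIV"
  shows "integrable lborel (dsq \<phi> i)"
proof (rule L2_mult_integrable[OF test_L2[OF assms] L2_cmult[OF test_L2[OF test_partial[OF assms]], of 2]])
  show "dsq \<phi> i \<in> borel_measurable lborel"
    by (simp, intro borel_measurable_continuous_onI dsq_continuous test_smooth[OF assms])
  show "norm (dsq \<phi> i x) \<le> cmod (\<phi> x) * cmod (2 * partial i \<phi> x)" for x
    using abs_Re_le_cmod[of "cnj (\<phi> x) * partial i \<phi> x"] by (simp add: dsq_def norm_mult abs_mult)
qed

lemma integral_derivative_half_line:
  fixes F f :: "real \<Rightarrow> real"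
  assumes F: "\<And>s. (F has_real_derivative f s) (at s)" and f: "continuous_on UNIV f"
    and B: "B > 0" "\<And>s. \<bar>s\<bar> \<ge> B \<Longrightarrow> F s = 0" "\<And>s. \<bar>s\<bar> \<ge> B \<Longrightarrow> f s = 0"
  shows "(\<integral>s. (if s < 0 then f s else 0) \<partial>lborel) = F 0" "(\<integral>s. (if s > 0 then f s else 0) \<partial>lborel) = - F 0"
proof -
  have c: "isCont f x" for x using f by (simp add: continuous_on_eq_continuous_at)
  have [measurable]: "f \<in> borel_measurable borel" using f by (rule borel_measurable_continuous_onI)
  have n0: "AE s in lborel. s \<noteq> (0::real)" by (rule AE_lborel_singleton)
  have "(\<integral>s. f s * indicator {-B..0} s \<partial>lborel) = F 0 - F (- B)"
    using B(1) F c by (intro integral_FTC_Icc_real) auto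
  moreover have "(\<integral>s. (if s < 0 then f s else 0) \<partial>lborel) = (\<integral>s. f s * indicator {-B..0} s \<partial>lborel)"
    by (rule integral_cong_AE) (use n0 B(3) in \<open>auto simp: indicator_def elim!: eventually_mono\<close>)
  ultimately show "(\<integral>s. (if s < 0 then f s else 0) \<partial>lborel) = F 0" using B(2)[of "- B"] B(1) by simp
  have "(\<integral>s. f s * indicator {0..B} s \<partial>lborel) = F B - F 0"
    using B(1) F c by (intro integral_FTC_Icc_real) auto
  moreover have "(\<integral>s. (if s > 0 then f s else 0) \<partial>lborel) = (\<integral>s. f s * indicator {0..B} s \<partial>lborel)"
    by (rule integral_cong_AE) (use n0 B(3) in \<open>auto simp: indicator_def elim!: eventually_mono\<close>)
  ultimately show "(\<integral>s. (if s > 0 then f s else 0) \<partial>lborel) = - F 0" using B(2)[of B] B(1) by simp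
qed

lemma fst_snd_borel [measurable]:
  "fst \<in> borel_measurable (borel :: ((real ^ 2) \<times> real) measure)" "snd \<in> borel_measurable (borel :: ((real ^ 2) \<times> real) measure)"
  by (intro borel_measurable_continuous_onI continuous_intros)+

lemma integral_pair:
  fixes f :: "(real ^ 2) \<times> real \<Rightarrow> 'b::{banach, second_countable_topology}"
  assumes "integrable lborel f"
  shows "(\<integral>x. f x \<partial>lborel) = (\<integral>p. (\<integral>s. f (p, s) \<partial>lborel) \<partial>lborel)"
  using lborel_pair.integral_fst'[of f] assms by (simp only: lborel_prod)

text \<open>The fundamental theorem of calculus on vertical lines.\<close>

lemma vertical_identity:
  assumes \<phi>: "\<phi> \<in> test_functions UNIV"
  shows "(\<integral>x. dsq \<phi> 3 x \<partial>leb (Omega2 \<theta>)) = (\<integral>p. (cmod (\<phi> (cone_param \<theta> p)))\<^sup>2 \<partial>lborel)"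
    "(\<integral>x. dsq \<phi> 3 x \<partial>leb (Omega1 \<theta>)) = - (\<integral>p. (cmod (\<phi> (cone_param \<theta> p)))\<^sup>2 \<partial>lborel)"
proof -
  define c where "c = cot \<theta>"
  have sO: "shear c x \<in> Omega1 \<theta> \<longleftrightarrow> snd x > 0" "shear c x \<in> Omega2 \<theta> \<longleftrightarrow> snd x < 0" for x by (simp_all add: c_def)
  note sm = test_smooth[OF \<phi>]
  have [measurable]: "dsq \<phi> 3 \<in> borel_measurable borel" by (intro borel_measurable_continuous_onI dsq_continuous sm)
  obtain K where K: "compact K" "\<And>x. x \<notin> K \<Longrightarrow> \<phi> x = 0" using \<phi> by (rule test_functionsE) blast
  obtain R where R: "R > 0" "\<And>x. x \<in> K \<Longrightarrow> norm x \<le> R" using compact_imp_bounded[OF K(1)] unfolding bounded_pos by blast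
  have line: "(\<integral>s. (if s < 0 then dsq \<phi> 3 (shear c (p, s)) else 0) \<partial>lborel) = (cmod (\<phi> (shear c (p, 0))))\<^sup>2"
    "(\<integral>s. (if s > 0 then dsq \<phi> 3 (shear c (p, s)) else 0) \<partial>lborel) = - (cmod (\<phi> (shear c (p, 0))))\<^sup>2" for p
  proof -
    define a where "a = shear c (p, 0)"
    have sh: "(\<lambda>s. shear c (p, s)) = (\<lambda>s. a + s *\<^sub>R axis 3 1)"
      by (auto simp: vec_eq_iff forall_3 axis_def a_def)
    have d: "((\<lambda>s. (cmod (\<phi> (shear c (p, s))))\<^sup>2) has_real_derivative dsq \<phi> 3 (shear c (p, s))) (at s)" for s
    proof -
      have "((\<lambda>s. shear c (p, s)) has_vector_derivative (axis 3 1)) (at s)"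
        unfolding sh by (auto intro!: derivative_eq_intros)
      from dsq_curve[OF sm this] show ?thesis by (simp add: sum_3 axis_def)
    qed
    have cont: "continuous_on UNIV (\<lambda>s. dsq \<phi> 3 (shear c (p, s)))"
      by (rule continuous_on_compose2[OF dsq_continuous[OF sm, of UNIV] continuous_on_compose2[OF shear_continuous[of UNIV]]])
         (auto intro!: continuous_intros)
    have out: "\<phi> (shear c (p, s)) = 0" if "\<bar>s\<bar> \<ge> R + 1 + \<bar>c\<bar> * norm p" for s
    proof (rule K(2), rule notI)
      assume "shear c (p, s) \<in> K"
      then have "norm (shear c (p, s)) \<le> R" by (rule R(2))
      then have "\<bar>c * norm p + s\<bar> \<le> R" using component_le_norm_cart[of "shear c (p, s)" 3] by simp
      moreover have "\<bar>c * norm p\<bar> = \<bar>c\<bar> * norm p" by (simp add: abs_mult)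
      ultimately show False using that by linarith
    qed
    have pos: "R + 1 + \<bar>c\<bar> * norm p > 0" using R(1) by (simp add: add_pos_nonneg)
    show "(\<integral>s. (if s < 0 then dsq \<phi> 3 (shear c (p, s)) else 0) \<partial>lborel) = (cmod (\<phi> (shear c (p, 0))))\<^sup>2"
      "(\<integral>s. (if s > 0 then dsq \<phi> 3 (shear c (p, s)) else 0) \<partial>lborel) = - (cmod (\<phi> (shear c (p, 0))))\<^sup>2"
      by (rule integral_derivative_half_line[OF d cont pos]; simp add: out dsq_def)+
  qed
  have int: "integrable lborel (\<lambda>x. dsq \<phi> 3 (shear c x))"
    using dsq_integrable[OF \<phi>] integral_shear(2)[of "dsq \<phi> 3" c] by simp
  have m: "(\<lambda>x. if snd x < 0 then dsq \<phi> 3 (shear c x) else 0) \<in> borel_measurable borel"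
    "(\<lambda>x. if snd x > 0 then dsq \<phi> 3 (shear c x) else 0) \<in> borel_measurable borel" by measurable
  have half: "integrable lborel (\<lambda>x. if snd x < 0 then dsq \<phi> 3 (shear c x) else 0)"
    "integrable lborel (\<lambda>x. if snd x > 0 then dsq \<phi> 3 (shear c x) else 0)"
    by (rule Bochner_Integration.integrable_bound[OF int]; use m in simp)+
  have m2: "ext0 (Omega2 \<theta>) (dsq \<phi> 3) \<in> borel_measurable borel" "ext0 (Omega1 \<theta>) (dsq \<phi> 3) \<in> borel_measurable borel"
    unfolding ext0_def[abs_def] by measurable
  have "(\<integral>x. dsq \<phi> 3 x \<partial>leb (Omega2 \<theta>)) = (\<integral>x. (if snd x < 0 then dsq \<phi> 3 (shear c x) else 0) \<partial>lborel)"
    by (simp add: leb_integral integral_shear(1)[OF m2(1), of c]) (simp add: ext0_def sO)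
  also have "\<dots> = (\<integral>p. (cmod (\<phi> (cone_param \<theta> p)))\<^sup>2 \<partial>lborel)"
    unfolding integral_pair[OF half(1)] by (simp add: line cone_param_shear c_def)
  finally show "(\<integral>x. dsq \<phi> 3 x \<partial>leb (Omega2 \<theta>)) = (\<integral>p. (cmod (\<phi> (cone_param \<theta> p)))\<^sup>2 \<partial>lborel)" .
  have "(\<integral>x. dsq \<phi> 3 x \<partial>leb (Omega1 \<theta>)) = (\<integral>x. (if snd x > 0 then dsq \<phi> 3 (shear c x) else 0) \<partial>lborel)"
    by (simp add: leb_integral integral_shear(1)[OF m2(2), of c]) (simp add: ext0_def sO)
  also have "\<dots> = - (\<integral>p. (cmod (\<phi> (cone_param \<theta> p)))\<^sup>2 \<partial>lborel)"
    unfolding integral_pair[OF half(2)] by (simp add: line cone_param_shear c_def)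
  finally show "(\<integral>x. dsq \<phi> 3 x \<partial>leb (Omega1 \<theta>)) = - (\<integral>p. (cmod (\<phi> (cone_param \<theta> p)))\<^sup>2 \<partial>lborel)" .
qed

text \<open>Translation invariance makes the integrals of the difference quotients vanish.\<close>

lemma integral_directional_derivative:
  fixes f d :: "'a::euclidean_space \<Rightarrow> real"
  assumes [measurable]: "f \<in> borel_measurable borel" "d \<in> borel_measurable borel"
    and K: "compact K" "\<And>x. x \<notin> K \<Longrightarrow> f x = 0" and B: "\<And>x. \<bar>f x\<bar> \<le> B"
    and L: "\<And>x t. \<bar>t\<bar> \<le> 1 \<Longrightarrow> \<bar>f (x + t *\<^sub>R b) - f x\<bar> \<le> L * \<bar>t\<bar>"
    and d: "AE x in lborel. ((\<lambda>t. f (x + t *\<^sub>R b)) has_real_derivative d x) (at 0)"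
  shows "integrable lborel d" "(\<integral>x. d x \<partial>lborel) = 0"
proof -
  define t where "t n = 1 / real (Suc n)" for n
  have t: "0 < t n" "t n \<le> 1" for n by (auto simp: t_def)
  have t0: "t \<longlonglongrightarrow> 0" unfolding t_def by (rule LIMSEQ_inverse_real_of_nat[unfolded inverse_eq_divide])
  define S where "S n x = (f (x + t n *\<^sub>R b) - f x) / t n" for n x
  define K' where "K' = (\<lambda>(x, s). x - s *\<^sub>R b) ` (K \<times> {0..1})"
  have K': "compact K'" unfolding K'_def case_prod_beta by (intro compact_continuous_image compact_Times K continuous_intros) auto
  have L0: "L \<ge> 0" using L[of 1 0] by simp
  have out: "S n x = 0" if "x \<notin> K'" for n x
  proof -
    have "x - 0 *\<^sub>R b \<in> K'" if "x \<in> K" using that unfolding K'_def by force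
    then have "x \<notin> K" using that by auto
    moreover have "x + t n *\<^sub>R b \<notin> K"
    proof
      assume "x + t n *\<^sub>R b \<in> K"
      then have "(\<lambda>(x, s). x - s *\<^sub>R b) (x + t n *\<^sub>R b, t n) \<in> K'" unfolding K'_def using t[of n] by (intro imageI) auto
      then show False using that by simp
    qed
    ultimately show ?thesis using K(2) by (simp add: S_def)
  qed
  have fint: "integrable lborel f"
  proof (rule Bochner_Integration.integrable_bound)
    show "integrable lborel (\<lambda>x. B * indicat_real K x)"
      using K(1) by (intro integrable_mult_right integrable_real_indicator emeasure_compact_finite) (auto intro: borel_compact)
    show "AE x in lborel. norm (f x) \<le> norm (B * indicat_real K x)"
    proof (rule AE_I2)
      fix x show "norm (f x) \<le> norm (B * indicat_real K x)" using K(2)[of x] B[of x] by (auto simp: indicator_def)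
    qed
  qed simp
  have wint: "integrable lborel (\<lambda>x. L * indicat_real K' x)"
    using K' by (intro integrable_mult_right integrable_real_indicator emeasure_compact_finite) (auto intro: borel_compact)
  have bound: "AE x in lborel. norm (S n x) \<le> L * indicat_real K' x" for n
  proof (rule AE_I2)
    fix x show "norm (S n x) \<le> L * indicat_real K' x"
      using L[of "t n" x] t[of n] out[of x n] L0 by (auto simp: S_def indicator_def field_simps)
  qed
  have lim: "AE x in lborel. (\<lambda>n. S n x) \<longlonglongrightarrow> d x"
    using d
  proof eventually_elim
    fix x assume "((\<lambda>t. f (x + t *\<^sub>R b)) has_real_derivative d x) (at 0)"
    then have "((\<lambda>h. (f (x + h *\<^sub>R b) - f x) / h) \<longlongrightarrow> d x) (at 0)" by (simp add: DERIV_def)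
    moreover have "filterlim t (at 0) sequentially"
      unfolding filterlim_at using t0 t by (auto simp: less_imp_neq[symmetric] intro: always_eventually)
    ultimately show "(\<lambda>n. S n x) \<longlonglongrightarrow> d x" unfolding S_def by (rule filterlim_compose)
  qed
  have Sm: "S n \<in> borel_measurable lborel" for n unfolding S_def[abs_def] by measurable
  have dm: "d \<in> borel_measurable lborel" by simp
  show "integrable lborel d" by (rule integrable_dominated_convergence[OF dm Sm wint lim bound])
  have "(\<lambda>n. \<integral>x. S n x \<partial>lborel) \<longlonglongrightarrow> (\<integral>x. d x \<partial>lborel)" by (rule integral_dominated_convergence[OF dm Sm wint lim bound])
  moreover have "(\<integral>x. S n x \<partial>lborel) = 0" for n
  proof -
    have sh: "distr lborel borel (\<lambda>x. x + t n *\<^sub>R b) = lborel" using lborel_distr_shift[of "- t n *\<^sub>R b"] by simp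
    have "integrable (distr lborel borel (\<lambda>x. x + t n *\<^sub>R b)) f" using fint by (simp add: sh)
    then have i: "integrable lborel (\<lambda>x. f (x + t n *\<^sub>R b))" by (subst (asm) integrable_distr_eq) auto
    have "(\<integral>x. f x \<partial>lborel) = (\<integral>x. f x \<partial>(distr lborel borel (\<lambda>x. x + t n *\<^sub>R b)))" by (simp add: sh)
    also have "\<dots> = (\<integral>x. f (x + t n *\<^sub>R b) \<partial>lborel)" by (rule integral_distr) auto
    finally show ?thesis using i fint by (simp add: S_def)
  qed
  ultimately show "(\<integral>x. d x \<partial>lborel) = 0" by (simp add: LIMSEQ_const_iff)
qed

lemma norm_line_derivative:
  assumes "(p :: real ^ 2) \<noteq> 0"
  shows "((\<lambda>t. norm (p + t *\<^sub>R axis i 1)) has_real_derivative (p $ i / norm p)) (at 0)"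
proof -
  have "((\<lambda>t. p + t *\<^sub>R axis i 1) has_derivative (\<lambda>t. t *\<^sub>R axis i 1)) (at 0)" by (auto intro!: derivative_eq_intros)
  from has_derivative_compose[OF this, of norm "\<lambda>h. sgn p \<bullet> h"]
  have "((\<lambda>t. norm (p + t *\<^sub>R axis i 1)) has_derivative (\<lambda>t. sgn p \<bullet> (t *\<^sub>R axis i 1))) (at 0)"
    using has_derivative_norm[OF assms] by (simp add: inner_commute)
  moreover have "(\<lambda>t. sgn p \<bullet> (t *\<^sub>R axis i 1)) = (*) (p $ i / norm p)"
    by (auto simp: inner_axis sgn_div_norm divide_inverse mult_ac)
  ultimately show ?thesis unfolding has_field_derivative_def by simp
qed

lemma AE_fst_nonzero: "AE x in lborel. fst (x :: (real ^ 2) \<times> real) \<noteq> 0"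
proof -
  have "AE x in lborel \<Otimes>\<^sub>M lborel. fst (x :: (real ^ 2) \<times> real) \<noteq> 0"
  proof (rule AE_I[of _ _ "{0} \<times> UNIV"])
    show "{x \<in> space (lborel \<Otimes>\<^sub>M lborel). \<not> fst (x :: (real ^ 2) \<times> real) \<noteq> 0} \<subseteq> {0} \<times> UNIV" by auto
    show "emeasure (lborel \<Otimes>\<^sub>M lborel) ({0 :: real ^ 2} \<times> (UNIV :: real set)) = 0"
      by (subst lborel.emeasure_pair_measure_Times) auto
  qed (auto intro: pair_measureI)
  then show ?thesis by (simp only: lborel_prod)
qed

text \<open>The derivative of \<open>|\<phi>|\<^sup>2\<close> along the generating lines of the translated cones. Its integral over
  \<open>\<Omega>\<^sub>2\<close> is nonpositive because moving along these lines expands volume: the field \<open>p / (\<epsilon> + |p|)\<close> has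
  nonnegative divergence, and \<open>\<epsilon>\<close> tends to \<open>0\<close>.\<close>

lemma tangential_integral_nonpos:
  fixes i :: 2 and j :: 3 and c :: real
  assumes \<phi>: "\<phi> \<in> test_functions UNIV" and ij: "i = 1 \<and> j = 1 \<or> i = 2 \<and> j = 2"
  defines "w \<equiv> \<lambda>x. dsq \<phi> j (shear c x) + c * (fst x $ i / norm (fst x)) * dsq \<phi> 3 (shear c x)"
  shows "integrable lborel (\<lambda>x. if snd x < 0 then (fst x $ i / norm (fst x)) * w x else 0)"
    "(\<integral>x. (if snd x < 0 then (fst x $ i / norm (fst x)) * w x else 0) \<partial>lborel) \<le> 0"
proof -
  note sm = test_smooth[OF \<phi>]
  have [measurable]: "dsq \<phi> k \<in> borel_measurable borel" for k by (intro borel_measurable_continuous_onI dsq_continuous sm)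
  have [measurable]: "\<phi> \<in> borel_measurable borel" using test_measurable[OF \<phi>] .
  have [measurable]: "(\<lambda>x :: (real ^ 2) \<times> real. fst x $ i) \<in> borel_measurable borel" "(\<lambda>x :: (real ^ 2) \<times> real. norm (fst x)) \<in> borel_measurable borel"
    by (intro borel_measurable_continuous_onI continuous_intros)+
  have [measurable]: "w \<in> borel_measurable borel" unfolding w_def by measurable
  have r1: "\<bar>p $ i / norm p\<bar> \<le> 1" for p :: "real ^ 2"
    using component_le_norm_cart[of p i] by (cases "p = 0") (auto simp: field_simps)
  have wbound: "\<bar>w x\<bar> \<le> \<bar>dsq \<phi> j (shear c x)\<bar> + \<bar>c\<bar> * \<bar>dsq \<phi> 3 (shear c x)\<bar>" for x
  proof -
    have "\<bar>c * (fst x $ i / norm (fst x)) * dsq \<phi> 3 (shear c x)\<bar> \<le> \<bar>c\<bar> * 1 * \<bar>dsq \<phi> 3 (shear c x)\<bar>"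
      unfolding abs_mult by (intro mult_mono r1) auto
    then show ?thesis unfolding w_def by linarith
  qed
  have sint: "integrable lborel (\<lambda>x. dsq \<phi> k (shear c x))" for k
    using dsq_integrable[OF \<phi>, of k] integral_shear(2)[of "dsq \<phi> k" c] by simp
  have wint: "integrable lborel (\<lambda>x. \<bar>dsq \<phi> j (shear c x)\<bar> + \<bar>c\<bar> * \<bar>dsq \<phi> 3 (shear c x)\<bar>)"
    by (intro Bochner_Integration.integrable_add integrable_mult_right integrable_abs sint)
  define h where "h e x = fst x $ i / (e + norm (fst x))" for e :: real and x :: "(real ^ 2) \<times> real"
  define G where "G x = (if snd x < 0 then (fst x $ i / norm (fst x)) * w x else 0)" for x
  define Ge where "Ge e x = (if snd x < 0 then h e x * w x else 0)" for e x
  have h1: "\<bar>h e x\<bar> \<le> 1" if "e > 0" for e x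
    using component_le_norm_cart[of "fst x" i] that by (simp add: h_def field_simps)
  have Gm: "G \<in> borel_measurable lborel" "Ge e \<in> borel_measurable lborel" for e
    unfolding G_def[abs_def] Ge_def[abs_def] h_def[abs_def] by measurable
  have Gb: "norm (G x) \<le> \<bar>dsq \<phi> j (shear c x)\<bar> + \<bar>c\<bar> * \<bar>dsq \<phi> 3 (shear c x)\<bar>" for x
  proof -
    have "\<bar>(fst x $ i / norm (fst x)) * w x\<bar> \<le> 1 * \<bar>w x\<bar>" unfolding abs_mult by (intro mult_right_mono r1) auto
    then show ?thesis using wbound[of x] by (auto simp: G_def)
  qed
  have Geb: "norm (Ge e x) \<le> \<bar>dsq \<phi> j (shear c x)\<bar> + \<bar>c\<bar> * \<bar>dsq \<phi> 3 (shear c x)\<bar>" if "e > 0" for e x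
  proof -
    have "\<bar>h e x * w x\<bar> \<le> 1 * \<bar>w x\<bar>" unfolding abs_mult by (intro mult_right_mono h1 that) auto
    then show ?thesis using wbound[of x] by (auto simp: Ge_def)
  qed
  show Gi: "integrable lborel (\<lambda>x. if snd x < 0 then (fst x $ i / norm (fst x)) * w x else 0)"
    using Bochner_Integration.integrable_bound[OF wint Gm(1)] Gb by (simp add: G_def[abs_def])
  have Gei: "integrable lborel (Ge e)" if "e > 0" for e
    using Bochner_Integration.integrable_bound[OF wint Gm(2)[of e]] Geb[OF that] by fastforce
  have neg: "(\<integral>x. Ge e x \<partial>lborel) \<le> 0" if e: "e > 0" for e
  proof -
    define u where "u x = (cmod (\<phi> (shear c x)))\<^sup>2" for x
    have [measurable]: "u \<in> borel_measurable borel" unfolding u_def[abs_def] by measurable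
    define f where "f x = (if snd x < 0 then h e x * u x else 0)" for x
    define A where "A x = (if snd x < 0 then (e + norm (fst x) - (fst x $ i)\<^sup>2 / norm (fst x)) / (e + norm (fst x))\<^sup>2 * u x else 0)" for x
    define b :: "(real ^ 2) \<times> real" where "b = (axis i 1, 0)"
    obtain M where M: "M > 0" "\<And>x. cmod (\<phi> x) \<le> M" using \<phi> by (rule test_bounded) blast
    obtain L where L: "L > 0" "\<And>x y. cmod (\<phi> x - \<phi> y) \<le> L * norm (x - y)" using \<phi> by (rule test_Lipschitz) blast
    obtain K where K: "compact K" "\<And>x. x \<notin> K \<Longrightarrow> \<phi> x = 0" using \<phi> by (rule test_functionsE) blast
    define inv where "inv y = (vector [y $ 1, y $ 2] :: real ^ 2, y $ 3 - c * norm (vector [y $ 1, y $ 2] :: real ^ 2))" for y :: "real ^ 3"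
    have inv: "inv (shear c x) = x" for x
    proof -
      have "vector [fst x $ 1, fst x $ 2] = fst x" by (simp add: vec_eq_iff forall_2)
      then show ?thesis by (simp add: inv_def prod_eq_iff)
    qed
    have inv_cont: "continuous_on UNIV inv"
    proof -
      have "(\<lambda>y :: real ^ 3. vector [y $ 1, y $ 2] :: real ^ 2) = (\<lambda>y. \<chi> k. if k = 1 then y $ 1 else y $ 2)" by (auto simp: vec_eq_iff forall_2)
      moreover have "continuous_on UNIV (\<lambda>y :: real ^ 3. (\<chi> k :: 2. if k = 1 then y $ 1 else y $ 2))"
      proof (rule continuous_on_vec_lambda)
        fix k :: 2 show "continuous_on UNIV (\<lambda>y :: real ^ 3. if k = 1 then y $ 1 else y $ 2)"
          by (cases "k = 1") (auto intro!: continuous_intros)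
      qed
      ultimately have "continuous_on UNIV (\<lambda>y :: real ^ 3. vector [y $ 1, y $ 2] :: real ^ 2)"
        by (rule ssubst[where P = "continuous_on UNIV"])
      then show ?thesis unfolding inv_def by (intro continuous_intros)
    qed
    have u_bound: "0 \<le> u x" "u x \<le> M\<^sup>2" for x using M(2)[of "shear c x"] by (auto simp: u_def intro: power_mono)
    have u_Lip: "\<bar>u (x + t *\<^sub>R b) - u x\<bar> \<le> 2 * M * L * (1 + \<bar>c\<bar>) * \<bar>t\<bar>" for x t
    proof -
      let ?a = "\<phi> (shear c (x + t *\<^sub>R b))" and ?z = "\<phi> (shear c x)"
      have "\<bar>(cmod ?a)\<^sup>2 - (cmod ?z)\<^sup>2\<bar> = \<bar>cmod ?a - cmod ?z\<bar> * (cmod ?a + cmod ?z)"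
        by (simp add: power2_eq_square square_diff_square_factored abs_mult)
      also have "\<dots> \<le> (L * ((1 + \<bar>c\<bar>) * \<bar>t\<bar>)) * (M + M)"
      proof (intro mult_mono add_mono M)
        have "norm (shear c (x + t *\<^sub>R b) - shear c x) \<le> (\<Sum>k\<in>UNIV. \<bar>(shear c (x + t *\<^sub>R b) - shear c x) $ k\<bar>)" by (rule norm_le_l1_cart)
        also have "\<dots> \<le> \<bar>t\<bar> + \<bar>c\<bar> * \<bar>t\<bar>"
        proof -
          have "\<bar>norm (fst x + t *\<^sub>R axis i 1) - norm (fst x)\<bar> \<le> \<bar>t\<bar>"
            using norm_triangle_ineq3[of "fst x + t *\<^sub>R axis i 1" "fst x"] by simp
          then have "\<bar>c * norm (fst x + t *\<^sub>R axis i 1) - c * norm (fst x)\<bar> \<le> \<bar>c\<bar> * \<bar>t\<bar>"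
            by (simp add: abs_mult mult_left_mono flip: right_diff_distrib)
          then show ?thesis using ij by (auto simp: sum_3 b_def axis_def)
        qed
        finally have "norm (shear c (x + t *\<^sub>R b) - shear c x) \<le> (1 + \<bar>c\<bar>) * \<bar>t\<bar>" by (simp add: algebra_simps)
        then have "L * norm (shear c (x + t *\<^sub>R b) - shear c x) \<le> L * ((1 + \<bar>c\<bar>) * \<bar>t\<bar>)" using L(1) by simp
        moreover have "\<bar>cmod ?a - cmod ?z\<bar> \<le> cmod (?a - ?z)" by (rule norm_triangle_ineq3)
        ultimately show "\<bar>cmod ?a - cmod ?z\<bar> \<le> L * ((1 + \<bar>c\<bar>) * \<bar>t\<bar>)" using L(2)[of "shear c (x + t *\<^sub>R b)" "shear c x"] by linarith
      qed (use L M in auto)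
      finally show ?thesis by (simp add: u_def algebra_simps)
    qed
    have h_Lip: "\<bar>h e (x + t *\<^sub>R b) - h e x\<bar> \<le> 2 / e * \<bar>t\<bar>" for x t
    proof -
      define n where "n = norm (fst x)"
      define n' where "n' = norm (fst x + t *\<^sub>R axis i 1)"
      have n: "n \<ge> 0" "n' \<ge> 0" "\<bar>n' - n\<bar> \<le> \<bar>t\<bar>"
        using norm_triangle_ineq3[of "fst x + t *\<^sub>R axis i 1" "fst x"] by (auto simp: n_def n'_def)
      define q where "q = fst x $ i"
      have q: "\<bar>q\<bar> \<le> n" unfolding q_def n_def by (rule component_le_norm_cart)
      have "h e (x + t *\<^sub>R b) - h e x = (q + t) / (e + n') - q / (e + n)"
        by (simp add: h_def b_def axis_def q_def n_def n'_def)
      also have "\<dots> = t / (e + n') + (q / (e + n)) * ((n - n') / (e + n'))"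
        using n e by (simp add: divide_simps) (simp add: algebra_simps)
      finally have "\<bar>h e (x + t *\<^sub>R b) - h e x\<bar> \<le> \<bar>t\<bar> / (e + n') + \<bar>q\<bar> / (e + n) * (\<bar>n - n'\<bar> / (e + n'))"
        using n e abs_triangle_ineq[of "t / (e + n')" "(q / (e + n)) * ((n - n') / (e + n'))"] by (simp add: abs_mult)
      also have "\<dots> \<le> \<bar>t\<bar> / e + 1 * (\<bar>t\<bar> / e)"
        using n e q by (intro add_mono mult_mono frac_le) (auto simp: abs_minus_commute)
      finally show ?thesis by simp
    qed
    have fL: "\<bar>f (x + t *\<^sub>R b) - f x\<bar> \<le> (2 / e * M\<^sup>2 + 2 * M * L * (1 + \<bar>c\<bar>)) * \<bar>t\<bar>" for x t
    proof (cases "snd x < 0")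
      case True
      have "f (x + t *\<^sub>R b) - f x = (h e (x + t *\<^sub>R b) - h e x) * u x + h e (x + t *\<^sub>R b) * (u (x + t *\<^sub>R b) - u x)"
        using True by (simp add: f_def b_def algebra_simps)
      also have "\<bar>\<dots>\<bar> \<le> \<bar>h e (x + t *\<^sub>R b) - h e x\<bar> * \<bar>u x\<bar> + \<bar>h e (x + t *\<^sub>R b)\<bar> * \<bar>u (x + t *\<^sub>R b) - u x\<bar>"
        unfolding abs_mult[symmetric] by (rule abs_triangle_ineq)
      also have "\<dots> \<le> 2 / e * \<bar>t\<bar> * M\<^sup>2 + 1 * (2 * M * L * (1 + \<bar>c\<bar>) * \<bar>t\<bar>)"
        by (intro add_mono mult_mono h_Lip u_Lip h1 e) (use u_bound e in auto)
      finally show ?thesis by (simp add: algebra_simps)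
    next
      case False
      then show ?thesis using M L e by (simp add: f_def b_def)
    qed
    have hu: "\<bar>f x\<bar> \<le> M\<^sup>2" for x
    proof -
      have "\<bar>h e x\<bar> * \<bar>u x\<bar> \<le> 1 * M\<^sup>2" by (intro mult_mono h1 e) (use u_bound in auto)
      then show ?thesis by (auto simp: f_def abs_mult)
    qed
    have supp: "f x = 0" if "x \<notin> inv ` K" for x
    proof -
      have "shear c x \<notin> K" using that inv by (metis image_eqI)
      then show ?thesis using K(2) by (simp add: f_def u_def)
    qed
    have deriv: "((\<lambda>t. f (x + t *\<^sub>R b)) has_real_derivative (A x + Ge e x)) (at 0)" if x0: "fst x \<noteq> 0" for x
    proof (cases "snd x < 0")
      case True
      define n where "n = norm (fst x)"
      have n: "n > 0" using x0 by (simp add: n_def)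
      have dn: "((\<lambda>t. norm (fst x + t *\<^sub>R axis i 1)) has_real_derivative (fst x $ i / n)) (at 0)"
        unfolding n_def by (rule norm_line_derivative[OF x0])
      have heq: "h e (x + t *\<^sub>R b) = (fst x $ i + t) / (e + norm (fst x + t *\<^sub>R axis i 1))" for t
        by (simp add: h_def b_def axis_def)
      have dh: "((\<lambda>t. h e (x + t *\<^sub>R b)) has_real_derivative ((e + n - (fst x $ i)\<^sup>2 / n) / (e + n)\<^sup>2)) (at 0)"
        unfolding heq
        by (rule derivative_eq_intros dn refl)+ (use n e in \<open>auto simp: n_def[symmetric] power2_eq_square field_simps\<close>)
      have sh: "shear c (x + t *\<^sub>R b) = shear c x + t *\<^sub>R axis j 1 + (c * (norm (fst x + t *\<^sub>R axis i 1) - n)) *\<^sub>R axis 3 1" for t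
        using ij by (auto simp: vec_eq_iff forall_3 b_def axis_def n_def algebra_simps)
      have dn': "((\<lambda>t. norm (fst x + t *\<^sub>R axis i 1)) has_vector_derivative (fst x $ i / n)) (at 0)"
        using dn by (simp add: has_real_derivative_iff_has_vector_derivative)
      have "((\<lambda>t. shear c (x + t *\<^sub>R b)) has_vector_derivative (axis j 1 + (c * (fst x $ i / n)) *\<^sub>R axis 3 1)) (at 0)"
        unfolding sh has_vector_derivative_def
        using dn[unfolded has_field_derivative_def]
        by (auto intro!: derivative_eq_intros simp: algebra_simps)
      from dsq_curve[OF sm this]
      have du: "((\<lambda>t. u (x + t *\<^sub>R b)) has_real_derivative w x) (at 0)"
        using ij by (auto simp: sum_3 axis_def w_def u_def n_def)
      have "((\<lambda>t. h e (x + t *\<^sub>R b) * u (x + t *\<^sub>R b)) has_real_derivative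
          ((e + n - (fst x $ i)\<^sup>2 / n) / (e + n)\<^sup>2) * u x + w x * h e x) (at 0)"
        using DERIV_mult[OF dh du] by simp
      then show ?thesis using True by (simp add: f_def A_def Ge_def b_def n_def mult.commute)
    next
      case False
      then show ?thesis by (simp add: f_def A_def Ge_def b_def)
    qed
    have A0: "A x \<ge> 0" for x
    proof -
      have "(fst x $ i)\<^sup>2 / norm (fst x) \<le> norm (fst x)"
      proof (cases "fst x = 0")
        case False
        have "(fst x $ i)\<^sup>2 \<le> (norm (fst x))\<^sup>2" using component_le_norm_cart[of "fst x" i] by (metis abs_ge_zero power2_abs power_mono)
        then show ?thesis using False by (simp add: divide_le_eq power2_eq_square)
      qed simp
      then show ?thesis using e u_bound(1)[of x] by (auto simp: A_def intro!: mult_nonneg_nonneg divide_nonneg_nonneg)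
    qed
    have fm: "f \<in> borel_measurable borel" unfolding f_def[abs_def] h_def by measurable
    have Am: "A \<in> borel_measurable borel" unfolding A_def[abs_def] by measurable
    have dm: "(\<lambda>x. A x + Ge e x) \<in> borel_measurable borel" using Am Gm(2)[of e] by simp
    have cK: "compact (inv ` K)" by (intro compact_continuous_image continuous_on_subset[OF inv_cont] K) auto
    have ae: "AE x in lborel. ((\<lambda>t. f (x + t *\<^sub>R b)) has_real_derivative (A x + Ge e x)) (at 0)"
      using AE_fst_nonzero by eventually_elim (rule deriv)
    note dd = integral_directional_derivative[OF fm dm cK supp hu fL ae]
    have Ai: "integrable lborel A" using Bochner_Integration.integrable_diff[OF dd(1) Gei[OF e]] by simp
    have "(\<integral>x. A x \<partial>lborel) + (\<integral>x. Ge e x \<partial>lborel) = 0" using dd(2) Ai Gei[OF e] by simp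
    moreover have "(\<integral>x. A x \<partial>lborel) \<ge> 0" by (rule Bochner_Integration.integral_nonneg) (rule A0)
    ultimately show ?thesis by linarith
  qed
  have "(\<lambda>n. \<integral>x. Ge (1 / real (Suc n)) x \<partial>lborel) \<longlonglongrightarrow> (\<integral>x. G x \<partial>lborel)"
  proof (rule integral_dominated_convergence[OF Gm(1) Gm(2) wint])
    show "AE x in lborel. norm (Ge (1 / real (Suc n)) x) \<le> \<bar>dsq \<phi> j (shear c x)\<bar> + \<bar>c\<bar> * \<bar>dsq \<phi> 3 (shear c x)\<bar>" for n
      by (intro AE_I2 Geb) simp
    show "AE x in lborel. (\<lambda>n. Ge (1 / real (Suc n)) x) \<longlonglongrightarrow> G x"
      using AE_fst_nonzero
    proof eventually_elim
      fix x :: "(real ^ 2) \<times> real" assume x: "fst x \<noteq> 0"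
      have "(\<lambda>n. fst x $ i / (1 / real (Suc n) + norm (fst x)) * w x) \<longlonglongrightarrow> fst x $ i / (0 + norm (fst x)) * w x"
        by (intro tendsto_intros LIMSEQ_inverse_real_of_nat[unfolded inverse_eq_divide]) (use x in auto)
      then show "(\<lambda>n. Ge (1 / real (Suc n)) x) \<longlonglongrightarrow> G x" by (simp add: Ge_def G_def h_def)
    qed
  qed
  moreover have "(\<integral>x. Ge (1 / real (Suc n)) x \<partial>lborel) \<le> 0" for n by (rule neg) simp
  ultimately have "(\<integral>x. G x \<partial>lborel) \<le> 0" by (intro LIMSEQ_le_const2) auto
  then show "(\<integral>x. (if snd x < 0 then (fst x $ i / norm (fst x)) * w x else 0) \<partial>lborel) \<le> 0" by (simp add: G_def[abs_def])
qed

section \<open>Traces on the cone\<close>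

locale cone =
  fixes \<theta> :: real
  assumes \<theta>: "0 < \<theta>" "\<theta> < pi / 2"
begin

abbreviation "\<sigma> \<equiv> surface_measure \<theta>"

lemma sin_pos: "sin \<theta> > 0" and cos_pos: "cos \<theta> > 0"
  using \<theta> by (auto intro: sin_gt_zero cos_gt_zero)

definition cone_domain :: "(real ^ 3) set \<Rightarrow> bool" where
  "cone_domain \<Omega> \<longleftrightarrow> \<Omega> \<in> {UNIV, Omega1 \<theta>, Omega2 \<theta>}"

lemma cone_domain_shiftable: "cone_domain \<Omega> \<Longrightarrow> shiftable \<Omega>"
  unfolding cone_domain_def using Omega_shiftable[OF \<theta>] by auto

lemma cone_domain_borel: "cone_domain \<Omega> \<Longrightarrow> \<Omega> \<in> sets borel"
  using cone_domain_shiftable shiftable_borel by blast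

lemma cone_domains [simp]: "cone_domain UNIV" "cone_domain (Omega1 \<theta>)" "cone_domain (Omega2 \<theta>)"
  by (auto simp: cone_domain_def)

lemma test_surface_L2:
  assumes \<phi>: "\<phi> \<in> test_functions UNIV"
  shows "\<phi> \<in> L2 \<sigma>" "(L2_norm \<sigma> \<phi>)\<^sup>2 = (1 / sin \<theta>) * (\<integral>p. (cmod (\<phi> (cone_param \<theta> p)))\<^sup>2 \<partial>lborel)"
proof -
  obtain K where K: "compact K" "\<And>x. x \<notin> K \<Longrightarrow> \<phi> x = 0" using \<phi> by (rule test_functionsE) blast
  obtain R where R: "R > 0" "\<And>x. x \<in> K \<Longrightarrow> norm x \<le> R" using compact_imp_bounded[OF K(1)] unfolding bounded_pos by blast
  obtain B where B: "B > 0" "\<And>x. cmod (\<phi> x) \<le> B" using \<phi> by (rule test_bounded) blast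
  have [measurable]: "\<phi> \<in> borel_measurable borel" using test_measurable[OF \<phi>] .
  have L: "(\<lambda>p. \<phi> (cone_param \<theta> p)) \<in> L2 lborel"
  proof (rule compact_support_L2[where K = "cball 0 (2 * R)" and B = B])
    show "\<phi> (cone_param \<theta> p) = 0" if "p \<notin> cball 0 (2 * R)" for p
    proof (rule K(2), rule notI)
      assume "cone_param \<theta> p \<in> K"
      then have n: "norm (cone_param \<theta> p) \<le> R" by (rule R(2))
      have "norm p \<le> \<bar>p $ 1\<bar> + \<bar>p $ 2\<bar>" using norm_le_l1_cart[of p] by (simp add: sum_2)
      also have "\<dots> \<le> norm (cone_param \<theta> p) + norm (cone_param \<theta> p)"
        using component_le_norm_cart[of "cone_param \<theta> p" 1] component_le_norm_cart[of "cone_param \<theta> p" 2]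
        by (simp add: cone_param_shear)
      finally show False using n that by simp
    qed
  qed (use B in auto)
  have m: "(\<lambda>x. (cmod (\<phi> x))\<^sup>2) \<in> borel_measurable \<sigma>"
    by (intro continuous_surface_measurable continuous_intros test_continuous[OF \<phi>])
  have "integrable \<sigma> (\<lambda>x. (cmod (\<phi> x))\<^sup>2)" using surface_integral(2)[OF \<theta> m] L2_integrable[OF L] by simp
  moreover have "\<phi> \<in> borel_measurable \<sigma>" by (intro continuous_surface_measurable test_continuous[OF \<phi>])
  ultimately show "\<phi> \<in> L2 \<sigma>" by (simp add: L2_def)
  show "(L2_norm \<sigma> \<phi>)\<^sup>2 = (1 / sin \<theta>) * (\<integral>p. (cmod (\<phi> (cone_param \<theta> p)))\<^sup>2 \<partial>lborel)"
    unfolding L2_norm_sq surface_integral(1)[OF \<theta> m] by simp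
qed

lemma dsq_ip:
  assumes \<Omega>: "\<Omega> \<in> sets borel" and \<phi>: "\<phi> \<in> test_functions UNIV"
  shows "(\<integral>x. dsq \<phi> i x \<partial>leb \<Omega>) = 2 * Re (ip (leb \<Omega>) (\<lambda>x. grad \<phi> x $ i) \<phi>)"
proof -
  have i: "integrable (leb \<Omega>) (\<lambda>x. partial i \<phi> x * cnj (\<phi> x))"
    by (intro ip_integrable test_L2_leb[OF \<Omega>] test_partial \<phi>)
  have "(\<integral>x. dsq \<phi> i x \<partial>leb \<Omega>) = (\<integral>x. 2 * Re (partial i \<phi> x * cnj (\<phi> x)) \<partial>leb \<Omega>)"
    by (simp add: dsq_def mult.commute)
  also have "\<dots> = 2 * Re (\<integral>x. partial i \<phi> x * cnj (\<phi> x) \<partial>leb \<Omega>)"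
    by (subst integral_mult_right_zero, subst integral_Re[OF i]) simp
  finally show ?thesis by (simp add: ip_def)
qed

lemma test_trace_identity:
  assumes \<phi>: "\<phi> \<in> test_functions UNIV"
  shows "sin \<theta> * (L2_norm \<sigma> \<phi>)\<^sup>2 = 2 * Re (ip (leb (Omega2 \<theta>)) (\<lambda>x. grad \<phi> x $ 3) \<phi>)"
    "sin \<theta> * (L2_norm \<sigma> \<phi>)\<^sup>2 = - 2 * Re (ip (leb (Omega1 \<theta>)) (\<lambda>x. grad \<phi> x $ 3) \<phi>)"
  using vertical_identity[OF \<phi>, of \<theta>] dsq_ip[OF _ \<phi>, of "Omega1 \<theta>" 3] dsq_ip[OF _ \<phi>, of "Omega2 \<theta>" 3] test_surface_L2(2)[OF \<phi>] sin_pos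
  by simp_all

lemma L2_norm_component_le:
  fixes G :: "'a \<Rightarrow> complex ^ 3"
  assumes "G \<in> L2 M"
  shows "L2_norm M (\<lambda>x. G x $ i) \<le> L2_norm M G"
  by (rule L2_norm_mono[OF assms]) (use L2_component[OF assms] Finite_Cartesian_Product.norm_nth_le in auto)

lemma test_trace_bound:
  assumes \<Omega>: "cone_domain \<Omega>" and \<phi>: "\<phi> \<in> test_functions UNIV"
  shows "sin \<theta> * (L2_norm \<sigma> \<phi>)\<^sup>2 \<le> 2 * (L2_norm (leb \<Omega>) \<phi> * L2_norm (leb \<Omega>) (grad \<phi>))"
proof -
  have gL: "grad \<phi> \<in> L2 (leb \<Omega>)" "\<phi> \<in> L2 (leb \<Omega>)" if "\<Omega> \<in> sets borel" for \<Omega>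
    using L2_leb_subset(1)[OF that test_grad_L2[OF \<phi>]] L2_leb_subset(1)[OF that test_L2[OF \<phi>]] by auto
  have CS: "\<bar>Re (ip (leb \<Omega>) (\<lambda>x. grad \<phi> x $ 3) \<phi>)\<bar> \<le> L2_norm (leb \<Omega>) \<phi> * L2_norm (leb \<Omega>) (grad \<phi>)"
    if "\<Omega> \<in> sets borel" for \<Omega>
  proof -
    have "\<bar>Re (ip (leb \<Omega>) (\<lambda>x. grad \<phi> x $ 3) \<phi>)\<bar> \<le> L2_norm (leb \<Omega>) (\<lambda>x. grad \<phi> x $ 3) * L2_norm (leb \<Omega>) \<phi>"
      using abs_Re_le_cmod ip_Cauchy_Schwarz[OF L2_component[OF gL(1)[OF that]] gL(2)[OF that]] order_trans by blast
    also have "\<dots> \<le> L2_norm (leb \<Omega>) (grad \<phi>) * L2_norm (leb \<Omega>) \<phi>"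
      by (intro mult_right_mono L2_norm_component_le gL that) auto
    finally show ?thesis by (simp add: mult.commute)
  qed
  consider "\<Omega> = UNIV" | "\<Omega> = Omega1 \<theta>" | "\<Omega> = Omega2 \<theta>" using \<Omega> by (auto simp: cone_domain_def)
  then show ?thesis
  proof cases
    case 1
    have "sin \<theta> * (L2_norm \<sigma> \<phi>)\<^sup>2 \<le> 2 * (L2_norm (leb (Omega2 \<theta>)) \<phi> * L2_norm (leb (Omega2 \<theta>)) (grad \<phi>))"
      using test_trace_identity(1)[OF \<phi>] CS[of "Omega2 \<theta>"] by simp
    also have "\<dots> \<le> 2 * (L2_norm lborel \<phi> * L2_norm lborel (grad \<phi>))"
      by (intro mult_left_mono mult_mono L2_leb_subset(2) test_L2[OF \<phi>] test_grad_L2[OF \<phi>]) auto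
    finally show ?thesis using 1 by simp
  next
    case 2
    then show ?thesis using test_trace_identity(2)[OF \<phi>] CS[of "Omega1 \<theta>"] by simp
  next
    case 3
    then show ?thesis using test_trace_identity(1)[OF \<phi>] CS[of "Omega2 \<theta>"] by simp
  qed
qed

text \<open>The sharp boundary inequality on the nonconvex side. It comes from the divergence theorem for the
  field \<open>F = cos \<theta> p / |p| - sin \<theta> e\<^sub>3\<close>, which has length \<open>1\<close>, is normal to the cone, and has
  nonnegative divergence; \<open>F\<close> is written as a tangential field and a multiple of \<open>e\<^sub>3\<close>.\<close>

lemma test_boundary_inequality:
  assumes \<phi>: "\<phi> \<in> test_functions UNIV" and \<gamma>: "\<gamma> \<ge> 0"
  shows "\<gamma> * (L2_norm \<sigma> \<phi>)\<^sup>2 \<le> (L2_norm (leb (Omega2 \<theta>)) (grad \<phi>))\<^sup>2 + \<gamma>\<^sup>2 * (L2_norm (leb (Omega2 \<theta>)) \<phi>)\<^sup>2"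
proof -
  define c where "c = cot \<theta>"
  have sO: "shear c x \<in> Omega2 \<theta> \<longleftrightarrow> snd x < 0" for x by (simp add: c_def)
  note sm = test_smooth[OF \<phi>]
  have [measurable]: "dsq \<phi> k \<in> borel_measurable borel" for k by (intro borel_measurable_continuous_onI dsq_continuous sm)
  have [measurable]: "\<phi> \<in> borel_measurable borel" "\<And>i. partial i \<phi> \<in> borel_measurable borel"
    using test_measurable[OF \<phi>] test_measurable[OF test_partial[OF \<phi>]] by auto
  define r where "r i x = fst x $ i / norm (fst x)" for i and x :: "(real ^ 2) \<times> real"
  define w1 where "w1 x = dsq \<phi> 1 (shear c x) + c * r 1 x * dsq \<phi> 3 (shear c x)" for x
  define w2 where "w2 x = dsq \<phi> 2 (shear c x) + c * r 2 x * dsq \<phi> 3 (shear c x)" for x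
  let ?H = "\<lambda>f x. if snd (x :: (real ^ 2) \<times> real) < 0 then f x else (0 :: real)"
  have T1: "integrable lborel (?H (\<lambda>x. r 1 x * w1 x))" "(\<integral>x. ?H (\<lambda>x. r 1 x * w1 x) x \<partial>lborel) \<le> 0"
    using tangential_integral_nonpos[OF \<phi>, of 1 1 c] unfolding w1_def r_def by simp_all
  have T2: "integrable lborel (?H (\<lambda>x. r 2 x * w2 x))" "(\<integral>x. ?H (\<lambda>x. r 2 x * w2 x) x \<partial>lborel) \<le> 0"
    using tangential_integral_nonpos[OF \<phi>, of 2 2 c] unfolding w2_def r_def by simp_all
  have move: "(\<integral>x. f x \<partial>leb (Omega2 \<theta>)) = (\<integral>x. ?H (\<lambda>x. f (shear c x)) x \<partial>lborel)"
    "integrable lborel f \<Longrightarrow> integrable lborel (?H (\<lambda>x. f (shear c x)))" if [measurable]: "f \<in> borel_measurable borel" for f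
  proof -
    have m: "ext0 (Omega2 \<theta>) f \<in> borel_measurable borel" unfolding ext0_def[abs_def] by measurable
    show "(\<integral>x. f x \<partial>leb (Omega2 \<theta>)) = (\<integral>x. ?H (\<lambda>x. f (shear c x)) x \<partial>lborel)"
      unfolding leb_integral[OF Omega_borel(2)] integral_shear(1)[OF m, of c] by (simp add: ext0_def sO)
    assume "integrable lborel f"
    then have "integrable lborel (ext0 (Omega2 \<theta>) f)"
      by (rule Bochner_Integration.integrable_bound) (use m in \<open>auto simp: ext0_def\<close>)
    then show "integrable lborel (?H (\<lambda>x. f (shear c x)))"
      unfolding integral_shear(2)[OF m, of c] by (simp add: ext0_def sO)
  qed
  have int3: "integrable lborel (?H (\<lambda>x. dsq \<phi> 3 (shear c x)))" by (rule move(2)[OF _ dsq_integrable[OF \<phi>]]) simp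
  have gL: "(\<lambda>x. grad \<phi> x) \<in> L2 lborel" by (rule test_grad_L2[OF \<phi>])
  have [measurable]: "(\<lambda>x. grad \<phi> x) \<in> borel_measurable borel" using L2_borel[OF gL] .
  define Q where "Q x = (norm (grad \<phi> x))\<^sup>2 + \<gamma>\<^sup>2 * (cmod (\<phi> x))\<^sup>2" for x
  have [measurable]: "Q \<in> borel_measurable borel" unfolding Q_def[abs_def] by measurable
  have Qi: "integrable lborel Q" unfolding Q_def[abs_def]
    using L2_integrable[OF gL] L2_integrable[OF test_L2[OF \<phi>]] by simp
  have intQ: "integrable lborel (?H (\<lambda>x. Q (shear c x)))" by (rule move(2)[OF _ Qi]) simp
  have key: "(1 / sin \<theta>) * dsq \<phi> 3 y - cos \<theta> * (r 1 x * w1 x + r 2 x * w2 x) \<le> 2 * (cmod (\<phi> y) * norm (grad \<phi> y))"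
    if x: "fst x \<noteq> 0" and y: "y = shear c x" for x y
  proof -
    have n: "norm (fst x) > 0" using x by simp
    have r: "(r 1 x)\<^sup>2 + (r 2 x)\<^sup>2 = 1"
    proof -
      have "(fst x $ 1)\<^sup>2 + (fst x $ 2)\<^sup>2 = (norm (fst x))\<^sup>2" by (simp add: norm_real2)
      then show ?thesis using n by (simp add: r_def power_divide flip: add_divide_distrib)
    qed
    define F :: "real ^ 3" where "F = vector [cos \<theta> * r 1 x, cos \<theta> * r 2 x, - sin \<theta>]"
    have "norm F = sqrt ((cos \<theta>)\<^sup>2 * ((r 1 x)\<^sup>2 + (r 2 x)\<^sup>2) + (sin \<theta>)\<^sup>2)"
      unfolding norm_vec_def L2_set_def sum_3 by (simp add: F_def power_mult_distrib algebra_simps)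
    then have F1: "norm F = 1" unfolding r by simp
    have "(1 / sin \<theta>) * dsq \<phi> 3 y - cos \<theta> * (r 1 x * w1 x + r 2 x * w2 x)
      = (1 / sin \<theta> - cos \<theta> * c * ((r 1 x)\<^sup>2 + (r 2 x)\<^sup>2)) * dsq \<phi> 3 y - cos \<theta> * (r 1 x * dsq \<phi> 1 y + r 2 x * dsq \<phi> 2 y)"
      unfolding w1_def w2_def y[symmetric] by (simp add: algebra_simps power2_eq_square)
    also have "1 / sin \<theta> - cos \<theta> * c * ((r 1 x)\<^sup>2 + (r 2 x)\<^sup>2) = sin \<theta>"
    proof -
      have "1 / sin \<theta> - cos \<theta> * c = (1 - (cos \<theta>)\<^sup>2) / sin \<theta>"
        by (simp add: c_def cot_def power2_eq_square diff_divide_distrib)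
      also have "\<dots> = sin \<theta>" unfolding sin_squared_eq[symmetric] using sin_pos by (simp add: power2_eq_square)
      finally show ?thesis unfolding r by simp
    qed
    also have "sin \<theta> * dsq \<phi> 3 y - cos \<theta> * (r 1 x * dsq \<phi> 1 y + r 2 x * dsq \<phi> 2 y) = - (\<Sum>i\<in>UNIV. F $ i * dsq \<phi> i y)"
      by (simp add: sum_3 F_def algebra_simps)
    also have "\<dots> = - 2 * Re (cnj (\<phi> y) * (\<Sum>i\<in>UNIV. of_real (F $ i) * grad \<phi> y $ i))"
      by (simp add: sum_3 dsq_def algebra_simps)
    also have "\<dots> \<le> 2 * cmod (cnj (\<phi> y) * (\<Sum>i\<in>UNIV. of_real (F $ i) * grad \<phi> y $ i))"
      using abs_Re_le_cmod[of "cnj (\<phi> y) * (\<Sum>i\<in>UNIV. of_real (F $ i) * grad \<phi> y $ i)"] by linarith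
    also have "\<dots> = 2 * (cmod (\<phi> y) * cmod (\<Sum>i\<in>UNIV. of_real (F $ i) * grad \<phi> y $ i))" by (simp add: norm_mult)
    also have "cmod (\<Sum>i\<in>UNIV. of_real (F $ i) * grad \<phi> y $ i) \<le> (\<Sum>i\<in>UNIV. \<bar>norm (F $ i)\<bar> * \<bar>norm (grad \<phi> y $ i)\<bar>)"
      by (rule order_trans[OF norm_sum]) (simp add: norm_mult)
    also have "\<dots> \<le> norm F * norm (grad \<phi> y)"
      unfolding norm_vec_def by (rule L2_set_mult_ineq)
    finally show ?thesis using F1 by (simp add: mult_left_mono)
  qed
  have "(1 / sin \<theta>) * (\<integral>x. ?H (\<lambda>x. dsq \<phi> 3 (shear c x)) x \<partial>lborel) = (1 / sin \<theta>) * (\<integral>x. dsq \<phi> 3 x \<partial>leb (Omega2 \<theta>))"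
    by (subst move(1)) auto
  also have "\<dots> = (L2_norm \<sigma> \<phi>)\<^sup>2" unfolding vertical_identity(1)[OF \<phi>] test_surface_L2(2)[OF \<phi>] ..
  finally have S: "(1 / sin \<theta>) * (\<integral>x. ?H (\<lambda>x. dsq \<phi> 3 (shear c x)) x \<partial>lborel) = (L2_norm \<sigma> \<phi>)\<^sup>2" .
  let ?I = "\<lambda>x. \<gamma> * ((1 / sin \<theta>) * ?H (\<lambda>x. dsq \<phi> 3 (shear c x)) x - cos \<theta> * (?H (\<lambda>x. r 1 x * w1 x) x + ?H (\<lambda>x. r 2 x * w2 x) x))"
  have Ii: "integrable lborel ?I"
    by (intro integrable_mult_right Bochner_Integration.integrable_diff Bochner_Integration.integrable_add int3 T1 T2)
  have "\<gamma> * (L2_norm \<sigma> \<phi>)\<^sup>2 \<le> \<gamma> * ((1 / sin \<theta>) * (\<integral>x. ?H (\<lambda>x. dsq \<phi> 3 (shear c x)) x \<partial>lborel)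
     - cos \<theta> * ((\<integral>x. ?H (\<lambda>x. r 1 x * w1 x) x \<partial>lborel) + (\<integral>x. ?H (\<lambda>x. r 2 x * w2 x) x \<partial>lborel)))"
  proof (rule mult_left_mono[OF _ \<gamma>])
    have "cos \<theta> * ((\<integral>x. ?H (\<lambda>x. r 1 x * w1 x) x \<partial>lborel) + (\<integral>x. ?H (\<lambda>x. r 2 x * w2 x) x \<partial>lborel)) \<le> 0"
      using cos_pos T1(2) T2(2) by (intro mult_nonneg_nonpos) auto
    then show "(L2_norm \<sigma> \<phi>)\<^sup>2 \<le> (1 / sin \<theta>) * (\<integral>x. ?H (\<lambda>x. dsq \<phi> 3 (shear c x)) x \<partial>lborel)
     - cos \<theta> * ((\<integral>x. ?H (\<lambda>x. r 1 x * w1 x) x \<partial>lborel) + (\<integral>x. ?H (\<lambda>x. r 2 x * w2 x) x \<partial>lborel))" unfolding S by linarith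
  qed
  also have "\<dots> = (\<integral>x. ?I x \<partial>lborel)"
    by (simp only: integral_mult_right_zero Bochner_Integration.integral_diff Bochner_Integration.integral_add
        integrable_mult_right Bochner_Integration.integrable_add int3 T1(1) T2(1))
  also have "\<dots> \<le> (\<integral>x. ?H (\<lambda>x. Q (shear c x)) x \<partial>lborel)"
  proof (rule integral_mono_AE[OF Ii intQ])
    show "AE x in lborel. ?I x \<le> ?H (\<lambda>x. Q (shear c x)) x"
      using AE_fst_nonzero
    proof eventually_elim
      fix x :: "(real ^ 2) \<times> real" assume x: "fst x \<noteq> 0"
      let ?y = "shear c x"
      have "\<gamma> * ((1 / sin \<theta>) * dsq \<phi> 3 ?y - cos \<theta> * (r 1 x * w1 x + r 2 x * w2 x)) \<le> \<gamma> * (2 * (cmod (\<phi> ?y) * norm (grad \<phi> ?y)))"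
        by (rule mult_left_mono[OF key[OF x refl] \<gamma>])
      also have "\<dots> = 2 * (\<gamma> * cmod (\<phi> ?y)) * norm (grad \<phi> ?y)" by simp
      also have "\<dots> \<le> (\<gamma> * cmod (\<phi> ?y))\<^sup>2 + (norm (grad \<phi> ?y))\<^sup>2" by (rule sum_squares_bound)
      also have "\<dots> = Q ?y" by (simp add: Q_def power_mult_distrib)
      finally show "?I x \<le> ?H (\<lambda>x. Q (shear c x)) x" by simp
    qed
  qed
  also have "\<dots> = (\<integral>x. Q x \<partial>leb (Omega2 \<theta>))" by (subst move(1)) auto
  also have "\<dots> = (L2_norm (leb (Omega2 \<theta>)) (grad \<phi>))\<^sup>2 + \<gamma>\<^sup>2 * (L2_norm (leb (Omega2 \<theta>)) \<phi>)\<^sup>2"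
    unfolding Q_def L2_norm_sq
    using L2_integrable[OF L2_leb_subset(1)[OF Omega_borel(2) gL, of \<theta>]] L2_integrable[OF L2_leb_subset(1)[OF Omega_borel(2) test_L2[OF \<phi>], of \<theta>]] by simp
  finally show ?thesis .
qed

lemma grad_lin:
  assumes "\<phi> \<in> test_functions UNIV" "\<psi> \<in> test_functions UNIV"
  shows "grad (\<lambda>x. \<phi> x + c * \<psi> x) x $ i = grad \<phi> x $ i + c * grad \<psi> x $ i"
proof -
  have d: "\<phi> differentiable at x" "\<psi> differentiable at x" using smooth_differentiable test_smooth assms by blast+
  have "partial i (\<lambda>x. c * \<psi> x) x = c * partial i \<psi> x" using partial_mult[OF differentiable_const d(2), of i c] by simp
  then show ?thesis using partial_add[OF d(1) differentiable_mult[OF differentiable_const d(2)], of i c] by simp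
qed

lemma test_surface_norm_le:
  assumes \<Omega>: "cone_domain \<Omega>" and \<phi>: "\<phi> \<in> test_functions UNIV"
    and e: "L2_norm (leb \<Omega>) \<phi> \<le> e" "L2_norm (leb \<Omega>) (grad \<phi>) \<le> e"
  shows "L2_norm \<sigma> \<phi> \<le> sqrt (2 / sin \<theta>) * e"
proof (rule power2_le_imp_le)
  have e0: "e \<ge> 0" using e(1) L2_norm_nonneg order_trans by blast
  have "sin \<theta> * (L2_norm \<sigma> \<phi>)\<^sup>2 \<le> 2 * (L2_norm (leb \<Omega>) \<phi> * L2_norm (leb \<Omega>) (grad \<phi>))" by (rule test_trace_bound[OF \<Omega> \<phi>])
  also have "\<dots> \<le> 2 * (e * e)" using e e0 by (intro mult_left_mono mult_mono) auto
  finally show "(L2_norm \<sigma> \<phi>)\<^sup>2 \<le> (sqrt (2 / sin \<theta>) * e)\<^sup>2"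
    using sin_pos by (simp add: power_mult_distrib field_simps power2_eq_square[of e])
  show "0 \<le> sqrt (2 / sin \<theta>) * e" using e0 sin_pos by simp
qed

lemma test_difference_norm_le:
  assumes \<Omega>: "cone_domain \<Omega>" and \<phi>: "\<phi> \<in> test_functions UNIV" "\<psi> \<in> test_functions UNIV"
    and L: "u \<in> L2 (leb \<Omega>)" "G \<in> L2 (leb \<Omega>)"
  shows "L2_norm \<sigma> (\<lambda>x. \<phi> x - \<psi> x) \<le> sqrt (2 / sin \<theta>) * (L2_norm (leb \<Omega>) (\<lambda>x. \<phi> x - u x) + L2_norm (leb \<Omega>) (\<lambda>x. \<psi> x - u x)
     + (L2_norm (leb \<Omega>) (\<lambda>x. grad \<phi> x - G x) + L2_norm (leb \<Omega>) (\<lambda>x. grad \<psi> x - G x)))"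
proof -
  note B = cone_domain_borel[OF \<Omega>]
  have t: "(\<lambda>x. \<phi> x - \<psi> x) \<in> test_functions UNIV" using test_add[OF \<phi>, of "-1"] by simp
  have gr: "grad (\<lambda>x. \<phi> x - \<psi> x) = (\<lambda>x. grad \<phi> x - grad \<psi> x)"
    using grad_lin[OF \<phi>, of "-1"] by (auto simp: vec_eq_iff)
  note tL = L2_leb_subset(1)[OF B test_L2[OF \<phi>(1)]] L2_leb_subset(1)[OF B test_L2[OF \<phi>(2)]]
    L2_leb_subset(1)[OF B test_grad_L2[OF \<phi>(1)]] L2_leb_subset(1)[OF B test_grad_L2[OF \<phi>(2)]]
  show ?thesis
  proof (rule test_surface_norm_le[OF \<Omega> t])
    have "L2_norm (leb \<Omega>) (\<lambda>x. \<phi> x - \<psi> x) \<le> L2_norm (leb \<Omega>) (\<lambda>x. \<phi> x - u x) + L2_norm (leb \<Omega>) (\<lambda>x. \<psi> x - u x)"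
      using L2_norm_triangle3[OF tL(1) L(1) tL(2)] L2_norm_minus_commute[of "leb \<Omega>" u \<psi>] by simp
    then show "L2_norm (leb \<Omega>) (\<lambda>x. \<phi> x - \<psi> x) \<le> L2_norm (leb \<Omega>) (\<lambda>x. \<phi> x - u x) + L2_norm (leb \<Omega>) (\<lambda>x. \<psi> x - u x)
     + (L2_norm (leb \<Omega>) (\<lambda>x. grad \<phi> x - G x) + L2_norm (leb \<Omega>) (\<lambda>x. grad \<psi> x - G x))"
      using L2_norm_nonneg[of "leb \<Omega>" "\<lambda>x. grad \<phi> x - G x"] L2_norm_nonneg[of "leb \<Omega>" "\<lambda>x. grad \<psi> x - G x"] by linarith
    have "L2_norm (leb \<Omega>) (\<lambda>x. grad \<phi> x - grad \<psi> x) \<le> L2_norm (leb \<Omega>) (\<lambda>x. grad \<phi> x - G x) + L2_norm (leb \<Omega>) (\<lambda>x. grad \<psi> x - G x)"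
      using L2_norm_triangle3[OF tL(3) L(2) tL(4)] L2_norm_minus_commute[of "leb \<Omega>" G "grad \<psi>"] by simp
    then show "L2_norm (leb \<Omega>) (grad (\<lambda>x. \<phi> x - \<psi> x)) \<le> L2_norm (leb \<Omega>) (\<lambda>x. \<phi> x - u x) + L2_norm (leb \<Omega>) (\<lambda>x. \<psi> x - u x)
     + (L2_norm (leb \<Omega>) (\<lambda>x. grad \<phi> x - G x) + L2_norm (leb \<Omega>) (\<lambda>x. grad \<psi> x - G x))"
      unfolding gr using L2_norm_nonneg[of "leb \<Omega>" "\<lambda>x. \<phi> x - u x"] L2_norm_nonneg[of "leb \<Omega>" "\<lambda>x. \<psi> x - u x"] by linarith
  qed
qed

theorem trace_exists:
  assumes \<Omega>: "cone_domain \<Omega>" and u: "u \<in> H1 \<Omega>"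
  shows "\<exists>g. has_trace \<theta> \<Omega> u g"
proof -
  let ?G = "weak_grad \<Omega> u" and ?N = "L2_norm (leb \<Omega>)"
  have "\<forall>k. \<exists>\<phi>\<in>test_functions UNIV. ?N (\<lambda>x. \<phi> x - u x) < 1 / real (Suc k) \<and> ?N (\<lambda>x. grad \<phi> x - ?G x) < 1 / real (Suc k)"
    by (intro allI test_functions_dense[OF cone_domain_shiftable[OF \<Omega>] H1D(1,2)[OF u]]) simp
  then have "\<exists>\<phi>. \<forall>k. \<phi> k \<in> test_functions UNIV \<and> ?N (\<lambda>x. \<phi> k x - u x) < 1 / real (Suc k)
    \<and> ?N (\<lambda>x. grad (\<phi> k) x - ?G x) < 1 / real (Suc k)" by (intro choice) blast
  then obtain \<phi> where \<phi>: "\<And>k. \<phi> k \<in> test_functions UNIV" "\<And>k. ?N (\<lambda>x. \<phi> k x - u x) < 1 / real (Suc k)"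
    "\<And>k. ?N (\<lambda>x. grad (\<phi> k) x - ?G x) < 1 / real (Suc k)" by blast
  define C where "C = sqrt (2 / sin \<theta>)"
  have C: "C > 0" using sin_pos by (simp add: C_def)
  have inv0: "(\<lambda>k. 1 / real (Suc k)) \<longlonglongrightarrow> 0" by (rule LIMSEQ_inverse_real_of_nat[unfolded inverse_eq_divide])
  have "\<exists>g\<in>L2 \<sigma>. (\<lambda>k. L2_norm \<sigma> (\<lambda>x. \<phi> k x - g x)) \<longlonglongrightarrow> 0"
  proof (rule L2_complete)
    show "\<phi> k \<in> L2 \<sigma>" for k by (rule test_surface_L2[OF \<phi>(1)])
    fix e :: real assume e: "e > 0"
    obtain N where N: "1 / real (Suc N) < e / (4 * C)"
      using reals_Archimedean[of "e / (4 * C)"] e C by (auto simp: inverse_eq_divide)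
    show "\<exists>N. \<forall>m\<ge>N. \<forall>n\<ge>N. L2_norm \<sigma> (\<lambda>x. \<phi> m x - \<phi> n x) < e"
    proof (intro exI allI impI)
      fix m n assume mn: "m \<ge> N" "n \<ge> N"
      have k: "1 / real (Suc k) < e / (4 * C)" if "k \<ge> N" for k
        by (rule le_less_trans[OF _ N]) (use that in \<open>simp add: frac_le\<close>)
      have "L2_norm \<sigma> (\<lambda>x. \<phi> m x - \<phi> n x) \<le> C * (?N (\<lambda>x. \<phi> m x - u x) + ?N (\<lambda>x. \<phi> n x - u x)
         + (?N (\<lambda>x. grad (\<phi> m) x - ?G x) + ?N (\<lambda>x. grad (\<phi> n) x - ?G x)))"
        unfolding C_def by (rule test_difference_norm_le[OF \<Omega> \<phi>(1) \<phi>(1) H1D(1,3)[OF u]])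
      also have "\<dots> < C * (e / (4 * C) + e / (4 * C) + (e / (4 * C) + e / (4 * C)))"
        using \<phi>(2,3)[of m] \<phi>(2,3)[of n] k[OF mn(1)] k[OF mn(2)] C by (intro mult_strict_left_mono add_strict_mono) auto
      also have "\<dots> = e" using C by (simp add: field_simps)
      finally show "L2_norm \<sigma> (\<lambda>x. \<phi> m x - \<phi> n x) < e" .
    qed
  qed
  then obtain g where g: "g \<in> L2 \<sigma>" "(\<lambda>k. L2_norm \<sigma> (\<lambda>x. \<phi> k x - g x)) \<longlonglongrightarrow> 0" by blast
  have "(\<lambda>k. ?N (\<lambda>x. \<phi> k x - u x)) \<longlonglongrightarrow> 0"
    by (rule Lim_null_comparison[OF _ inv0]) (use \<phi>(2) in \<open>auto simp: less_imp_le\<close>)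
  moreover have "(\<lambda>k. ?N (\<lambda>x. grad (\<phi> k) x - ?G x)) \<longlonglongrightarrow> 0"
    by (rule Lim_null_comparison[OF _ inv0]) (use \<phi>(3) in \<open>auto simp: less_imp_le\<close>)
  ultimately show ?thesis using g \<phi>(1) unfolding has_trace_def by blast
qed

lemma trace_unique:
  assumes \<Omega>: "cone_domain \<Omega>" and u: "u \<in> H1 \<Omega>" and g: "has_trace \<theta> \<Omega> u g" "has_trace \<theta> \<Omega> u g'"
  shows "AE x in \<sigma>. g x = g' x"
proof -
  let ?G = "weak_grad \<Omega> u" and ?N = "L2_norm (leb \<Omega>)"
  obtain \<phi> where \<phi>: "\<And>k. \<phi> k \<in> test_functions UNIV" "(\<lambda>k. ?N (\<lambda>x. \<phi> k x - u x)) \<longlonglongrightarrow> 0"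
    "(\<lambda>k. ?N (\<lambda>x. grad (\<phi> k) x - ?G x)) \<longlonglongrightarrow> 0" "(\<lambda>k. L2_norm \<sigma> (\<lambda>x. \<phi> k x - g x)) \<longlonglongrightarrow> 0" "g \<in> L2 \<sigma>"
    using g(1) unfolding has_trace_def by blast
  obtain \<psi> where \<psi>: "\<And>k. \<psi> k \<in> test_functions UNIV" "(\<lambda>k. ?N (\<lambda>x. \<psi> k x - u x)) \<longlonglongrightarrow> 0"
    "(\<lambda>k. ?N (\<lambda>x. grad (\<psi> k) x - ?G x)) \<longlonglongrightarrow> 0" "(\<lambda>k. L2_norm \<sigma> (\<lambda>x. \<psi> k x - g' x)) \<longlonglongrightarrow> 0" "g' \<in> L2 \<sigma>"
    using g(2) unfolding has_trace_def by blast
  define C where "C = sqrt (2 / sin \<theta>)"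
  let ?b = "\<lambda>k. L2_norm \<sigma> (\<lambda>x. \<phi> k x - g x) + (C * (?N (\<lambda>x. \<phi> k x - u x) + ?N (\<lambda>x. \<psi> k x - u x)
     + (?N (\<lambda>x. grad (\<phi> k) x - ?G x) + ?N (\<lambda>x. grad (\<psi> k) x - ?G x))) + L2_norm \<sigma> (\<lambda>x. \<psi> k x - g' x))"
  have "?b \<longlonglongrightarrow> 0 + (C * (0 + 0 + (0 + 0)) + 0)" by (intro tendsto_intros \<phi> \<psi>)
  moreover have "L2_norm \<sigma> (\<lambda>x. g x - g' x) \<le> ?b k" for k
  proof -
    note L = test_surface_L2(1)[OF \<phi>(1)[of k]] test_surface_L2(1)[OF \<psi>(1)[of k]]
    have "L2_norm \<sigma> (\<lambda>x. g x - g' x) \<le> L2_norm \<sigma> (\<lambda>x. g x - \<phi> k x) + L2_norm \<sigma> (\<lambda>x. \<phi> k x - g' x)"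
      by (rule L2_norm_triangle3[OF \<phi>(5) L(1) \<psi>(5)])
    also have "L2_norm \<sigma> (\<lambda>x. \<phi> k x - g' x) \<le> L2_norm \<sigma> (\<lambda>x. \<phi> k x - \<psi> k x) + L2_norm \<sigma> (\<lambda>x. \<psi> k x - g' x)"
      by (rule L2_norm_triangle3[OF L \<psi>(5)])
    also have "L2_norm \<sigma> (\<lambda>x. \<phi> k x - \<psi> k x) \<le> C * (?N (\<lambda>x. \<phi> k x - u x) + ?N (\<lambda>x. \<psi> k x - u x)
     + (?N (\<lambda>x. grad (\<phi> k) x - ?G x) + ?N (\<lambda>x. grad (\<psi> k) x - ?G x)))"
      unfolding C_def by (rule test_difference_norm_le[OF \<Omega> \<phi>(1) \<psi>(1) H1D(1,3)[OF u]])
    finally show ?thesis using L2_norm_minus_commute[of \<sigma> g "\<phi> k"] by simp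
  qed
  ultimately have "L2_norm \<sigma> (\<lambda>x. g x - g' x) \<le> 0" by (intro LIMSEQ_le_const) auto
  then have "L2_norm \<sigma> (\<lambda>x. g x - g' x) = 0" by (simp add: antisym)
  then show ?thesis using L2_norm_zero_iff[OF L2_diff[OF \<phi>(5) \<psi>(5)]] by (simp add: eventually_mono)
qed

lemma L2_norm_tendsto_cong:
  fixes f g :: "nat \<Rightarrow> 'a \<Rightarrow> 'b::{real_normed_vector, second_countable_topology}"
  assumes "\<And>k. f k \<in> L2 M" "u \<in> L2 M" "u' \<in> L2 M" "AE x in M. u x = u' x" "(\<lambda>k. L2_norm M (\<lambda>x. f k x - u x)) \<longlonglongrightarrow> 0"
  shows "(\<lambda>k. L2_norm M (\<lambda>x. f k x - u' x)) \<longlonglongrightarrow> 0"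
proof -
  have "L2_norm M (\<lambda>x. f k x - u' x) = L2_norm M (\<lambda>x. f k x - u x)" for k
    by (rule L2_norm_cong_AE) (use assms(4) L2_measurable[OF L2_diff[OF assms(1,2)]] L2_measurable[OF L2_diff[OF assms(1,3)]] in \<open>auto elim: eventually_mono\<close>)
  then show ?thesis using assms(5) by simp
qed

lemma has_trace_lin:
  assumes \<Omega>: "cone_domain \<Omega>" and H: "u \<in> H1 \<Omega>" "v \<in> H1 \<Omega>" and g: "has_trace \<theta> \<Omega> u g" "has_trace \<theta> \<Omega> v h"
  shows "has_trace \<theta> \<Omega> (\<lambda>x. u x + c * v x) (\<lambda>x. g x + c * h x)"
proof -
  let ?N = "L2_norm (leb \<Omega>)"
  note B = cone_domain_borel[OF \<Omega>]
  obtain \<phi> where \<phi>: "\<And>k. \<phi> k \<in> test_functions UNIV" "(\<lambda>k. ?N (\<lambda>x. \<phi> k x - u x)) \<longlonglongrightarrow> 0"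
    "(\<lambda>k. ?N (\<lambda>x. grad (\<phi> k) x - weak_grad \<Omega> u x)) \<longlonglongrightarrow> 0" "(\<lambda>k. L2_norm \<sigma> (\<lambda>x. \<phi> k x - g x)) \<longlonglongrightarrow> 0" "g \<in> L2 \<sigma>"
    using g(1) unfolding has_trace_def by blast
  obtain \<psi> where \<psi>: "\<And>k. \<psi> k \<in> test_functions UNIV" "(\<lambda>k. ?N (\<lambda>x. \<psi> k x - v x)) \<longlonglongrightarrow> 0"
    "(\<lambda>k. ?N (\<lambda>x. grad (\<psi> k) x - weak_grad \<Omega> v x)) \<longlonglongrightarrow> 0" "(\<lambda>k. L2_norm \<sigma> (\<lambda>x. \<psi> k x - h x)) \<longlonglongrightarrow> 0" "h \<in> L2 \<sigma>"
    using g(2) unfolding has_trace_def by blast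
  have comb: "(\<lambda>k. L2_norm M (\<lambda>x. (f k x + c * f' k x) - (w x + c * w' x))) \<longlonglongrightarrow> 0"
    if "\<And>k. f k \<in> L2 M" "\<And>k. f' k \<in> L2 M" "w \<in> L2 M" "w' \<in> L2 M"
      "(\<lambda>k. L2_norm M (\<lambda>x. f k x - w x)) \<longlonglongrightarrow> 0" "(\<lambda>k. L2_norm M (\<lambda>x. f' k x - w' x)) \<longlonglongrightarrow> 0"
    for f f' :: "nat \<Rightarrow> real ^ 3 \<Rightarrow> complex" and w w' M
  proof (rule Lim_null_comparison)
    show "\<forall>\<^sub>F k in sequentially. norm (L2_norm M (\<lambda>x. (f k x + c * f' k x) - (w x + c * w' x)))
       \<le> L2_norm M (\<lambda>x. f k x - w x) + cmod c * L2_norm M (\<lambda>x. f' k x - w' x)"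
    proof (intro always_eventually allI)
      fix k
      have "(\<lambda>x. (f k x + c * f' k x) - (w x + c * w' x)) = (\<lambda>x. (f k x - w x) + c * (f' k x - w' x))" by (auto simp: algebra_simps)
      then show "norm (L2_norm M (\<lambda>x. (f k x + c * f' k x) - (w x + c * w' x))) \<le> L2_norm M (\<lambda>x. f k x - w x) + cmod c * L2_norm M (\<lambda>x. f' k x - w' x)"
        using L2_norm_triangle[OF L2_diff[OF that(1,3)] L2_cmult[OF L2_diff[OF that(2,4)], of c], of k k] by (simp add: L2_norm_cmult)
    qed
    have "(\<lambda>k. L2_norm M (\<lambda>x. f k x - w x) + cmod c * L2_norm M (\<lambda>x. f' k x - w' x)) \<longlonglongrightarrow> 0 + cmod c * 0"
      by (intro tendsto_intros that)
    then show "(\<lambda>k. L2_norm M (\<lambda>x. f k x - w x) + cmod c * L2_norm M (\<lambda>x. f' k x - w' x)) \<longlonglongrightarrow> 0" by simp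
  qed
  define \<zeta> where "\<zeta> k x = \<phi> k x + c * \<psi> k x" for k x
  have \<zeta>: "\<zeta> k \<in> test_functions UNIV" for k unfolding \<zeta>_def[abs_def] by (rule test_add[OF \<phi>(1) \<psi>(1)])
  have 1: "(\<lambda>k. ?N (\<lambda>x. \<zeta> k x - (u x + c * v x))) \<longlonglongrightarrow> 0"
    unfolding \<zeta>_def by (intro comb \<phi> \<psi> H1D(1)[OF H(1)] H1D(1)[OF H(2)] test_L2_leb[OF B])
  have 2: "(\<lambda>k. L2_norm \<sigma> (\<lambda>x. \<zeta> k x - (g x + c * h x))) \<longlonglongrightarrow> 0"
    unfolding \<zeta>_def by (intro comb \<phi> \<psi> test_surface_L2)
  let ?W = "weak_grad \<Omega> (\<lambda>x. u x + c * v x)"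
  have WL: "?W \<in> L2 (leb \<Omega>)" by (rule H1D(3)[OF H1_lin[OF B H]])
  have GL: "grad (\<zeta> k) \<in> L2 (leb \<Omega>)" for k by (rule L2_leb_subset(1)[OF B test_grad_L2[OF \<zeta>]])
  have comp: "(\<lambda>k. ?N (\<lambda>x. grad (\<zeta> k) x $ i - ?W x $ i)) \<longlonglongrightarrow> 0" for i
  proof (rule L2_norm_tendsto_cong)
    have ci: "(\<lambda>k. ?N (\<lambda>x. grad (\<phi> k) x $ i - weak_grad \<Omega> u x $ i)) \<longlonglongrightarrow> 0"
      if "\<And>k. \<phi> k \<in> test_functions UNIV" "u \<in> H1 \<Omega>" "(\<lambda>k. ?N (\<lambda>x. grad (\<phi> k) x - weak_grad \<Omega> u x)) \<longlonglongrightarrow> 0" for \<phi> u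
    proof (rule Lim_null_comparison[OF _ that(3)], intro always_eventually allI)
      fix k
      have "(\<lambda>x. grad (\<phi> k) x - weak_grad \<Omega> u x) \<in> L2 (leb \<Omega>)"
        by (intro L2_diff L2_leb_subset(1)[OF B] test_grad_L2[OF that(1)] H1D(3)[OF that(2)])
      from L2_norm_component_le[OF this, of i]
      show "norm (?N (\<lambda>x. grad (\<phi> k) x $ i - weak_grad \<Omega> u x $ i)) \<le> ?N (\<lambda>x. grad (\<phi> k) x - weak_grad \<Omega> u x)" by simp
    qed
    have "(\<lambda>k. ?N (\<lambda>x. (grad (\<phi> k) x $ i + c * grad (\<psi> k) x $ i) - (weak_grad \<Omega> u x $ i + c * weak_grad \<Omega> v x $ i))) \<longlonglongrightarrow> 0"
      by (intro comb ci \<phi> \<psi> H L2_component H1D(3) L2_leb_subset(1)[OF B test_grad_L2[OF \<phi>(1)]] L2_leb_subset(1)[OF B test_grad_L2[OF \<psi>(1)]])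
    then show "(\<lambda>k. ?N (\<lambda>x. grad (\<zeta> k) x $ i - (weak_grad \<Omega> u x $ i + c * weak_grad \<Omega> v x $ i))) \<longlonglongrightarrow> 0"
      using grad_lin[OF \<phi>(1) \<psi>(1)] by (simp only: \<zeta>_def[abs_def])
    show "AE x in leb \<Omega>. weak_grad \<Omega> u x $ i + c * weak_grad \<Omega> v x $ i = ?W x $ i"
      using weak_grad_lin[OF cone_domain_shiftable[OF \<Omega>] H, of c] by eventually_elim simp
  qed (intro L2_lin L2_component GL WL H1D(3) H)+
  have 3: "(\<lambda>k. ?N (\<lambda>x. grad (\<zeta> k) x - ?W x)) \<longlonglongrightarrow> 0"
  proof (rule Lim_null_comparison)
    show "\<forall>\<^sub>F k in sequentially. norm (?N (\<lambda>x. grad (\<zeta> k) x - ?W x)) \<le> (\<Sum>i\<in>UNIV. ?N (\<lambda>x. grad (\<zeta> k) x $ i - ?W x $ i))"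
    proof (intro always_eventually allI)
      fix k
      have "?N (\<lambda>x. grad (\<zeta> k) x - ?W x) \<le> (\<Sum>i\<in>UNIV. ?N (\<lambda>x. (grad (\<zeta> k) x - ?W x) $ i))"
        by (intro L2_vec(2) L2_component L2_diff GL WL)
      then show "norm (?N (\<lambda>x. grad (\<zeta> k) x - ?W x)) \<le> (\<Sum>i\<in>UNIV. ?N (\<lambda>x. grad (\<zeta> k) x $ i - ?W x $ i))" by simp
    qed
    have "(\<lambda>k. \<Sum>i\<in>UNIV. ?N (\<lambda>x. grad (\<zeta> k) x $ i - ?W x $ i)) \<longlonglongrightarrow> (\<Sum>i\<in>(UNIV :: 3 set). 0)"
      by (intro tendsto_sum comp)
    then show "(\<lambda>k. \<Sum>i\<in>UNIV. ?N (\<lambda>x. grad (\<zeta> k) x $ i - ?W x $ i)) \<longlonglongrightarrow> 0" by simp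
  qed
  show ?thesis unfolding has_trace_def using L2_lin[OF \<phi>(5) \<psi>(5)] \<zeta> 1 2 3 by blast
qed

lemma cone_trace:
  assumes "cone_domain \<Omega>" "u \<in> H1 \<Omega>"
  shows "has_trace \<theta> \<Omega> u (cone_trace \<theta> \<Omega> u)" "cone_trace \<theta> \<Omega> u \<in> L2 \<sigma>"
proof -
  show t: "has_trace \<theta> \<Omega> u (cone_trace \<theta> \<Omega> u)"
    unfolding cone_trace_def by (rule someI_ex[OF trace_exists[OF assms]])
  then show "cone_trace \<theta> \<Omega> u \<in> L2 \<sigma>" by (simp add: has_trace_def)
qed

lemma cone_trace_lin:
  assumes "cone_domain \<Omega>" "u \<in> H1 \<Omega>" "v \<in> H1 \<Omega>"
  shows "AE x in \<sigma>. cone_trace \<theta> \<Omega> (\<lambda>x. u x + c * v x) x = cone_trace \<theta> \<Omega> u x + c * cone_trace \<theta> \<Omega> v x"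
proof -
  note l = H1_lin[OF cone_domain_borel[OF assms(1)] assms(2,3), of c]
  show ?thesis
    by (rule trace_unique[OF assms(1) l cone_trace(1)[OF assms(1) l]
        has_trace_lin[OF assms cone_trace(1)[OF assms(1,2)] cone_trace(1)[OF assms(1,3)]]])
qed

lemma has_trace_cong:
  assumes "\<Omega> \<in> sets borel" "\<And>x. x \<in> \<Omega> \<Longrightarrow> u x = v x"
  shows "has_trace \<theta> \<Omega> u = has_trace \<theta> \<Omega> v"
proof -
  have "L2_norm (leb \<Omega>) (\<lambda>x. \<phi> x - u x) = L2_norm (leb \<Omega>) (\<lambda>x. \<phi> x - v x)" for \<phi>
    by (rule L2_leb_cong(2)) (use assms in auto)
  moreover have "weak_grad \<Omega> u = weak_grad \<Omega> v" by (rule weak_grad_cong) (use assms in auto)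
  ultimately show ?thesis unfolding has_trace_def by (intro ext) simp
qed

lemma cone_trace_cong:
  "\<Omega> \<in> sets borel \<Longrightarrow> (\<And>x. x \<in> \<Omega> \<Longrightarrow> u x = v x) \<Longrightarrow> cone_trace \<theta> \<Omega> u = cone_trace \<theta> \<Omega> v"
  unfolding cone_trace_def using has_trace_cong by metis

lemma cone_trace_restrict:
  assumes \<Omega>: "cone_domain \<Omega>" and u: "u \<in> H1 UNIV"
  shows "AE x in \<sigma>. cone_trace \<theta> \<Omega> u x = cone_trace \<theta> UNIV u x"
proof -
  note B = cone_domain_borel[OF \<Omega>]
  have uO: "u \<in> H1 \<Omega>" by (rule H1_restrict[OF B u])
  let ?g = "cone_trace \<theta> UNIV u"
  obtain \<phi> where \<phi>: "\<And>k. \<phi> k \<in> test_functions UNIV" "(\<lambda>k. L2_norm lborel (\<lambda>x. \<phi> k x - u x)) \<longlonglongrightarrow> 0"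
    "(\<lambda>k. L2_norm lborel (\<lambda>x. grad (\<phi> k) x - weak_grad UNIV u x)) \<longlonglongrightarrow> 0" "(\<lambda>k. L2_norm \<sigma> (\<lambda>x. \<phi> k x - ?g x)) \<longlonglongrightarrow> 0" "?g \<in> L2 \<sigma>"
    using cone_trace(1)[of UNIV, OF _ u] unfolding has_trace_def by auto
  have uL: "u \<in> L2 lborel" "weak_grad UNIV u \<in> L2 lborel" using H1D(1,3)[OF u] by auto
  have "(\<lambda>k. L2_norm (leb \<Omega>) (\<lambda>x. \<phi> k x - u x)) \<longlonglongrightarrow> 0"
    by (rule Lim_null_comparison[OF _ \<phi>(2)]) (use L2_leb_subset(2)[OF B L2_diff[OF test_L2[OF \<phi>(1)] uL(1)]] in auto)
  moreover have "(\<lambda>k. L2_norm (leb \<Omega>) (\<lambda>x. grad (\<phi> k) x - weak_grad \<Omega> u x)) \<longlonglongrightarrow> 0"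
  proof (rule L2_norm_tendsto_cong)
    show "(\<lambda>k. L2_norm (leb \<Omega>) (\<lambda>x. grad (\<phi> k) x - weak_grad UNIV u x)) \<longlonglongrightarrow> 0"
      by (rule Lim_null_comparison[OF _ \<phi>(3)]) (use L2_leb_subset(2)[OF B L2_diff[OF test_grad_L2[OF \<phi>(1)] uL(2)]] in auto)
    show "AE x in leb \<Omega>. weak_grad UNIV u x = weak_grad \<Omega> u x"
      using weak_grad_restrict[OF cone_domain_shiftable[OF \<Omega>] u] by eventually_elim simp
  qed (intro L2_leb_subset(1)[OF B test_grad_L2[OF \<phi>(1)]] L2_leb_subset(1)[OF B uL(2)] H1D(3) uO)+
  ultimately have "has_trace \<theta> \<Omega> u ?g" using \<phi> unfolding has_trace_def by blast
  then show ?thesis by (rule trace_unique[OF \<Omega> uO cone_trace(1)[OF \<Omega> uO]])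
qed

text \<open>The identities and inequalities for test functions pass to the limit.\<close>

lemma trace_approximation:
  assumes \<Omega>: "cone_domain \<Omega>" and u: "u \<in> H1 \<Omega>"
  obtains \<phi> where "\<And>k. \<phi> k \<in> test_functions UNIV"
    "(\<lambda>k. L2_norm \<sigma> (\<phi> k)) \<longlonglongrightarrow> L2_norm \<sigma> (cone_trace \<theta> \<Omega> u)"
    "(\<lambda>k. L2_norm (leb \<Omega>) (\<phi> k)) \<longlonglongrightarrow> L2_norm (leb \<Omega>) u"
    "(\<lambda>k. L2_norm (leb \<Omega>) (grad (\<phi> k))) \<longlonglongrightarrow> L2_norm (leb \<Omega>) (weak_grad \<Omega> u)"
    "(\<lambda>k. ip (leb \<Omega>) (\<lambda>x. grad (\<phi> k) x $ i) (\<phi> k)) \<longlonglongrightarrow> ip (leb \<Omega>) (\<lambda>x. weak_grad \<Omega> u x $ i) u"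
proof -
  let ?g = "cone_trace \<theta> \<Omega> u"
  note B = cone_domain_borel[OF \<Omega>]
  obtain \<phi> where \<phi>: "\<And>k. \<phi> k \<in> test_functions UNIV" "(\<lambda>k. L2_norm (leb \<Omega>) (\<lambda>x. \<phi> k x - u x)) \<longlonglongrightarrow> 0"
    "(\<lambda>k. L2_norm (leb \<Omega>) (\<lambda>x. grad (\<phi> k) x - weak_grad \<Omega> u x)) \<longlonglongrightarrow> 0" "(\<lambda>k. L2_norm \<sigma> (\<lambda>x. \<phi> k x - ?g x)) \<longlonglongrightarrow> 0" "?g \<in> L2 \<sigma>"
    using cone_trace(1)[OF \<Omega> u] unfolding has_trace_def by auto
  have GL: "grad (\<phi> k) \<in> L2 (leb \<Omega>)" for k by (rule L2_leb_subset(1)[OF B test_grad_L2[OF \<phi>(1)]])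
  show ?thesis
  proof (rule that[OF \<phi>(1)])
    show "(\<lambda>k. L2_norm \<sigma> (\<phi> k)) \<longlonglongrightarrow> L2_norm \<sigma> ?g" by (intro L2_norm_tendsto test_surface_L2 \<phi>)
    show "(\<lambda>k. L2_norm (leb \<Omega>) (\<phi> k)) \<longlonglongrightarrow> L2_norm (leb \<Omega>) u" by (intro L2_norm_tendsto test_L2_leb[OF B] \<phi> H1D(1)[OF u])
    show "(\<lambda>k. L2_norm (leb \<Omega>) (grad (\<phi> k))) \<longlonglongrightarrow> L2_norm (leb \<Omega>) (weak_grad \<Omega> u)" by (intro L2_norm_tendsto GL \<phi> H1D(3)[OF u])
    show "(\<lambda>k. ip (leb \<Omega>) (\<lambda>x. grad (\<phi> k) x $ i) (\<phi> k)) \<longlonglongrightarrow> ip (leb \<Omega>) (\<lambda>x. weak_grad \<Omega> u x $ i) u"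
    proof (rule ip_tendsto)
      show "(\<lambda>k. L2_norm (leb \<Omega>) (\<lambda>x. grad (\<phi> k) x $ i - weak_grad \<Omega> u x $ i)) \<longlonglongrightarrow> 0"
      proof (rule Lim_null_comparison[OF _ \<phi>(3)], intro always_eventually allI)
        fix k
        from L2_norm_component_le[OF L2_diff[OF GL H1D(3)[OF u]], of k i]
        show "norm (L2_norm (leb \<Omega>) (\<lambda>x. grad (\<phi> k) x $ i - weak_grad \<Omega> u x $ i)) \<le> L2_norm (leb \<Omega>) (\<lambda>x. grad (\<phi> k) x - weak_grad \<Omega> u x)" by simp
      qed
    qed (intro L2_component GL H1D[OF u] test_L2_leb[OF B] \<phi>)+
  qed
qed

lemma trace_identity:
  assumes u: "u \<in> H1 (Omega2 \<theta>)"
  shows "sin \<theta> * (L2_norm \<sigma> (cone_trace \<theta> (Omega2 \<theta>) u))\<^sup>2 = 2 * Re (ip (leb (Omega2 \<theta>)) (\<lambda>x. weak_grad (Omega2 \<theta>) u x $ 3) u)"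
proof -
  obtain \<phi> where \<phi>: "\<And>k. \<phi> k \<in> test_functions UNIV"
    "(\<lambda>k. L2_norm \<sigma> (\<phi> k)) \<longlonglongrightarrow> L2_norm \<sigma> (cone_trace \<theta> (Omega2 \<theta>) u)"
    "(\<lambda>k. ip (leb (Omega2 \<theta>)) (\<lambda>x. grad (\<phi> k) x $ 3) (\<phi> k)) \<longlonglongrightarrow> ip (leb (Omega2 \<theta>)) (\<lambda>x. weak_grad (Omega2 \<theta>) u x $ 3) u"
    by (rule trace_approximation[OF cone_domains(3) u, of 3]) blast
  have "(\<lambda>k. sin \<theta> * (L2_norm \<sigma> (\<phi> k))\<^sup>2) \<longlonglongrightarrow> sin \<theta> * (L2_norm \<sigma> (cone_trace \<theta> (Omega2 \<theta>) u))\<^sup>2" by (intro tendsto_intros \<phi>)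
  moreover have "(\<lambda>k. sin \<theta> * (L2_norm \<sigma> (\<phi> k))\<^sup>2) \<longlonglongrightarrow> 2 * Re (ip (leb (Omega2 \<theta>)) (\<lambda>x. weak_grad (Omega2 \<theta>) u x $ 3) u)"
    unfolding test_trace_identity(1)[OF \<phi>(1)] by (intro tendsto_intros \<phi>)
  ultimately show ?thesis by (rule LIMSEQ_unique)
qed

lemma trace_bound:
  assumes \<Omega>: "cone_domain \<Omega>" and u: "u \<in> H1 \<Omega>"
  shows "sin \<theta> * (L2_norm \<sigma> (cone_trace \<theta> \<Omega> u))\<^sup>2 \<le> 2 * (L2_norm (leb \<Omega>) u * L2_norm (leb \<Omega>) (weak_grad \<Omega> u))"
proof -
  obtain \<phi> where \<phi>: "\<And>k. \<phi> k \<in> test_functions UNIV"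
    "(\<lambda>k. L2_norm \<sigma> (\<phi> k)) \<longlonglongrightarrow> L2_norm \<sigma> (cone_trace \<theta> \<Omega> u)"
    "(\<lambda>k. L2_norm (leb \<Omega>) (\<phi> k)) \<longlonglongrightarrow> L2_norm (leb \<Omega>) u"
    "(\<lambda>k. L2_norm (leb \<Omega>) (grad (\<phi> k))) \<longlonglongrightarrow> L2_norm (leb \<Omega>) (weak_grad \<Omega> u)"
    by (rule trace_approximation[OF \<Omega> u]) blast
  have "(\<lambda>k. sin \<theta> * (L2_norm \<sigma> (\<phi> k))\<^sup>2) \<longlonglongrightarrow> sin \<theta> * (L2_norm \<sigma> (cone_trace \<theta> \<Omega> u))\<^sup>2" by (intro tendsto_intros \<phi>)
  moreover have "(\<lambda>k. 2 * (L2_norm (leb \<Omega>) (\<phi> k) * L2_norm (leb \<Omega>) (grad (\<phi> k)))) \<longlonglongrightarrow> 2 * (L2_norm (leb \<Omega>) u * L2_norm (leb \<Omega>) (weak_grad \<Omega> u))"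
    by (intro tendsto_intros \<phi>)
  ultimately show ?thesis by (rule LIMSEQ_le) (use test_trace_bound[OF \<Omega> \<phi>(1)] in auto)
qed

theorem boundary_inequality:
  assumes u: "u \<in> H1 (Omega2 \<theta>)" and \<gamma>: "\<gamma> \<ge> 0"
  shows "\<gamma> * (L2_norm \<sigma> (cone_trace \<theta> (Omega2 \<theta>) u))\<^sup>2
    \<le> (L2_norm (leb (Omega2 \<theta>)) (weak_grad (Omega2 \<theta>) u))\<^sup>2 + \<gamma>\<^sup>2 * (L2_norm (leb (Omega2 \<theta>)) u)\<^sup>2"
proof -
  let ?\<Omega> = "Omega2 \<theta>"
  obtain \<phi> where \<phi>: "\<And>k. \<phi> k \<in> test_functions UNIV"
    "(\<lambda>k. L2_norm \<sigma> (\<phi> k)) \<longlonglongrightarrow> L2_norm \<sigma> (cone_trace \<theta> ?\<Omega> u)"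
    "(\<lambda>k. L2_norm (leb ?\<Omega>) (\<phi> k)) \<longlonglongrightarrow> L2_norm (leb ?\<Omega>) u"
    "(\<lambda>k. L2_norm (leb ?\<Omega>) (grad (\<phi> k))) \<longlonglongrightarrow> L2_norm (leb ?\<Omega>) (weak_grad ?\<Omega> u)"
    by (rule trace_approximation[OF cone_domains(3) u]) blast
  have "(\<lambda>k. \<gamma> * (L2_norm \<sigma> (\<phi> k))\<^sup>2) \<longlonglongrightarrow> \<gamma> * (L2_norm \<sigma> (cone_trace \<theta> ?\<Omega> u))\<^sup>2" by (intro tendsto_intros \<phi>)
  moreover have "(\<lambda>k. (L2_norm (leb ?\<Omega>) (grad (\<phi> k)))\<^sup>2 + \<gamma>\<^sup>2 * (L2_norm (leb ?\<Omega>) (\<phi> k))\<^sup>2) \<longlonglongrightarrow> (L2_norm (leb ?\<Omega>) (weak_grad ?\<Omega> u))\<^sup>2 + \<gamma>\<^sup>2 * (L2_norm (leb ?\<Omega>) u)\<^sup>2"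
    by (intro tendsto_intros \<phi>)
  ultimately show ?thesis by (rule LIMSEQ_le) (use test_boundary_inequality[OF \<phi>(1) \<gamma>] in auto)
qed

end

section \<open>The two forms\<close>

lemma ip3_lin_left_AE:
  assumes L: "F \<in> L2 M" "F1 \<in> L2 M" "F2 \<in> L2 M" "H \<in> L2 M"
    and eq: "AE x in M. \<forall>i. F x $ i = F1 x $ i + c * F2 x $ i"
  shows "ip3 M F H = ip3 M F1 H + c * ip3 M F2 H"
proof -
  note C = L2_component[OF L(1)] L2_component[OF L(2)] L2_component[OF L(3)] L2_component[OF L(4)]
  have "ip M (\<lambda>x. F x $ i) (\<lambda>x. H x $ i) = ip M (\<lambda>x. F1 x $ i) (\<lambda>x. H x $ i) + c * ip M (\<lambda>x. F2 x $ i) (\<lambda>x. H x $ i)" for i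
  proof -
    have "ip M (\<lambda>x. F x $ i) (\<lambda>x. H x $ i) = ip M (\<lambda>x. F1 x $ i + c * F2 x $ i) (\<lambda>x. H x $ i)"
    proof (rule ip_cong_AE)
      show "AE x in M. F x $ i = F1 x $ i + c * F2 x $ i" using eq by eventually_elim simp
    qed (intro L2_measurable L2_lin C AE_I2 refl)+
    also have "\<dots> = ip M (\<lambda>x. F1 x $ i) (\<lambda>x. H x $ i) + c * ip M (\<lambda>x. F2 x $ i) (\<lambda>x. H x $ i)" by (rule ip_lin_left[OF C(2,3,4)])
    finally show ?thesis .
  qed
  then show ?thesis by (simp add: ip3_components L sum.distrib sum_distrib_left)
qed

lemma ip3_cnj: "F \<in> L2 M \<Longrightarrow> G \<in> L2 M \<Longrightarrow> cnj (ip3 M F G) = ip3 M G F"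
  by (simp add: ip3_components ip_cnj)

lemma ip3_self: "F \<in> L2 M \<Longrightarrow> ip3 M F F = of_real ((L2_norm M F)\<^sup>2)"
  by (simp add: ip3_components ip_self L2_norm_vec_sq)

lemma L2_zero_norm [simp]: "L2_norm M (\<lambda>x. 0) = 0"
  by (simp add: L2_norm_def)

context cone
begin

lemma delta_semibounded:
  assumes \<alpha>: "\<alpha> > 0"
  shows "semibounded_form (H1 UNIV) (delta_form \<theta> \<alpha>) ((\<alpha> / sin \<theta>)\<^sup>2)"
proof
  let ?D = "H1 UNIV"
  have tr: "cone_trace \<theta> UNIV u \<in> L2 \<sigma>" if "u \<in> ?D" for u using cone_trace(2)[OF _ that] by simp
  have wg: "weak_grad UNIV u \<in> L2 lborel" if "u \<in> ?D" for u using H1D(3)[OF that] by simp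
  have at: "(\<lambda>x. of_real \<alpha> * cone_trace \<theta> UNIV u x) \<in> L2 \<sigma>" if "u \<in> ?D" for u by (rule L2_cmult[OF tr[OF that]])
  have "is_weak_grad UNIV (\<lambda>x. 0) (\<lambda>x. 0)" by (simp add: is_weak_grad_def)
  then have "(\<lambda>x. 0) \<in> ?D" by (intro H1I) simp
  then show "?D \<noteq> {}" by blast
  show "u \<in> L2 lborel" if "u \<in> ?D" for u using H1D(1)[OF that] by simp
  show "(\<lambda>x. u x + c * v x) \<in> ?D" if "u \<in> ?D" "v \<in> ?D" for u v c using H1_lin[of UNIV u v c] that by simp
  show "delta_form \<theta> \<alpha> (\<lambda>x. u x + c * v x) w = delta_form \<theta> \<alpha> u w + c * delta_form \<theta> \<alpha> v w"
    if D: "u \<in> ?D" "v \<in> ?D" "w \<in> ?D" for u v w c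
  proof -
    have uv: "(\<lambda>x. u x + c * v x) \<in> ?D" using H1_lin[of UNIV u v c] D by simp
    have 1: "ip3 lborel (weak_grad UNIV (\<lambda>x. u x + c * v x)) (weak_grad UNIV w) =
      ip3 lborel (weak_grad UNIV u) (weak_grad UNIV w) + c * ip3 lborel (weak_grad UNIV v) (weak_grad UNIV w)"
      by (rule ip3_lin_left_AE[OF wg[OF uv] wg[OF D(1)] wg[OF D(2)] wg[OF D(3)]])
         (use weak_grad_lin[OF cone_domain_shiftable[OF cone_domains(1)] D(1,2), of c] in \<open>simp only: leb_UNIV\<close>)
    have "ip \<sigma> (\<lambda>x. of_real \<alpha> * cone_trace \<theta> UNIV (\<lambda>x. u x + c * v x) x) (cone_trace \<theta> UNIV w)
      = ip \<sigma> (\<lambda>x. of_real \<alpha> * cone_trace \<theta> UNIV u x + c * (of_real \<alpha> * cone_trace \<theta> UNIV v x)) (cone_trace \<theta> UNIV w)"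
    proof (rule ip_cong_AE)
      show "AE x in \<sigma>. of_real \<alpha> * cone_trace \<theta> UNIV (\<lambda>x. u x + c * v x) x = of_real \<alpha> * cone_trace \<theta> UNIV u x + c * (of_real \<alpha> * cone_trace \<theta> UNIV v x)"
        using cone_trace_lin[OF _ D(1,2), of c] by (simp add: algebra_simps) (auto elim!: eventually_mono simp: algebra_simps)
    qed (intro L2_measurable L2_lin at tr D uv AE_I2 refl)+
    also have "\<dots> = ip \<sigma> (\<lambda>x. of_real \<alpha> * cone_trace \<theta> UNIV u x) (cone_trace \<theta> UNIV w) + c * ip \<sigma> (\<lambda>x. of_real \<alpha> * cone_trace \<theta> UNIV v x) (cone_trace \<theta> UNIV w)"
      by (intro ip_lin_left at tr D)
    finally show ?thesis unfolding delta_form_def 1 by (simp add: algebra_simps)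
  qed
  show "delta_form \<theta> \<alpha> v u = cnj (delta_form \<theta> \<alpha> u v)" if D: "u \<in> ?D" "v \<in> ?D" for u v
  proof -
    have "cnj (ip \<sigma> (\<lambda>x. of_real \<alpha> * cone_trace \<theta> UNIV u x) (cone_trace \<theta> UNIV v)) = ip \<sigma> (\<lambda>x. of_real \<alpha> * cone_trace \<theta> UNIV v x) (cone_trace \<theta> UNIV u)"
      by (simp add: ip_cmult_left ip_cnj)
    then show ?thesis using ip3_cnj[OF wg[OF D(1)] wg[OF D(2)]] by (simp add: delta_form_def)
  qed
  show "- ((\<alpha> / sin \<theta>)\<^sup>2) * (L2_norm lborel u)\<^sup>2 \<le> Re (delta_form \<theta> \<alpha> u u)" if u: "u \<in> ?D" for u
  proof -
    define n where "n = L2_norm lborel (weak_grad UNIV u)"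
    define m where "m = L2_norm lborel u"
    define t where "t = (L2_norm \<sigma> (cone_trace \<theta> UNIV u))\<^sup>2"
    have "sin \<theta> * t \<le> 2 * (m * n)" using trace_bound[of UNIV u, OF _ u] by (simp add: t_def m_def n_def)
    then have "t \<le> 2 * (m * n) / sin \<theta>" using sin_pos by (simp add: field_simps)
    then have "\<alpha> * t \<le> \<alpha> * (2 * (m * n) / sin \<theta>)" using \<alpha> by (intro mult_left_mono) auto
    also have "\<dots> = 2 * (\<alpha> / sin \<theta> * m) * n" by simp
    also have "\<dots> \<le> (\<alpha> / sin \<theta> * m)\<^sup>2 + n\<^sup>2" by (rule sum_squares_bound)
    finally have "- ((\<alpha> / sin \<theta>)\<^sup>2) * m\<^sup>2 \<le> n\<^sup>2 - \<alpha> * t" unfolding power_mult_distrib by simp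
    also have "n\<^sup>2 - \<alpha> * t = Re (delta_form \<theta> \<alpha> u u)"
      by (simp add: delta_form_def ip3_self[OF wg[OF u]] ip_cmult_left ip_self n_def t_def)
    finally show ?thesis by (simp add: m_def)
  qed
qed

lemma trace_jump_L2: "u \<in> H1 (Omega1 \<theta>) \<Longrightarrow> u \<in> H1 (Omega2 \<theta>) \<Longrightarrow> trace_jump \<theta> u \<in> L2 \<sigma>"
  unfolding trace_jump_def[abs_def] by (intro L2_diff cone_trace(2)) auto

lemma H1_minus_coneD: "u \<in> H1_minus_cone \<theta> \<Longrightarrow> u \<in> L2 lborel" "u \<in> H1_minus_cone \<theta> \<Longrightarrow> u \<in> H1 (Omega1 \<theta>)"
  "u \<in> H1_minus_cone \<theta> \<Longrightarrow> u \<in> H1 (Omega2 \<theta>)"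
  by (auto simp: H1_minus_cone_def)

lemma H1_zero: "\<Omega> \<in> sets borel \<Longrightarrow> (\<lambda>x. 0) \<in> H1 \<Omega>" "is_weak_grad \<Omega> (\<lambda>x. 0) (\<lambda>x. 0)"
  by (auto simp: is_weak_grad_def intro!: H1I[of _ _ "\<lambda>x. 0"])

lemma delta'_semibounded:
  assumes \<beta>: "\<beta> > 0"
  shows "semibounded_form (H1_minus_cone \<theta>) (delta'_form \<theta> \<beta>) (2 * (2 / (\<beta> * sin \<theta>))\<^sup>2)"
proof
  let ?D = "H1_minus_cone \<theta>"
  have H: "u \<in> H1 \<Omega>" if "u \<in> ?D" "\<Omega> = Omega1 \<theta> \<or> \<Omega> = Omega2 \<theta>" for u \<Omega> using that H1_minus_coneD by blast
  have tj: "trace_jump \<theta> u \<in> L2 \<sigma>" if "u \<in> ?D" for u using trace_jump_L2 H1_minus_coneD that by blast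
  have bt: "(\<lambda>x. of_real (1 / \<beta>) * trace_jump \<theta> u x) \<in> L2 \<sigma>" if "u \<in> ?D" for u by (rule L2_cmult[OF tj[OF that]])
  have wg: "weak_grad \<Omega> u \<in> L2 (leb \<Omega>)" if "u \<in> ?D" "\<Omega> = Omega1 \<theta> \<or> \<Omega> = Omega2 \<theta>" for u \<Omega> using H1D(3) H that by blast
  have "(\<lambda>x. 0) \<in> ?D" using H1_zero by (auto simp: H1_minus_cone_def)
  then show "?D \<noteq> {}" by blast
  show "u \<in> L2 lborel" if "u \<in> ?D" for u using H1_minus_coneD(1)[OF that] .
  have lin: "(\<lambda>x. u x + c * v x) \<in> ?D" if "u \<in> ?D" "v \<in> ?D" for u v c
    using that unfolding H1_minus_cone_def by (auto intro: L2_lin H1_lin)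
  then show "(\<lambda>x. u x + c * v x) \<in> ?D" if "u \<in> ?D" "v \<in> ?D" for u v c using that by blast
  show "delta'_form \<theta> \<beta> (\<lambda>x. u x + c * v x) w = delta'_form \<theta> \<beta> u w + c * delta'_form \<theta> \<beta> v w"
    if D: "u \<in> ?D" "v \<in> ?D" "w \<in> ?D" for u v w c
  proof -
    have 1: "ip3 (leb \<Omega>) (weak_grad \<Omega> (\<lambda>x. u x + c * v x)) (weak_grad \<Omega> w) =
      ip3 (leb \<Omega>) (weak_grad \<Omega> u) (weak_grad \<Omega> w) + c * ip3 (leb \<Omega>) (weak_grad \<Omega> v) (weak_grad \<Omega> w)"
      if \<Omega>: "\<Omega> = Omega1 \<theta> \<or> \<Omega> = Omega2 \<theta>" for \<Omega>
      by (rule ip3_lin_left_AE) (use wg[OF _ \<Omega>] D lin[OF D(1,2)] weak_grad_lin[OF cone_domain_shiftable[of \<Omega>] H[OF D(1) \<Omega>] H[OF D(2) \<Omega>], of c] \<Omega> in auto)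
    have "ip \<sigma> (\<lambda>x. of_real (1 / \<beta>) * trace_jump \<theta> (\<lambda>x. u x + c * v x) x) (trace_jump \<theta> w)
      = ip \<sigma> (\<lambda>x. of_real (1 / \<beta>) * trace_jump \<theta> u x + c * (of_real (1 / \<beta>) * trace_jump \<theta> v x)) (trace_jump \<theta> w)"
    proof (rule ip_cong_AE)
      show "AE x in \<sigma>. of_real (1 / \<beta>) * trace_jump \<theta> (\<lambda>x. u x + c * v x) x = of_real (1 / \<beta>) * trace_jump \<theta> u x + c * (of_real (1 / \<beta>) * trace_jump \<theta> v x)"
        using cone_trace_lin[OF cone_domains(2) H H, of u v c, OF D(1) _ D(2)] cone_trace_lin[OF cone_domains(3) H H, of u v c, OF D(1) _ D(2)]
        by (auto elim!: eventually_elim2 simp: trace_jump_def algebra_simps simp del: of_real_divide)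
    qed (intro L2_measurable L2_lin bt tj D lin AE_I2 refl)+
    also have "\<dots> = ip \<sigma> (\<lambda>x. of_real (1 / \<beta>) * trace_jump \<theta> u x) (trace_jump \<theta> w) + c * ip \<sigma> (\<lambda>x. of_real (1 / \<beta>) * trace_jump \<theta> v x) (trace_jump \<theta> w)"
      by (intro ip_lin_left bt tj D)
    finally show ?thesis unfolding delta'_form_def 1[OF disjI1[OF refl]] 1[OF disjI2[OF refl]] by (simp add: algebra_simps)
  qed
  show "delta'_form \<theta> \<beta> v u = cnj (delta'_form \<theta> \<beta> u v)" if D: "u \<in> ?D" "v \<in> ?D" for u v
  proof -
    have "cnj (ip \<sigma> (\<lambda>x. of_real (1 / \<beta>) * trace_jump \<theta> u x) (trace_jump \<theta> v)) = ip \<sigma> (\<lambda>x. of_real (1 / \<beta>) * trace_jump \<theta> v x) (trace_jump \<theta> u)"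
      by (simp add: ip_cmult_left ip_cnj del: of_real_divide)
    then show ?thesis using ip3_cnj[OF wg[OF D(1)] wg[OF D(2)]] by (simp add: delta'_form_def del: of_real_divide)
  qed
  show "- (2 * (2 / (\<beta> * sin \<theta>))\<^sup>2) * (L2_norm lborel u)\<^sup>2 \<le> Re (delta'_form \<theta> \<beta> u u)" if u: "u \<in> ?D" for u
  proof -
    define n where "n \<Omega> = L2_norm (leb \<Omega>) (weak_grad \<Omega> u)" for \<Omega>
    define t where "t \<Omega> = (L2_norm \<sigma> (cone_trace \<theta> \<Omega> u))\<^sup>2" for \<Omega>
    define m where "m = L2_norm lborel u"
    define k where "k = 2 / (\<beta> * sin \<theta>)"
    have b: "(2 / \<beta>) * t \<Omega> \<le> k\<^sup>2 * m\<^sup>2 + (n \<Omega>)\<^sup>2" if \<Omega>: "\<Omega> = Omega1 \<theta> \<or> \<Omega> = Omega2 \<theta>" for \<Omega>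
    proof -
      have B: "\<Omega> \<in> sets borel" "cone_domain \<Omega>" using \<Omega> by auto
      have "sin \<theta> * t \<Omega> \<le> 2 * (L2_norm (leb \<Omega>) u * n \<Omega>)"
        using trace_bound[OF B(2) H[OF u \<Omega>]] by (simp add: t_def n_def)
      also have "\<dots> \<le> 2 * (m * n \<Omega>)"
        using L2_leb_subset(2)[OF B(1) H1_minus_coneD(1)[OF u]] by (intro mult_left_mono mult_right_mono) (auto simp: m_def n_def)
      finally have "t \<Omega> \<le> 2 * (m * n \<Omega>) / sin \<theta>" using sin_pos by (simp add: field_simps)
      then have "(2 / \<beta>) * t \<Omega> \<le> (2 / \<beta>) * (2 * (m * n \<Omega>) / sin \<theta>)" using \<beta> by (intro mult_left_mono) auto
      also have "\<dots> = 2 * (k * m) * n \<Omega>" by (simp add: k_def)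
      also have "\<dots> \<le> (k * m)\<^sup>2 + (n \<Omega>)\<^sup>2" by (rule sum_squares_bound)
      finally show ?thesis by (simp add: power_mult_distrib)
    qed
    have "L2_norm \<sigma> (trace_jump \<theta> u) \<le> L2_norm \<sigma> (cone_trace \<theta> (Omega1 \<theta>) u) + L2_norm \<sigma> (cone_trace \<theta> (Omega2 \<theta>) u)"
      using L2_norm_triangle3[OF cone_trace(2)[OF _ H[OF u]] L2_zero cone_trace(2)[OF _ H[OF u]], of "Omega1 \<theta>" "Omega2 \<theta>"]
      by (simp add: trace_jump_def[abs_def])
    then have "(L2_norm \<sigma> (trace_jump \<theta> u))\<^sup>2 \<le> (L2_norm \<sigma> (cone_trace \<theta> (Omega1 \<theta>) u) + L2_norm \<sigma> (cone_trace \<theta> (Omega2 \<theta>) u))\<^sup>2"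
      by (intro power_mono) auto
    also have "\<dots> \<le> 2 * t (Omega1 \<theta>) + 2 * t (Omega2 \<theta>)"
      using sum_squares_bound[of "L2_norm \<sigma> (cone_trace \<theta> (Omega1 \<theta>) u)" "L2_norm \<sigma> (cone_trace \<theta> (Omega2 \<theta>) u)"]
      by (simp add: t_def power2_sum)
    finally have "(1 / \<beta>) * (L2_norm \<sigma> (trace_jump \<theta> u))\<^sup>2 \<le> (1 / \<beta>) * (2 * t (Omega1 \<theta>) + 2 * t (Omega2 \<theta>))"
      using \<beta> by (intro mult_left_mono) auto
    also have "\<dots> = (2 / \<beta>) * t (Omega1 \<theta>) + (2 / \<beta>) * t (Omega2 \<theta>)" by (simp add: algebra_simps add_divide_distrib)
    finally have "- (2 * k\<^sup>2) * m\<^sup>2 \<le> (n (Omega1 \<theta>))\<^sup>2 + (n (Omega2 \<theta>))\<^sup>2 - (1 / \<beta>) * (L2_norm \<sigma> (trace_jump \<theta> u))\<^sup>2"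
      using b[of "Omega1 \<theta>"] b[of "Omega2 \<theta>"] by simp
    also have "\<dots> = Re (delta'_form \<theta> \<beta> u u)"
      by (simp add: delta'_form_def ip3_self wg[OF u] ip_cmult_left ip_self n_def del: of_real_divide)
    finally show ?thesis by (simp add: k_def m_def)
  qed
qed

subsection \<open>Changing the sign on one side of the cone\<close>

definition flip :: "(real ^ 3 \<Rightarrow> complex) \<Rightarrow> real ^ 3 \<Rightarrow> complex" where
  "flip u x = (if x \<in> Omega1 \<theta> then u x else - u x)"

lemma Omega_disjoint: "x \<in> Omega1 \<theta> \<Longrightarrow> x \<notin> Omega2 \<theta>"
  by (simp add: Omega1_def Omega2_def)

lemma norm_split:
  fixes f :: "real ^ 3 \<Rightarrow> 'b::{real_normed_vector, second_countable_topology}"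
  assumes f: "f \<in> L2 lborel"
  shows "(L2_norm lborel f)\<^sup>2 = (L2_norm (leb (Omega1 \<theta>)) f)\<^sup>2 + (L2_norm (leb (Omega2 \<theta>)) f)\<^sup>2"
proof -
  let ?n = "\<lambda>x. (norm (f x))\<^sup>2"
  have i: "integrable lborel (ext0 \<Omega> ?n)" if "\<Omega> = Omega1 \<theta> \<or> \<Omega> = Omega2 \<theta>" for \<Omega>
    using leb_integrable[of \<Omega> ?n] L2_integrable[OF L2_leb_subset(1)[of \<Omega>, OF _ f]] that by auto
  have "(\<integral>x. ?n x \<partial>lborel) = (\<integral>x. ext0 (Omega1 \<theta>) ?n x + ext0 (Omega2 \<theta>) ?n x \<partial>lborel)"
  proof (rule integral_cong_AE)
    show "AE x in lborel. ?n x = ext0 (Omega1 \<theta>) ?n x + ext0 (Omega2 \<theta>) ?n x"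
      using cone_null[of \<theta>] by eventually_elim (auto simp: ext0_def dest: Omega_disjoint)
    show "(\<lambda>x. ext0 (Omega1 \<theta>) ?n x + ext0 (Omega2 \<theta>) ?n x) \<in> borel_measurable lborel"
      by (rule borel_measurable_integrable[OF Bochner_Integration.integrable_add[OF i i]]) auto
  qed (use borel_measurable_integrable[OF L2_integrable[OF f]] in simp)
  then show ?thesis using i by (simp add: L2_norm_sq leb_integral)
qed

lemma flip_L2:
  assumes "u \<in> L2 lborel"
  shows "flip u \<in> L2 lborel" "L2_norm lborel (flip u) = L2_norm lborel u"
proof -
  have [measurable]: "u \<in> borel_measurable borel" using L2_borel[OF assms] .
  have "flip u \<in> borel_measurable borel" unfolding flip_def[abs_def] by measurable
  then show "flip u \<in> L2 lborel" by (intro L2I[OF _ L2_integrable[OF assms]]) (auto simp: flip_def)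
  show "L2_norm lborel (flip u) = L2_norm lborel u"
    unfolding L2_norm_def by (intro arg_cong[where f = sqrt] Bochner_Integration.integral_cong refl) (auto simp: flip_def)
qed

lemma H1_neg: "\<Omega> \<in> sets borel \<Longrightarrow> u \<in> H1 \<Omega> \<Longrightarrow> (\<lambda>x. - u x) \<in> H1 \<Omega>"
  using H1_lin[OF _ H1_zero(1), of \<Omega> u "-1"] by simp

lemma weak_grad_zero: "cone_domain \<Omega> \<Longrightarrow> AE x in leb \<Omega>. weak_grad \<Omega> (\<lambda>x. 0) x = 0"
  by (rule weak_grad_AE[OF cone_domain_shiftable H1_zero(1)[OF cone_domain_borel] H1_zero(2)])

lemma cone_trace_zero:
  assumes "cone_domain \<Omega>"
  shows "AE x in \<sigma>. cone_trace \<theta> \<Omega> (\<lambda>x. 0) x = 0"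
  using cone_trace_lin[OF assms H1_zero(1) H1_zero(1), of "-1"] cone_domain_borel[OF assms] by (auto elim!: eventually_mono)

lemma weak_grad_neg:
  assumes "cone_domain \<Omega>" "u \<in> H1 \<Omega>"
  shows "AE x in leb \<Omega>. weak_grad \<Omega> (\<lambda>x. - u x) x = - weak_grad \<Omega> u x"
  using weak_grad_lin[OF cone_domain_shiftable[OF assms(1)] H1_zero(1)[OF cone_domain_borel[OF assms(1)]] assms(2), of "-1"]
    weak_grad_zero[OF assms(1)]
  by eventually_elim (auto simp: vec_eq_iff)

lemma cone_trace_neg:
  assumes "cone_domain \<Omega>" "u \<in> H1 \<Omega>"
  shows "AE x in \<sigma>. cone_trace \<theta> \<Omega> (\<lambda>x. - u x) x = - cone_trace \<theta> \<Omega> u x"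
  using cone_trace_lin[OF assms(1) H1_zero(1)[OF cone_domain_borel[OF assms(1)]] assms(2), of "-1"] cone_trace_zero[OF assms(1)]
  by eventually_elim auto

lemma flip_H1:
  assumes u: "u \<in> H1 UNIV"
  shows "flip u \<in> H1_minus_cone \<theta>"
proof -
  have "flip u \<in> H1 (Omega1 \<theta>)"
    using H1_cong[of "Omega1 \<theta>" "flip u" u] H1_restrict[OF _ u] by (simp add: flip_def)
  moreover have "flip u \<in> H1 (Omega2 \<theta>)"
    by (rule iffD2[OF H1_cong[of "Omega2 \<theta>" "flip u" "\<lambda>x. - u x"] H1_neg[OF _ H1_restrict[OF _ u], of "Omega2 \<theta>"]])
       (use Omega_disjoint in \<open>auto simp: flip_def\<close>)
  ultimately show ?thesis using flip_L2(1) H1D(1)[OF u] by (simp add: H1_minus_cone_def)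
qed

lemma flip_traces:
  assumes u: "u \<in> H1 UNIV"
  shows "AE x in \<sigma>. cone_trace \<theta> (Omega1 \<theta>) (flip u) x = cone_trace \<theta> UNIV u x"
    "AE x in \<sigma>. cone_trace \<theta> (Omega2 \<theta>) (flip u) x = - cone_trace \<theta> UNIV u x"
    "AE x in \<sigma>. trace_jump \<theta> (flip u) x = 2 * cone_trace \<theta> UNIV u x"
proof -
  have "cone_trace \<theta> (Omega1 \<theta>) (flip u) = cone_trace \<theta> (Omega1 \<theta>) u" by (rule cone_trace_cong) (auto simp: flip_def)
  then show 1: "AE x in \<sigma>. cone_trace \<theta> (Omega1 \<theta>) (flip u) x = cone_trace \<theta> UNIV u x"
    using cone_trace_restrict[OF cone_domains(2) u] by simp
  have "cone_trace \<theta> (Omega2 \<theta>) (flip u) = cone_trace \<theta> (Omega2 \<theta>) (\<lambda>x. - u x)"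
    by (rule cone_trace_cong) (use Omega_disjoint in \<open>auto simp: flip_def\<close>)
  then show 2: "AE x in \<sigma>. cone_trace \<theta> (Omega2 \<theta>) (flip u) x = - cone_trace \<theta> UNIV u x"
    using cone_trace_neg[OF cone_domains(3) H1_restrict[OF _ u]] cone_trace_restrict[OF cone_domains(3) u] by (auto elim!: eventually_elim2)
  show "AE x in \<sigma>. trace_jump \<theta> (flip u) x = 2 * cone_trace \<theta> UNIV u x"
    using 1 2 by eventually_elim (simp add: trace_jump_def)
qed

lemma flip_form:
  assumes u: "u \<in> H1 UNIV" and \<alpha>: "\<alpha> > 0"
  shows "Re (delta'_form \<theta> (4 / \<alpha>) (flip u) (flip u)) = Re (delta_form \<theta> \<alpha> u u)"
proof -
  let ?G = "weak_grad UNIV u"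
  have GL: "?G \<in> L2 lborel" using H1D(3)[OF u] by simp
  have uO: "u \<in> H1 (Omega1 \<theta>)" "u \<in> H1 (Omega2 \<theta>)" using H1_restrict[OF _ u] by auto
  note D = flip_H1[OF u]
  have L: "weak_grad (Omega1 \<theta>) (flip u) \<in> L2 (leb (Omega1 \<theta>))" "weak_grad (Omega2 \<theta>) (flip u) \<in> L2 (leb (Omega2 \<theta>))"
    using H1D(3) H1_minus_coneD D by blast+
  have "weak_grad (Omega1 \<theta>) (flip u) = weak_grad (Omega1 \<theta>) u" by (rule weak_grad_cong) (auto simp: flip_def)
  then have "AE x in leb (Omega1 \<theta>). weak_grad (Omega1 \<theta>) (flip u) x = ?G x"
    using weak_grad_restrict[OF cone_domain_shiftable[OF cone_domains(2)] u] by simp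
  then have n1: "L2_norm (leb (Omega1 \<theta>)) (weak_grad (Omega1 \<theta>) (flip u)) = L2_norm (leb (Omega1 \<theta>)) ?G"
    by (rule L2_norm_cong_AE) (use L2_measurable[OF L(1)] L2_measurable[OF L2_leb_subset(1)[OF _ GL, of "Omega1 \<theta>"]] in auto)
  have "weak_grad (Omega2 \<theta>) (flip u) = weak_grad (Omega2 \<theta>) (\<lambda>x. - u x)"
    by (rule weak_grad_cong) (use Omega_disjoint in \<open>auto simp: flip_def\<close>)
  then have "AE x in leb (Omega2 \<theta>). weak_grad (Omega2 \<theta>) (flip u) x = - ?G x"
    using weak_grad_restrict[OF cone_domain_shiftable[OF cone_domains(3)] u] weak_grad_neg[OF cone_domains(3) uO(2)] by (auto elim!: eventually_elim2)
  then have "L2_norm (leb (Omega2 \<theta>)) (weak_grad (Omega2 \<theta>) (flip u)) = L2_norm (leb (Omega2 \<theta>)) (\<lambda>x. - ?G x)"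
    by (rule L2_norm_cong_AE) (use L2_measurable[OF L(2)] L2_measurable[OF L2_uminus[OF L2_leb_subset(1)[OF _ GL, of "Omega2 \<theta>"]]] in auto)
  then have n2: "L2_norm (leb (Omega2 \<theta>)) (weak_grad (Omega2 \<theta>) (flip u)) = L2_norm (leb (Omega2 \<theta>)) ?G" by simp
  have gL: "cone_trace \<theta> UNIV u \<in> L2 \<sigma>" using cone_trace(2)[OF cone_domains(1) u] .
  have "L2_norm \<sigma> (trace_jump \<theta> (flip u)) = L2_norm \<sigma> (\<lambda>x. 2 * cone_trace \<theta> UNIV u x)"
    by (rule L2_norm_cong_AE[OF flip_traces(3)[OF u]])
       (use L2_measurable[OF trace_jump_L2[OF H1_minus_coneD(2,3)[OF D]]] L2_measurable[OF L2_cmult[OF gL]] in auto)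
  then have j: "(L2_norm \<sigma> (trace_jump \<theta> (flip u)))\<^sup>2 = 4 * (L2_norm \<sigma> (cone_trace \<theta> UNIV u))\<^sup>2"
    by (simp add: L2_norm_cmult power_mult_distrib)
  have "Re (delta'_form \<theta> (4 / \<alpha>) (flip u) (flip u)) = (L2_norm (leb (Omega1 \<theta>)) ?G)\<^sup>2 + (L2_norm (leb (Omega2 \<theta>)) ?G)\<^sup>2 - 1 / (4 / \<alpha>) * (L2_norm \<sigma> (trace_jump \<theta> (flip u)))\<^sup>2"
    unfolding delta'_form_def ip3_self[OF L(1)] ip3_self[OF L(2)] ip_cmult_left ip_self n1 n2 by (simp only: of_real_mult[symmetric] of_real_add[symmetric] of_real_diff[symmetric] Re_complex_of_real)
  also have "\<dots> = (L2_norm lborel ?G)\<^sup>2 - \<alpha> * (L2_norm \<sigma> (cone_trace \<theta> UNIV u))\<^sup>2"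
    unfolding j norm_split[OF GL] using \<alpha> by (simp add: field_simps)
  also have "\<dots> = Re (delta_form \<theta> \<alpha> u u)"
    unfolding delta_form_def ip3_self[OF GL] ip_cmult_left ip_self by (simp only: of_real_mult[symmetric] of_real_add[symmetric] of_real_diff[symmetric] Re_complex_of_real)
  finally show ?thesis .
qed

lemma L2_cut:
  assumes "v \<in> L2 lborel" and [measurable]: "\<Omega> \<in> sets borel"
  shows "ext0 \<Omega> v \<in> L2 lborel"
proof -
  have [measurable]: "v \<in> borel_measurable borel" using L2_borel[OF assms(1)] .
  have "ext0 \<Omega> v \<in> borel_measurable borel" unfolding ext0_def[abs_def] by measurable
  then show ?thesis by (intro L2I[OF _ L2_integrable[OF assms(1)]]) (auto simp: ext0_def)
qed

text \<open>A weak eigenfunction of the second operator that comes from a function \<open>u\<close> without jump solves the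
  Robin problem on each side of the cone. On \<open>\<Omega>\<^sub>2\<close> the boundary inequality leaves only \<open>0\<close> below
  \<open>- \<alpha>\<^sup>2 / 4\<close>; then \<open>u\<close> has trace \<open>0\<close>, and it vanishes on \<open>\<Omega>\<^sub>1\<close> because the Dirichlet problem has no
  negative eigenvalue.\<close>

lemma no_common_eigenfunction:
  assumes u: "u \<in> H1 UNIV" and \<alpha>: "\<alpha> > 0" and l: "l < - (\<alpha>\<^sup>2 / 4)"
    and eq: "\<And>w. w \<in> H1_minus_cone \<theta> \<Longrightarrow> delta'_form \<theta> (4 / \<alpha>) (flip u) w = of_real l * ip lborel (flip u) w"
  shows "L2_norm lborel (flip u) = 0"
proof -
  define v where "v = flip u"
  let ?O1 = "Omega1 \<theta>" and ?O2 = "Omega2 \<theta>"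
  define g where "g = cone_trace \<theta> UNIV u"
  have gL: "g \<in> L2 \<sigma>" unfolding g_def by (rule cone_trace(2)[OF cone_domains(1) u])
  have vD: "v \<in> H1_minus_cone \<theta>" unfolding v_def by (rule flip_H1[OF u])
  note vH = H1_minus_coneD[OF vD]
  have jv: "AE x in \<sigma>. trace_jump \<theta> v x = 2 * g x" using flip_traces(3)[OF u] by (simp add: v_def g_def)
  have cut: "(L2_norm (leb A) (weak_grad A v))\<^sup>2 - (\<alpha> / 2) * (L2_norm \<sigma> g)\<^sup>2 = l * (L2_norm (leb A) v)\<^sup>2"
    if AB: "A = ?O1 \<and> B = ?O2 \<or> A = ?O2 \<and> B = ?O1" for A B
  proof -
    have m: "A \<in> sets borel" "B \<in> sets borel" "cone_domain A" "cone_domain B" using AB by auto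
    have vA: "v \<in> H1 A" using AB vH by auto
    define w where "w = ext0 A v"
    have wA: "w x = v x" if "x \<in> A" for x using that by (simp add: w_def ext0_def)
    have wB: "w x = 0" if "x \<in> B" for x using that AB Omega_disjoint by (auto simp: w_def ext0_def)
    have wH: "w \<in> H1 A" "w \<in> H1 B" using H1_cong[OF m(1) wA] vA H1_cong[OF m(2) wB] H1_zero(1)[OF m(2)] by auto
    have wD: "w \<in> H1_minus_cone \<theta>"
      using wH AB L2_cut[OF vH(1) m(1)] by (auto simp: H1_minus_cone_def w_def)
    have GA: "weak_grad A w = weak_grad A v" by (rule weak_grad_cong[OF m(1) wA])
    have GB: "weak_grad B w = weak_grad B (\<lambda>x. 0)" by (rule weak_grad_cong[OF m(2) wB])
    have vGL: "weak_grad A v \<in> L2 (leb A)" "weak_grad B v \<in> L2 (leb B)" using H1D(3) AB vH by auto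
    have zGL: "weak_grad B (\<lambda>x. 0) \<in> L2 (leb B)" by (rule H1D(3)[OF H1_zero(1)[OF m(2)]])
    have "ip3 (leb B) (weak_grad B (\<lambda>x. 0)) (weak_grad B v) = ip3 (leb B) (\<lambda>x. 0) (weak_grad B v) + 0 * ip3 (leb B) (\<lambda>x. 0) (weak_grad B v)"
      by (rule ip3_lin_left_AE) (use zGL vGL weak_grad_zero[OF m(4)] in \<open>auto elim!: eventually_mono\<close>)
    then have "ip3 (leb B) (weak_grad B (\<lambda>x. 0)) (weak_grad B v) = 0" by (simp add: ip3_def)
    then have B0: "ip3 (leb B) (weak_grad B v) (weak_grad B w) = 0"
      using ip3_cnj[OF zGL vGL(2)] unfolding GB by simp
    have TA: "cone_trace \<theta> A w = cone_trace \<theta> A v" by (rule cone_trace_cong[OF m(1) wA])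
    have TB: "cone_trace \<theta> B w = cone_trace \<theta> B (\<lambda>x. 0)" by (rule cone_trace_cong[OF m(2) wB])
    have jw: "AE x in \<sigma>. trace_jump \<theta> w x = g x"
    proof (cases "A = ?O1")
      case True
      then have "B = ?O2" using AB by (metis Omega_disjoint)
      then show ?thesis using True flip_traces(1)[OF u] cone_trace_zero[OF m(4)] TA TB
        by (auto simp: trace_jump_def v_def g_def elim!: eventually_elim2)
    next
      case False
      then have "A = ?O2" "B = ?O1" using AB by auto
      then show ?thesis using flip_traces(2)[OF u] cone_trace_zero[OF m(4)] TA TB
        by (auto simp: trace_jump_def v_def g_def elim!: eventually_elim2)
    qed
    have jL: "trace_jump \<theta> v \<in> L2 \<sigma>" "trace_jump \<theta> w \<in> L2 \<sigma>" using trace_jump_L2 H1_minus_coneD vD wD by blast+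
    have "ip \<sigma> (\<lambda>x. of_real (1 / (4 / \<alpha>)) * trace_jump \<theta> v x) (trace_jump \<theta> w) = of_real (1 / (4 / \<alpha>)) * ip \<sigma> (trace_jump \<theta> v) (trace_jump \<theta> w)"
      by (rule ip_cmult_left)
    also have "ip \<sigma> (trace_jump \<theta> v) (trace_jump \<theta> w) = ip \<sigma> (\<lambda>x. 2 * g x) g"
      by (rule ip_cong_AE[OF jv jw]) (use jL gL L2_cmult[OF gL] in \<open>auto dest: L2_measurable\<close>)
    also have "\<dots> = 2 * of_real ((L2_norm \<sigma> g)\<^sup>2)" by (simp only: ip_cmult_left ip_self)
    finally have J: "ip \<sigma> (\<lambda>x. of_real (1 / (4 / \<alpha>)) * trace_jump \<theta> v x) (trace_jump \<theta> w) = of_real ((\<alpha> / 2) * (L2_norm \<sigma> g)\<^sup>2)"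
      using \<alpha> by simp
    have "delta'_form \<theta> (4 / \<alpha>) v w = ip3 (leb A) (weak_grad A v) (weak_grad A w) + ip3 (leb B) (weak_grad B v) (weak_grad B w)
      - ip \<sigma> (\<lambda>x. of_real (1 / (4 / \<alpha>)) * trace_jump \<theta> v x) (trace_jump \<theta> w)"
      unfolding delta'_form_def using AB by auto
    also have "\<dots> = of_real ((L2_norm (leb A) (weak_grad A v))\<^sup>2 - (\<alpha> / 2) * (L2_norm \<sigma> g)\<^sup>2)"
      unfolding B0 J GA ip3_self[OF vGL(1)] by (simp only: of_real_diff add_0_right)
    finally have lhs: "delta'_form \<theta> (4 / \<alpha>) v w = of_real ((L2_norm (leb A) (weak_grad A v))\<^sup>2 - (\<alpha> / 2) * (L2_norm \<sigma> g)\<^sup>2)" .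
    have "ip lborel v w = ip lborel w w"
      unfolding ip_def by (intro Bochner_Integration.integral_cong refl) (simp add: w_def ext0_def)
    also have "\<dots> = of_real ((L2_norm (leb A) v)\<^sup>2)" unfolding ip_self w_def leb_L2_norm[OF m(1)] ..
    finally have "of_real ((L2_norm (leb A) (weak_grad A v))\<^sup>2 - (\<alpha> / 2) * (L2_norm \<sigma> g)\<^sup>2) = (of_real (l * (L2_norm (leb A) v)\<^sup>2) :: complex)"
      using eq[OF wD] lhs unfolding v_def[symmetric] by simp
    then show ?thesis by (simp only: of_real_eq_iff)
  qed
  have g2: "L2_norm \<sigma> (cone_trace \<theta> ?O2 v) = L2_norm \<sigma> g"
  proof -
    have "L2_norm \<sigma> (cone_trace \<theta> ?O2 v) = L2_norm \<sigma> (\<lambda>x. - g x)"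
      by (rule L2_norm_cong_AE) (use flip_traces(2)[OF u] L2_measurable[OF cone_trace(2)[OF cone_domains(3) vH(3)]] L2_measurable[OF L2_uminus[OF gL]] in \<open>auto simp: v_def g_def\<close>)
    then show ?thesis by simp
  qed
  have "(\<alpha> / 2) * (L2_norm \<sigma> g)\<^sup>2 \<le> (L2_norm (leb ?O2) (weak_grad ?O2 v))\<^sup>2 + (\<alpha> / 2)\<^sup>2 * (L2_norm (leb ?O2) v)\<^sup>2"
    using boundary_inequality[OF vH(3), of "\<alpha> / 2"] \<alpha> unfolding g2 by simp
  then have "0 \<le> (l + \<alpha>\<^sup>2 / 4) * (L2_norm (leb ?O2) v)\<^sup>2"
    using cut[of ?O2 ?O1] by (simp add: power_divide algebra_simps)
  then have "(L2_norm (leb ?O2) v)\<^sup>2 \<le> 0" using l by (simp add: zero_le_mult_iff)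
  then have v2: "L2_norm (leb ?O2) v = 0" by simp
  have "sin \<theta> * (L2_norm \<sigma> g)\<^sup>2 \<le> 0" using trace_bound[OF cone_domains(3) vH(3)] unfolding g2 v2 by simp
  then have g0: "L2_norm \<sigma> g = 0" using sin_pos by (simp add: mult_le_0_iff)
  have "l < 0" using l by (smt (verit) zero_le_power2 divide_nonneg_pos)
  moreover have "0 \<le> l * (L2_norm (leb ?O1) v)\<^sup>2"
    using cut[of ?O1 ?O2] g0 zero_le_power2[of "L2_norm (leb ?O1) (weak_grad ?O1 v)"] by (simp only: simp_thms power2_eq_square mult_zero_right diff_zero)
  ultimately have "(L2_norm (leb ?O1) v)\<^sup>2 \<le> 0" by (simp add: zero_le_mult_iff)
  then show ?thesis using norm_split[OF vH(1)] v2 unfolding v_def[symmetric] by simp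
qed

end

section \<open>Quasi-modes along the cone\<close>

lemma continuous_compact_support_integrable:
  fixes f :: "'a::euclidean_space \<Rightarrow> 'b::{banach, second_countable_topology}"
  assumes "continuous_on UNIV f" "compact K" "\<And>x. x \<notin> K \<Longrightarrow> f x = 0"
  shows "integrable lborel f"
proof -
  have "integrable lborel (\<lambda>x. indicator K x *\<^sub>R f x)"
    by (rule borel_integrable_compact) (use assms continuous_on_subset[OF assms(1)] in auto)
  also have "(\<lambda>x. indicator K x *\<^sub>R f x) = f" using assms(3) by (auto simp: indicator_def)
  finally show ?thesis .
qed

lemma continuous_compact_support_bounded:
  fixes f :: "'a::t2_space \<Rightarrow> 'b::real_normed_vector"
  assumes "continuous_on UNIV f" "compact K" "\<And>x. x \<notin> K \<Longrightarrow> f x = 0"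
  obtains B where "B \<ge> 0" "\<And>x. norm (f x) \<le> B"
proof -
  have "bounded (f ` K)" using assms continuous_on_subset[OF assms(1)] by (intro compact_imp_bounded compact_continuous_image) auto
  then obtain B where B: "B > 0" "\<And>x. x \<in> K \<Longrightarrow> norm (f x) \<le> B" unfolding bounded_pos by blast
  show ?thesis by (rule that[of B]) (use B assms(3) in \<open>metis norm_zero less_imp_le\<close>)+
qed

lemma integral_product:
  fixes a :: "real ^ 2 \<Rightarrow> real" and b :: "real \<Rightarrow> real"
  assumes a: "integrable lborel a" and b: "integrable lborel b"
  shows "integrable lborel (\<lambda>x. a (fst x) * b (snd x))"
    "(\<integral>x. a (fst x) * b (snd x) \<partial>lborel) = (\<integral>p. a p \<partial>lborel) * (\<integral>s. b s \<partial>lborel)"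
proof -
  have [measurable]: "a \<in> borel_measurable borel" "b \<in> borel_measurable borel" using a b by (auto dest: borel_measurable_integrable)
  have "integrable (lborel \<Otimes>\<^sub>M lborel) (\<lambda>x. a (fst x) * b (snd x))"
  proof (rule lborel_pair.Fubini_integrable)
    show "integrable lborel (\<lambda>x. \<integral>y. norm (a (fst (x, y)) * b (snd (x, y))) \<partial>lborel)"
      using a by (simp add: abs_mult integrable_abs)
    show "AE x in lborel. integrable lborel (\<lambda>y. a (fst (x, y)) * b (snd (x, y)))" using b by simp
  qed measurable
  then show i: "integrable lborel (\<lambda>x. a (fst x) * b (snd x))" by (simp only: lborel_prod)
  show "(\<integral>x. a (fst x) * b (snd x) \<partial>lborel) = (\<integral>p. a p \<partial>lborel) * (\<integral>s. b s \<partial>lborel)"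
    using integral_pair[OF i] by simp
qed

lemma integral_scaled:
  fixes h :: "real ^ 2 \<Rightarrow> real"
  assumes R: "R > 0" and [measurable]: "h \<in> borel_measurable borel"
  shows "(\<integral>p. h ((1 / R) *\<^sub>R p - a) \<partial>lborel) = R\<^sup>2 * (\<integral>p. h p \<partial>lborel)"
proof -
  have "(\<integral>p. h ((1 / R) *\<^sub>R p - a) \<partial>lborel) =
    (\<integral>p. h ((1 / R) *\<^sub>R p - a) \<partial>density (distr lborel borel (\<lambda>x. R *\<^sub>R a + R *\<^sub>R x)) (\<lambda>_. ennreal (\<bar>R\<bar> ^ DIM(real ^ 2))))"
    using lborel_affine[of R "R *\<^sub>R a"] R by simp
  also have "\<dots> = (\<integral>p. R\<^sup>2 * h ((1 / R) *\<^sub>R (R *\<^sub>R a + R *\<^sub>R p) - a) \<partial>lborel)"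
    using R by (subst integral_density) (simp_all add: integral_distr)
  also have "\<dots> = R\<^sup>2 * (\<integral>p. h p \<partial>lborel)" using R by (simp add: scaleR_right_distrib)
  finally show ?thesis .
qed

lemma C1_weak_grad:
  assumes u: "\<And>x. (u has_derivative (\<lambda>h. \<Sum>i\<in>UNIV. h $ i *\<^sub>R G x $ i)) (at x)"
    and G: "\<And>i. continuous_on UNIV (\<lambda>x. G x $ i)" "G \<in> L2 lborel"
  shows "is_weak_grad UNIV u G"
  unfolding is_weak_grad_def
proof (intro conjI ballI allI)
  show "G \<in> L2 (leb UNIV)" using G(2) by simp
  fix \<phi> :: "real ^ 3 \<Rightarrow> complex" and i :: 3
  assume \<phi>: "\<phi> \<in> test_functions UNIV"
  define b :: "real ^ 3" where "b = axis i 1"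
  define W where "W x = u x * \<phi> x" for x
  define d where "d x = u x * partial i \<phi> x + G x $ i * \<phi> x" for x
  obtain K where K: "compact K" "\<And>x. x \<notin> K \<Longrightarrow> \<phi> x = 0" "\<And>x. x \<notin> K \<Longrightarrow> partial i \<phi> x = 0" using \<phi> by (rule test_functionsE) blast
  have uc: "continuous_on UNIV u" using u has_derivative_continuous continuous_at_imp_continuous_on by blast
  note pc = test_continuous[OF \<phi>] test_continuous[OF test_partial[OF \<phi>]]
  have Wc: "continuous_on UNIV W" unfolding W_def[abs_def] by (intro continuous_intros uc pc)
  have c1: "continuous_on UNIV (\<lambda>x. u x * partial i \<phi> x)" and c2: "continuous_on UNIV (\<lambda>x. G x $ i * \<phi> x)"
    by (intro continuous_intros uc pc G)+
  have dc: "continuous_on UNIV d" unfolding d_def[abs_def] by (intro continuous_on_add c1 c2)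
  have i: "integrable lborel (\<lambda>x. u x * partial i \<phi> x)" "integrable lborel (\<lambda>x. G x $ i * \<phi> x)"
    by (rule continuous_compact_support_integrable[OF _ K(1)], use c1 c2 K in auto)+
  obtain B where B: "B \<ge> 0" "\<And>x. norm (W x) \<le> B"
    by (rule continuous_compact_support_bounded[OF Wc K(1)]) (use K in \<open>auto simp: W_def\<close>)
  obtain L where L: "L \<ge> 0" "\<And>x. norm (d x) \<le> L"
    by (rule continuous_compact_support_bounded[OF dc K(1)]) (use K in \<open>auto simp: d_def\<close>)
  have line: "((\<lambda>t. W (x + t *\<^sub>R b)) has_vector_derivative d (x + t *\<^sub>R b)) (at t)" for x t
  proof -
    let ?y = "x + t *\<^sub>R b"
    let ?W' = "\<lambda>h. u ?y * frechet_derivative \<phi> (at ?y) h + (\<Sum>i\<in>UNIV. h $ i *\<^sub>R G ?y $ i) * \<phi> ?y"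
    have "(W has_derivative ?W') (at ?y)"
      unfolding W_def[abs_def]
      by (intro has_derivative_mult u frechet_derivative_works[THEN iffD1] smooth_differentiable test_smooth[OF \<phi>])
    moreover have "((\<lambda>t. x + t *\<^sub>R b) has_derivative (\<lambda>s. s *\<^sub>R b)) (at t)" by (auto intro!: derivative_eq_intros)
    ultimately have "((\<lambda>t. W (x + t *\<^sub>R b)) has_derivative (\<lambda>s. ?W' (s *\<^sub>R b))) (at t)"
      by (rule has_derivative_compose[rotated])
    moreover have "?W' (s *\<^sub>R b) = s *\<^sub>R ?W' b" for s
      using linear_scale[OF has_derivative_linear[OF \<open>(W has_derivative ?W') (at ?y)\<close>]] .
    moreover have "(\<Sum>j\<in>UNIV. b $ j *\<^sub>R G ?y $ j) = G ?y $ i"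
      by (simp add: b_def axis_def if_distrib[of "\<lambda>r. r *\<^sub>R _"] cong: if_cong)
    then have "?W' b = d ?y" by (simp add: d_def partial_def b_def)
    ultimately show ?thesis unfolding has_vector_derivative_def by simp
  qed
  have zero: "(\<integral>x. \<rho> (d x) \<partial>lborel) = 0" if \<rho>: "bounded_linear \<rho>" "\<And>z. \<bar>\<rho> z\<bar> \<le> cmod z" for \<rho> :: "complex \<Rightarrow> real"
  proof (rule integral_directional_derivative(2))
    have \<rho>c: "continuous_on UNIV \<rho>" using linear_continuous_on[OF \<rho>(1)] .
    show "(\<lambda>x. \<rho> (W x)) \<in> borel_measurable borel" "(\<lambda>x. \<rho> (d x)) \<in> borel_measurable borel"
      by (intro borel_measurable_continuous_onI continuous_on_compose2[OF \<rho>c] Wc dc; simp)+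
    have der: "((\<lambda>t. \<rho> (W (x + t *\<^sub>R b))) has_real_derivative \<rho> (d (x + t *\<^sub>R b))) (at t)" for x t
      using bounded_linear.has_vector_derivative[OF \<rho>(1) line] by (simp add: has_real_derivative_iff_has_vector_derivative)
    show "\<bar>\<rho> (W (x + t *\<^sub>R b)) - \<rho> (W x)\<bar> \<le> L * \<bar>t\<bar>" for x t
    proof -
      have "norm (\<rho> (W (x + t *\<^sub>R b)) - \<rho> (W (x + 0 *\<^sub>R b))) \<le> L * norm (t - 0)"
        by (rule field_differentiable_bound[OF convex_UNIV der]) (use order_trans[OF \<rho>(2) L(2)] in auto)
      then show ?thesis by simp
    qed
    show "AE x in lborel. ((\<lambda>t. \<rho> (W (x + t *\<^sub>R b))) has_real_derivative \<rho> (d x)) (at 0)"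
      using der[of _ 0] by simp
    show "\<rho> (W x) = 0" if "x \<notin> K" for x
      using K(2)[OF that] \<rho>(2)[of 0] by (simp add: W_def)
    show "\<bar>\<rho> (W x)\<bar> \<le> B" for x using \<rho>(2)[of "W x"] B(2)[of x] by linarith
  qed (rule K(1))
  have di: "integrable lborel d" unfolding d_def[abs_def] by (intro Bochner_Integration.integrable_add i)
  have "(\<integral>x. d x \<partial>lborel) = 0"
    using zero[OF bounded_linear_Re abs_Re_le_cmod] zero[OF bounded_linear_Im abs_Im_le_cmod] di
    by (intro complex_eqI) simp_all
  then show "(\<integral>x. u x * partial i \<phi> x \<partial>leb UNIV) = - (\<integral>x. G x $ i * \<phi> x \<partial>leb UNIV)"
    using i by (simp add: d_def[abs_def] add_eq_0_iff2)
qed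

definition base :: "real ^ 3 \<Rightarrow> real ^ 2" where
  "base x = vector [x $ 1, x $ 2]"

lemma base_component [simp]: "base x $ 1 = x $ 1" "base x $ 2 = x $ 2"
  by (simp_all add: base_def)

lemma base_shear [simp]: "base (shear c x) = fst x"
  by (simp add: vec_eq_iff forall_2)

lemma bounded_linear_base: "bounded_linear base"
  by (intro linear_conv_bounded_linear[THEN iffD1] linearI) (simp_all add: vec_eq_iff forall_2)

text \<open>The functions \<open>F (x\<^sub>1, x\<^sub>2) g (x\<^sub>3 - cot \<theta> \<bar>(x\<^sub>1, x\<^sub>2)\<bar>)\<close> follow the cone. Since \<open>F\<close> vanishes near the
  origin, they do not feel the apex and are continuously differentiable.\<close>

locale cone_profile = cone +
  fixes F D1 D2 :: "real ^ 2 \<Rightarrow> complex" and K :: "(real ^ 2) set" and r :: real and g g' :: "real \<Rightarrow> real"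
  assumes F: "\<And>p. (F has_derivative (\<lambda>h. h $ 1 *\<^sub>R D1 p + h $ 2 *\<^sub>R D2 p)) (at p)"
    and D_cont: "continuous_on UNIV D1" "continuous_on UNIV D2"
    and K: "compact K" "\<And>p. p \<notin> K \<Longrightarrow> F p = 0" "\<And>p. p \<notin> K \<Longrightarrow> D1 p = 0" "\<And>p. p \<notin> K \<Longrightarrow> D2 p = 0"
    and r: "r > 0" "\<And>p. p $ 1 < r \<Longrightarrow> F p = 0" "\<And>p. p $ 1 < r \<Longrightarrow> D1 p = 0" "\<And>p. p $ 1 < r \<Longrightarrow> D2 p = 0"
    and g: "\<And>s. (g has_real_derivative g' s) (at s)" "continuous_on UNIV g'" "\<And>s. g (- s) = g s" "\<And>s. g' (- s) = - g' s"
    and g_int: "integrable lborel (\<lambda>s. (g s)\<^sup>2)" "integrable lborel (\<lambda>s. (g' s)\<^sup>2)"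
    and g_half: "(\<integral>s. (if s < 0 then 2 * g s * g' s else 0) \<partial>lborel) = (g 0)\<^sup>2"
begin

abbreviation c where "c \<equiv> cot \<theta>"

definition height :: "real ^ 3 \<Rightarrow> real" where
  "height x = x $ 3 - c * norm (base x)"

definition mode :: "real ^ 3 \<Rightarrow> complex" where
  "mode x = F (base x) * of_real (g (height x))"

definition mode_grad :: "real ^ 3 \<Rightarrow> complex ^ 3" where
  "mode_grad x = vector [
     D1 (base x) * of_real (g (height x)) - F (base x) * of_real (g' (height x) * (c * (x $ 1 / norm (base x)))),
     D2 (base x) * of_real (g (height x)) - F (base x) * of_real (g' (height x) * (c * (x $ 2 / norm (base x)))),
     F (base x) * of_real (g' (height x))]"

lemma height_shear [simp]: "height (shear c x) = snd x"
  by (simp add: height_def)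

lemma F_cont: "continuous_on UNIV F"
  using F has_derivative_continuous continuous_at_imp_continuous_on by blast

lemma g_cont: "continuous_on UNIV g"
  using g(1) DERIV_continuous continuous_at_imp_continuous_on by blast

lemma height_cont: "continuous_on A height"
  unfolding height_def[abs_def] by (intro continuous_intros bounded_linear.continuous_on[OF bounded_linear_base])

lemma apex_zero:
  assumes "x $ 1 < r"
  shows "mode x = 0" "mode_grad x $ i = 0"
  using r(2,3,4)[of "base x"] assms exhaust_3[of i] by (auto simp: mode_def mode_grad_def)

lemma base_nonzero: "x $ 1 > 0 \<Longrightarrow> base x \<noteq> 0"
  by (metis base_component(1) less_irrefl zero_index)

lemma mode_derivative: "(mode has_derivative (\<lambda>h. \<Sum>i\<in>UNIV. h $ i *\<^sub>R mode_grad x $ i)) (at x)"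
proof (cases "x $ 1 > 0")
  case True
  note b0 = base_nonzero[OF True]
  have b: "(base has_derivative base) (at x)" by (rule bounded_linear_imp_has_derivative[OF bounded_linear_base])
  have dF: "((\<lambda>x. F (base x)) has_derivative (\<lambda>h. base h $ 1 *\<^sub>R D1 (base x) + base h $ 2 *\<^sub>R D2 (base x))) (at x)"
    by (rule has_derivative_compose[OF b F])
  have "((\<lambda>x. norm (base x)) has_derivative (\<lambda>h. base h \<bullet> sgn (base x))) (at x)"
    using has_derivative_compose[OF b has_derivative_norm[OF b0]] by (simp add: inner_commute)
  then have "(height has_derivative (\<lambda>h. h $ 3 - c * (base h \<bullet> sgn (base x)))) (at x)"
    unfolding height_def[abs_def] by (intro has_derivative_diff has_derivative_mult_right bounded_linear_imp_has_derivative bounded_linear_vec_nth)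
  then have "((\<lambda>x. g (height x)) has_derivative (\<lambda>h. g' (height x) * (h $ 3 - c * (base h \<bullet> sgn (base x))))) (at x)"
    using has_derivative_compose[OF _ g(1)[unfolded has_field_derivative_def]] by blast
  then have "((\<lambda>x. complex_of_real (g (height x))) has_derivative (\<lambda>h. of_real (g' (height x) * (h $ 3 - c * (base h \<bullet> sgn (base x)))))) (at x)"
    by (rule has_derivative_of_real)
  from has_derivative_mult[OF dF this]
  show ?thesis unfolding mode_def[abs_def]
    by (rule has_derivative_eq_rhs)
       (simp add: fun_eq_iff sum_3 mode_grad_def inner_vec_def sum_2 sgn_div_norm scaleR_conv_of_real[where 'a = complex] divide_inverse algebra_simps)
next
  case False
  have "((\<lambda>x. 0 :: complex) has_derivative (\<lambda>h. \<Sum>i\<in>UNIV. h $ i *\<^sub>R mode_grad x $ i)) (at x)"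
    using apex_zero(2)[of x] False r(1) by simp
  then show ?thesis
  proof (rule has_derivative_transform_within_open)
    show "open {x :: real ^ 3. x $ 1 < r}" by (intro open_Collect_less continuous_intros)
    show "x \<in> {x. x $ 1 < r}" using False r(1) by simp
  qed (simp add: apex_zero)
qed

lemma mode_grad_continuous: "continuous_on UNIV (\<lambda>x. mode_grad x $ i)"
proof -
  let ?A = "{x :: real ^ 3. 0 < x $ 1}" and ?B = "{x :: real ^ 3. x $ 1 < r}"
  have "continuous_on ?B (\<lambda>x. mode_grad x $ i)"
    by (rule iffD2[OF continuous_on_cong[OF refl, of ?B _ "\<lambda>x. 0"]]) (auto simp: apex_zero)
  moreover have "continuous_on ?A (\<lambda>x. mode_grad x $ i)"
  proof -
    have bc: "continuous_on ?A base" by (rule linear_continuous_on[OF bounded_linear_base])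
    note cs = continuous_on_compose2[OF F_cont bc] continuous_on_compose2[OF D_cont(1) bc] continuous_on_compose2[OF D_cont(2) bc]
      continuous_on_compose2[OF g_cont height_cont] continuous_on_compose2[OF g(2) height_cont]
    show ?thesis using exhaust_3[of i]
      by (elim disjE) (auto simp: mode_grad_def base_nonzero intro!: continuous_intros cs bc)
  qed
  moreover have "open ?A" "open ?B" by (intro open_Collect_less continuous_intros)+
  ultimately have "continuous_on (?A \<union> ?B) (\<lambda>x. mode_grad x $ i)" by (intro continuous_on_open_Un)
  moreover have "?A \<union> ?B = UNIV" using r(1) by force
  ultimately show ?thesis by simp
qed

definition mass :: real where "mass = (\<integral>p. (cmod (F p))\<^sup>2 \<partial>lborel)"
definition slope :: real where "slope = (\<integral>p. (cmod (D1 p))\<^sup>2 + (cmod (D2 p))\<^sup>2 \<partial>lborel)"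

lemma profile_integrable: "integrable lborel (\<lambda>p. (cmod (F p))\<^sup>2)" "integrable lborel (\<lambda>p. (cmod (D1 p))\<^sup>2 + (cmod (D2 p))\<^sup>2)"
  by (rule continuous_compact_support_integrable[OF _ K(1)], (intro continuous_intros F_cont D_cont), simp add: K)+

lemma mode_measurable: "mode \<in> borel_measurable borel" "(\<lambda>x. mode_grad x $ i) \<in> borel_measurable borel"
  using has_derivative_continuous[OF mode_derivative] continuous_at_imp_continuous_on
  by (intro borel_measurable_continuous_onI mode_grad_continuous; blast)+

lemma mode_L2: "mode \<in> L2 lborel" "(L2_norm lborel mode)\<^sup>2 = mass * (\<integral>s. (g s)\<^sup>2 \<partial>lborel)"
proof -
  have [measurable]: "mode \<in> borel_measurable borel" by (rule mode_measurable)
  have eq: "(cmod (mode (shear c x)))\<^sup>2 = (cmod (F (fst x)))\<^sup>2 * (g (snd x))\<^sup>2" for x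
    by (simp add: mode_def norm_mult power_mult_distrib)
  note P = integral_product[OF profile_integrable(1) g_int(1)]
  note S = integral_shear[of "\<lambda>x. (cmod (mode x))\<^sup>2" c, unfolded eq]
  show "mode \<in> L2 lborel" unfolding L2_def using S(2) P(1) by simp
  show "(L2_norm lborel mode)\<^sup>2 = mass * (\<integral>s. (g s)\<^sup>2 \<partial>lborel)" using S(1) P(2) by (simp add: L2_norm_sq mass_def)
qed

lemma even_odd_integral: "(\<integral>s. g s * g' s \<partial>lborel) = 0"
proof -
  have "(\<integral>s. g s * g' s \<partial>lborel) = (\<integral>s. g (- s) * g' (- s) \<partial>lborel)"
    using lborel_integral_real_affine[of "-1" "\<lambda>s. g s * g' s" 0] by simp
  then show ?thesis using g(3,4) by simp
qed

lemma g_product_integrable: "integrable lborel (\<lambda>s. g s * g' s)"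
proof (rule Bochner_Integration.integrable_bound[OF Bochner_Integration.integrable_add[OF g_int]])
  show "(\<lambda>s. g s * g' s) \<in> borel_measurable lborel"
    using borel_measurable_continuous_onI[OF g_cont] borel_measurable_continuous_onI[OF g(2)] by simp
  show "AE s in lborel. norm (g s * g' s) \<le> norm ((g s)\<^sup>2 + (g' s)\<^sup>2)"
  proof (rule AE_I2)
    fix s
    have "0 \<le> \<bar>g s\<bar> * \<bar>g' s\<bar>" by simp
    then have "\<bar>g s\<bar> * \<bar>g' s\<bar> \<le> (g s)\<^sup>2 + (g' s)\<^sup>2" using sum_squares_bound[of "\<bar>g s\<bar>" "\<bar>g' s\<bar>"] unfolding power2_abs by linarith
    then show "norm (g s * g' s) \<le> norm ((g s)\<^sup>2 + (g' s)\<^sup>2)" by (simp add: abs_mult)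
  qed
qed

lemma mode_grad_L2:
  "mode_grad \<in> L2 lborel"
  "(L2_norm lborel mode_grad)\<^sup>2 = slope * (\<integral>s. (g s)\<^sup>2 \<partial>lborel) + (1 / (sin \<theta>)\<^sup>2) * (mass * (\<integral>s. (g' s)\<^sup>2 \<partial>lborel))"
proof -
  define X where "X p = Re (cnj (F p) * (D1 p * of_real (p $ 1 / norm p) + D2 p * of_real (p $ 2 / norm p)))" for p
  have [measurable]: "(\<lambda>x. mode_grad x $ i) \<in> borel_measurable borel" for i by (rule mode_measurable)
  have n: "(norm (mode_grad x))\<^sup>2 = (\<Sum>i\<in>UNIV. (cmod (mode_grad x $ i))\<^sup>2)" for x
    by (simp add: norm_vec_def L2_set_def sum_nonneg)
  have cs: "1 + c\<^sup>2 = 1 / (sin \<theta>)\<^sup>2"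
    using sin_pos sin_cos_squared_add[of \<theta>] by (simp add: cot_def field_simps)
  have eq: "(norm (mode_grad (shear c x)))\<^sup>2 = ((cmod (D1 (fst x)))\<^sup>2 + (cmod (D2 (fst x)))\<^sup>2) * (g (snd x))\<^sup>2
      + (-2 * c) * (X (fst x) * (g (snd x) * g' (snd x))) + (1 / (sin \<theta>)\<^sup>2) * ((cmod (F (fst x)))\<^sup>2 * (g' (snd x))\<^sup>2)" for x
  proof (cases "fst x = 0")
    case True
    then show ?thesis using r(1) r(2,3,4)[of 0] unfolding n sum_3 by (simp add: mode_grad_def X_def)
  next
    case False
    define q1 q2 where "q1 = fst x $ 1 / norm (fst x)" and "q2 = fst x $ 2 / norm (fst x)"
    have q: "q1\<^sup>2 + q2\<^sup>2 = 1"
      using False by (simp add: q1_def q2_def power_divide norm_real2 flip: add_divide_distrib) (metis norm_eq_zero norm_real2 sum_power2_eq_zero_iff real_sqrt_eq_zero_cancel_iff)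
    have "(norm (mode_grad (shear c x)))\<^sup>2 = (cmod (D1 (fst x) * of_real (g (snd x)) - F (fst x) * of_real (g' (snd x) * (c * q1))))\<^sup>2
      + (cmod (D2 (fst x) * of_real (g (snd x)) - F (fst x) * of_real (g' (snd x) * (c * q2))))\<^sup>2 + (cmod (F (fst x) * of_real (g' (snd x))))\<^sup>2"
      unfolding n sum_3 by (simp add: mode_grad_def q1_def q2_def)
    also have "\<dots> = ((cmod (D1 (fst x)))\<^sup>2 + (cmod (D2 (fst x)))\<^sup>2) * (g (snd x))\<^sup>2
      + (-2 * c) * (X (fst x) * (g (snd x) * g' (snd x))) + (1 + c\<^sup>2 * (q1\<^sup>2 + q2\<^sup>2)) * ((cmod (F (fst x)))\<^sup>2 * (g' (snd x))\<^sup>2)"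
      unfolding X_def q1_def[symmetric] q2_def[symmetric] cmod_power2 by (simp add: power2_eq_square algebra_simps)
    finally show ?thesis using cs by (simp add: q)
  qed
  have Xb: "\<bar>X p\<bar> \<le> (cmod (F p))\<^sup>2 + ((cmod (D1 p))\<^sup>2 + (cmod (D2 p))\<^sup>2)" for p
  proof -
    have q: "\<bar>p $ i / norm p\<bar> \<le> 1" for i using component_le_norm_cart[of p i] by (simp add: divide_le_eq_1)
    have m: "cmod (z * of_real (p $ i / norm p)) \<le> cmod z * 1" for z i
      unfolding norm_mult norm_of_real by (intro mult_left_mono q) simp
    have "\<bar>X p\<bar> \<le> cmod (F p) * cmod (D1 p * of_real (p $ 1 / norm p) + D2 p * of_real (p $ 2 / norm p))"
      unfolding X_def using abs_Re_le_cmod by (metis complex_mod_cnj norm_mult)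
    also have "\<dots> \<le> cmod (F p) * (cmod (D1 p) * 1 + cmod (D2 p) * 1)"
      by (intro mult_left_mono[OF norm_triangle_le] add_mono m norm_ge_zero)
    also have "\<dots> \<le> (cmod (F p))\<^sup>2 + ((cmod (D1 p))\<^sup>2 + (cmod (D2 p))\<^sup>2)"
      using sum_squares_bound[of "cmod (F p)" "cmod (D1 p)"] sum_squares_bound[of "cmod (F p)" "cmod (D2 p)"] zero_le_power2[of "cmod (D1 p)"] zero_le_power2[of "cmod (D2 p)"]
      unfolding distrib_left mult_1_right by linarith
    finally show ?thesis .
  qed
  have Xi: "integrable lborel X"
  proof (rule Bochner_Integration.integrable_bound[OF Bochner_Integration.integrable_add[OF profile_integrable]])
    have [measurable]: "F \<in> borel_measurable borel" "D1 \<in> borel_measurable borel" "D2 \<in> borel_measurable borel"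
      by (intro borel_measurable_continuous_onI F_cont D_cont)+
    have [measurable]: "(\<lambda>p :: real ^ 2. p $ i) \<in> borel_measurable borel" for i by (intro borel_measurable_continuous_onI continuous_intros)
    have [measurable]: "cnj \<in> borel_measurable borel" by (intro borel_measurable_continuous_onI continuous_intros)
    show "X \<in> borel_measurable lborel" unfolding X_def[abs_def] by measurable
    show "AE p in lborel. norm (X p) \<le> norm ((cmod (F p))\<^sup>2 + ((cmod (D1 p))\<^sup>2 + (cmod (D2 p))\<^sup>2))"
      using Xb by (intro AE_I2) (simp add: order_trans[OF _ abs_ge_self])
  qed
  note P = integral_product[OF profile_integrable(2) g_int(1)] integral_product[OF Xi g_product_integrable] integral_product[OF profile_integrable(1) g_int(2)]
  have [measurable]: "mode_grad \<in> borel_measurable borel" 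
    using continuous_on_vec_lambda[of UNIV "\<lambda>i x. mode_grad x $ i", OF mode_grad_continuous] by (intro borel_measurable_continuous_onI) simp
  note S = integral_shear[of "\<lambda>x. (norm (mode_grad x))\<^sup>2" c, unfolded eq]
  show "mode_grad \<in> L2 lborel" unfolding L2_def using S(2) P by simp
  show "(L2_norm lborel mode_grad)\<^sup>2 = slope * (\<integral>s. (g s)\<^sup>2 \<partial>lborel) + (1 / (sin \<theta>)\<^sup>2) * (mass * (\<integral>s. (g' s)\<^sup>2 \<partial>lborel))"
    unfolding L2_norm_sq using S(1) P by (simp add: even_odd_integral slope_def mass_def)
qed

lemma mode_weak_grad: "is_weak_grad UNIV mode mode_grad"
  by (rule C1_weak_grad[OF mode_derivative mode_grad_continuous mode_grad_L2(1)])

lemma mode_H1: "mode \<in> H1 UNIV"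
  using H1I[OF _ mode_weak_grad] mode_L2(1) by simp

lemma mode_trace: "sin \<theta> * (L2_norm \<sigma> (cone_trace \<theta> UNIV mode))\<^sup>2 = mass * (g 0)\<^sup>2"
proof -
  let ?O = "Omega2 \<theta>"
  have B: "?O \<in> sets borel" using cone_domain_borel by simp
  have mO: "mode \<in> H1 ?O" using H1_restrict[OF B mode_H1] .
  have GL: "mode_grad \<in> L2 (leb ?O)" "mode \<in> L2 (leb ?O)" using L2_leb_subset(1)[OF B] mode_grad_L2(1) mode_L2(1) by auto
  have ae: "AE x in leb ?O. weak_grad ?O mode x = mode_grad x"
    by (rule weak_grad_AE[OF cone_domain_shiftable mO is_weak_grad_restrict]) (use B mode_weak_grad mode_H1 in auto)
  have "L2_norm \<sigma> (cone_trace \<theta> UNIV mode) = L2_norm \<sigma> (cone_trace \<theta> ?O mode)"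
    by (rule L2_norm_cong_AE) (use cone_trace_restrict[OF cone_domains(3) mode_H1] L2_measurable[OF cone_trace(2)] mO mode_H1 in auto)
  then have "sin \<theta> * (L2_norm \<sigma> (cone_trace \<theta> UNIV mode))\<^sup>2 = 2 * Re (ip (leb ?O) (\<lambda>x. weak_grad ?O mode x $ 3) mode)"
    using trace_identity[OF mO] by simp
  also have "ip (leb ?O) (\<lambda>x. weak_grad ?O mode x $ 3) mode = ip (leb ?O) (\<lambda>x. mode_grad x $ 3) mode"
    by (rule ip_cong_AE) (use ae L2_measurable[OF L2_component[OF H1D(3)[OF mO]]] L2_measurable[OF L2_component[OF GL(1)]] L2_measurable[OF GL(2)] in auto)
  also have "\<dots> = (\<integral>x. ext0 ?O (\<lambda>x. mode_grad x $ 3 * cnj (mode x)) x \<partial>lborel)"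
    unfolding ip_def by (rule leb_integral[OF B])
  also have "\<dots> = (\<integral>x. ext0 ?O (\<lambda>x. mode_grad x $ 3 * cnj (mode x)) (shear c x) \<partial>lborel)"
  proof (rule integral_shear(1))
    have [measurable]: "(\<lambda>x. mode_grad x $ 3) \<in> borel_measurable borel" "mode \<in> borel_measurable borel" by (rule mode_measurable)+
    have [measurable]: "cnj \<in> borel_measurable borel" by (intro borel_measurable_continuous_onI continuous_intros)
    have [measurable]: "?O \<in> sets borel" by (rule B)
    show "ext0 ?O (\<lambda>x. mode_grad x $ 3 * cnj (mode x)) \<in> borel_measurable borel" unfolding ext0_def[abs_def] by measurable
  qed
  also have "\<dots> = (\<integral>x. of_real ((1 / 2) * ((cmod (F (fst x)))\<^sup>2 * (if snd x < 0 then 2 * g (snd x) * g' (snd x) else 0))) \<partial>lborel)"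
  proof (intro Bochner_Integration.integral_cong refl)
    fix x :: "(real ^ 2) \<times> real"
    have "mode_grad (shear c x) $ 3 * cnj (mode (shear c x)) = (F (fst x) * cnj (F (fst x))) * of_real (g (snd x) * g' (snd x))"
      by (simp add: mode_grad_def mode_def)
    also have "\<dots> = of_real ((cmod (F (fst x)))\<^sup>2 * (g (snd x) * g' (snd x)))"
      by (simp only: complex_norm_square[symmetric] of_real_mult of_real_power)
    finally show "ext0 ?O (\<lambda>x. mode_grad x $ 3 * cnj (mode x)) (shear c x)
      = of_real ((1 / 2) * ((cmod (F (fst x)))\<^sup>2 * (if snd x < 0 then 2 * g (snd x) * g' (snd x) else 0)))"
      by (simp add: ext0_def)
  qed
  also have "\<dots> = of_real ((1 / 2) * (mass * (g 0)\<^sup>2))"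
  proof -
    have [measurable]: "g \<in> borel_measurable borel" "g' \<in> borel_measurable borel"
      by (intro borel_measurable_continuous_onI g_cont g)+
    have "integrable lborel (\<lambda>s. if s < 0 then 2 * g s * g' s else 0)"
      by (rule Bochner_Integration.integrable_bound[OF integrable_mult_right[OF g_product_integrable, of 2]]) auto
    from integral_product(2)[OF profile_integrable(1) this]
    show ?thesis by (simp only: integral_complex_of_real integral_mult_right_zero g_half mass_def)
  qed
  finally show ?thesis by simp
qed

lemma mode_energy:
  "Re (delta_form \<theta> \<alpha> mode mode) = slope * (\<integral>s. (g s)\<^sup>2 \<partial>lborel)
     + mass * ((\<integral>s. (g' s)\<^sup>2 \<partial>lborel) / (sin \<theta>)\<^sup>2 - \<alpha> * (g 0)\<^sup>2 / sin \<theta>)"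
proof -
  let ?G = "weak_grad UNIV mode"
  have GL: "?G \<in> L2 lborel" using H1D(3)[OF mode_H1] by simp
  have ae: "AE x in lborel. ?G x = mode_grad x"
    using weak_grad_AE[OF cone_domain_shiftable[OF cone_domains(1)] mode_H1 mode_weak_grad] by (simp only: leb_UNIV)
  have "L2_norm lborel ?G = L2_norm lborel mode_grad"
    by (rule L2_norm_cong_AE[OF ae]) (intro L2_measurable GL mode_grad_L2(1))+
  moreover have "(L2_norm \<sigma> (cone_trace \<theta> UNIV mode))\<^sup>2 = mass * (g 0)\<^sup>2 / sin \<theta>" using mode_trace sin_pos by (simp add: field_simps)
  ultimately show ?thesis unfolding delta_form_def ip3_self[OF GL] ip_cmult_left ip_self
    by (simp add: mode_grad_L2(2) algebra_simps del: of_real_power)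
qed

end

lemma continuous_integral_pos:
  fixes f :: "'a::euclidean_space \<Rightarrow> real"
  assumes f: "continuous_on UNIV f" "integrable lborel f" "\<And>x. f x \<ge> 0" and a: "f a > 0"
  shows "(\<integral>x. f x \<partial>lborel) > 0"
proof -
  have "(\<integral>x. f x \<partial>lborel) \<noteq> 0"
  proof
    assume "(\<integral>x. f x \<partial>lborel) = 0"
    then have "AE x in lborel. f x = 0" using integral_nonneg_eq_0_iff_AE[OF f(2)] f(3) by simp
    then have ae: "AE x in lebesgue. x \<in> UNIV \<longrightarrow> x \<in> {x. f x = 0}" by (simp add: AE_completion)
    have "closed {x. f x = 0}" by (intro closed_Collect_eq f continuous_on_const)
    then have "a \<in> {x. f x = 0}" using mem_closed_if_AE_lebesgue_open[OF open_UNIV _ ae] by simp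
    then show False using a by simp
  qed
  moreover have "(\<integral>x. f x \<partial>lborel) \<ge> 0" using f(3) by simp
  ultimately show ?thesis by simp
qed

lemma half_line_integral:
  fixes f F :: "real \<Rightarrow> real"
  assumes [measurable]: "f \<in> borel_measurable borel" and F: "\<And>s. s \<ge> 0 \<Longrightarrow> (F has_real_derivative f s) (at s)"
    and f: "\<And>s. s \<ge> 0 \<Longrightarrow> f s \<ge> 0" and T: "(F \<longlongrightarrow> T) at_top" "F 0 \<le> T"
  shows "has_bochner_integral lborel (\<lambda>s. indicator {0..} s * f s) (T - F 0)"
    "has_bochner_integral lborel (\<lambda>s. indicator {0..} (- s) * f (- s)) (T - F 0)"
proof -
  have "(\<integral>\<^sup>+ s. ennreal (indicator {0..} s * f s) \<partial>lborel) = (\<integral>\<^sup>+ s. ennreal (f s) * indicator {0..} s \<partial>lborel)"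
    by (intro nn_integral_cong) (auto simp: indicator_def)
  also have "\<dots> = T - F 0" by (rule nn_integral_FTC_atLeast[OF assms(1) F f T(1)])
  finally show *: "has_bochner_integral lborel (\<lambda>s. indicator {0..} s * f s) (T - F 0)"
    by (intro has_bochner_integral_nn_integral) (use T f in \<open>auto simp: indicator_def\<close>)
  show "has_bochner_integral lborel (\<lambda>s. indicator {0..} (- s) * f (- s)) (T - F 0)"
    using lborel_has_bochner_integral_real_affine_iff[of "-1" "\<lambda>s. indicator {0..} s * f s" "T - F 0" 0] * by simp
qed

lemma exp_minus_tendsto_0: "a > 0 \<Longrightarrow> ((\<lambda>s::real. exp (- (a * s))) \<longlongrightarrow> 0) at_top"
  by (intro filterlim_compose[OF exp_at_bot] filterlim_compose[OF filterlim_uminus_at_bot_at_top]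
      filterlim_tendsto_pos_mult_at_top[OF tendsto_const _ filterlim_ident])

text \<open>A smoothed version of \<open>s \<mapsto> exp (- \<kappa> \<bar>s\<bar>)\<close>, the ground state of a point interaction on the line.\<close>

definition soft_exp :: "real \<Rightarrow> real \<Rightarrow> real \<Rightarrow> real" where
  "soft_exp \<kappa> \<eta> s = exp (- (\<kappa> * sqrt (s\<^sup>2 + \<eta>\<^sup>2)))"

definition soft_exp' :: "real \<Rightarrow> real \<Rightarrow> real \<Rightarrow> real" where
  "soft_exp' \<kappa> \<eta> s = - (\<kappa> * (s / sqrt (s\<^sup>2 + \<eta>\<^sup>2))) * soft_exp \<kappa> \<eta> s"

lemma soft_exp_properties:
  assumes \<kappa>: "\<kappa> > 0" and \<eta>: "\<eta> > 0"
  shows "(soft_exp \<kappa> \<eta> has_real_derivative soft_exp' \<kappa> \<eta> s) (at s)"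
    "continuous_on UNIV (soft_exp' \<kappa> \<eta>)" "soft_exp \<kappa> \<eta> (- s) = soft_exp \<kappa> \<eta> s" "soft_exp' \<kappa> \<eta> (- s) = - soft_exp' \<kappa> \<eta> s"
    "integrable lborel (\<lambda>s. (soft_exp \<kappa> \<eta> s)\<^sup>2)" "integrable lborel (\<lambda>s. (soft_exp' \<kappa> \<eta> s)\<^sup>2)"
    "(\<integral>s. (if s < 0 then 2 * soft_exp \<kappa> \<eta> s * soft_exp' \<kappa> \<eta> s else 0) \<partial>lborel) = (soft_exp \<kappa> \<eta> 0)\<^sup>2"
    "(\<integral>s. (soft_exp \<kappa> \<eta> s)\<^sup>2 \<partial>lborel) > 0" "(\<integral>s. (soft_exp \<kappa> \<eta> s)\<^sup>2 \<partial>lborel) \<le> 1 / \<kappa>"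
    "(\<integral>s. (soft_exp' \<kappa> \<eta> s)\<^sup>2 \<partial>lborel) \<le> \<kappa>\<^sup>2 * (\<integral>s. (soft_exp \<kappa> \<eta> s)\<^sup>2 \<partial>lborel)"
proof -
  define g where "g = soft_exp \<kappa> \<eta>"
  define g' where "g' = soft_exp' \<kappa> \<eta>"
  have w: "s\<^sup>2 + \<eta>\<^sup>2 > 0" for s using \<eta> by (simp add: add_nonneg_pos)
  have d: "(g has_real_derivative g' s) (at s)" for s
  proof -
    have "((\<lambda>s. s\<^sup>2 + \<eta>\<^sup>2) has_real_derivative 2 * s) (at s)" by (auto intro!: derivative_eq_intros)
    from DERIV_chain2[OF DERIV_real_sqrt[OF w] this]
    have "((\<lambda>s. sqrt (s\<^sup>2 + \<eta>\<^sup>2)) has_real_derivative s / sqrt (s\<^sup>2 + \<eta>\<^sup>2)) (at s)" by (simp add: field_simps)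
    from DERIV_chain2[OF DERIV_exp DERIV_minus[OF DERIV_cmult[OF this, of \<kappa>]]]
    show ?thesis unfolding g_def g'_def soft_exp_def[abs_def] soft_exp'_def by (simp add: mult.commute)
  qed
  have gc: "continuous_on UNIV g" using d DERIV_continuous continuous_at_imp_continuous_on by blast
  have w': "sqrt (s\<^sup>2 + \<eta>\<^sup>2) \<noteq> 0" for s using \<eta> by simp
  have g'c: "continuous_on UNIV g'"
    unfolding g'_def soft_exp'_def[abs_def] g_def[symmetric] by (intro continuous_intros gc) (use w' in auto)
  have [measurable]: "g \<in> borel_measurable borel" "g' \<in> borel_measurable borel"
    by (intro borel_measurable_continuous_onI gc g'c)+
  have even: "g (- s) = g s" "g' (- s) = - g' s" for s by (simp_all add: g_def g'_def soft_exp_def soft_exp'_def)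
  have pos: "g s > 0" for s by (simp add: g_def soft_exp_def)
  have sq: "(g s)\<^sup>2 = exp (- ((2 * \<kappa>) * sqrt (s\<^sup>2 + \<eta>\<^sup>2)))" for s
    by (simp add: g_def soft_exp_def power2_eq_square flip: exp_add)
  have h: "\<bar>s\<bar> \<le> sqrt (s\<^sup>2 + \<eta>\<^sup>2)" for s by (rule real_le_rsqrt) simp
  have le: "(g s)\<^sup>2 \<le> exp (- ((2 * \<kappa>) * \<bar>s\<bar>))" for s unfolding sq using h \<kappa> by simp
  have g'_le: "(g' s)\<^sup>2 \<le> \<kappa>\<^sup>2 * (g s)\<^sup>2" for s
  proof -
    have "\<bar>s / sqrt (s\<^sup>2 + \<eta>\<^sup>2)\<bar> \<le> 1" using h[of s] w[of s] by (simp add: abs_divide divide_le_eq_1)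
    then have "(s / sqrt (s\<^sup>2 + \<eta>\<^sup>2))\<^sup>2 \<le> 1" by (simp add: abs_square_le_1)
    then have "\<kappa>\<^sup>2 * (s / sqrt (s\<^sup>2 + \<eta>\<^sup>2))\<^sup>2 * (g s)\<^sup>2 \<le> \<kappa>\<^sup>2 * 1 * (g s)\<^sup>2" by (intro mult_right_mono mult_left_mono) auto
    then show ?thesis unfolding g'_def soft_exp'_def g_def[symmetric] by (simp only: power_mult_distrib power2_minus mult_1_right)
  qed
  have "has_bochner_integral lborel (\<lambda>s. indicator {0..} s * exp (- ((2 * \<kappa>) * s))) (0 - (- exp (- ((2 * \<kappa>) * 0)) / (2 * \<kappa>)))"
    and "has_bochner_integral lborel (\<lambda>s. indicator {0..} (- s) * exp (- ((2 * \<kappa>) * (- s)))) (0 - (- exp (- ((2 * \<kappa>) * 0)) / (2 * \<kappa>)))"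
  proof -
    have 1: "((\<lambda>s. - exp (- ((2 * \<kappa>) * s)) / (2 * \<kappa>)) has_real_derivative exp (- ((2 * \<kappa>) * s))) (at s)" for s
      using \<kappa> by (auto intro!: derivative_eq_intros)
    have 2: "((\<lambda>s. - exp (- ((2 * \<kappa>) * s)) / (2 * \<kappa>)) \<longlongrightarrow> 0) at_top"
      using tendsto_divide[OF tendsto_minus[OF exp_minus_tendsto_0[of "2 * \<kappa>"]] tendsto_const[of "2 * \<kappa>"]] \<kappa> by simp
    show "has_bochner_integral lborel (\<lambda>s. indicator {0..} s * exp (- ((2 * \<kappa>) * s))) (0 - (- exp (- ((2 * \<kappa>) * 0)) / (2 * \<kappa>)))"
      by (rule half_line_integral(1)[OF _ 1 _ 2]) (use \<kappa> in auto)
    show "has_bochner_integral lborel (\<lambda>s. indicator {0..} (- s) * exp (- ((2 * \<kappa>) * (- s)))) (0 - (- exp (- ((2 * \<kappa>) * 0)) / (2 * \<kappa>)))"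
      by (rule half_line_integral(2)[OF _ 1 _ 2]) (use \<kappa> in auto)
  qed
  from has_bochner_integral_add[OF this]
  have E: "has_bochner_integral lborel (\<lambda>s. indicator {0..} s * exp (- ((2 * \<kappa>) * s)) + indicator {0..} (- s) * exp (- ((2 * \<kappa>) * (- s)))) (1 / \<kappa>)"
    by simp
  have gE: "(g s)\<^sup>2 \<le> indicator {0..} s * exp (- ((2 * \<kappa>) * s)) + indicator {0..} (- s) * exp (- ((2 * \<kappa>) * (- s)))" for s
    using le[of s] by (cases "s \<ge> 0") (auto simp: indicator_def intro: order_trans)
  have gi: "integrable lborel (\<lambda>s. (g s)\<^sup>2)"
    by (rule Bochner_Integration.integrable_bound[OF integrable.intros[OF E]])
       (use gE order_trans[OF _ abs_ge_self] in auto)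
  have g'i: "integrable lborel (\<lambda>s. (g' s)\<^sup>2)"
    by (rule Bochner_Integration.integrable_bound[OF integrable_mult_right[OF gi, of "\<kappa>\<^sup>2"]])
       (use g'_le in auto)
  have half: "(\<integral>s. (if s < 0 then 2 * g s * g' s else 0) \<partial>lborel) = (g 0)\<^sup>2"
  proof -
    have "has_bochner_integral lborel (\<lambda>s. indicator {0..} (- s) * (- (2 * g (- s) * g' (- s)))) (0 - (- (g 0)\<^sup>2))"
    proof (rule half_line_integral(2)[where f = "\<lambda>s. - (2 * g s * g' s)" and F = "\<lambda>s. - (g s)\<^sup>2"])
      show "((\<lambda>s. - (g s)\<^sup>2) has_real_derivative - (2 * g s * g' s)) (at s)" for s
        using DERIV_minus[OF DERIV_power[OF d, of 2]] by (simp add: mult_ac)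
      show "0 \<le> - (2 * g s * g' s)" if "s \<ge> 0" for s
        using \<kappa> that pos[of s] w[of s] by (simp add: g'_def soft_exp'_def g_def[symmetric])
      have "((\<lambda>s. (g s)\<^sup>2) \<longlongrightarrow> 0) at_top"
      proof (rule tendsto_sandwich[OF _ _ tendsto_const])
        show "((\<lambda>s. exp (- ((2 * \<kappa>) * s))) \<longlongrightarrow> 0) at_top" by (rule exp_minus_tendsto_0) (use \<kappa> in simp)
        show "\<forall>\<^sub>F s in at_top. (g s)\<^sup>2 \<le> exp (- ((2 * \<kappa>) * s))"
          using eventually_ge_at_top[of 0] by eventually_elim (metis le abs_of_nonneg)
      qed simp
      from tendsto_minus[OF this] show "((\<lambda>s. - (g s)\<^sup>2) \<longlongrightarrow> 0) at_top" by simp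
    qed auto
    moreover have "indicator {0..} (- s) * (- (2 * g (- s) * g' (- s))) = (if s < 0 then 2 * g s * g' s else 0)" for s
      using even[of s] by (cases "s = 0") (auto simp: indicator_def g'_def soft_exp'_def)
    ultimately show ?thesis using has_bochner_integral_integral_eq by fastforce
  qed
  show "(soft_exp \<kappa> \<eta> has_real_derivative soft_exp' \<kappa> \<eta> s) (at s)"
    "continuous_on UNIV (soft_exp' \<kappa> \<eta>)" "soft_exp \<kappa> \<eta> (- s) = soft_exp \<kappa> \<eta> s" "soft_exp' \<kappa> \<eta> (- s) = - soft_exp' \<kappa> \<eta> s"
    "integrable lborel (\<lambda>s. (soft_exp \<kappa> \<eta> s)\<^sup>2)" "integrable lborel (\<lambda>s. (soft_exp' \<kappa> \<eta> s)\<^sup>2)"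
    "(\<integral>s. (if s < 0 then 2 * soft_exp \<kappa> \<eta> s * soft_exp' \<kappa> \<eta> s else 0) \<partial>lborel) = (soft_exp \<kappa> \<eta> 0)\<^sup>2"
    using d g'c even gi g'i half unfolding g_def g'_def by blast+
  show "(\<integral>s. (soft_exp \<kappa> \<eta> s)\<^sup>2 \<partial>lborel) > 0"
    using continuous_integral_pos[OF _ gi, of 0] pos[of 0] continuous_on_power[OF gc] unfolding g_def by simp
  show "(\<integral>s. (soft_exp \<kappa> \<eta> s)\<^sup>2 \<partial>lborel) \<le> 1 / \<kappa>"
    using integral_mono[OF gi integrable.intros[OF E] gE] has_bochner_integral_integral_eq[OF E] unfolding g_def by simp
  show "(\<integral>s. (soft_exp' \<kappa> \<eta> s)\<^sup>2 \<partial>lborel) \<le> \<kappa>\<^sup>2 * (\<integral>s. (soft_exp \<kappa> \<eta> s)\<^sup>2 \<partial>lborel)"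
    using integral_mono[OF g'i integrable_mult_right[OF gi, of "\<kappa>\<^sup>2"] g'_le] unfolding g_def g'_def by simp
qed

subsection \<open>Bumps far apart\<close>

definition bump1 :: "real \<Rightarrow> real" where
  "bump1 t = flat t * flat (1 - t)"

definition bump1' :: "real \<Rightarrow> real" where
  "bump1' t = flat_exp [:0, 0, 1:] t * flat (1 - t) - flat t * flat_exp [:0, 0, 1:] (1 - t)"

lemma flat_derivative: "(flat has_real_derivative flat_exp [:0, 0, 1:] x) (at x)"
  using flat_exp_derivative[of 1] by (simp add: flat_def pderiv_1)

lemma bump1_derivative: "(bump1 has_real_derivative bump1' t) (at t)"
proof -
  have "((\<lambda>t. flat (1 - t)) has_real_derivative (- flat_exp [:0, 0, 1:] (1 - t))) (at t)"
    using DERIV_chain2[OF flat_derivative DERIV_diff[OF DERIV_const DERIV_ident]] by simp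
  from DERIV_mult[OF flat_derivative this] show ?thesis by (simp add: bump1_def[abs_def] bump1'_def algebra_simps)
qed

lemma bump1_continuous: "continuous_on A bump1" "continuous_on A bump1'"
proof -
  have c: "continuous_on UNIV (flat_exp p)" for p
    using flat_exp_derivative DERIV_continuous continuous_at_imp_continuous_on by blast
  have "continuous_on UNIV bump1" "continuous_on UNIV bump1'"
    unfolding bump1_def[abs_def] bump1'_def[abs_def]
    by (intro continuous_intros continuous_on_compose2[OF c] continuous_on_compose2[OF flat_continuous[of UNIV]]; simp)+
  then show "continuous_on A bump1" "continuous_on A bump1'" by (auto intro: continuous_on_subset)
qed

lemma bump1_support: "\<not> (0 < t \<and> t < 1) \<Longrightarrow> bump1 t = 0" "\<not> (0 < t \<and> t < 1) \<Longrightarrow> bump1' t = 0"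
  by (auto simp: bump1_def bump1'_def flat_def flat_exp_def)

definition bump2 :: "(real \<Rightarrow> real) \<Rightarrow> (real \<Rightarrow> real) \<Rightarrow> real ^ 2 \<Rightarrow> real" where
  "bump2 a b p = a (p $ 1) * b (p $ 2)"

lemma disjoint_sum_square:
  fixes c :: "nat \<Rightarrow> complex" and f :: "nat \<Rightarrow> real"
  assumes "\<And>i j. i < N \<Longrightarrow> j < N \<Longrightarrow> f i \<noteq> 0 \<Longrightarrow> f j \<noteq> 0 \<Longrightarrow> i = j"
  shows "(cmod (\<Sum>i<N. c i * of_real (f i)))\<^sup>2 = (\<Sum>i<N. (cmod (c i))\<^sup>2 * (f i)\<^sup>2)"
proof (cases "\<exists>i<N. f i \<noteq> 0")
  case True
  then obtain k where k: "k < N" "f k \<noteq> 0" by blast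
  have z: "f i = 0" if "i < N" "i \<noteq> k" for i using assms[OF that(1) k(1)] k that by blast
  have "(\<Sum>i<N. c i * of_real (f i)) = (\<Sum>i\<in>{k}. c i * of_real (f i))"
    by (rule sum.mono_neutral_right) (use z k in auto)
  moreover have "(\<Sum>i<N. (cmod (c i))\<^sup>2 * (f i)\<^sup>2) = (\<Sum>i\<in>{k}. (cmod (c i))\<^sup>2 * (f i)\<^sup>2)"
    by (rule sum.mono_neutral_right) (use z k in auto)
  ultimately show ?thesis by (simp add: norm_mult power_mult_distrib)
qed simp

locale bump_row =
  fixes R :: real and N :: nat
  assumes R: "R > 0"
begin

definition shifted :: "nat \<Rightarrow> real ^ 2 \<Rightarrow> real ^ 2" where
  "shifted i p = (1 / R) *\<^sub>R p - axis 1 (real i + 1)"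

lemma shifted_component [simp]: "shifted i p $ 1 = p $ 1 / R - (real i + 1)" "shifted i p $ 2 = p $ 2 / R"
  by (simp_all add: shifted_def axis_def)

definition bump_sum :: "(real \<Rightarrow> real) \<Rightarrow> (real \<Rightarrow> real) \<Rightarrow> (nat \<Rightarrow> complex) \<Rightarrow> real ^ 2 \<Rightarrow> complex" where
  "bump_sum a b c p = (\<Sum>i<N. c i * of_real (bump2 a b (shifted i p)))"

definition K :: "(real ^ 2) set" where
  "K = cbox 0 (vector [R * (real N + 1), R])"

lemma bump_sum_support:
  assumes ab: "\<And>t. \<not> (0 < t \<and> t < 1) \<Longrightarrow> a t = 0" "\<And>t. \<not> (0 < t \<and> t < 1) \<Longrightarrow> b t = 0"
  shows "p \<notin> K \<Longrightarrow> bump_sum a b c p = 0" "p $ 1 < R \<Longrightarrow> bump_sum a b c p = 0"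
    "(cmod (bump_sum a b c p))\<^sup>2 = (\<Sum>i<N. (cmod (c i))\<^sup>2 * (bump2 a b (shifted i p))\<^sup>2)"
proof -
  have nz: "p $ 1 > R * (real i + 1) \<and> p $ 1 < R * (real i + 2) \<and> p $ 2 > 0 \<and> p $ 2 < R" if "bump2 a b (shifted i p) \<noteq> 0" for i
  proof -
    have "0 < p $ 1 / R - (real i + 1)" "p $ 1 / R - (real i + 1) < 1" "0 < p $ 2 / R" "p $ 2 / R < 1"
      using that ab by (fastforce simp: bump2_def)+
    then show ?thesis using R by (simp add: field_simps)
  qed
  show "bump_sum a b c p = 0" if "p \<notin> K"
  proof -
    have "bump2 a b (shifted i p) = 0" if i: "i < N" for i
    proof (rule ccontr)
      assume "bump2 a b (shifted i p) \<noteq> 0"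
      note n = nz[OF this]
      have "R * (real i + 2) \<le> R * (real N + 1)" using R i by (intro mult_left_mono) auto
      moreover have "0 < R * (real i + 1)" using R by simp
      ultimately have "0 \<le> p $ 1 \<and> p $ 1 \<le> R * (real N + 1)" using n by linarith
      then have "p \<in> K" using n by (simp add: K_def mem_box_cart forall_2)
      then show False using \<open>p \<notin> K\<close> by blast
    qed
    then show ?thesis by (simp add: bump_sum_def)
  qed
  show "bump_sum a b c p = 0" if "p $ 1 < R"
  proof -
    have "bump2 a b (shifted i p) = 0" for i
    proof (rule ccontr)
      assume "bump2 a b (shifted i p) \<noteq> 0"
      then have "R * (real i + 1) < R" using nz[of i] that by linarith
      then show False using R by (simp add: mult_less_0_iff algebra_simps)
    qed
    then show ?thesis by (simp add: bump_sum_def)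
  qed
  show "(cmod (bump_sum a b c p))\<^sup>2 = (\<Sum>i<N. (cmod (c i))\<^sup>2 * (bump2 a b (shifted i p))\<^sup>2)"
    unfolding bump_sum_def
  proof (rule disjoint_sum_square)
    fix i j assume "bump2 a b (shifted i p) \<noteq> 0" "bump2 a b (shifted j p) \<noteq> 0"
    then have "R * (real i + 1) < R * (real j + 2)" "R * (real j + 1) < R * (real i + 2)" using nz[of i] nz[of j] by linarith+
    then show "i = j" using R by simp
  qed
qed

lemma bump_sum_continuous:
  assumes "continuous_on UNIV a" "continuous_on UNIV b"
  shows "continuous_on UNIV (bump_sum a b c)"
  unfolding bump_sum_def[abs_def] bump2_def shifted_component
  by (intro continuous_intros continuous_on_compose2[OF assms(1)] continuous_on_compose2[OF assms(2)]) (use R in auto)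

lemma bump_sum_integral:
  assumes ab: "\<And>t. \<not> (0 < t \<and> t < 1) \<Longrightarrow> a t = 0" "\<And>t. \<not> (0 < t \<and> t < 1) \<Longrightarrow> b t = 0"
    and c: "continuous_on UNIV a" "continuous_on UNIV b"
  shows "(\<integral>p. (cmod (bump_sum a b \<gamma> p))\<^sup>2 \<partial>lborel) = R\<^sup>2 * (\<integral>p. (bump2 a b p)\<^sup>2 \<partial>lborel) * (\<Sum>i<N. (cmod (\<gamma> i))\<^sup>2)"
proof -
  have b2: "continuous_on UNIV (\<lambda>p. (bump2 a b p)\<^sup>2)" unfolding bump2_def
    by (intro continuous_intros continuous_on_compose2[OF c(1)] continuous_on_compose2[OF c(2)]) auto
  then have [measurable]: "(\<lambda>p. (bump2 a b p)\<^sup>2) \<in> borel_measurable borel" by (rule borel_measurable_continuous_onI)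
  have i: "integrable lborel (\<lambda>p. (bump2 a b (shifted i p))\<^sup>2)" if "i < N" for i
  proof (rule continuous_compact_support_integrable[of _ K])
    show "continuous_on UNIV (\<lambda>p. (bump2 a b (shifted i p))\<^sup>2)"
      by (rule continuous_on_compose2[OF b2]) (auto simp: shifted_def[abs_def] intro!: continuous_intros)
    show "(bump2 a b (shifted i p))\<^sup>2 = 0" if "p \<notin> K" for p
      using bump_sum_support(1)[OF ab that, where c = "\<lambda>_. 1"] bump_sum_support(3)[OF ab, where c = "\<lambda>_. 1" and p = p] \<open>i < N\<close> by (simp add: sum_nonneg_eq_0_iff)
  qed (simp add: K_def compact_cbox)
  have s: "(\<integral>p. (bump2 a b (shifted i p))\<^sup>2 \<partial>lborel) = R\<^sup>2 * (\<integral>p. (bump2 a b p)\<^sup>2 \<partial>lborel)" for i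
    unfolding shifted_def by (rule integral_scaled[OF R]) measurable
  have "(\<integral>p. (cmod (bump_sum a b \<gamma> p))\<^sup>2 \<partial>lborel) = (\<integral>p. (\<Sum>i<N. (cmod (\<gamma> i))\<^sup>2 * (bump2 a b (shifted i p))\<^sup>2) \<partial>lborel)"
    by (intro Bochner_Integration.integral_cong refl bump_sum_support(3)[OF ab])
  then show ?thesis
    using i by (simp add: s sum_distrib_left sum_distrib_right mult_ac)
qed

lemma bump_sum_derivative:
  "(bump_sum bump1 bump1 c has_derivative
     (\<lambda>h. h $ 1 *\<^sub>R (of_real (1 / R) * bump_sum bump1' bump1 c p) + h $ 2 *\<^sub>R (of_real (1 / R) * bump_sum bump1 bump1' c p))) (at p)"
proof -
  have 1: "((\<lambda>p. bump2 bump1 bump1 (shifted i p)) has_derivative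
     (\<lambda>h. h $ 1 * (bump2 bump1' bump1 (shifted i p) / R) + h $ 2 * (bump2 bump1 bump1' (shifted i p) / R))) (at p)" for i
  proof -
    have v: "((\<lambda>p. p $ k / R) has_derivative (\<lambda>h. h $ k / R)) (at p)" for k :: 2
      by (intro bounded_linear_imp_has_derivative bounded_linear_compose[OF bounded_linear_divide bounded_linear_vec_nth])
    have "((\<lambda>p. p $ 1 / R - (real i + 1)) has_derivative (\<lambda>h. h $ 1 / R)) (at p)"
      using has_derivative_diff[OF v has_derivative_const] by simp
    note this v[of 2]
    from has_derivative_mult[OF has_derivative_compose[OF this(1) bump1_derivative[unfolded has_field_derivative_def]]
        has_derivative_compose[OF this(2) bump1_derivative[unfolded has_field_derivative_def]]]
    show ?thesis unfolding bump2_def shifted_component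
      by (rule has_derivative_eq_rhs) (simp add: fun_eq_iff field_simps)
  qed
  have "(bump_sum bump1 bump1 c has_derivative (\<lambda>h. \<Sum>i<N. c i * of_real (h $ 1 * (bump2 bump1' bump1 (shifted i p) / R)
      + h $ 2 * (bump2 bump1 bump1' (shifted i p) / R)))) (at p)"
    unfolding bump_sum_def[abs_def] by (intro has_derivative_sum has_derivative_mult_right has_derivative_of_real 1)
  then show ?thesis
    by (rule has_derivative_eq_rhs)
       (simp add: fun_eq_iff bump_sum_def sum_distrib_left scaleR_conv_of_real algebra_simps flip: sum.distrib)
qed

end

context cone
begin

lemma quasi_modes:
  assumes \<alpha>: "\<alpha> > 0" and l: "l > - (\<alpha>\<^sup>2 / 4)"
  shows "\<exists>vs. length vs = N \<and> set vs \<subseteq> H1 UNIV \<and> L2_independent vs \<and>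
    (\<forall>c. Re (delta_form \<theta> \<alpha> (lincomb c vs) (lincomb c vs)) \<le> l * (L2_norm lborel (lincomb c vs))\<^sup>2)"
proof -
  define \<delta> where "\<delta> = l + \<alpha>\<^sup>2 / 4"
  have \<delta>: "\<delta> > 0" using l by (simp add: \<delta>_def)
  define \<kappa> where "\<kappa> = \<alpha> * sin \<theta> / 2"
  have \<kappa>: "\<kappa> > 0" using \<alpha> sin_pos by (simp add: \<kappa>_def)
  define \<eta> where "\<eta> = min (1 / (2 * \<kappa>)) (\<delta> / (2 * \<alpha>\<^sup>2 * \<kappa>))"
  have \<eta>: "\<eta> > 0" "2 * \<kappa> * \<eta> \<le> 1" "\<alpha>\<^sup>2 * \<kappa> * \<eta> \<le> \<delta> / 2"
  proof -
    show "\<eta> > 0" using \<kappa> \<delta> \<alpha> by (simp add: \<eta>_def)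
    have "\<eta> \<le> 1 / (2 * \<kappa>)" "\<eta> \<le> \<delta> / (2 * \<alpha>\<^sup>2 * \<kappa>)" by (simp_all add: \<eta>_def)
    then show "2 * \<kappa> * \<eta> \<le> 1" "\<alpha>\<^sup>2 * \<kappa> * \<eta> \<le> \<delta> / 2" using \<kappa> \<alpha> by (simp_all add: field_simps)
  qed
  let ?g = "soft_exp \<kappa> \<eta>" and ?g' = "soft_exp' \<kappa> \<eta>"
  note G = soft_exp_properties[OF \<kappa> \<eta>(1)]
  define b0 where "b0 = (\<integral>p. (bump2 bump1 bump1 p)\<^sup>2 \<partial>lborel)"
  define e0 where "e0 = (\<integral>p. (bump2 bump1' bump1 p)\<^sup>2 \<partial>lborel) + (\<integral>p. (bump2 bump1 bump1' p)\<^sup>2 \<partial>lborel)"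
  note bc = bump1_continuous[of UNIV]
  have b0: "b0 > 0" unfolding b0_def
  proof (rule continuous_integral_pos)
    show c: "continuous_on UNIV (\<lambda>p. (bump2 bump1 bump1 p)\<^sup>2)" unfolding bump2_def
      by (intro continuous_intros continuous_on_compose2[OF bc(1)]) auto
    show "integrable lborel (\<lambda>p. (bump2 bump1 bump1 p)\<^sup>2)"
    proof (rule continuous_compact_support_integrable[OF c])
      show "compact (cbox 0 (1 :: real ^ 2))" by (rule compact_cbox)
      fix p :: "real ^ 2" assume "p \<notin> cbox 0 1"
      then have "\<not> (0 < p $ 1 \<and> p $ 1 < 1) \<or> \<not> (0 < p $ 2 \<and> p $ 2 < 1)" by (auto simp: mem_box_cart forall_2)
      then show "(bump2 bump1 bump1 p)\<^sup>2 = 0" using bump1_support(1) by (auto simp: bump2_def)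
    qed
    have "bump1 (1 / 2) > 0" by (simp add: bump1_def flat_pos_iff)
    then show "(bump2 bump1 bump1 (vector [1 / 2, 1 / 2]))\<^sup>2 > 0" by (simp add: bump2_def)
  qed simp
  have e0: "e0 \<ge> 0" by (simp add: e0_def)
  define R where "R = max 1 (2 * e0 / (b0 * \<delta>))"
  have R: "R > 0" "e0 / R\<^sup>2 \<le> b0 * \<delta> / 2"
  proof -
    show "R > 0" by (simp add: R_def)
    have "2 * e0 / (b0 * \<delta>) \<le> R" "1 \<le> R" by (simp_all add: R_def)
    moreover from this(2) have "R * 1 \<le> R * R" by (intro mult_left_mono) auto
    ultimately have "2 * e0 / (b0 * \<delta>) \<le> R\<^sup>2" unfolding power2_eq_square by linarith
    then show "e0 / R\<^sup>2 \<le> b0 * \<delta> / 2" using b0 \<delta> \<open>R > 0\<close> by (simp add: field_simps)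
  qed
  interpret B: bump_row R N by unfold_locales (rule R(1))
  define F where "F = B.bump_sum bump1 bump1"
  define D1 where "D1 c p = of_real (1 / R) * B.bump_sum bump1' bump1 c p" for c p
  define D2 where "D2 c p = of_real (1 / R) * B.bump_sum bump1 bump1' c p" for c p
  have P: "cone_profile \<theta> (F c) (D1 c) (D2 c) B.K R ?g ?g'" for c
  proof unfold_locales
    show "(F c has_derivative (\<lambda>h. h $ 1 *\<^sub>R D1 c p + h $ 2 *\<^sub>R D2 c p)) (at p)" for p
      unfolding F_def D1_def D2_def by (rule B.bump_sum_derivative)
    show "continuous_on UNIV (D1 c)" "continuous_on UNIV (D2 c)"
      unfolding D1_def[abs_def] D2_def[abs_def] by (intro continuous_intros B.bump_sum_continuous bc)+
    show "compact B.K" by (simp add: B.K_def compact_cbox)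
  qed (use B.bump_sum_support(1,2) bump1_support R(1) G in \<open>simp_all add: F_def D1_def D2_def\<close>)
  define m where "m c x = F c (base x) * of_real (?g (x $ 3 - cot \<theta> * norm (base x)))" for c x
  have mm: "cone_profile.mode \<theta> (F c) ?g = m c" for c
    by (simp add: fun_eq_iff m_def cone_profile.mode_def[OF P] cone_profile.height_def[OF P])
  define I where "I = (\<integral>s. (?g s)\<^sup>2 \<partial>lborel)"
  define S where "S c = (\<Sum>i<N. (cmod (c i))\<^sup>2)" for c :: "nat \<Rightarrow> complex"
  have S0: "S c \<ge> 0" for c unfolding S_def by (intro sum_nonneg) auto
  have I: "I > 0" "\<kappa> * I \<le> 1" using G(8,9) \<kappa> by (simp_all add: I_def field_simps)
  have mass: "cone_profile.mass (F c) = R\<^sup>2 * b0 * S c" for c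
    unfolding cone_profile.mass_def[OF P] unfolding F_def b0_def S_def by (rule B.bump_sum_integral) (use bump1_support bc in auto)
  have slope: "cone_profile.slope (D1 c) (D2 c) = e0 * S c" for c
  proof -
    have n: "(cmod (D1 c p))\<^sup>2 + (cmod (D2 c p))\<^sup>2 = (1 / R\<^sup>2) * ((cmod (B.bump_sum bump1' bump1 c p))\<^sup>2 + (cmod (B.bump_sum bump1 bump1' c p))\<^sup>2)" for p
      unfolding D1_def D2_def norm_mult power_mult_distrib norm_of_real by (simp add: power_divide add_divide_distrib)
    have i: "integrable lborel (\<lambda>p. (cmod (B.bump_sum a b c p))\<^sup>2)"
      if "continuous_on UNIV a" "continuous_on UNIV b" "\<And>t. \<not> (0 < t \<and> t < 1) \<Longrightarrow> a t = 0" "\<And>t. \<not> (0 < t \<and> t < 1) \<Longrightarrow> b t = 0" for a b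
      by (rule continuous_compact_support_integrable[of _ B.K])
         (use B.bump_sum_continuous[OF that(1,2)] B.bump_sum_support(1)[OF that(3,4)] in \<open>auto simp: B.K_def compact_cbox intro!: continuous_intros\<close>)
    have "cone_profile.slope (D1 c) (D2 c) = (1 / R\<^sup>2) * ((\<integral>p. (cmod (B.bump_sum bump1' bump1 c p))\<^sup>2 \<partial>lborel) + (\<integral>p. (cmod (B.bump_sum bump1 bump1' c p))\<^sup>2 \<partial>lborel))"
      unfolding cone_profile.slope_def[OF P] n using i[OF bc(2,1)] i[OF bc] bump1_support by simp
    also have "(\<integral>p. (cmod (B.bump_sum bump1' bump1 c p))\<^sup>2 \<partial>lborel) = R\<^sup>2 * (\<integral>p. (bump2 bump1' bump1 p)\<^sup>2 \<partial>lborel) * S c"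
      unfolding S_def by (rule B.bump_sum_integral) (use bump1_support bc in auto)
    also have "(\<integral>p. (cmod (B.bump_sum bump1 bump1' c p))\<^sup>2 \<partial>lborel) = R\<^sup>2 * (\<integral>p. (bump2 bump1 bump1' p)\<^sup>2 \<partial>lborel) * S c"
      unfolding S_def by (rule B.bump_sum_integral) (use bump1_support bc in auto)
    also have "(1 / R\<^sup>2) * (R\<^sup>2 * (\<integral>p. (bump2 bump1' bump1 p)\<^sup>2 \<partial>lborel) * S c + R\<^sup>2 * (\<integral>p. (bump2 bump1 bump1' p)\<^sup>2 \<partial>lborel) * S c)
      = (1 / R\<^sup>2 * R\<^sup>2) * (e0 * S c)" unfolding e0_def by algebra
    finally show ?thesis using R(1) by simp
  qed
  have norm: "(L2_norm lborel (m c))\<^sup>2 = R\<^sup>2 * b0 * S c * I" for c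
    using cone_profile.mode_L2(2)[OF P, of c] unfolding mm mass I_def .
  have energy: "Re (delta_form \<theta> \<alpha> (m c) (m c)) \<le> l * (L2_norm lborel (m c))\<^sup>2" for c
  proof -
    define J where "J = (\<integral>s. (?g' s)\<^sup>2 \<partial>lborel)"
    have J: "J \<le> \<kappa>\<^sup>2 * I" unfolding J_def I_def by (rule G(10))
    have g0: "(?g 0)\<^sup>2 \<ge> 1 - 2 * \<kappa> * \<eta>"
      using exp_ge_add_one_self[of "- (2 * \<kappa> * \<eta>)"] \<eta>(1) by (simp add: soft_exp_def power2_eq_square mult_ac flip: exp_add)
    have "(1 - 2 * \<kappa> * \<eta>) * (\<kappa> * I) \<le> (1 - 2 * \<kappa> * \<eta>) * 1" by (intro mult_left_mono I) (use \<eta>(2) in simp)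
    then have "J - 2 * \<kappa> * (?g 0)\<^sup>2 \<le> \<kappa>\<^sup>2 * I - 2 * \<kappa> * ((1 - 2 * \<kappa> * \<eta>) * (\<kappa> * I))"
      using J g0 \<kappa> by (intro diff_mono mult_left_mono) auto
    then have "(J - 2 * \<kappa> * (?g 0)\<^sup>2) / (sin \<theta>)\<^sup>2 \<le> (\<kappa>\<^sup>2 * I - 2 * \<kappa> * ((1 - 2 * \<kappa> * \<eta>) * (\<kappa> * I))) / (sin \<theta>)\<^sup>2"
      by (intro divide_right_mono) auto
    moreover have "(J - 2 * \<kappa> * (?g 0)\<^sup>2) / (sin \<theta>)\<^sup>2 = J / (sin \<theta>)\<^sup>2 - \<alpha> * (?g 0)\<^sup>2 / sin \<theta>"
      using sin_pos by (simp add: \<kappa>_def power2_eq_square field_simps)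
    moreover have "(\<kappa>\<^sup>2 * I - 2 * \<kappa> * ((1 - 2 * \<kappa> * \<eta>) * (\<kappa> * I))) / (sin \<theta>)\<^sup>2 = (\<alpha>\<^sup>2 * \<kappa> * \<eta> - \<alpha>\<^sup>2 / 4) * I"
    proof -
      have "\<kappa>\<^sup>2 * I - 2 * \<kappa> * ((1 - 2 * \<kappa> * \<eta>) * (\<kappa> * I)) = \<kappa>\<^sup>2 * ((4 * \<kappa> * \<eta> - 1) * I)" by (simp add: power2_eq_square algebra_simps)
      also have "\<dots> / (sin \<theta>)\<^sup>2 = (\<alpha>\<^sup>2 / 4) * ((4 * \<kappa> * \<eta> - 1) * I)"
        using sin_pos unfolding \<kappa>_def[unfolded] by (simp add: power_mult_distrib power_divide)
      finally show ?thesis by (simp add: algebra_simps)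
    qed
    ultimately have k: "J / (sin \<theta>)\<^sup>2 - \<alpha> * (?g 0)\<^sup>2 / sin \<theta> \<le> (\<alpha>\<^sup>2 * \<kappa> * \<eta> - \<alpha>\<^sup>2 / 4) * I" by simp
    also have "\<dots> \<le> (\<delta> / 2 - \<alpha>\<^sup>2 / 4) * I" using \<eta>(3) I(1) by (intro mult_right_mono) auto
    finally have k: "J / (sin \<theta>)\<^sup>2 - \<alpha> * (?g 0)\<^sup>2 / sin \<theta> \<le> (\<delta> / 2 - \<alpha>\<^sup>2 / 4) * I" .
    have e: "e0 \<le> R\<^sup>2 * b0 * (\<delta> / 2)" using R by (simp add: field_simps)
    have "Re (delta_form \<theta> \<alpha> (m c) (m c)) = e0 * S c * I + R\<^sup>2 * b0 * S c * (J / (sin \<theta>)\<^sup>2 - \<alpha> * (?g 0)\<^sup>2 / sin \<theta>)"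
      using cone_profile.mode_energy[OF P[of c], of \<alpha>] unfolding mm mass slope I_def J_def .
    also have "\<dots> \<le> R\<^sup>2 * b0 * (\<delta> / 2) * S c * I + R\<^sup>2 * b0 * S c * ((\<delta> / 2 - \<alpha>\<^sup>2 / 4) * I)"
      by (intro add_mono mult_right_mono mult_left_mono e k S0) (use I(1) b0 S0 in auto)
    also have "\<dots> = l * (L2_norm lborel (m c))\<^sup>2" unfolding norm \<delta>_def by (simp add: field_simps)
    finally show ?thesis .
  qed
  define vs where "vs = map (\<lambda>i. m (\<lambda>j. if j = i then 1 else 0)) [0..<N]"
  have lin: "lincomb c vs = m c" for c
  proof
    fix x
    have "F c p = (\<Sum>i<N. c i * F (\<lambda>j. if j = i then 1 else 0) p)" for p
      by (simp add: F_def B.bump_sum_def if_distrib[of "\<lambda>z. z * _"] cong: if_cong)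
    then show "lincomb c vs x = m c x" by (simp add: lincomb_def vs_def m_def sum_distrib_right mult.assoc)
  qed
  have "set vs \<subseteq> H1 UNIV" using cone_profile.mode_H1[OF P] by (auto simp: vs_def mm)
  moreover have "L2_independent vs"
    unfolding L2_independent_def
  proof (intro allI impI)
    fix c i assume z: "AE x in lborel. (\<Sum>i<length vs. c i * (vs ! i) x) = 0" and i: "i < length vs"
    have mL: "m c \<in> L2 lborel" using cone_profile.mode_L2(1)[OF P, of c] unfolding mm .
    have "AE x in lborel. m c x = 0" using z by (simp flip: lin add: lincomb_def)
    then have "L2_norm lborel (m c) = L2_norm lborel (\<lambda>x :: real ^ 3. 0 :: complex)"
      by (rule L2_norm_cong_AE) (use L2_measurable[OF mL] in auto)
    then have "R\<^sup>2 * b0 * S c * I = 0" using norm[of c] by simp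
    then have "S c = 0" using R(1) b0 I(1) by simp
    then show "c i = 0" using i by (simp add: S_def vs_def sum_nonneg_eq_0_iff)
  qed
  ultimately show ?thesis using energy lin by (intro exI[of _ vs]) (simp add: vs_def)
qed

lemma delta_essential_spectrum_bound:
  assumes \<alpha>: "\<alpha> > 0" and l: "ereal l < inf_ess_spectrum (delta_operator \<theta> \<alpha>)"
  shows "l < - (\<alpha>\<^sup>2 / 4)"
proof (rule ccontr)
  assume "\<not> l < - (\<alpha>\<^sup>2 / 4)"
  then have l0: "- (\<alpha>\<^sup>2 / 4) \<le> l" by simp
  obtain l1 where l1: "ereal l < ereal l1" "ereal l1 < inf_ess_spectrum (delta_operator \<theta> \<alpha>)"
    using ereal_dense2[OF l] by blast
  interpret S: semibounded_form "H1 UNIV" "delta_form \<theta> \<alpha>" "(\<alpha> / sin \<theta>)\<^sup>2" by (rule delta_semibounded[OF \<alpha>])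
  have Op: "delta_operator \<theta> \<alpha> = S.Op" by (simp add: delta_operator_def)
  define l2 where "l2 = (l + l1) / 2"
  have l2: "- (\<alpha>\<^sup>2 / 4) < l2" "l2 < l1" using l0 l1(1) by (simp_all add: l2_def)
  obtain vs where vs: "length vs = Suc (S.dim_below l1)" "set vs \<subseteq> H1 UNIV" "L2_independent vs"
    "\<And>c. Re (delta_form \<theta> \<alpha> (lincomb c vs) (lincomb c vs)) \<le> l2 * (L2_norm lborel (lincomb c vs))\<^sup>2"
    using quasi_modes[OF \<alpha> l2(1)] by blast
  have le: "Re (delta_form \<theta> \<alpha> (lincomb c vs) (lincomb c vs)) \<le> l1 * (L2_norm lborel (lincomb c vs))\<^sup>2" for c
    using vs(4)[of c] mult_right_mono[of l2 l1 "(L2_norm lborel (lincomb c vs))\<^sup>2"] l2(2) by simp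
  obtain c where "L2_norm lborel (lincomb c vs) \<noteq> 0"
    "Re (delta_form \<theta> \<alpha> (lincomb c vs) (lincomb c vs)) = l1 * (L2_norm lborel (lincomb c vs))\<^sup>2"
    using S.trial_space_eigenvector[OF l1(2)[unfolded Op] vs(2,3) _ le] vs(1) by auto
  then show False using vs(4)[of c] l2(2) by simp
qed

lemma lincomb_map_flip: "lincomb c (map flip us) = flip (lincomb c us)"
  by (auto simp: fun_eq_iff lincomb_def flip_def sum_negf)

lemma flip_independent: "L2_independent us \<Longrightarrow> L2_independent (map flip us)"
proof -
  assume us: "L2_independent us"
  have "(\<Sum>i<length us. c i * (map flip us ! i) x) = 0 \<longleftrightarrow> (\<Sum>i<length us. c i * (us ! i) x) = 0" for c x
    using fun_cong[OF lincomb_map_flip[of c us], of x] by (simp add: lincomb_def flip_def split: if_splits)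
  then show ?thesis using us by (simp add: L2_independent_def)
qed

end

text \<open>Every eigenvalue below the essential spectrum lies below \<open>- \<alpha>\<^sup>2 / 4\<close>. Were there fewer than \<open>n\<close>
  eigenvalues of the second operator below \<open>\<lambda>\<^sub>n\<close> of the first one, then the flipped span of \<open>n\<close>
  eigenfunctions would contain an eigenfunction of the second operator for \<open>\<lambda>\<^sub>n\<close>.\<close>

theorem mainTheorem4:
  fixes \<theta> \<alpha> \<beta> :: real and n :: nat
  assumes "0 < \<theta>" and "\<theta> < pi / 2"
    and "\<alpha> > 0" and "\<beta> = 4 / \<alpha>"
    and "eigenvalue_exists (delta_operator \<theta> \<alpha>) n"
    and "ereal (eigenvalue (delta_operator \<theta> \<alpha>) n) < inf_ess_spectrum (delta'_operator \<theta> \<beta>)"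
  shows "eigenvalue_exists (delta'_operator \<theta> \<beta>) n \<and>
         eigenvalue (delta'_operator \<theta> \<beta>) n < eigenvalue (delta_operator \<theta> \<alpha>) n"
proof -
  interpret cone \<theta> by unfold_locales (rule assms(1,2))+
  note \<alpha> = assms(3) and \<beta> = assms(4)
  have \<beta>0: "\<beta> > 0" using \<alpha> \<beta> by simp
  interpret S: semibounded_form "H1 UNIV" "delta_form \<theta> \<alpha>" "(\<alpha> / sin \<theta>)\<^sup>2" by (rule delta_semibounded[OF \<alpha>])
  interpret S': semibounded_form "H1_minus_cone \<theta>" "delta'_form \<theta> \<beta>" "2 * (2 / (\<beta> * sin \<theta>))\<^sup>2" by (rule delta'_semibounded[OF \<beta>0])
  have Op: "delta_operator \<theta> \<alpha> = S.Op" "delta'_operator \<theta> \<beta> = S'.Op" by (simp_all add: delta_operator_def delta'_operator_def)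
  obtain l where l: "is_nth_eigenvalue S.Op n l" using assms(5) by (auto simp: eigenvalue_exists_def Op)
  have el: "eigenvalue S.Op n = l" using eigenvalue_eqI[OF l] .
  have le': "ereal l < inf_ess_spectrum S'.Op" using assms(6) by (simp add: el Op)
  have n0: "n \<noteq> 0" using l by (auto simp: is_nth_eigenvalue_def)
  have lneg: "l < - (\<alpha>\<^sup>2 / 4)"
    using delta_essential_spectrum_bound[OF \<alpha>] l by (simp add: is_nth_eigenvalue_def Op)
  have "n \<le> S'.dim_below l"
  proof (rule ccontr)
    assume "\<not> n \<le> S'.dim_below l"
    obtain us where us: "length us = n" "set us \<subseteq> H1 UNIV" "L2_independent us"
      "\<And>c. Re (delta_form \<theta> \<alpha> (lincomb c us) (lincomb c us)) \<le> l * (L2_norm lborel (lincomb c us))\<^sup>2"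
      using S.nth_eigenvalue_trial_space[OF l] by blast
    have uH: "lincomb c us \<in> H1 UNIV" for c by (rule lincomb_mem) (use S.D_lin S.zero_in_D us in auto)
    have D: "set (map flip us) \<subseteq> H1_minus_cone \<theta>" using us(2) flip_H1 by auto
    have le: "Re (delta'_form \<theta> \<beta> (lincomb c (map flip us)) (lincomb c (map flip us))) \<le> l * (L2_norm lborel (lincomb c (map flip us)))\<^sup>2" for c
      unfolding lincomb_map_flip \<beta> flip_form[OF uH \<alpha>] using us(4)[of c] flip_L2(2)[OF S.D_L2[OF uH]] by simp
    obtain c where c: "L2_norm lborel (lincomb c (map flip us)) \<noteq> 0"
      "\<forall>w\<in>H1_minus_cone \<theta>. delta'_form \<theta> \<beta> (lincomb c (map flip us)) w = of_real l * ip lborel (lincomb c (map flip us)) w"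
      using S'.trial_space_eigenvector[OF le' D flip_independent[OF us(3)] _ le] us(1) \<open>\<not> n \<le> S'.dim_below l\<close> by auto
    then show False using no_common_eigenfunction[OF uH \<alpha> lneg, of c] by (simp add: lincomb_map_flip \<beta>)
  qed
  then obtain l' where l': "l' < l" "is_nth_eigenvalue S'.Op n l'" using S'.eigenvalue_exists_below[OF le' n0] by blast
  then show ?thesis using eigenvalue_eqI[OF l'(2)] by (auto simp: eigenvalue_exists_def el Op)
qed

end
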